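(* Let $m\ge n\ge 1$ and let $\pi:\Sigma^m\to\mathbb{S}^n(1)$ be a Riemannian submersion with minimal fibers of a closed $m$-dimensional Riemannian manifold $\Sigma$ onto the sphere $\mathbb{S}^n(1)$. Then for any point $p\in\mathbb{S}^n(1)$ and any $\epsilon\in(0,\pi/2)$, $$1\ \ge\ \frac{\mathrm{vol}\left(\pi^{-1}(\Omega(p,\epsilon))\right)}{\mathrm{vol}(\Sigma)}=\frac{\mathrm{vol}\left(\Omega(p,\epsilon)\right)}{\mathrm{vol}\left(\mathbb{S}^n(1)\right)}\ \ge\ 1-\sqrt{\frac{\pi}{2}}\;e^{-\epsilon^2\frac{n-1}{2}}$$ (where the $\pi$ under the square root and in $\pi/2$ is the number $\pi$). Hence, for each $\epsilon\in(0,\pi/2)$, $$\lim_{n\to\infty}\frac{\mathrm{vol}\left(\pi^{-1}(\Omega(p,\epsilon))\right)}{\mathrm{vol}(\Sigma)}=1,$$ that is, for every family of Riemannian submersions with minimal fibers $\pi_n:\Sigma_n\to\mathbb{S}^n(1)$ from closed manifolds $\Sigma_n$ and points $p_n\in\mathbb{S}^n(1)$, $n=1,2,\dots$, the ratio $\mathrm{vol}(\pi_n^{-1}(\Omega(p_n,\epsilon)))/\mathrm{vol}(\Sigma_n)$ tends to $1$ as $n\to\infty$.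
   Context: $\mathbb{S}^n(1)\subset\mathbb{R}^{n+1}$ is the unit sphere with its round metric of constant sectional curvature $1$. Closed means compact without boundary (and non-empty). $\mathrm{vol}$ is Riemannian volume of the appropriate dimension. The submersion has minimal fibers if every fiber $\pi^{-1}(q)$, $q\in\mathbb{S}^n(1)$, is a minimal submanifold of $\Sigma$ (zero mean curvature vector). For $p\in\mathbb{S}^n(1)$, $\mathrm{dist}^{\mathbb{S}^n(1)}(p,y)=\arccos(p\cdot y)$ and $$\Omega(p,\epsilon)=\{y\in\mathbb{S}^n(1): \tfrac{\pi}{2}-\epsilon<\mathrm{dist}^{\mathbb{S}^n(1)}(p,y)<\tfrac{\pi}{2}+\epsilon\}=\{y\in\mathbb{S}^n(1): -\sin\epsilon<p\cdot y<\sin\epsilon\}.$$ *)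

theory Defs
  imports "HOL-Analysis.Analysis" "Jordan_Normal_Form.Determinant"
begin

section \<open>Calculus on \<open>Euclidean_space m\<close>\<close>

text \<open>
  Dimensions vary inside the statement, so coordinates live in the library's topology
  \<open>Euclidean_space m\<close> on \<open>nat \<Rightarrow> real\<close>: the points are the sequences that vanish from
  index \<open>m\<close> on, and the coordinate directions are the indices \<open>i < m\<close>.
\<close>

definition partial :: "nat \<Rightarrow> ((nat \<Rightarrow> real) \<Rightarrow> real) \<Rightarrow> (nat \<Rightarrow> real) \<Rightarrow> real" where
  "partial i f x = deriv (\<lambda>t. f (x(i := t))) (x i)"

fun iterated_partial :: "nat list \<Rightarrow> ((nat \<Rightarrow> real) \<Rightarrow> real) \<Rightarrow> (nat \<Rightarrow> real) \<Rightarrow> real" where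
  "iterated_partial [] f = f"
| "iterated_partial (i # is) f = partial i (iterated_partial is f)"

text \<open>\<open>f\<close> is of class \<open>C\<^sup>\<infinity>\<close> on \<open>V\<close>, an open subset of \<open>Euclidean_space m\<close>: all its
  iterated partial derivatives exist and are continuous on \<open>V\<close>.\<close>

definition smooth_on :: "nat \<Rightarrow> (nat \<Rightarrow> real) set \<Rightarrow> ((nat \<Rightarrow> real) \<Rightarrow> real) \<Rightarrow> bool" where
  "smooth_on m V f \<longleftrightarrow>
     (\<forall>is. set is \<subseteq> {..<m} \<longrightarrow>
        continuous_map (subtopology (Euclidean_space m) V) euclideanreal (iterated_partial is f) \<and>
        (\<forall>x\<in>V. \<forall>i<m. (\<lambda>t. iterated_partial is f (x(i := t))) differentiable (at (x i))))"

definition jacobian :: "((nat \<Rightarrow> real) \<Rightarrow> (nat \<Rightarrow> real)) \<Rightarrow> (nat \<Rightarrow> real) \<Rightarrow> nat \<Rightarrow> nat \<Rightarrow> real" where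
  "jacobian u x k i = partial i (\<lambda>z. u z k) x"

definition apply_matrix :: "nat \<Rightarrow> (nat \<Rightarrow> nat \<Rightarrow> real) \<Rightarrow> (nat \<Rightarrow> real) \<Rightarrow> (nat \<Rightarrow> real)" where
  "apply_matrix m J v = (\<lambda>k. \<Sum>i<m. J k i * v i)"

definition bilinear_form :: "nat \<Rightarrow> (nat \<Rightarrow> nat \<Rightarrow> real) \<Rightarrow> (nat \<Rightarrow> real) \<Rightarrow> (nat \<Rightarrow> real) \<Rightarrow> real" where
  "bilinear_form m G v w = (\<Sum>i<m. \<Sum>j<m. G i j * v i * w j)"

definition determinant :: "nat \<Rightarrow> (nat \<Rightarrow> nat \<Rightarrow> real) \<Rightarrow> real" where
  "determinant m G = Determinant.det (mat m m (\<lambda>(i, j). G i j))"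

definition inverse_matrix :: "nat \<Rightarrow> (nat \<Rightarrow> nat \<Rightarrow> real) \<Rightarrow> nat \<Rightarrow> nat \<Rightarrow> real" where
  "inverse_matrix m G i j = adj_mat (mat m m (\<lambda>(i, j). G i j)) $$ (i, j) / determinant m G"

text \<open>The \<open>m\<close>-dimensional Lebesgue measure of \<open>Euclidean_space m\<close>, regarded as a Borel measure
  on \<open>nat \<Rightarrow> real\<close> concentrated on this subspace.\<close>

definition lebesgue_space :: "nat \<Rightarrow> (nat \<Rightarrow> real) measure" where
  "lebesgue_space m =
     distr (\<Pi>\<^sub>M i\<in>{..<m}. (lborel :: real measure)) borel (\<lambda>x i. if i < m then x i else 0)"


section \<open>Riemannian manifolds\<close>

record 'a chart =
  chart_dom :: "'a set"
  chart_map :: "'a \<Rightarrow> (nat \<Rightarrow> real)"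

definition chart_inv :: "'a chart \<Rightarrow> (nat \<Rightarrow> real) \<Rightarrow> 'a" where
  "chart_inv c = inv_into (chart_dom c) (chart_map c)"

definition is_chart :: "nat \<Rightarrow> 'a topology \<Rightarrow> 'a chart \<Rightarrow> bool" where
  "is_chart m T c \<longleftrightarrow>
     openin T (chart_dom c) \<and>
     openin (Euclidean_space m) (chart_map c ` chart_dom c) \<and>
     homeomorphic_map (subtopology T (chart_dom c))
       (subtopology (Euclidean_space m) (chart_map c ` chart_dom c)) (chart_map c)"

text \<open>\<open>components M c x i j\<close> is the component \<open>g\<^sub>i\<^sub>j\<close> of the metric in the chart \<open>c\<close>
  at the point with coordinates \<open>x\<close>. The atlas need not be maximal.\<close>

record 'a riemannian =
  topology_of :: "'a topology"
  atlas :: "'a chart set"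
  components :: "'a chart \<Rightarrow> (nat \<Rightarrow> real) \<Rightarrow> nat \<Rightarrow> nat \<Rightarrow> real"

definition points :: "'a riemannian \<Rightarrow> 'a set" where
  "points M = topspace (topology_of M)"

definition smooth_manifold :: "nat \<Rightarrow> 'a riemannian \<Rightarrow> bool" where
  "smooth_manifold m M \<longleftrightarrow>
     Hausdorff_space (topology_of M) \<and> second_countable (topology_of M) \<and>
     (\<forall>c\<in>atlas M. is_chart m (topology_of M) c) \<and>
     points M = (\<Union>c\<in>atlas M. chart_dom c) \<and>
     (\<forall>c\<in>atlas M. \<forall>d\<in>atlas M. \<forall>k<m.
        smooth_on m (chart_map c ` (chart_dom c \<inter> chart_dom d))
          (\<lambda>x. chart_map d (chart_inv c x) k))"

text \<open>The last conjunct is the transformation law of a covariant 2-tensor under a change of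
  charts.\<close>

definition riemannian_metric :: "nat \<Rightarrow> 'a riemannian \<Rightarrow> bool" where
  "riemannian_metric m M \<longleftrightarrow>
     (\<forall>c\<in>atlas M. \<forall>i<m. \<forall>j<m.
        smooth_on m (chart_map c ` chart_dom c) (\<lambda>x. components M c x i j)) \<and>
     (\<forall>c\<in>atlas M. \<forall>x\<in>chart_map c ` chart_dom c.
        (\<forall>i<m. \<forall>j<m. components M c x i j = components M c x j i) \<and>
        (\<forall>v. (\<exists>i<m. v i \<noteq> 0) \<longrightarrow> 0 < bilinear_form m (components M c x) v v)) \<and>
     (\<forall>c\<in>atlas M. \<forall>d\<in>atlas M. \<forall>p\<in>chart_dom c \<inter> chart_dom d. \<forall>i<m. \<forall>j<m.
        (let J = jacobian (\<lambda>x. chart_map d (chart_inv c x)) (chart_map c p)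
         in components M c (chart_map c p) i j =
              (\<Sum>k<m. \<Sum>l<m. J k i * J l j * components M d (chart_map d p) k l)))"

definition riemannian_manifold :: "nat \<Rightarrow> 'a riemannian \<Rightarrow> bool" where
  "riemannian_manifold m M \<longleftrightarrow> smooth_manifold m M \<and> riemannian_metric m M"

definition closed_riemannian_manifold :: "nat \<Rightarrow> 'a riemannian \<Rightarrow> bool" where
  "closed_riemannian_manifold m M \<longleftrightarrow>
     riemannian_manifold m M \<and> compact_space (topology_of M) \<and> points M \<noteq> {}"

text \<open>The Riemannian volume: the unique Borel measure with density \<open>sqrt (det g)\<close> with respect to
  Lebesgue measure in every chart.\<close>

definition riemannian_volume :: "nat \<Rightarrow> 'a riemannian \<Rightarrow> 'a measure" where
  "riemannian_volume m M =
     (THE \<mu>. space \<mu> = points M \<and>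
             sets \<mu> = sigma_sets (points M) {U. openin (topology_of M) U} \<and>
             (\<forall>c\<in>atlas M. \<forall>A\<in>sets \<mu>. A \<subseteq> chart_dom c \<longrightarrow>
                emeasure \<mu> A =
                  (\<integral>\<^sup>+x\<in>chart_map c ` A. ennreal (sqrt (determinant m (components M c x)))
                     \<partial>lebesgue_space m)))"


section \<open>Minimal submanifolds\<close>

text \<open>A local parametrization \<open>\<psi> : V \<rightarrow> F\<close> of a \<open>k\<close>-dimensional embedded submanifold \<open>F\<close> of the
  \<open>m\<close>-dimensional manifold \<open>M\<close>: a smooth immersion of an open set of \<open>Euclidean_space k\<close> which is
  a homeomorphism onto a relatively open subset of \<open>F\<close>.\<close>

definition local_parametrization ::
  "nat \<Rightarrow> 'a riemannian \<Rightarrow> nat \<Rightarrow> 'a set \<Rightarrow> (nat \<Rightarrow> real) set \<Rightarrow> ((nat \<Rightarrow> real) \<Rightarrow> 'a) \<Rightarrow> bool" where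
  "local_parametrization m M k F V \<psi> \<longleftrightarrow>
     openin (Euclidean_space k) V \<and>
     openin (subtopology (topology_of M) F) (\<psi> ` V) \<and>
     homeomorphic_map (subtopology (Euclidean_space k) V)
       (subtopology (topology_of M) (\<psi> ` V)) \<psi> \<and>
     (\<forall>c\<in>atlas M. \<forall>i<m. smooth_on k {y\<in>V. \<psi> y \<in> chart_dom c} (\<lambda>y. chart_map c (\<psi> y) i)) \<and>
     (\<forall>c\<in>atlas M. \<forall>y\<in>V. \<psi> y \<in> chart_dom c \<longrightarrow>
        (\<forall>v. (\<forall>i<m. apply_matrix k (jacobian (\<lambda>y. chart_map c (\<psi> y)) y) v i = 0) \<longrightarrow>
             (\<forall>a<k. v a = 0)))"

definition embedded_submanifold :: "nat \<Rightarrow> 'a riemannian \<Rightarrow> nat \<Rightarrow> 'a set \<Rightarrow> bool" where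
  "embedded_submanifold m M k F \<longleftrightarrow>
     F \<subseteq> points M \<and> (\<forall>p\<in>F. \<exists>V \<psi>. local_parametrization m M k F V \<psi> \<and> p \<in> \<psi> ` V)"

text \<open>\<open>christoffel m M c x i j k\<close> is the symbol with upper index \<open>i\<close> and lower indices \<open>j\<close>, \<open>k\<close>
  of the Levi-Civita connection.\<close>

definition christoffel ::
  "nat \<Rightarrow> 'a riemannian \<Rightarrow> 'a chart \<Rightarrow> (nat \<Rightarrow> real) \<Rightarrow> nat \<Rightarrow> nat \<Rightarrow> nat \<Rightarrow> real" where
  "christoffel m M c x i j k =
     (\<Sum>l<m. inverse_matrix m (components M c x) i l *
        (partial j (\<lambda>z. components M c z k l) x +
         partial k (\<lambda>z. components M c z j l) x -
         partial l (\<lambda>z. components M c z j k) x)) / 2"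

text \<open>For a local parametrization \<open>\<psi>\<close>, everything below is expressed in the chart \<open>c\<close> at the
  parameter \<open>y\<close>, with \<open>u = chart_map c \<circ> \<psi>\<close>: the tangent vectors
  \<open>\<partial>\<^sub>a u\<close>, the first fundamental form \<open>h\<^sub>a\<^sub>b = g(\<partial>\<^sub>a u, \<partial>\<^sub>b u)\<close>, the ambient covariant derivative
  of \<open>\<partial>\<^sub>b u\<close> in the direction \<open>\<partial>\<^sub>a u\<close>, and the projection of a vector to the normal space.
  The mean curvature vector is the trace of the second fundamental form with respect to \<open>h\<close>
  (not divided by the dimension \<open>k\<close>).\<close>

definition tangent_vector ::
  "'a chart \<Rightarrow> ((nat \<Rightarrow> real) \<Rightarrow> 'a) \<Rightarrow> (nat \<Rightarrow> real) \<Rightarrow> nat \<Rightarrow> (nat \<Rightarrow> real)" where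
  "tangent_vector c \<psi> y a = (\<lambda>i. partial a (\<lambda>z. chart_map c (\<psi> z) i) y)"

definition first_fundamental_form ::
  "nat \<Rightarrow> 'a riemannian \<Rightarrow> 'a chart \<Rightarrow> ((nat \<Rightarrow> real) \<Rightarrow> 'a) \<Rightarrow> (nat \<Rightarrow> real) \<Rightarrow> nat \<Rightarrow> nat \<Rightarrow> real" where
  "first_fundamental_form m M c \<psi> y a b =
     bilinear_form m (components M c (chart_map c (\<psi> y)))
       (tangent_vector c \<psi> y a) (tangent_vector c \<psi> y b)"

definition covariant_derivative ::
  "nat \<Rightarrow> 'a riemannian \<Rightarrow> 'a chart \<Rightarrow> ((nat \<Rightarrow> real) \<Rightarrow> 'a) \<Rightarrow> (nat \<Rightarrow> real) \<Rightarrow> nat \<Rightarrow> nat \<Rightarrow> (nat \<Rightarrow> real)" where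
  "covariant_derivative m M c \<psi> y a b =
     (\<lambda>i. partial a (\<lambda>z. tangent_vector c \<psi> z b i) y +
          (\<Sum>j<m. \<Sum>k<m. christoffel m M c (chart_map c (\<psi> y)) i j k *
              tangent_vector c \<psi> y a j * tangent_vector c \<psi> y b k))"

definition normal_part ::
  "nat \<Rightarrow> 'a riemannian \<Rightarrow> nat \<Rightarrow> 'a chart \<Rightarrow> ((nat \<Rightarrow> real) \<Rightarrow> 'a) \<Rightarrow> (nat \<Rightarrow> real) \<Rightarrow> (nat \<Rightarrow> real) \<Rightarrow> (nat \<Rightarrow> real)" where
  "normal_part m M k c \<psi> y v =
     (\<lambda>i. v i - (\<Sum>a<k. \<Sum>b<k. inverse_matrix k (first_fundamental_form m M c \<psi> y) a b *
        bilinear_form m (components M c (chart_map c (\<psi> y))) v (tangent_vector c \<psi> y b) *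
        tangent_vector c \<psi> y a i))"

definition second_fundamental_form ::
  "nat \<Rightarrow> 'a riemannian \<Rightarrow> nat \<Rightarrow> 'a chart \<Rightarrow> ((nat \<Rightarrow> real) \<Rightarrow> 'a) \<Rightarrow> (nat \<Rightarrow> real) \<Rightarrow> nat \<Rightarrow> nat \<Rightarrow> (nat \<Rightarrow> real)" where
  "second_fundamental_form m M k c \<psi> y a b =
     normal_part m M k c \<psi> y (covariant_derivative m M c \<psi> y a b)"

definition mean_curvature_vector ::
  "nat \<Rightarrow> 'a riemannian \<Rightarrow> nat \<Rightarrow> 'a chart \<Rightarrow> ((nat \<Rightarrow> real) \<Rightarrow> 'a) \<Rightarrow> (nat \<Rightarrow> real) \<Rightarrow> (nat \<Rightarrow> real)" where
  "mean_curvature_vector m M k c \<psi> y =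
     (\<lambda>i. \<Sum>a<k. \<Sum>b<k. inverse_matrix k (first_fundamental_form m M c \<psi> y) a b *
        second_fundamental_form m M k c \<psi> y a b i)"

definition minimal_submanifold :: "nat \<Rightarrow> 'a riemannian \<Rightarrow> nat \<Rightarrow> 'a set \<Rightarrow> bool" where
  "minimal_submanifold m M k F \<longleftrightarrow>
     embedded_submanifold m M k F \<and>
     (\<forall>V \<psi>. local_parametrization m M k F V \<psi> \<longrightarrow>
        (\<forall>c\<in>atlas M. \<forall>y\<in>V. \<psi> y \<in> chart_dom c \<longrightarrow>
           (\<forall>i<m. mean_curvature_vector m M k c \<psi> y i = 0)))"


section \<open>Riemannian submersions\<close>

definition smooth_map :: "nat \<Rightarrow> 'a riemannian \<Rightarrow> nat \<Rightarrow> 'b riemannian \<Rightarrow> ('a \<Rightarrow> 'b) \<Rightarrow> bool" where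
  "smooth_map m M n N f \<longleftrightarrow>
     continuous_map (topology_of M) (topology_of N) f \<and>
     (\<forall>c\<in>atlas M. \<forall>d\<in>atlas N. \<forall>k<n.
        smooth_on m (chart_map c ` {p\<in>chart_dom c. f p \<in> chart_dom d})
          (\<lambda>x. chart_map d (f (chart_inv c x)) k))"

definition differential :: "'a chart \<Rightarrow> 'b chart \<Rightarrow> ('a \<Rightarrow> 'b) \<Rightarrow> 'a \<Rightarrow> nat \<Rightarrow> nat \<Rightarrow> real" where
  "differential c d f p = jacobian (\<lambda>x. chart_map d (f (chart_inv c x))) (chart_map c p)"

definition vertical ::
  "nat \<Rightarrow> nat \<Rightarrow> 'a chart \<Rightarrow> 'b chart \<Rightarrow> ('a \<Rightarrow> 'b) \<Rightarrow> 'a \<Rightarrow> (nat \<Rightarrow> real) \<Rightarrow> bool" where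
  "vertical m n c d f p v \<longleftrightarrow> (\<forall>k<n. apply_matrix m (differential c d f p) v k = 0)"

definition horizontal ::
  "nat \<Rightarrow> 'a riemannian \<Rightarrow> nat \<Rightarrow> 'a chart \<Rightarrow> 'b chart \<Rightarrow> ('a \<Rightarrow> 'b) \<Rightarrow> 'a \<Rightarrow> (nat \<Rightarrow> real) \<Rightarrow> bool" where
  "horizontal m M n c d f p v \<longleftrightarrow>
     (\<forall>u. vertical m n c d f p u \<longrightarrow> bilinear_form m (components M c (chart_map c p)) v u = 0)"

text \<open>A smooth map onto \<open>N\<close> whose differential is surjective at every point and isometric on
  horizontal vectors.\<close>

definition riemannian_submersion ::
  "nat \<Rightarrow> 'a riemannian \<Rightarrow> nat \<Rightarrow> 'b riemannian \<Rightarrow> ('a \<Rightarrow> 'b) \<Rightarrow> bool" where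
  "riemannian_submersion m M n N f \<longleftrightarrow>
     smooth_map m M n N f \<and> f ` points M = points N \<and>
     (\<forall>c\<in>atlas M. \<forall>d\<in>atlas N. \<forall>p\<in>chart_dom c. f p \<in> chart_dom d \<longrightarrow>
        (\<forall>w. \<exists>v. \<forall>k<n. apply_matrix m (differential c d f p) v k = w k) \<and>
        (\<forall>v w. horizontal m M n c d f p v \<and> horizontal m M n c d f p w \<longrightarrow>
           bilinear_form n (components N d (chart_map d (f p)))
             (apply_matrix m (differential c d f p) v) (apply_matrix m (differential c d f p) w) =
           bilinear_form m (components M c (chart_map c p)) v w))"

definition minimal_fibers :: "nat \<Rightarrow> 'a riemannian \<Rightarrow> nat \<Rightarrow> 'b riemannian \<Rightarrow> ('a \<Rightarrow> 'b) \<Rightarrow> bool" where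
  "minimal_fibers m M n N f \<longleftrightarrow>
     (\<forall>q\<in>points N. minimal_submanifold m M (m - n) {x\<in>points M. f x = q})"


section \<open>The unit sphere\<close>

text \<open>The stereographic projection from the pole \<open>(0, \<dots>, 0, s)\<close>, for \<open>s = 1\<close> or \<open>s = -1\<close>.\<close>

definition stereographic :: "nat \<Rightarrow> real \<Rightarrow> (nat \<Rightarrow> real) chart" where
  "stereographic n s =
     \<lparr>chart_dom = {y \<in> topspace (nsphere n). y n \<noteq> s},
      chart_map = (\<lambda>y i. if i < n then y i / (1 - s * y n) else 0)\<rparr>"

text \<open>The metric is the one induced by the inner product of the ambient \<open>(n + 1)\<close>-dimensional
  space.\<close>

definition round_sphere :: "nat \<Rightarrow> (nat \<Rightarrow> real) riemannian" where
  "round_sphere n =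
     \<lparr>topology_of = nsphere n,
      atlas = {stereographic n 1, stereographic n (- 1)},
      components = (\<lambda>c x i j. \<Sum>k\<le>n. jacobian (chart_inv c) x k i * jacobian (chart_inv c) x k j)\<rparr>"

definition sphere_dist :: "nat \<Rightarrow> (nat \<Rightarrow> real) \<Rightarrow> (nat \<Rightarrow> real) \<Rightarrow> real" where
  "sphere_dist n p y = arccos (\<Sum>i\<le>n. p i * y i)"

definition equatorial_band :: "nat \<Rightarrow> (nat \<Rightarrow> real) \<Rightarrow> real \<Rightarrow> (nat \<Rightarrow> real) set" where
  "equatorial_band n p \<epsilon> =
     {y \<in> points (round_sphere n). pi / 2 - \<epsilon> < sphere_dist n p y \<and> sphere_dist n p y < pi / 2 + \<epsilon>}"

definition band_preimage ::
  "'a riemannian \<Rightarrow> nat \<Rightarrow> ('a \<Rightarrow> nat \<Rightarrow> real) \<Rightarrow> (nat \<Rightarrow> real) \<Rightarrow> real \<Rightarrow> 'a set" where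
  "band_preimage M n f p \<epsilon> = {x \<in> points M. f x \<in> equatorial_band n p \<epsilon>}"

end

theory Submission
  imports Defs "HOL-Real_Asymp.Real_Asymp"
begin

text \<open>
  Let \<open>h = p \<bullet> \<pi>\<close> on \<open>\<Sigma>\<close>. As \<open>\<pi>\<close> is a Riemannian submersion, the coordinate functions \<open>\<pi>\<^sub>\<alpha>\<close> satisfy
  \<open>\<langle>grad \<pi>\<^sub>\<alpha>, grad \<pi>\<^sub>\<beta>\<rangle> = \<delta>\<^sub>\<alpha>\<^sub>\<beta> - \<pi>\<^sub>\<alpha> \<pi>\<^sub>\<beta>\<close>. This alone determines their Hessians on the span of the gradients
  (Koszul's trick), whose trace is \<open>- n \<pi>\<^sub>\<alpha>\<close>; the trace over the fiber is the derivative of \<open>\<pi>\<^sub>\<alpha>\<close> along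
  the mean curvature vector of the fiber and vanishes. Hence \<open>|grad h|\<^sup>2 = 1 - h\<^sup>2\<close> and \<open>\<Delta> h = - n h\<close>, and
  Green's identity for \<open>h\<^sup>j\<close> and \<open>h\<close> is a recursion for the moments of \<open>h\<close>. It is also satisfied by the
  function \<open>sin t\<close> on \<open>[- pi / 2, pi / 2]\<close> with the measure \<open>cos\<^sup>n\<^sup>-\<^sup>1 t dt\<close>, so both functions have the same
  law up to normalization. The same argument applies to the identity map of the sphere, so the two
  ratios in the theorem are equal. The lower bound follows from \<open>cos (\<epsilon> + s) \<le> cos \<epsilon> cos s\<close> and
  \<open>cos \<epsilon> \<le> exp (- \<epsilon>\<^sup>2 / 2)\<close>.

  The volume of a compact manifold exists by the change of variables formula for \<open>C\<^sup>1\<close> diffeomorphisms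
  of open subsets of \<open>Euclidean_space m\<close>, which is obtained by comparing both sides on small cubes.
\<close>

section \<open>Continuously differentiable functions of finitely many coordinates\<close>

text \<open>A band is a condition on the single function \<open>h\<close>, so no integration along
  fibers and no coarea formula occurs. The scalar products of the gradients are those of the vectors
  \<open>e_a - y_a y\<close>, the tangential parts of the ambient basis at a point \<open>y\<close>
  of the sphere; a submersion keeps them because it is isometric on horizontal vectors. There are
  \<open>n + 1\<close> gradients in an \<open>n\<close>-dimensional horizontal space. They are
  dependent but form a tight frame, so a trace over that space is a plain sum over them and no
  orthonormal frame is chosen; the factor \<open>n\<close> is \<open>(n + 1) - 1\<close>, the sum of
  all \<open>1 - (\<pi>\<^sub>\<alpha>)\<^sup>2\<close>. The recursion links moments two orders
  apart and starts from the total mass; as \<open>h\<close> is bounded by 1, polynomial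
  approximation turns equal moments into equal laws. The tail estimate yields the constant 1, and
  \<open>sqrt (pi / 2)\<close> enters by being at least 1. The dimension is a number and not a type,
  so all analysis lives on sequences that vanish from index \<open>m\<close> on. Functions are
  differentiated twice and the metric once, which fixes the regularity \<open>C1\<close> and
  \<open>C2\<close> used throughout.\<close>

lemma sum_swap3: "(\<Sum>i\<in>A. \<Sum>j\<in>B. \<Sum>a\<in>C. F i j a) = (\<Sum>a\<in>C. \<Sum>i\<in>A. \<Sum>j\<in>B. F i j a)"
proof -
  have "(\<Sum>i\<in>A. \<Sum>j\<in>B. \<Sum>a\<in>C. F i j a) = (\<Sum>i\<in>A. \<Sum>a\<in>C. \<Sum>j\<in>B. F i j a)" by (intro sum.cong refl sum.swap)
  also have "\<dots> = (\<Sum>a\<in>C. \<Sum>i\<in>A. \<Sum>j\<in>B. F i j a)" by (rule sum.swap)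
  finally show ?thesis .
qed

lemma sum_swap_pairs:
  "(\<Sum>i\<in>A. \<Sum>j\<in>B. \<Sum>a\<in>C. \<Sum>b\<in>D. F i j a b) = (\<Sum>a\<in>C. \<Sum>b\<in>D. \<Sum>i\<in>A. \<Sum>j\<in>B. F i j a b)"
  by (rule trans[OF sum_swap3]) (intro sum.cong refl sum_swap3)

section \<open>Open sets of \<open>Euclidean_space m\<close> tested on coordinate cubes\<close>

abbreviation (input) "flat m x \<equiv> \<forall>i\<ge>m. x i = (0 :: real)"
abbreviation (input) "close m r x y \<equiv> \<forall>i<m. \<bar>y i - x i\<bar> < (r :: real)"
abbreviation "eucl_open m \<equiv> openin (Euclidean_space m)"

lemma openin_Euclidean_space_iff:
  "eucl_open m V \<longleftrightarrow> (\<exists>T. open T \<and> V = T \<inter> {x. \<forall>i\<ge>m. x i = 0})"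
  unfolding Euclidean_space_def openin_subtopology euclidean_product_topology by simp

lemma openin_Euclidean_space_subset:
  "eucl_open m V \<Longrightarrow> x \<in> V \<Longrightarrow> i \<ge> m \<Longrightarrow> x i = 0"
  unfolding openin_Euclidean_space_iff by auto

lemma continuous_map_Euclidean_real:
  assumes "eucl_open m V"
  shows "continuous_map (subtopology (Euclidean_space m) V) euclideanreal f \<longleftrightarrow> continuous_on V f"
proof -
  have V: "{x. \<forall>i\<ge>m. x i = 0} \<inter> V = V" using assms unfolding openin_Euclidean_space_iff by auto
  show ?thesis
    unfolding Euclidean_space_def subtopology_subtopology V euclidean_product_topology
    by simp
qed

text \<open>Radii found for each coordinate separately are merged into one. The induction stands in
  for a minimum over a possibly empty set: for \<open>m = 0\<close> any positive radius will
  do.\<close>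

lemma ex_common_radius:
  fixes m :: nat
  assumes "\<And>i. i < m \<Longrightarrow> \<exists>r>0. P i (r::real)" and "\<And>i r s. P i r \<Longrightarrow> 0 < s \<Longrightarrow> s \<le> r \<Longrightarrow> P i s"
  shows "\<exists>r>0. \<forall>i<m. P i r"
  using assms(1)
proof (induction m)
  case 0
  then show ?case by (auto intro: exI[of _ 1])
next
  case (Suc m)
  then obtain r where r: "r > 0" "\<forall>i<m. P i r" by auto
  obtain s where s: "s > 0" "P m s" using Suc.prems[of m] by auto
  have "P i (min r s)" if "i < Suc m" for i
    using r s assms(2)[of i r "min r s"] assms(2)[of m s "min r s"] that by (cases "i = m") auto
  moreover have "min r s > 0" using r s by simp
  ultimately show ?case by blast
qed

text \<open>A basic open set of the product topology restricts every coordinate by an open set. Only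
  the first \<open>m\<close> of these restrictions bind, because \<open>x\<close> and
  \<open>y\<close> both vanish from index \<open>m\<close> on.\<close>

lemma openin_Euclidean_cube:
  assumes V: "eucl_open m V" and x: "x \<in> V"
  shows "\<exists>r>0. \<forall>y. flat m y \<longrightarrow> close m r x y \<longrightarrow> y \<in> V"
proof -
  obtain T where T: "open T" "V = T \<inter> {x. \<forall>i\<ge>m. x i = 0}"
    using V unfolding openin_Euclidean_space_iff by auto
  have "openin (product_topology (\<lambda>i. euclidean) UNIV) T"
    using T(1) by (simp add: euclidean_product_topology)
  from product_topology_open_contains_basis[OF this, of x] T x
  obtain X where X: "x \<in> (\<Pi>\<^sub>E i\<in>UNIV. X i)" "\<And>i. open (X i)" "(\<Pi>\<^sub>E i\<in>UNIV. X i) \<subseteq> T"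
    by auto
  have "\<exists>r>0. \<forall>i<m. \<forall>t. \<bar>t - x i\<bar> < r \<longrightarrow> t \<in> X i"
  proof (rule ex_common_radius)
    fix i assume "i < m"
    have "x i \<in> X i" using X(1) by auto
    then show "\<exists>r>0. \<forall>t. \<bar>t - x i\<bar> < r \<longrightarrow> t \<in> X i"
      using X(2)[of i] unfolding open_real by blast
  qed auto
  then obtain r where r: "r > 0" "\<forall>i<m. \<forall>t. \<bar>t - x i\<bar> < r \<longrightarrow> t \<in> X i" by blast
  show ?thesis
  proof (rule exI[of _ r], rule conjI[OF r(1)], intro allI impI)
    fix y assume y: "flat m y" "close m r x y"
    have "y i \<in> X i" for i
    proof (cases "i < m")
      case True
      then show ?thesis using r y by auto
    next
      case False
      then have "y i = x i" using y(1) x T(2) by auto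
      then show ?thesis using X(1) by auto
    qed
    then have "y \<in> T" using X(3) by auto
    then show "y \<in> V" using y(1) T(2) by auto
  qed
qed

lemma openin_Euclidean_cubeI:
  assumes "finite I"
  shows "eucl_open m {y. flat m y \<and> (\<forall>i\<in>I. \<bar>y i - x i\<bar> < r)}"
proof -
  have "open (\<Inter>i\<in>I. {y :: nat \<Rightarrow> real. \<bar>y i - x i\<bar> < r})"
    by (intro open_INT assms ballI open_Collect_less continuous_intros continuous_on_product_coordinates)
  then show ?thesis unfolding openin_Euclidean_space_iff by (intro exI conjI) auto
qed

lemma openin_Euclidean_vimage:
  assumes V: "eucl_open m V" and f: "continuous_on V f" and "open S"
  shows "eucl_open m {x\<in>V. f x \<in> S}"
proof -
  obtain T where T: "open T" "V = T \<inter> {x. \<forall>i\<ge>m. x i = 0}"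
    using V unfolding openin_Euclidean_space_iff by auto
  obtain A where A: "open A" "A \<inter> V = f -` S \<inter> V"
    using f \<open>open S\<close> unfolding continuous_on_open_invariant by blast
  then have "{x\<in>V. f x \<in> S} = (A \<inter> T) \<inter> {x. \<forall>i\<ge>m. x i = 0}" using T by auto
  then show ?thesis unfolding openin_Euclidean_space_iff using A T by blast
qed

lemma continuous_on_cube:
  fixes f :: "(nat \<Rightarrow> real) \<Rightarrow> real"
  assumes V: "eucl_open m V" and f: "continuous_on V f" and x: "x \<in> V" and "e > 0"
  shows "\<exists>r>0. \<forall>y. flat m y \<longrightarrow> close m r x y \<longrightarrow> y \<in> V \<and> \<bar>f y - f x\<bar> < e"
proof -
  have "eucl_open m {y\<in>V. f y \<in> ball (f x) e}"
    by (rule openin_Euclidean_vimage[OF V f]) simp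
  moreover have "x \<in> {y\<in>V. f y \<in> ball (f x) e}" using x \<open>e > 0\<close> by simp
  ultimately obtain r where "r > 0"
    "\<forall>y. flat m y \<longrightarrow> close m r x y \<longrightarrow> y \<in> {y\<in>V. f y \<in> ball (f x) e}"
    using openin_Euclidean_cube by blast
  then show ?thesis by (intro exI[of _ r]) (auto simp: dist_real_def abs_minus_commute)
qed

lemma continuous_on_cubeI:
  fixes f :: "(nat \<Rightarrow> real) \<Rightarrow> real"
  assumes "\<And>x e. x \<in> V \<Longrightarrow> e > 0 \<Longrightarrow> \<exists>r>0. \<forall>y\<in>V. close m r x y \<longrightarrow> \<bar>f y - f x\<bar> < e"
  shows "continuous_on V f"
  unfolding continuous_on_def
proof (intro ballI tendstoI)
  fix x e assume "x \<in> V" "e > (0::real)"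
  then obtain r where r: "r > 0" "\<forall>y\<in>V. close m r x y \<longrightarrow> \<bar>f y - f x\<bar> < e"
    using assms by blast
  have "open (\<Inter>i\<in>{..<m}. {y :: nat \<Rightarrow> real. \<bar>y i - x i\<bar> < r})"
    by (intro open_INT ballI open_Collect_less continuous_intros continuous_on_product_coordinates) auto
  then have "\<forall>\<^sub>F y in at x within V. y \<in> (\<Inter>i\<in>{..<m}. {y. \<bar>y i - x i\<bar> < r})"
    by (rule eventually_at_topological[THEN iffD2, OF exI, OF conjI]) (use r in auto)
  moreover have "\<forall>\<^sub>F y in at x within V. y \<in> V"
    unfolding eventually_at_topological by blast
  ultimately show "\<forall>\<^sub>F y in at x within V. dist (f y) (f x) < e"
    by eventually_elim (use r in \<open>auto simp: dist_real_def\<close>)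
qed

lemma continuous_on_upd:
  fixes x :: "nat \<Rightarrow> real"
  shows "continuous_on S (\<lambda>t. x(i := t))"
proof (rule continuous_on_coordinatewise_then_product)
  fix j show "continuous_on S (\<lambda>t. (x(i := t)) j)" by (cases "j = i") (auto intro: continuous_intros)
qed

lemma open_upd_vimage:
  assumes V: "eucl_open m V" and "i < m" and x: "\<And>j. j \<ge> m \<Longrightarrow> x j = 0"
  shows "open {t. x(i := t) \<in> V}"
proof -
  obtain T where T: "open T" "V = T \<inter> {x. \<forall>i\<ge>m. x i = 0}"
    using V unfolding openin_Euclidean_space_iff by auto
  have "{t. x(i := t) \<in> V} = (\<lambda>t. x(i := t)) -` T" using T(2) x \<open>i < m\<close> by auto
  then show ?thesis using open_vimage[OF T(1) continuous_on_upd] by simp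
qed

text \<open>A coordinate line stays in \<open>V\<close> near a point of \<open>V\<close>, so
  \<open>partial\<close> sees only the values on \<open>V\<close>. All congruence lemmas for
  derivatives rest on this.\<close>

lemma eventually_upd:
  assumes "eucl_open m V" and "i < m" and "x(i := t) \<in> V"
  shows "\<forall>\<^sub>F s in nhds t. x(i := s) \<in> V"
proof -
  have "open {s. (x(i:=t))(i := s) \<in> V}"
    by (rule open_upd_vimage[OF assms(1,2)]) (use openin_Euclidean_space_subset[OF assms(1,3)] in auto)
  then have "open {s. x(i := s) \<in> V}" by simp
  then show ?thesis unfolding eventually_nhds using assms(3) by blast
qed

section \<open>The classes \<open>C1\<close> and \<open>C2\<close>, their closure properties and the
  chain rule\<close>

definition C1 :: "nat \<Rightarrow> (nat \<Rightarrow> real) set \<Rightarrow> ((nat \<Rightarrow> real) \<Rightarrow> real) \<Rightarrow> bool" where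
  "C1 m V f \<longleftrightarrow> continuous_on V f \<and>
     (\<forall>i<m. continuous_on V (partial i f) \<and> (\<forall>x\<in>V. (\<lambda>t. f (x(i := t))) differentiable (at (x i))))"

definition C2 :: "nat \<Rightarrow> (nat \<Rightarrow> real) set \<Rightarrow> ((nat \<Rightarrow> real) \<Rightarrow> real) \<Rightarrow> bool" where
  "C2 m V f \<longleftrightarrow> C1 m V f \<and> (\<forall>i<m. C1 m V (partial i f))"

lemma C1_continuous: "C1 m V f \<Longrightarrow> continuous_on V f"
  by (simp add: C1_def)

lemma C1_continuous_partial: "C1 m V f \<Longrightarrow> i < m \<Longrightarrow> continuous_on V (partial i f)"
  by (simp add: C1_def)

lemma C2_C1: "C2 m V f \<Longrightarrow> C1 m V f"
  by (simp add: C2_def)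

lemma C2_partial: "C2 m V f \<Longrightarrow> i < m \<Longrightarrow> C1 m V (partial i f)"
  by (simp add: C2_def)

lemma C1_deriv:
  assumes "C1 m V f" "i < m" "x \<in> V"
  shows "((\<lambda>t. f (x(i := t))) has_real_derivative partial i f x) (at (x i))"
  using assms unfolding C1_def partial_def
  by (metis DERIV_deriv_iff_real_differentiable)

lemma C1_deriv_upd:
  assumes "C1 m V f" "i < m" "x(i := t) \<in> V"
  shows "((\<lambda>s. f (x(i := s))) has_real_derivative partial i f (x(i := t))) (at t)"
  using C1_deriv[OF assms] by simp

lemma partial_eqI:
  "((\<lambda>t. f (x(i := t))) has_real_derivative D) (at (x i)) \<Longrightarrow> partial i f x = D"
  unfolding partial_def by (rule DERIV_imp_deriv)

text \<open>\<open>partial\<close> is defined through \<open>deriv\<close>, which is a mere choice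
  where no derivative exists. Candidates \<open>D i\<close> are therefore exhibited first and
  identified with the partial derivatives afterwards.\<close>

lemma C1I:
  assumes "continuous_on V f" and "\<And>i. i < m \<Longrightarrow> continuous_on V (D i)"
    and "\<And>x i. x \<in> V \<Longrightarrow> i < m \<Longrightarrow> ((\<lambda>t. f (x(i := t))) has_real_derivative D i x) (at (x i))"
  shows "C1 m V f"
  unfolding C1_def
proof (intro conjI allI impI ballI)
  fix i assume i: "i < m"
  have "partial i f x = D i x" if "x \<in> V" for x by (rule partial_eqI[OF assms(3)[OF that i]])
  then show "continuous_on V (partial i f)"
    using continuous_on_cong[OF refl, of V "partial i f" "D i"] assms(2)[OF i] by blast
  show "(\<lambda>t. f (x(i := t))) differentiable at (x i)" if "x \<in> V" for x
    using assms(3)[OF that i] real_differentiable_def by blast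
qed (fact assms(1))

lemma partial_cong:
  assumes "eucl_open m V" and "i < m" and "x \<in> V" and "\<And>y. y \<in> V \<Longrightarrow> f y = g y"
  shows "partial i f x = partial i g x"
  unfolding partial_def
proof (rule deriv_cong_ev[OF _ refl])
  have "\<forall>\<^sub>F s in nhds (x i). x(i := s) \<in> V"
    using eventually_upd[OF assms(1,2), of x "x i"] assms(3) by simp
  then show "\<forall>\<^sub>F t in nhds (x i). f (x(i := t)) = g (x(i := t))"
    by eventually_elim (use assms in auto)
qed

lemma C1_cong:
  assumes V: "eucl_open m V" and eq: "\<And>y. y \<in> V \<Longrightarrow> f y = g y"
  shows "C1 m V f \<longleftrightarrow> C1 m V g"
proof -
  have *: "C1 m V h" if "C1 m V f" "\<And>y. y \<in> V \<Longrightarrow> f y = h y" for f h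
  proof (rule C1I)
    show "continuous_on V h" using C1_continuous[OF that(1)] that(2) continuous_on_cong by blast
    show "continuous_on V (partial i f)" if "i < m" for i using C1_continuous_partial \<open>C1 m V f\<close> that .
    fix x i assume x: "x \<in> V" "i < m"
    have "\<forall>\<^sub>F s in nhds (x i). x(i := s) \<in> V"
      using eventually_upd[OF V x(2), of x "x i"] x by simp
    then have "\<forall>\<^sub>F t in nhds (x i). f (x(i := t)) = h (x(i := t))"
      by eventually_elim (use that in auto)
    then show "((\<lambda>t. h (x(i := t))) has_real_derivative partial i f x) (at (x i))"
      using C1_deriv[OF that(1) x(2,1)] by (rule DERIV_cong_ev[OF refl _ refl, THEN iffD1])
  qed
  show ?thesis using *[of f g] *[of g f] eq by metis
qed

lemma C1_subset: "C1 m V f \<Longrightarrow> W \<subseteq> V \<Longrightarrow> C1 m W f"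
  unfolding C1_def by (meson continuous_on_subset subsetD)

text \<open>Differentiability is a pointwise matter. Continuity passes from \<open>W\<close> to
  \<open>V\<close> because a small enough cube about \<open>x\<close> meets \<open>V\<close> only
  inside \<open>W\<close>.\<close>

lemma C1_local:
  assumes V: "\<And>x. x \<in> V \<Longrightarrow> \<exists>W. eucl_open m W \<and> x \<in> W \<and> W \<subseteq> V \<and> C1 m W f"
  shows "C1 m V f"
proof -
  have c: "continuous_on V h" if h: "\<And>W. C1 m W f \<Longrightarrow> continuous_on W h" for h :: "(nat \<Rightarrow> real) \<Rightarrow> real"
  proof (rule continuous_on_cubeI[of _ m])
    fix x e assume x: "x \<in> V" "e > (0::real)"
    then obtain W where W: "eucl_open m W" "x \<in> W" "W \<subseteq> V" "C1 m W f" using V by blast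
    obtain r where "r > 0" and r: "\<forall>y. flat m y \<longrightarrow> close m r x y \<longrightarrow>
        y \<in> W \<and> \<bar>h y - h x\<bar> < e"
      using continuous_on_cube[OF W(1) h[OF W(4)] W(2) x(2)] by blast
    have "y i = 0" if y: "y \<in> V" and i: "i \<ge> m" for y i
    proof -
      obtain W' where "eucl_open m W'" "y \<in> W'" using V[OF y] by blast
      then show ?thesis using openin_Euclidean_space_subset i by blast
    qed
    then have "\<bar>h y - h x\<bar> < e" if "y \<in> V" "close m r x y" for y
      using r[rule_format, of y] that by simp
    then show "\<exists>r>0. \<forall>y\<in>V. close m r x y \<longrightarrow> \<bar>h y - h x\<bar> < e"
      using \<open>r > 0\<close> by (intro exI[of _ r]) simp
  qed
  show ?thesis
    unfolding C1_def
  proof (intro conjI allI impI ballI c)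
    fix x i assume "x \<in> V" "i < m"
    then show "(\<lambda>t. f (x(i := t))) differentiable at (x i)" using V[of x] unfolding C1_def by blast
  qed (auto simp: C1_def)
qed

lemma smooth_on_C1:
  assumes "eucl_open m V" "smooth_on m V f"
  shows "C1 m V f"
proof -
  have *: "continuous_on V (iterated_partial is f)" if "set is \<subseteq> {..<m}" for "is"
    using assms(2) that unfolding smooth_on_def continuous_map_Euclidean_real[OF assms(1)] by blast
  have "continuous_on V (iterated_partial [] f)" by (rule *) simp
  moreover have "continuous_on V (iterated_partial [i] f)" if "i < m" for i by (rule *) (use that in simp)
  moreover have "\<forall>x\<in>V. \<forall>i<m. (\<lambda>t. iterated_partial [] f (x(i := t))) differentiable (at (x i))"
    using assms unfolding smooth_on_def by (metis empty_subsetI list.set(1))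
  ultimately show ?thesis unfolding C1_def by simp
qed

text \<open>The head of the list is the derivative taken last. Absorbing the end of the list into
  \<open>f\<close> is what shows that a derivative of a smooth function is smooth.\<close>

lemma iterated_partial_snoc: "iterated_partial (is @ [i]) f = iterated_partial is (partial i f)"
  by (induction "is") auto

lemma smooth_on_partial:
  assumes "smooth_on m V f" "i < m"
  shows "smooth_on m V (partial i f)"
  unfolding smooth_on_def
proof (intro allI impI)
  fix "is" assume "set is \<subseteq> {..<m}"
  then have "set (is @ [i]) \<subseteq> {..<m}" using assms(2) by auto
  then show "continuous_map (subtopology (Euclidean_space m) V) euclideanreal (iterated_partial is (partial i f)) \<and>
     (\<forall>x\<in>V. \<forall>ia<m. (\<lambda>t. iterated_partial is (partial i f) (x(ia := t))) differentiable at (x ia))"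
    using assms(1) unfolding smooth_on_def iterated_partial_snoc[symmetric] by blast
qed

lemma smooth_on_C2:
  assumes "eucl_open m V" "smooth_on m V f"
  shows "C2 m V f"
  unfolding C2_def using smooth_on_C1[OF assms(1)] smooth_on_partial[OF assms(2)] assms(2) by blast

text \<open>Strict differentiability: the error is small relative to \<open>z - y\<close>, not only to \<open>z - x\<close>. The
  proof changes one coordinate at a time.\<close>

lemma C1_strict:
  assumes V: "eucl_open m V" and f: "C1 m V f" and x: "x \<in> V" and "e > 0"
  shows "\<exists>r>0. \<forall>y z. flat m y \<longrightarrow> flat m z \<longrightarrow>
       close m r x y \<longrightarrow> close m r x z \<longrightarrow>
       y \<in> V \<and> \<bar>f z - f y - (\<Sum>i<m. partial i f x * (z i - y i))\<bar> \<le> e * (\<Sum>i<m. \<bar>z i - y i\<bar>)"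
proof -
  have "\<exists>r>0. \<forall>i<m. \<forall>y. (\<forall>j\<ge>m. y j = 0) \<longrightarrow> (\<forall>j<m. \<bar>y j - x j\<bar> < r) \<longrightarrow>
      y \<in> V \<and> \<bar>partial i f y - partial i f x\<bar> < e"
  proof (rule ex_common_radius)
    fix i assume "i < m"
    from continuous_on_cube[OF V C1_continuous_partial[OF f this] x \<open>e > 0\<close>]
    show "\<exists>r>0. \<forall>y. (\<forall>j\<ge>m. y j = 0) \<longrightarrow> (\<forall>j<m. \<bar>y j - x j\<bar> < r) \<longrightarrow>
      y \<in> V \<and> \<bar>partial i f y - partial i f x\<bar> < e" by blast
  next
    fix i r s
    assume *: "\<forall>y. (\<forall>j\<ge>m. y j = 0) \<longrightarrow> (\<forall>j<m. \<bar>y j - x j\<bar> < r) \<longrightarrow>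
      y \<in> V \<and> \<bar>partial i f y - partial i f x\<bar> < e" and "s \<le> (r :: real)"
    show "\<forall>y. (\<forall>j\<ge>m. y j = 0) \<longrightarrow> (\<forall>j<m. \<bar>y j - x j\<bar> < s) \<longrightarrow>
      y \<in> V \<and> \<bar>partial i f y - partial i f x\<bar> < e"
    proof (intro allI impI *[rule_format])
      fix y j assume "\<forall>j<m. \<bar>y j - x j\<bar> < s" "j < m"
      then show "\<bar>y j - x j\<bar> < r" using \<open>s \<le> r\<close> by force
    qed auto
  qed
  then obtain r0 where r0: "r0 > 0" "\<And>i y. i < m \<Longrightarrow> (\<forall>j\<ge>m. y j = 0) \<Longrightarrow> (\<forall>j<m. \<bar>y j - x j\<bar> < r0) \<Longrightarrow>
      y \<in> V \<and> \<bar>partial i f y - partial i f x\<bar> < e" by blast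
  obtain r1 where r1: "r1 > 0" "\<forall>y. flat m y \<longrightarrow> close m r1 x y \<longrightarrow> y \<in> V"
    using openin_Euclidean_cube[OF V x] by blast
  define r where "r = min r0 r1"
  have "r > 0" "r \<le> r0" "r \<le> r1" using r0 r1 by (auto simp: r_def)
  show ?thesis
  proof (rule exI[of _ r], rule conjI[OF \<open>r > 0\<close>], intro allI impI)
    fix y z :: "nat \<Rightarrow> real"
    assume "flat m y" "flat m z" "close m r x y" "close m r x z"
    then have y0: "\<And>i. i \<ge> m \<Longrightarrow> y i = 0" and z0: "\<And>i. i \<ge> m \<Longrightarrow> z i = 0"
      and y: "\<And>i. i < m \<Longrightarrow> \<bar>y i - x i\<bar> < r" and z: "\<And>i. i < m \<Longrightarrow> \<bar>z i - x i\<bar> < r" by auto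
    \<comment> \<open>Hybrid points: the first \<open>k\<close> coordinates are those of
      \<open>z\<close> and the others those of \<open>y\<close>, so \<open>w\<close> leads from
      \<open>y\<close> to \<open>z\<close> by moves along single coordinates.\<close>
    define w where "w k = (\<lambda>i. if i < k then z i else y i)" for k
    have w0: "w 0 = y" by (auto simp: w_def)
    have wm: "w m = z" using y0 z0 by (auto simp: w_def)
    have ws: "w (Suc k) = (w k)(k := z k)" for k by (auto simp: w_def less_Suc_eq)
    have step: "\<bar>f (w (Suc k)) - f (w k) - partial k f x * (z k - y k)\<bar> \<le> e * \<bar>z k - y k\<bar>" if k: "k < m" for k
    proof -
      define S where "S = {x k - r <..< x k + r}"
      \<comment> \<open>Without its linear part the function has as derivative the deviation of
        \<open>partial k f\<close> from its value at \<open>x\<close>, which is below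
        \<open>e\<close> on the cube.\<close>
      define g where "g t = f ((w k)(k := t)) - partial k f x * t" for t
      have near: "(w k)(k := t) \<in> V \<and> \<bar>partial k f ((w k)(k := t)) - partial k f x\<bar> < e" if "t \<in> S" for t
      proof (rule r0(2)[OF k])
        show "\<forall>j\<ge>m. ((w k)(k := t)) j = 0" using y0 z0 k by (auto simp: w_def)
        show "\<forall>j<m. \<bar>((w k)(k := t)) j - x j\<bar> < r0"
        proof (intro allI impI)
          fix j assume "j < m"
          then show "\<bar>((w k)(k := t)) j - x j\<bar> < r0"
            using y[of j] z[of j] that \<open>r \<le> r0\<close> by (cases "j = k"; cases "j < k") (auto simp: w_def S_def)
        qed
      qed
      have "norm (g (z k) - g (y k)) \<le> e * norm (z k - y k)"
      proof (rule field_differentiable_bound[where S = S and f' = "\<lambda>t. partial k f ((w k)(k := t)) - partial k f x"])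
        show "convex S" by (simp add: S_def)
        fix t assume t: "t \<in> S"
        have "(g has_real_derivative (partial k f ((w k)(k := t)) - partial k f x * 1)) (at t)"
          unfolding g_def using near[OF t]
          by (intro DERIV_diff C1_deriv_upd[OF f k] DERIV_cmult DERIV_ident) auto
        then show "(g has_real_derivative (partial k f ((w k)(k := t)) - partial k f x)) (at t within S)"
          by (simp add: has_field_derivative_at_within)
        show "norm (partial k f ((w k)(k := t)) - partial k f x) \<le> e" using near[OF t] by simp
      qed (use y[OF k] z[OF k] in \<open>auto simp: S_def abs_less_iff\<close>)
      moreover have "(w k)(k := y k) = w k" by (auto simp: w_def)
      ultimately show ?thesis by (simp add: g_def ws algebra_simps)
    qed
    have "f z - f y - (\<Sum>i<m. partial i f x * (z i - y i)) =
        (\<Sum>k<m. f (w (Suc k)) - f (w k)) - (\<Sum>i<m. partial i f x * (z i - y i))"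
      using sum_lessThan_telescope[of "\<lambda>k. f (w k)" m] by (simp add: w0 wm)
    also have "\<dots> = (\<Sum>k<m. f (w (Suc k)) - f (w k) - partial k f x * (z k - y k))"
      by (simp add: sum_subtractf)
    also have "\<bar>\<dots>\<bar> \<le> (\<Sum>k<m. e * \<bar>z k - y k\<bar>)"
      by (rule order_trans[OF sum_abs]) (auto intro: sum_mono step)
    finally have "\<bar>f z - f y - (\<Sum>i<m. partial i f x * (z i - y i))\<bar> \<le> e * (\<Sum>i<m. \<bar>z i - y i\<bar>)"
      by (simp add: sum_distrib_left)
    moreover have "y \<in> V"
    proof (rule r1(2)[rule_format])
      show "\<bar>y i - x i\<bar> < r1" if "i < m" for i using y[OF that] \<open>r \<le> r1\<close> by simp
    qed (rule y0)
    ultimately show "y \<in> V \<and> \<bar>f z - f y - (\<Sum>i<m. partial i f x * (z i - y i))\<bar> \<le> e * (\<Sum>i<m. \<bar>z i - y i\<bar>)"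
      by blast
  qed
qed

text \<open>By strict differentiability the error is small relative to the sum of the increments of
  \<open>g\<close>, and divided by \<open>s - t\<close> these increments stay bounded. The curve
  must be flat near \<open>t\<close> because cubes control only flat points.\<close>

lemma C1_chain:
  assumes V: "eucl_open n V" and f: "C1 n V f" and g0: "g t \<in> V"
    and g: "\<And>k. k < n \<Longrightarrow> ((\<lambda>s. g s k) has_real_derivative g' k) (at t)"
    and gz: "\<forall>\<^sub>F s in at t. \<forall>k\<ge>n. g s k = 0"
  shows "((\<lambda>s. f (g s)) has_real_derivative (\<Sum>k<n. partial k f (g t) * g' k)) (at t)"
proof -
  define q where "q s k = (g s k - g t k) / (s - t)" for s k
  have q: "((\<lambda>s. q s k) \<longlongrightarrow> g' k) (at t)" if "k < n" for k
    using g[OF that] unfolding has_field_derivative_iff q_def .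
  define B where "B = (\<Sum>k<n. \<bar>g' k\<bar>) + 1"
  have "B > 0" unfolding B_def by (simp add: add_nonneg_pos sum_nonneg)
  have "((\<lambda>s. \<Sum>k<n. \<bar>q s k\<bar>) \<longlongrightarrow> (\<Sum>k<n. \<bar>g' k\<bar>)) (at t)"
    by (intro tendsto_sum tendsto_rabs q) auto
  then have Bev: "\<forall>\<^sub>F s in at t. (\<Sum>k<n. \<bar>q s k\<bar>) < B"
    by (rule order_tendstoD) (simp add: B_def)
  define R where "R s = (f (g s) - f (g t)) / (s - t) - (\<Sum>k<n. partial k f (g t) * q s k)" for s
  have "(R \<longlongrightarrow> 0) (at t)"
  proof (rule tendstoI)
    fix e :: real assume "e > 0"
    \<comment> \<open>Near \<open>t\<close> the difference quotients of \<open>g\<close> add up to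
      less than \<open>B\<close>, and \<open>e' * B = e / 2\<close>.\<close>
    define e' where "e' = e / (2 * B)"
    have "e' > 0" using \<open>e > 0\<close> \<open>B > 0\<close> by (simp add: e'_def)
    obtain r where r: "r > 0" "\<forall>y z. flat n y \<longrightarrow> flat n z \<longrightarrow>
       (\<forall>i<n. \<bar>y i - g t i\<bar> < r) \<longrightarrow> (\<forall>i<n. \<bar>z i - g t i\<bar> < r) \<longrightarrow>
       y \<in> V \<and> \<bar>f z - f y - (\<Sum>i<n. partial i f (g t) * (z i - y i))\<bar> \<le> e' * (\<Sum>i<n. \<bar>z i - y i\<bar>)"
      using C1_strict[OF V f g0 \<open>e' > 0\<close>] by blast
    have "\<forall>\<^sub>F s in at t. \<forall>k\<in>{..<n}. \<bar>g s k - g t k\<bar> < r"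
    proof (rule eventually_ball_finite, simp, intro ballI)
      fix k assume "k \<in> {..<n}"
      then have "((\<lambda>s. g s k) \<longlongrightarrow> g t k) (at t)"
        using DERIV_isCont[OF g] by (simp add: isCont_def)
      from tendstoD[OF this r(1)] show "\<forall>\<^sub>F s in at t. \<bar>g s k - g t k\<bar> < r" by (simp add: dist_real_def)
    qed
    moreover have "\<forall>\<^sub>F s in at t. s \<noteq> t" by (simp add: eventually_at_filter)
    ultimately show "\<forall>\<^sub>F s in at t. dist (R s) 0 < e"
      using gz Bev
    proof eventually_elim
      case (elim s)
      have "\<bar>f (g s) - f (g t) - (\<Sum>i<n. partial i f (g t) * (g s i - g t i))\<bar> \<le> e' * (\<Sum>i<n. \<bar>g s i - g t i\<bar>)"
        using r(2)[rule_format, of "g t" "g s"] elim r(1) openin_Euclidean_space_subset[OF V g0] by auto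
      then have "\<bar>f (g s) - f (g t) - (\<Sum>i<n. partial i f (g t) * (g s i - g t i))\<bar> / \<bar>s - t\<bar> \<le> e' * (\<Sum>i<n. \<bar>g s i - g t i\<bar>) / \<bar>s - t\<bar>"
        by (rule divide_right_mono) simp
      also have "\<bar>f (g s) - f (g t) - (\<Sum>i<n. partial i f (g t) * (g s i - g t i))\<bar> / \<bar>s - t\<bar> = \<bar>R s\<bar>"
      proof -
        have "(\<Sum>i<n. partial i f (g t) * (g s i - g t i)) / (s - t) = (\<Sum>k<n. partial k f (g t) * q s k)"
          by (simp add: q_def sum_divide_distrib)
        then have "R s = (f (g s) - f (g t) - (\<Sum>i<n. partial i f (g t) * (g s i - g t i))) / (s - t)"
          by (simp only: R_def diff_divide_distrib[of "f (g s) - f (g t)"])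
        then show ?thesis by (simp only: abs_divide)
      qed
      also have "e' * (\<Sum>i<n. \<bar>g s i - g t i\<bar>) / \<bar>s - t\<bar> = e' * (\<Sum>k<n. \<bar>q s k\<bar>)"
        unfolding q_def abs_divide sum_divide_distrib[symmetric] by simp
      also have "\<dots> \<le> e' * B" using elim \<open>e' > 0\<close> by (intro mult_left_mono) auto
      also have "\<dots> < e" using \<open>e > 0\<close> \<open>B > 0\<close> by (simp add: e'_def field_simps)
      finally show ?case by simp
    qed
  qed
  moreover have "((\<lambda>s. \<Sum>k<n. partial k f (g t) * q s k) \<longlongrightarrow> (\<Sum>k<n. partial k f (g t) * g' k)) (at t)"
    by (intro tendsto_sum tendsto_mult tendsto_const q) auto
  ultimately have "((\<lambda>s. R s + (\<Sum>k<n. partial k f (g t) * q s k)) \<longlongrightarrow> 0 + (\<Sum>k<n. partial k f (g t) * g' k)) (at t)"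
    by (rule tendsto_add)
  then show ?thesis unfolding has_field_derivative_iff R_def by simp
qed

lemma C1_compose_deriv:
  assumes V: "eucl_open m V" and W: "eucl_open n W" and f: "C1 n W f"
    and w: "\<And>k. k < n \<Longrightarrow> C1 m V (\<lambda>x. w x k)" and wW: "\<And>x. x \<in> V \<Longrightarrow> w x \<in> W"
    and x: "x \<in> V" and i: "i < m"
  shows "((\<lambda>t. f (w (x(i := t)))) has_real_derivative
    (\<Sum>k<n. partial k f (w x) * partial i (\<lambda>z. w z k) x)) (at (x i))"
proof -
  have ev: "\<forall>\<^sub>F s in nhds (x i). x(i := s) \<in> V"
    using eventually_upd[OF V i, of x "x i"] x by simp
  have "((\<lambda>t. f (w (x(i := t)))) has_real_derivative
    (\<Sum>k<n. partial k f (w (x(i := x i))) * partial i (\<lambda>z. w z k) x)) (at (x i))"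
  proof (rule C1_chain[OF W f])
    show "((\<lambda>s. w (x(i := s)) k) has_real_derivative partial i (\<lambda>z. w z k) x) (at (x i))" if "k < n" for k
      using C1_deriv[OF w[OF that] i x] .
    have "\<forall>\<^sub>F s in nhds (x i). \<forall>k\<ge>n. w (x(i := s)) k = 0"
      using ev by eventually_elim (use wW openin_Euclidean_space_subset[OF W] in blast)
    then show "\<forall>\<^sub>F s in at (x i). \<forall>k\<ge>n. w (x(i := s)) k = 0"
      by (simp add: eventually_at_filter eventually_mono)
  qed (use wW x in simp)
  then show ?thesis by simp
qed

lemma partial_compose:
  assumes "eucl_open m V" "eucl_open n W" "C1 n W f"
    "\<And>k. k < n \<Longrightarrow> C1 m V (\<lambda>x. w x k)" "\<And>x. x \<in> V \<Longrightarrow> w x \<in> W" "x \<in> V" "i < m"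
  shows "partial i (\<lambda>x. f (w x)) x = (\<Sum>k<n. partial k f (w x) * partial i (\<lambda>z. w z k) x)"
  by (rule partial_eqI, rule C1_compose_deriv[OF assms])

lemma continuous_on_components:
  assumes W: "eucl_open n W" and "\<And>k. k < n \<Longrightarrow> continuous_on V (\<lambda>x. w x k)"
    and wW: "\<And>x. x \<in> V \<Longrightarrow> w x \<in> W"
  shows "continuous_on V w"
proof (rule continuous_on_coordinatewise_then_product)
  fix k show "continuous_on V (\<lambda>x. w x k)"
  proof (cases "k < n")
    case False
    then have "\<And>x. x \<in> V \<Longrightarrow> w x k = 0" using openin_Euclidean_space_subset[OF W] wW by simp
    then show ?thesis using continuous_on_cong[of V V "\<lambda>x. w x k" "\<lambda>_. 0"] by simp
  qed (use assms in auto)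
qed

lemma C1_compose:
  assumes V: "eucl_open m V" and W: "eucl_open n W" and f: "C1 n W f"
    and w: "\<And>k. k < n \<Longrightarrow> C1 m V (\<lambda>x. w x k)" and wW: "\<And>x. x \<in> V \<Longrightarrow> w x \<in> W"
  shows "C1 m V (\<lambda>x. f (w x))"
proof (rule C1I)
  have c: "continuous_on V w" by (rule continuous_on_components[OF W C1_continuous[OF w] wW])
  have cW: "continuous_on V (\<lambda>x. h (w x))" if "continuous_on W h" for h :: "(nat \<Rightarrow> real) \<Rightarrow> real"
    by (rule continuous_on_compose2[OF that c]) (use wW in auto)
  show "continuous_on V (\<lambda>x. f (w x))" by (rule cW[OF C1_continuous[OF f]])
  show "continuous_on V (\<lambda>x. \<Sum>k<n. partial k f (w x) * partial i (\<lambda>z. w z k) x)" if "i < m" for i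
    by (intro continuous_on_sum continuous_on_mult cW C1_continuous_partial[OF f] C1_continuous_partial[OF w] that) auto
qed (use C1_compose_deriv[OF V W f w wW] in auto)

lemma C1_const: "C1 m V (\<lambda>x. c)"
  by (rule C1I[of _ _ _ "\<lambda>_ _. 0"]) auto

lemma C1_coord: "C1 m V (\<lambda>x. x i)"
proof (rule C1I[of _ _ _ "\<lambda>j _. if i = j then 1 else 0"])
  show "continuous_on V (\<lambda>x. x i)" by (intro continuous_on_subset[OF continuous_on_product_coordinates]) auto
qed auto

lemma partial_coord: "partial j (\<lambda>x. x i) x = (if i = j then 1 else 0)"
  by (rule partial_eqI) auto

lemma partial_const: "partial j (\<lambda>x. c) x = 0"
  by (rule partial_eqI) auto

lemma C1_add:
  assumes "C1 m V f" "C1 m V g"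
  shows "C1 m V (\<lambda>x. f x + g x)"
    and "x \<in> V \<Longrightarrow> i < m \<Longrightarrow> partial i (\<lambda>x. f x + g x) x = partial i f x + partial i g x"
proof -
  have d: "((\<lambda>t. f (x(i := t)) + g (x(i := t))) has_real_derivative partial i f x + partial i g x) (at (x i))"
    if "x \<in> V" "i < m" for x i
    by (intro DERIV_add C1_deriv[OF assms(1) that(2,1)] C1_deriv[OF assms(2) that(2,1)])
  show "C1 m V (\<lambda>x. f x + g x)"
    by (rule C1I[OF _ _ d]) (intro continuous_on_add C1_continuous[OF assms(1)] C1_continuous[OF assms(2)] C1_continuous_partial[OF assms(1)] C1_continuous_partial[OF assms(2)]; assumption)+
  show "x \<in> V \<Longrightarrow> i < m \<Longrightarrow> partial i (\<lambda>x. f x + g x) x = partial i f x + partial i g x"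
    by (rule partial_eqI[OF d])
qed

lemma C1_mult:
  assumes "C1 m V f" "C1 m V g"
  shows "C1 m V (\<lambda>x. f x * g x)"
    and "x \<in> V \<Longrightarrow> i < m \<Longrightarrow> partial i (\<lambda>x. f x * g x) x = partial i f x * g x + f x * partial i g x"
proof -
  have d: "((\<lambda>t. f (x(i := t)) * g (x(i := t))) has_real_derivative partial i f x * g x + f x * partial i g x) (at (x i))"
    if "x \<in> V" "i < m" for x i
    using DERIV_mult[OF C1_deriv[OF assms(1) that(2,1)] C1_deriv[OF assms(2) that(2,1)]]
    by (simp add: algebra_simps)
  show "C1 m V (\<lambda>x. f x * g x)"
    by (rule C1I[OF _ _ d]) (intro continuous_on_add continuous_on_mult C1_continuous[OF assms(1)] C1_continuous[OF assms(2)] C1_continuous_partial[OF assms(1)] C1_continuous_partial[OF assms(2)]; assumption)+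
  show "x \<in> V \<Longrightarrow> i < m \<Longrightarrow> partial i (\<lambda>x. f x * g x) x = partial i f x * g x + f x * partial i g x"
    by (rule partial_eqI[OF d])
qed

lemma C1_sum:
  assumes "finite I" "\<And>k. k \<in> I \<Longrightarrow> C1 m V (f k)"
  shows "C1 m V (\<lambda>x. \<Sum>k\<in>I. f k x)"
    and "x \<in> V \<Longrightarrow> i < m \<Longrightarrow> partial i (\<lambda>x. \<Sum>k\<in>I. f k x) x = (\<Sum>k\<in>I. partial i (f k) x)"
proof -
  have d: "((\<lambda>t. \<Sum>k\<in>I. f k (x(i := t))) has_real_derivative (\<Sum>k\<in>I. partial i (f k) x)) (at (x i))"
    if "x \<in> V" "i < m" for x i
    by (intro DERIV_sum C1_deriv[OF assms(2) that(2,1)])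
  show "C1 m V (\<lambda>x. \<Sum>k\<in>I. f k x)"
    by (rule C1I[OF _ _ d]) (intro continuous_on_sum C1_continuous[OF assms(2)] C1_continuous_partial[OF assms(2)]; assumption)+
  show "x \<in> V \<Longrightarrow> i < m \<Longrightarrow> partial i (\<lambda>x. \<Sum>k\<in>I. f k x) x = (\<Sum>k\<in>I. partial i (f k) x)"
    by (rule partial_eqI[OF d])
qed

lemma C1_prod:
  assumes "finite I" "\<And>k. k \<in> I \<Longrightarrow> C1 m V (f k)"
  shows "C1 m V (\<lambda>x. \<Prod>k\<in>I. f k x)"
  using assms by (induction I rule: finite_induct) (auto intro: C1_const C1_mult(1))

lemma C1_real_compose:
  assumes f: "C1 m V f" and h: "\<And>x. x \<in> V \<Longrightarrow> (h has_real_derivative h' (f x)) (at (f x))"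
    and h': "continuous_on (f ` V) h'"
  shows "C1 m V (\<lambda>x. h (f x))"
    and "x \<in> V \<Longrightarrow> i < m \<Longrightarrow> partial i (\<lambda>x. h (f x)) x = h' (f x) * partial i f x"
proof -
  have d: "((\<lambda>t. h (f (x(i := t)))) has_real_derivative h' (f x) * partial i f x) (at (x i))"
    if "x \<in> V" "i < m" for x i
    using DERIV_chain2[of h "h' (f (x(i := x i)))" "\<lambda>t. f (x(i := t))" "x i", OF _ C1_deriv[OF f that(2,1)]] h[OF that(1)]
    by simp
  have ch: "continuous_on (f ` V) h"
    unfolding continuous_on_eq_continuous_within
    by (auto intro!: continuous_at_imp_continuous_at_within DERIV_isCont h)
  show "C1 m V (\<lambda>x. h (f x))"
    by (rule C1I[OF _ _ d])
      (auto intro!: continuous_on_mult C1_continuous_partial[OF f] continuous_on_compose2[OF ch C1_continuous[OF f]]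
        continuous_on_compose2[OF h' C1_continuous[OF f]])
  show "x \<in> V \<Longrightarrow> i < m \<Longrightarrow> partial i (\<lambda>x. h (f x)) x = h' (f x) * partial i f x"
    by (rule partial_eqI[OF d])
qed

lemma C1_inverse:
  assumes "C1 m V f" "\<And>x. x \<in> V \<Longrightarrow> f x \<noteq> 0"
  shows "C1 m V (\<lambda>x. inverse (f x))"
    and "x \<in> V \<Longrightarrow> i < m \<Longrightarrow> partial i (\<lambda>x. inverse (f x)) x = - (inverse (f x) ^ 2) * partial i f x"
  by (rule C1_real_compose[OF assms(1), where h' = "\<lambda>u. - (inverse u ^ 2)"];
      (auto intro!: DERIV_inverse[simplified numeral_2_eq_2[symmetric]] continuous_intros simp: assms))+

lemma C1_uminus:
  assumes "C1 m V f"
  shows "C1 m V (\<lambda>x. - f x)"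
    and "x \<in> V \<Longrightarrow> i < m \<Longrightarrow> partial i (\<lambda>x. - f x) x = - partial i f x"
  using C1_mult[OF C1_const[of m V "- 1"] assms] by (auto simp: partial_const)

lemma C1_diff:
  assumes "C1 m V f" "C1 m V g"
  shows "C1 m V (\<lambda>x. f x - g x)"
    and "x \<in> V \<Longrightarrow> i < m \<Longrightarrow> partial i (\<lambda>x. f x - g x) x = partial i f x - partial i g x"
  using C1_add[OF assms(1) C1_uminus(1)[OF assms(2)]] C1_uminus(2)[OF assms(2)] by auto

lemma C1_divide:
  assumes "C1 m V f" "C1 m V g" "\<And>x. x \<in> V \<Longrightarrow> g x \<noteq> 0"
  shows "C1 m V (\<lambda>x. f x / g x)"
  using C1_mult(1)[OF assms(1) C1_inverse(1)[OF assms(2,3)]] by (simp add: divide_inverse)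

lemma C1_power:
  assumes "C1 m V f"
  shows "C1 m V (\<lambda>x. f x ^ k)"
    and "x \<in> V \<Longrightarrow> i < m \<Longrightarrow> partial i (\<lambda>x. f x ^ k) x = real k * f x ^ (k - 1) * partial i f x"
  by (rule C1_real_compose[OF assms(1), where h' = "\<lambda>u. real k * u ^ (k - 1)"];
      (auto intro!: continuous_intros derivative_eq_intros))+

lemma C1_sqrt:
  assumes "C1 m V f" "\<And>x. x \<in> V \<Longrightarrow> f x > 0"
  shows "C1 m V (\<lambda>x. sqrt (f x))"
    and "x \<in> V \<Longrightarrow> i < m \<Longrightarrow> partial i (\<lambda>x. sqrt (f x)) x = inverse (sqrt (f x)) / 2 * partial i f x"
  by (rule C1_real_compose[OF assms(1), where h' = "\<lambda>u. inverse (sqrt u) / 2"];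
      (auto intro!: continuous_intros DERIV_real_sqrt dest: assms(2)))+

lemma C2_compose:
  assumes V: "eucl_open m V" and W: "eucl_open n W" and f: "C2 n W f"
    and w: "\<And>k. k < n \<Longrightarrow> C2 m V (\<lambda>x. w x k)" and wW: "\<And>x. x \<in> V \<Longrightarrow> w x \<in> W"
  shows "C2 m V (\<lambda>x. f (w x))"
  unfolding C2_def
proof (intro conjI allI impI)
  note w1 = C2_C1[OF w]
  show "C1 m V (\<lambda>x. f (w x))" by (rule C1_compose[OF V W C2_C1[OF f] w1 wW])
  fix i assume i: "i < m"
  have "C1 m V (\<lambda>x. \<Sum>k<n. partial k f (w x) * partial i (\<lambda>z. w z k) x)"
    by (intro C1_sum(1) C1_mult(1) C1_compose[OF V W C2_partial[OF f] w1 wW] C2_partial[OF w] i) auto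
  then show "C1 m V (partial i (\<lambda>x. f (w x)))"
    using C1_cong[OF V partial_compose[OF V W C2_C1[OF f] w1 wW _ i]] by simp
qed

lemma C2I:
  assumes V: "eucl_open m V" and "C1 m V f"
    and D: "\<And>i x. i < m \<Longrightarrow> x \<in> V \<Longrightarrow> partial i f x = D i x" and "\<And>i. i < m \<Longrightarrow> C1 m V (D i)"
  shows "C2 m V f"
  unfolding C2_def using assms(2,4) C1_cong[OF V D] by simp

lemma C2_const: assumes "eucl_open m V" shows "C2 m V (\<lambda>x. c)"
  by (rule C2I[OF assms C1_const, of _ "\<lambda>_ _. 0"]) (auto intro: C1_const partial_const)

lemma C2_coord: assumes "eucl_open m V" shows "C2 m V (\<lambda>x. x i)"
  by (rule C2I[OF assms C1_coord, of _ "\<lambda>j _. if i = j then 1 else 0"]) (auto intro: C1_const simp: partial_coord)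

lemma C2_add: assumes "eucl_open m V" "C2 m V f" "C2 m V g" shows "C2 m V (\<lambda>x. f x + g x)"
  by (rule C2I[OF assms(1) C1_add(1) C1_add(2)]) (auto intro: C1_add(1) C2_C1 C2_partial assms)

lemma C2_mult: assumes "eucl_open m V" "C2 m V f" "C2 m V g" shows "C2 m V (\<lambda>x. f x * g x)"
  by (rule C2I[OF assms(1) C1_mult(1) C1_mult(2)]) (auto intro!: C1_add(1) C1_mult(1) intro: C2_C1 C2_partial assms)

lemma C2_sum:
  assumes "eucl_open m V" "finite I" "\<And>k. k \<in> I \<Longrightarrow> C2 m V (f k)"
  shows "C2 m V (\<lambda>x. \<Sum>k\<in>I. f k x)"
  by (rule C2I[OF assms(1) C1_sum(1) C1_sum(2)]) (auto intro!: C1_sum(1) intro: C2_C1 C2_partial assms)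

lemma C2_inverse:
  assumes "eucl_open m V" "C2 m V f" "\<And>x. x \<in> V \<Longrightarrow> f x \<noteq> 0"
  shows "C2 m V (\<lambda>x. inverse (f x))"
  by (rule C2I[OF assms(1) C1_inverse(1) C1_inverse(2)])
    (auto intro!: C1_mult(1) C1_uminus(1) C1_power(1) C1_inverse(1) intro: C2_C1[OF assms(2)] C2_partial[OF assms(2)] dest: assms(3))

lemma C2_cong:
  assumes V: "eucl_open m V" and eq: "\<And>y. y \<in> V \<Longrightarrow> f y = g y"
  shows "C2 m V f \<longleftrightarrow> C2 m V g"
  unfolding C2_def using C1_cong[OF V eq] C1_cong[OF V partial_cong[OF V _ _ eq]] by simp

lemma C2_local:
  assumes V: "\<And>x. x \<in> V \<Longrightarrow> \<exists>W. eucl_open m W \<and> x \<in> W \<and> W \<subseteq> V \<and> C2 m W f"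
  shows "C2 m V f"
  unfolding C2_def
proof (intro conjI allI impI; rule C1_local)
  fix x assume x: "x \<in> V"
  show "\<exists>W. eucl_open m W \<and> x \<in> W \<and> W \<subseteq> V \<and> C1 m W f"
    using V[OF x] C2_C1 by blast
  show "\<exists>W. eucl_open m W \<and> x \<in> W \<and> W \<subseteq> V \<and> C1 m W (partial i f)" if "i < m" for i
    using V[OF x] C2_partial that by blast
qed

text \<open>The second difference of \<open>f\<close> over a square of side \<open>h\<close> is
  \<open>h * h\<close> times either mixed derivative at some point of the square. If the two
  differed at \<open>x\<close>, continuity would keep them apart on a small square.\<close>

lemma partial_commute:
  assumes V: "eucl_open m V" and f: "C2 m V f" and x: "x \<in> V" and ij: "i < m" "j < m"
  shows "partial i (partial j f) x = partial j (partial i f) x"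
proof (cases "i = j")
  case False
  show ?thesis
  proof (rule ccontr)
    assume ne: "partial i (partial j f) x \<noteq> partial j (partial i f) x"
    \<comment> \<open>Half the gap, so that values within \<open>e\<close> of the two mixed
      derivatives cannot coincide.\<close>
    define e where "e = \<bar>partial i (partial j f) x - partial j (partial i f) x\<bar> / 2"
    have "e > 0" using ne by (simp add: e_def)
    have near: "\<exists>r>0. \<forall>y. (\<forall>k\<ge>m. y k = 0) \<longrightarrow> (\<forall>k<m. \<bar>y k - x k\<bar> < r) \<longrightarrow>
        y \<in> V \<and> \<bar>partial a (partial b f) y - partial a (partial b f) x\<bar> < e" if "a < m" "b < m" for a b
      using continuous_on_cube[OF V C1_continuous_partial[OF C2_partial[OF f that(2)] that(1)] x \<open>e > 0\<close>]
      by blast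
    obtain r1 where r1p: "r1 > 0" and r1': "\<forall>y. (\<forall>k\<ge>m. y k = 0) \<longrightarrow> (\<forall>k<m. \<bar>y k - x k\<bar> < r1) \<longrightarrow>
        y \<in> V \<and> \<bar>partial i (partial j f) y - partial i (partial j f) x\<bar> < e"
      using near[OF ij] by blast
    obtain r2 where r2p: "r2 > 0" and r2': "\<forall>y. (\<forall>k\<ge>m. y k = 0) \<longrightarrow> (\<forall>k<m. \<bar>y k - x k\<bar> < r2) \<longrightarrow>
        y \<in> V \<and> \<bar>partial j (partial i f) y - partial j (partial i f) x\<bar> < e"
      using near[OF ij(2,1)] by blast
    note r1 = r1'[rule_format] and r2 = r2'[rule_format] and r = r1p r2p
    define h where "h = min r1 r2 / 2"
    have h: "h > 0" "h < r1" "h < r2" using r by (auto simp: h_def min_def)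
    define p where "p a b s t = x(a := x a + s, b := x b + t)" for a b s t
    have key: "\<exists>s t. 0 < s \<and> s < h \<and> 0 < t \<and> t < h \<and>
        f (p a b h h) - f (p a b h 0) - f (p a b 0 h) + f (p a b 0 0) = h * h * partial b (partial a f) (p a b s t)"
      if ab: "a < m" "b < m" "a \<noteq> b" for a b
    proof -
      have inV: "p a b s t \<in> V" if "0 \<le> s" "s \<le> h" "0 \<le> t" "t \<le> h" for s t
        by (rule r1[THEN conjunct1]) (use that h r openin_Euclidean_space_subset[OF V x] ab in \<open>simp_all add: p_def\<close>)
      have ds: "((\<lambda>s. f (p a b s t)) has_real_derivative partial a f (p a b s t)) (at s)"
        if "0 \<le> s" "s \<le> h" "0 \<le> t" "t \<le> h" for s t
      proof -
        have p_eq: "p a b s t = (x(b := x b + t))(a := x a + s)" for s using ab by (auto simp: p_def)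
        then have "((\<lambda>u. f ((x(b := x b + t))(a := u))) has_real_derivative partial a f (p a b s t)) (at (x a + s))"
          using C1_deriv_upd[OF C2_C1[OF f] ab(1), of "x(b := x b + t)" "x a + s"] inV[OF that] by simp
        from DERIV_shift[THEN iffD1, OF this[unfolded add.commute[of "x a"]]]
        show ?thesis by (simp add: add.commute p_eq)
      qed
      have dt: "((\<lambda>t. partial a f (p a b s t)) has_real_derivative partial b (partial a f) (p a b s t)) (at t)"
        if "0 \<le> s" "s \<le> h" "0 \<le> t" "t \<le> h" for s t
      proof -
        have "((\<lambda>u. partial a f ((x(a := x a + s))(b := u))) has_real_derivative partial b (partial a f) (p a b s t)) (at (x b + t))"
          using C1_deriv_upd[OF C2_partial[OF f ab(1)] ab(2), of "x(a := x a + s)" "x b + t"] inV[OF that] by (simp add: p_def)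
        from DERIV_shift[THEN iffD1, OF this[unfolded add.commute[of "x b"]]]
        show ?thesis by (simp add: add.commute p_def)
      qed
      \<comment> \<open>The mean value theorem in direction \<open>a\<close> is applied to the
        increment of \<open>f\<close> in direction \<open>b\<close>; a second application in
        direction \<open>b\<close> then produces the mixed derivative.\<close>
      have "\<exists>z>0. z < h \<and> (f (p a b h h) - f (p a b h 0)) - (f (p a b 0 h) - f (p a b 0 0)) =
          (h - 0) * (partial a f (p a b z h) - partial a f (p a b z 0))"
        by (rule MVT2[OF h(1)]) (use h in \<open>auto intro!: DERIV_diff ds\<close>)
      then obtain s where s: "0 < s" "s < h" "(f (p a b h h) - f (p a b h 0)) - (f (p a b 0 h) - f (p a b 0 0)) =
          h * (partial a f (p a b s h) - partial a f (p a b s 0))" by auto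
      have "\<exists>z>0. z < h \<and> partial a f (p a b s h) - partial a f (p a b s 0) = (h - 0) * partial b (partial a f) (p a b s z)"
        by (rule MVT2[OF h(1)]) (use s in \<open>auto intro!: dt\<close>)
      then obtain t where "0 < t" "t < h" "partial a f (p a b s h) - partial a f (p a b s 0) = h * partial b (partial a f) (p a b s t)"
        by auto
      with s show ?thesis by (intro exI[of _ s] exI[of _ t]) (simp add: algebra_simps)
    qed
    obtain s t where st: "0 < s" "s < h" "0 < t" "t < h"
        "f (p i j h h) - f (p i j h 0) - f (p i j 0 h) + f (p i j 0 0) = h * h * partial j (partial i f) (p i j s t)"
      using key[OF ij False] by blast
    obtain s' t' where st': "0 < s'" "s' < h" "0 < t'" "t' < h"
        "f (p j i h h) - f (p j i h 0) - f (p j i 0 h) + f (p j i 0 0) = h * h * partial i (partial j f) (p j i s' t')"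
      using key[OF ij(2,1)] False by blast
    have sw: "p j i u v = p i j v u" for u v using False by (auto simp: p_def fun_upd_twist)
    have "h * h * partial j (partial i f) (p i j s t) = h * h * partial i (partial j f) (p j i s' t')"
      using st(5) st'(5) unfolding sw by linarith
    then have "partial j (partial i f) (p i j s t) = partial i (partial j f) (p j i s' t')" using h(1) by simp
    moreover have "\<bar>partial j (partial i f) (p i j s t) - partial j (partial i f) x\<bar> < e"
      by (rule r2[THEN conjunct2]) (use st h openin_Euclidean_space_subset[OF V x] ij in \<open>auto simp: p_def\<close>)
    moreover have "\<bar>partial i (partial j f) (p j i s' t') - partial i (partial j f) x\<bar> < e"
      by (rule r1[THEN conjunct2]) (use st' h openin_Euclidean_space_subset[OF V x] ij in \<open>auto simp: p_def\<close>)
    ultimately show False unfolding e_def by argo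
  qed
qed simp

section \<open>Determinants and positive definite matrices\<close>

lemma mat_carrier_fun: "mat m m f \<in> carrier_mat m m"
  by simp

lemma determinant_cong:
  "(\<And>i j. i < m \<Longrightarrow> j < m \<Longrightarrow> A i j = B i j) \<Longrightarrow> determinant m A = determinant m B"
  unfolding determinant_def by (rule arg_cong[where f = Determinant.det]) auto

lemma determinant_mult:
  "determinant m (\<lambda>i j. \<Sum>k<m. A i k * B k j) = determinant m A * determinant m B"
proof -
  have "mat m m (\<lambda>(i, j). \<Sum>k<m. A i k * B k j) = mat m m (\<lambda>(i, j). A i j) * mat m m (\<lambda>(i, j). B i j)"
    by (rule eq_matI) (auto simp: scalar_prod_def atLeast0LessThan)
  then show ?thesis
    unfolding determinant_def using det_mult[OF mat_carrier_fun mat_carrier_fun] by metis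
qed

lemma determinant_Suc_lower_zero:
  assumes "\<And>j. j < m \<Longrightarrow> A m j = 0"
  shows "determinant (Suc m) A = A m m * determinant m A"
proof -
  let ?A = "mat (Suc m) (Suc m) (\<lambda>(i, j). A i j)"
  have "determinant (Suc m) A = (\<Sum>j<Suc m. ?A $$ (m, j) * cofactor ?A m j)"
    unfolding determinant_def by (rule laplace_expansion_row) auto
  also have "\<dots> = A m m * cofactor ?A m m" using assms by simp
  also have "mat_delete ?A m m = mat m m (\<lambda>(i, j). A i j)"
    unfolding mat_delete_def by (rule eq_matI) auto
  then have "cofactor ?A m m = determinant m A"
    unfolding cofactor_def determinant_def by simp
  finally show ?thesis .
qed

lemma determinant_unit_lower:
  assumes "\<And>i j. i < j \<Longrightarrow> j < m \<Longrightarrow> A i j = 0" and "\<And>i. i < m \<Longrightarrow> A i i = 1"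
  shows "determinant m A = 1"
proof -
  have "determinant m A = prod_list (diag_mat (mat m m (\<lambda>(i, j). A i j)))"
    unfolding determinant_def by (rule det_lower_triangular[where n = m]) (use assms in auto)
  also have "\<dots> = (\<Prod>i = 0..<m. 1)"
    unfolding prod_list_diag_prod using assms(2) by (auto intro: prod.cong)
  finally show ?thesis by simp
qed

text \<open>What remains after eliminating the last row and column with the pivot
  \<open>A m m\<close>. Inductions on the size of a matrix (determinants, positivity, sums of
  squares, linear substitutions) all pass through it.\<close>

definition schur_complement :: "nat \<Rightarrow> (nat \<Rightarrow> nat \<Rightarrow> real) \<Rightarrow> nat \<Rightarrow> nat \<Rightarrow> real" where
  "schur_complement m A i j = A i j - A i m * A m j / A m m"

text \<open>Block factorization \<open>A = P Q\<close>: the unit lower triangular \<open>Q\<close>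
  carries the last row divided by the pivot, and the last row of \<open>P\<close> is zero except for
  the pivot.\<close>

lemma determinant_Suc_schur:
  assumes "A m m \<noteq> 0"
  shows "determinant (Suc m) A = A m m * determinant m (schur_complement m A)"
proof -
  define P where "P i j = (if i < m then if j < m then schur_complement m A i j else A i m else if j < m then 0 else A m m)" for i j
  define Q where "Q i j = (if i = m \<and> j < m then A m j / A m m else if i = j then 1 else 0)" for i j
  have "determinant (Suc m) A = determinant (Suc m) (\<lambda>i j. \<Sum>k<Suc m. P i k * Q k j)"
  proof (rule determinant_cong)
    fix i j assume "i < Suc m" "j < Suc m"
    have "(\<Sum>k<m. P i k * Q k j) = (\<Sum>k<m. if k = j then P i k else 0)"
      by (rule sum.cong) (auto simp: Q_def)
    also have "\<dots> = (if j < m then P i j else 0)" by (simp add: sum.delta)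
    finally show "A i j = (\<Sum>k<Suc m. P i k * Q k j)"
      using \<open>i < Suc m\<close> \<open>j < Suc m\<close> assms
      by (cases "i = m"; cases "j = m") (auto simp: P_def Q_def schur_complement_def)
  qed
  also have "\<dots> = determinant (Suc m) P * determinant (Suc m) Q" by (rule determinant_mult)
  also have "determinant (Suc m) P = P m m * determinant m P"
    by (rule determinant_Suc_lower_zero) (simp add: P_def)
  also have "determinant m P = determinant m (schur_complement m A)"
    by (rule determinant_cong) (simp add: P_def)
  also have "determinant (Suc m) Q = 1"
    by (rule determinant_unit_lower) (auto simp: Q_def)
  finally show ?thesis by (simp add: P_def)
qed

lemma determinant_add_row:
  assumes "k < m" "l < m" "k \<noteq> l"
  shows "determinant m (\<lambda>i j. if i = k then A k j + A l j else A i j) = determinant m A"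
proof -
  have "mat m m (\<lambda>(i, j). if i = k then A k j + A l j else A i j) = addrow 1 k l (mat m m (\<lambda>(i, j). A i j))"
    unfolding mat_addrow_def by (rule eq_matI) (use assms in auto)
  then show ?thesis
    unfolding determinant_def using det_addrow[OF assms(2,3) mat_carrier_fun] by metis
qed

lemma determinant_zero_column:
  assumes "l < m" "\<And>i. i < m \<Longrightarrow> A i l = 0"
  shows "determinant m A = 0"
proof -
  have "determinant m A = (\<Sum>i<m. mat m m (\<lambda>(i, j). A i j) $$ (i, l) * cofactor (mat m m (\<lambda>(i, j). A i j)) i l)"
    unfolding determinant_def by (rule laplace_expansion_column) (use assms in auto)
  also have "\<dots> = 0" using assms by (intro sum.neutral) auto
  finally show ?thesis .
qed

lemma determinant_zero_kernel:
  assumes "determinant m A = 0"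
  shows "\<exists>v. (\<exists>i<m. v i \<noteq> 0) \<and> (\<forall>i<m. apply_matrix m A v i = 0)"
proof -
  obtain v where v: "v \<in> carrier_vec m" "v \<noteq> 0\<^sub>v m" "mat m m (\<lambda>(i, j). A i j) *\<^sub>v v = 0\<^sub>v m"
    using assms det_0_iff_vec_prod_zero[OF mat_carrier_fun] unfolding determinant_def by blast
  have "\<exists>i<m. v $ i \<noteq> 0" using v(1,2) by (metis carrier_vecD eq_vecI index_zero_vec)
  moreover have "apply_matrix m A (\<lambda>i. v $ i) i = 0" if "i < m" for i
  proof -
    have "(mat m m (\<lambda>(i, j). A i j) *\<^sub>v v) $ i = (\<Sum>j<m. A i j * v $ j)"
      using that v(1) by (simp add: scalar_prod_def atLeast0LessThan)
    then show ?thesis using v(3) that by (simp add: apply_matrix_def)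
  qed
  ultimately show ?thesis by (intro exI[of _ "\<lambda>i. v $ i"]) simp
qed

lemma inverse_matrix_right:
  assumes "determinant m A \<noteq> 0" "i < m" "j < m"
  shows "(\<Sum>k<m. A i k * inverse_matrix m A k j) = (if i = j then 1 else 0)"
proof -
  let ?A = "mat m m (\<lambda>(i, j). A i j)"
  have "(?A * adj_mat ?A) $$ (i, j) = (\<Sum>k<m. A i k * adj_mat ?A $$ (k, j))"
    using assms(2,3) adj_mat(1)[OF mat_carrier_fun, of m "\<lambda>(i, j). A i j"]
    by (simp add: scalar_prod_def atLeast0LessThan)
  moreover have "(?A * adj_mat ?A) $$ (i, j) = determinant m A * (if i = j then 1 else 0)"
    unfolding adj_mat(2)[OF mat_carrier_fun] determinant_def using assms(2,3) by simp
  ultimately have "(\<Sum>k<m. A i k * adj_mat ?A $$ (k, j)) = determinant m A * (if i = j then 1 else 0)"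
    by (rule trans[OF sym])
  moreover have "(\<Sum>k<m. A i k * inverse_matrix m A k j) = (\<Sum>k<m. A i k * adj_mat ?A $$ (k, j)) / determinant m A"
    by (simp add: inverse_matrix_def sum_divide_distrib)
  ultimately show ?thesis using assms(1) by simp
qed

lemma inverse_matrix_left:
  assumes "determinant m A \<noteq> 0" "i < m" "j < m"
  shows "(\<Sum>k<m. inverse_matrix m A i k * A k j) = (if i = j then 1 else 0)"
proof -
  let ?A = "mat m m (\<lambda>(i, j). A i j)"
  have "(adj_mat ?A * ?A) $$ (i, j) = (\<Sum>k<m. adj_mat ?A $$ (i, k) * A k j)"
    using assms(2,3) adj_mat(1)[OF mat_carrier_fun, of m "\<lambda>(i, j). A i j"]
    by (simp add: scalar_prod_def atLeast0LessThan)
  moreover have "(adj_mat ?A * ?A) $$ (i, j) = determinant m A * (if i = j then 1 else 0)"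
    unfolding adj_mat(3)[OF mat_carrier_fun] determinant_def using assms(2,3) by simp
  ultimately have "(\<Sum>k<m. adj_mat ?A $$ (i, k) * A k j) = determinant m A * (if i = j then 1 else 0)"
    by (rule trans[OF sym])
  moreover have "(\<Sum>k<m. inverse_matrix m A i k * A k j) = (\<Sum>k<m. adj_mat ?A $$ (i, k) * A k j) / determinant m A"
    by (simp add: inverse_matrix_def sum_divide_distrib)
  ultimately show ?thesis using assms(1) by simp
qed

lemma apply_matrix_cancel:
  assumes i: "i < m" and "\<And>j. j < m \<Longrightarrow> (\<Sum>k<n. P i k * Q k j) = (if i = j then 1 else 0)"
  shows "apply_matrix n P (apply_matrix m Q v) i = v i"
proof -
  have "apply_matrix n P (apply_matrix m Q v) i = (\<Sum>k<n. \<Sum>j<m. P i k * Q k j * v j)"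
    by (simp add: apply_matrix_def sum_distrib_left mult.assoc)
  also have "\<dots> = (\<Sum>j<m. (\<Sum>k<n. P i k * Q k j) * v j)" unfolding sum_distrib_right by (rule sum.swap)
  also have "\<dots> = (\<Sum>j<m. if i = j then v j else 0)" by (rule sum.cong) (auto simp: assms(2))
  finally show ?thesis using i by simp
qed

lemma apply_matrix_inverse:
  assumes "determinant m A \<noteq> 0" "i < m"
  shows "apply_matrix m A (apply_matrix m (inverse_matrix m A) v) i = v i"
    and "apply_matrix m (inverse_matrix m A) (apply_matrix m A v) i = v i"
  using apply_matrix_cancel[where P = A and Q = "inverse_matrix m A", OF assms(2) inverse_matrix_right[OF assms]]
    apply_matrix_cancel[where P = "inverse_matrix m A" and Q = A, OF assms(2) inverse_matrix_left[OF assms]] by auto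

lemma inverse_matrix_unique:
  assumes A: "determinant m A \<noteq> 0" and B: "\<And>i j. i < m \<Longrightarrow> j < m \<Longrightarrow> (\<Sum>k<m. A i k * B k j) = (if i = j then 1 else 0)"
    and ij: "i < m" "j < m"
  shows "B i j = inverse_matrix m A i j"
proof -
  have "B i j = apply_matrix m (inverse_matrix m A) (apply_matrix m A (\<lambda>k. B k j)) i"
    by (rule apply_matrix_inverse(2)[OF A ij(1), symmetric])
  also have "\<dots> = (\<Sum>k<m. inverse_matrix m A i k * (if k = j then 1 else 0))"
    unfolding apply_matrix_def by (rule sum.cong) (auto simp: B ij)
  also have "\<dots> = (\<Sum>k<m. if k = j then inverse_matrix m A i k else 0)"
    by (rule sum.cong) auto
  finally show ?thesis using ij by simp
qed

lemma inverse_matrix_sym: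
  assumes A: "determinant m A \<noteq> 0" and sym: "\<And>i j. i < m \<Longrightarrow> j < m \<Longrightarrow> A i j = A j i" and ij: "i < m" "j < m"
  shows "inverse_matrix m A i j = inverse_matrix m A j i"
proof -
  have "inverse_matrix m A j i = inverse_matrix m A i j"
  proof (rule inverse_matrix_unique[OF A _ ij, of "\<lambda>i j. inverse_matrix m A j i"])
    fix a b assume ab: "a < m" "b < m"
    have "(\<Sum>k<m. A a k * inverse_matrix m A b k) = (\<Sum>k<m. inverse_matrix m A b k * A k a)"
      by (rule sum.cong) (auto simp: sym ab)
    then show "(\<Sum>k<m. A a k * inverse_matrix m A b k) = (if a = b then 1 else 0)"
      using inverse_matrix_left[OF A ab(2,1)] by auto
  qed
  then show ?thesis by simp
qed

section \<open>Positive definite matrices and the scalar products they define\<close>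

definition posdef :: "nat \<Rightarrow> (nat \<Rightarrow> nat \<Rightarrow> real) \<Rightarrow> bool" where
  "posdef m G \<longleftrightarrow> (\<forall>i<m. \<forall>j<m. G i j = G j i) \<and>
     (\<forall>v. (\<exists>i<m. v i \<noteq> 0) \<longrightarrow> 0 < bilinear_form m G v v)"

lemma posdefD: "posdef m G \<Longrightarrow> i < m \<Longrightarrow> v i \<noteq> 0 \<Longrightarrow> 0 < bilinear_form m G v v"
  unfolding posdef_def by auto

lemma posdef_diag:
  assumes "posdef m G" "k < m"
  shows "G k k > 0"
proof -
  have "bilinear_form m G (\<lambda>i. if i = k then 1 else 0) (\<lambda>i. if i = k then 1 else 0) =
      (\<Sum>i<m. \<Sum>j<m. if j = k then if i = k then G i j else 0 else 0)"
    unfolding bilinear_form_def by (intro sum.cong) auto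
  also have "\<dots> = G k k" using assms(2) by simp
  finally have "bilinear_form m G (\<lambda>i. if i = k then 1 else 0) (\<lambda>i. if i = k then 1 else 0) = G k k" .
  moreover have "0 < bilinear_form m G (\<lambda>i. if i = k then 1 else 0) (\<lambda>i. if i = k then 1 else 0)"
    by (rule posdefD[OF assms]) simp
  ultimately show ?thesis by simp
qed

lemma bilinear_form_Suc:
  "bilinear_form (Suc m) G v v = bilinear_form m G v v +
     (\<Sum>i<m. G i m * v i) * v m + (\<Sum>j<m. G m j * v j) * v m + G m m * v m * v m"
  unfolding bilinear_form_def sum_distrib_right by (simp add: sum.distrib algebra_simps)

text \<open>The Schur form at \<open>v\<close> is the minimum of the full form over the last
  coordinate, attained at \<open>- s / G m m\<close>; hence positivity is inherited.\<close>

lemma posdef_schur: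
  assumes G: "posdef (Suc m) G"
  shows "posdef m (schur_complement m G)"
  unfolding posdef_def
proof (intro conjI allI impI)
  have sym: "G i j = G j i" if "i < Suc m" "j < Suc m" for i j using G that unfolding posdef_def by blast
  then show "schur_complement m G i j = schur_complement m G j i" if "i < m" "j < m" for i j
    using that by (simp add: schur_complement_def)
  have d: "G m m > 0" using posdef_diag[OF G] by simp
  fix v :: "nat \<Rightarrow> real" assume "\<exists>i<m. v i \<noteq> 0"
  then obtain i where v: "i < m" "v i \<noteq> 0" by blast
  define s where "s = (\<Sum>j<m. G m j * v j)"
  define w where "w = v(m := - s / G m m)"
  have s': "(\<Sum>i<m. G i m * v i) = s" unfolding s_def by (rule sum.cong) (auto simp: sym)
  have "0 < bilinear_form (Suc m) G w w"
    by (rule posdefD[OF G, of i]) (use v in \<open>auto simp: w_def\<close>)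
  also have "\<dots> = bilinear_form m G v v - s * s / G m m"
  proof -
    have "bilinear_form m G w w = bilinear_form m G v v" "(\<Sum>i<m. G i m * w i) = s" "(\<Sum>j<m. G m j * w j) = s"
      unfolding bilinear_form_def w_def s'[symmetric] s_def by (auto intro!: sum.cong simp: sym)
    then show ?thesis unfolding bilinear_form_Suc using d by (simp add: w_def field_simps)
  qed
  also have "s * s / G m m = (\<Sum>i<m. \<Sum>j<m. G i m * G m j / G m m * v i * v j)"
    by (subst s'[symmetric]) (simp add: s_def sum_product sum_divide_distrib algebra_simps)
  also have "bilinear_form m G v v - \<dots> = bilinear_form m (schur_complement m G) v v"
    by (simp add: bilinear_form_def schur_complement_def sum_subtractf[symmetric] algebra_simps)
  finally show "0 < bilinear_form m (schur_complement m G) v v" .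
qed

lemma posdef_determinant_pos: "posdef m G \<Longrightarrow> determinant m G > 0"
proof (induction m arbitrary: G)
  case 0
  then show ?case by (simp add: determinant_def)
next
  case (Suc m)
  have d: "G m m > 0" using posdef_diag[OF Suc.prems] by simp
  then show ?case
    using determinant_Suc_schur[of G m] Suc.IH[OF posdef_schur[OF Suc.prems]] by simp
qed

text \<open>Cholesky by induction: the new square comes from the last column divided by the root of
  the pivot, the others from the Schur complement. It serves to write the trace of
  \<open>R G\<close> as a sum of values of the form \<open>R\<close>.\<close>

lemma posdef_sum_of_squares:
  "posdef m G \<Longrightarrow> \<exists>b. \<forall>i<m. \<forall>j<m. G i j = (\<Sum>s<m. b s i * b s j)"
proof (induction m arbitrary: G)
  case (Suc m)
  have d: "G m m > 0" using posdef_diag[OF Suc.prems] by simp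
  obtain b where b: "\<And>i j. i < m \<Longrightarrow> j < m \<Longrightarrow> schur_complement m G i j = (\<Sum>s<m. b s i * b s j)"
    using Suc.IH[OF posdef_schur[OF Suc.prems]] by blast
  define c where "c s i = (if s < m then if i < m then b s i else 0 else G i m / sqrt (G m m))" for s i
  have sym: "G i j = G j i" if "i < Suc m" "j < Suc m" for i j using Suc.prems that unfolding posdef_def by blast
  have "G i j = (\<Sum>s<Suc m. c s i * c s j)" if ij: "i < Suc m" "j < Suc m" for i j
  proof (cases "i < m \<and> j < m")
    case True
    then have "(\<Sum>s<m. c s i * c s j) = schur_complement m G i j" by (simp add: b c_def)
    then show ?thesis using d sym[of j m] True by (simp add: c_def schur_complement_def)
  next
    case False
    then have "(\<Sum>s<m. c s i * c s j) = 0" by (intro sum.neutral) (auto simp: c_def)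
    moreover have "G i m * G j m / G m m = G i j" using False ij d sym[of i j] by (auto simp: less_Suc_eq)
    ultimately show ?thesis using d by (simp add: c_def)
  qed
  then show ?case by blast
qed simp

lemma bilinear_form_apply:
  "bilinear_form m G v w = (\<Sum>i<m. v i * apply_matrix m G w i)"
  unfolding bilinear_form_def apply_matrix_def by (simp add: sum_distrib_left algebra_simps)

lemma bilinear_form_commute:
  assumes "\<And>i j. i < m \<Longrightarrow> j < m \<Longrightarrow> G i j = G j i"
  shows "bilinear_form m G v w = bilinear_form m G w v"
  unfolding bilinear_form_def
  by (subst sum.swap) (auto intro!: sum.cong simp: assms)

lemma posdef_sym: "posdef m G \<Longrightarrow> i < m \<Longrightarrow> j < m \<Longrightarrow> G i j = G j i"
  unfolding posdef_def by blast

lemma posdef_det_nz: "posdef m G \<Longrightarrow> determinant m G \<noteq> 0"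
  using posdef_determinant_pos[of m G] by simp

lemma posdef_inverse_sym:
  "posdef m G \<Longrightarrow> i < m \<Longrightarrow> j < m \<Longrightarrow> inverse_matrix m G i j = inverse_matrix m G j i"
  by (rule inverse_matrix_sym[OF posdef_det_nz]) (auto simp: posdef_sym)

lemma bilinear_form_inverse:
  assumes G: "posdef m G"
  shows "bilinear_form m G (apply_matrix m (inverse_matrix m G) \<xi>) w = (\<Sum>i<m. \<xi> i * w i)"
proof -
  have "bilinear_form m G (apply_matrix m (inverse_matrix m G) \<xi>) w =
      bilinear_form m G w (apply_matrix m (inverse_matrix m G) \<xi>)"
    by (rule bilinear_form_commute) (rule posdef_sym[OF G])
  also have "\<dots> = (\<Sum>i<m. w i * \<xi> i)"
    unfolding bilinear_form_apply using apply_matrix_inverse(1)[OF posdef_det_nz[OF G]] by simp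
  finally show ?thesis by (simp add: mult.commute)
qed

lemma apply_matrix_eq_bilinear: "(\<Sum>i<m. v i * apply_matrix n A w i) = (\<Sum>j<n. (\<Sum>i<m. A i j * v i) * w j)"
proof -
  have "(\<Sum>i<m. v i * apply_matrix n A w i) = (\<Sum>i<m. \<Sum>j<n. A i j * v i * w j)"
    unfolding apply_matrix_def by (simp add: sum_distrib_left algebra_simps)
  also have "\<dots> = (\<Sum>j<n. \<Sum>i<m. A i j * v i * w j)" by (rule sum.swap)
  finally show ?thesis by (simp add: sum_distrib_right)
qed

text \<open>The matrix \<open>B = A G\<^sup>-\<^sup>1 A\<^sup>T\<close> satisfies \<open>B H B = B\<close> and is invertible.\<close>

lemma submersion_inverse_metric:
  assumes G: "posdef m G" and H: "determinant n H \<noteq> 0" and Hsym: "\<And>k l. k < n \<Longrightarrow> l < n \<Longrightarrow> H k l = H l k"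
    and surj: "\<And>w. \<exists>v. \<forall>k<n. apply_matrix m A v k = w k"
    and iso: "\<And>v w. (\<And>u. (\<forall>k<n. apply_matrix m A u k = 0) \<Longrightarrow> bilinear_form m G v u = 0) \<Longrightarrow>
       (\<And>u. (\<forall>k<n. apply_matrix m A u k = 0) \<Longrightarrow> bilinear_form m G w u = 0) \<Longrightarrow>
       bilinear_form n H (apply_matrix m A v) (apply_matrix m A w) = bilinear_form m G v w"
    and kl: "k < n" "l < n"
  shows "(\<Sum>i<m. \<Sum>j<m. A k i * inverse_matrix m G i j * A l j) = inverse_matrix n H k l"
proof -
  define B where "B k l = (\<Sum>i<m. \<Sum>j<m. A k i * inverse_matrix m G i j * A l j)" for k l
  \<comment> \<open>\<open>V \<xi>\<close> is the vector dual, with respect to \<open>G\<close>, to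
    the pullback of the covector \<open>\<xi>\<close>. It is orthogonal to the kernel of
    \<open>A\<close>, and \<open>A\<close> sends it to \<open>B \<xi>\<close>, so the isometry
    assumption applies to such vectors.\<close>
  define V where "V \<xi> = apply_matrix m (inverse_matrix m G) (\<lambda>j. \<Sum>k<n. A k j * \<xi> k)" for \<xi>
  have GV: "bilinear_form m G (V \<xi>) u = (\<Sum>k<n. \<xi> k * apply_matrix m A u k)" for \<xi> u
    unfolding V_def bilinear_form_inverse[OF G] apply_matrix_eq_bilinear ..
  have AV: "apply_matrix m A (V \<xi>) k = apply_matrix n B \<xi> k" for \<xi> k
  proof -
    have "apply_matrix m A (V \<xi>) k = (\<Sum>i<m. \<Sum>j<m. \<Sum>l<n. A k i * inverse_matrix m G i j * A l j * \<xi> l)"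
      unfolding apply_matrix_def V_def by (simp add: sum_distrib_left algebra_simps)
    also have "\<dots> = (\<Sum>l<n. \<Sum>i<m. \<Sum>j<m. A k i * inverse_matrix m G i j * A l j * \<xi> l)" by (rule sum_swap3)
    finally show ?thesis unfolding apply_matrix_def B_def by (simp add: sum_distrib_right)
  qed
  have hor: "bilinear_form m G (V \<xi>) u = 0" if "\<forall>k<n. apply_matrix m A u k = 0" for \<xi> u
    unfolding GV using that by simp
  have key: "bilinear_form n H (apply_matrix n B \<xi>) (apply_matrix n B \<eta>) = (\<Sum>k<n. \<xi> k * apply_matrix n B \<eta> k)" for \<xi> \<eta>
    using iso[OF hor hor, of \<xi> \<eta>] unfolding GV AV by (simp add: bilinear_form_def AV)
  \<comment> \<open>If \<open>B \<xi> = 0\<close>, then \<open>V \<xi>\<close> has length zero and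
    vanishes. Surjectivity gives \<open>u\<close> with \<open>A u = \<xi>\<close>, and pairing
    \<open>V \<xi>\<close> with \<open>u\<close> shows that the squared norm of \<open>\<xi>\<close>
    is zero.\<close>
  have Bker: "\<xi> i = 0" if B0: "\<And>i. i < n \<Longrightarrow> apply_matrix n B \<xi> i = 0" and i: "i < n" for \<xi> i
  proof -
    have "bilinear_form m G (V \<xi>) (V \<xi>) = 0" unfolding GV AV using B0 by simp
    then have V0: "V \<xi> i = 0" if "i < m" for i using posdefD[OF G that, of "V \<xi>"] by auto
    obtain u where u: "\<And>k. k < n \<Longrightarrow> apply_matrix m A u k = \<xi> k" using surj by blast
    have "(\<Sum>k<n. \<xi> k * \<xi> k) = bilinear_form m G (V \<xi>) u" unfolding GV by (simp add: u)
    also have "\<dots> = 0" unfolding bilinear_form_def using V0 by simp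
    finally show ?thesis using i by (simp add: sum_nonneg_eq_0_iff)
  qed
  have detB: "determinant n B \<noteq> 0"
  proof
    assume "determinant n B = 0"
    from determinant_zero_kernel[OF this] show False using Bker by blast
  qed
  \<comment> \<open>\<open>key\<close> is the identity \<open>B H B = B\<close> as an equality of
    forms. Testing it with a unit vector and with \<open>\<eta>\<close>, the preimage of a unit
    vector under \<open>B\<close>, isolates one entry of \<open>H B\<close>.\<close>
  have HB: "(\<Sum>k<n. H i k * B k j) = (if i = j then 1 else 0)" if ij: "i < n" "j < n" for i j
  proof -
    define \<xi> where "\<xi> k = (if k = j then 1 else 0 :: real)" for k
    define \<eta> where "\<eta> = apply_matrix n (inverse_matrix n B) (\<lambda>k. if k = i then 1 else 0)"
    have B\<eta>: "apply_matrix n B \<eta> k = (if k = i then 1 else 0)" if "k < n" for k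
      unfolding \<eta>_def by (rule apply_matrix_inverse(1)[OF detB that])
    have B\<xi>: "apply_matrix n B \<xi> k = B k j" for k
    proof -
      have "apply_matrix n B \<xi> k = (\<Sum>l<n. if l = j then B k l else 0)"
        unfolding apply_matrix_def \<xi>_def by (rule sum.cong) auto
      then show ?thesis using ij by simp
    qed
    have "(\<Sum>k<n. \<xi> k * apply_matrix n B \<eta> k) = (\<Sum>k<n. if k = i then \<xi> k else 0)"
      by (rule sum.cong) (auto simp: B\<eta>)
    also have "\<dots> = (if i = j then 1 else 0)" using ij by (simp add: \<xi>_def)
    finally have "(if i = j then 1 else 0) = bilinear_form n H (apply_matrix n B \<xi>) (apply_matrix n B \<eta>)"
      unfolding key by simp
    also have "\<dots> = (\<Sum>k<n. \<Sum>l<n. if l = i then H k l * B k j else 0)"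
      unfolding bilinear_form_def by (intro sum.cong refl) (auto simp: B\<eta> B\<xi>)
    also have "\<dots> = (\<Sum>k<n. H i k * B k j)" using ij by (simp add: Hsym[of _ i])
    finally show ?thesis by simp
  qed
  have "B k l = inverse_matrix n H k l" by (rule inverse_matrix_unique[OF H HB kl])
  then show ?thesis unfolding B_def .
qed

text \<open>If \<open>R\<close> is a contravariant symmetric tensor such that \<open>R G\<close> is a projection, then \<open>R G\<close> is
  self-adjoint and its trace is its rank.\<close>

lemma projection_trace_zero:
  assumes G: "posdef m G" and Rsym: "\<And>i j. i < m \<Longrightarrow> j < m \<Longrightarrow> R i j = R j i"
    and RGR: "\<And>i j. i < m \<Longrightarrow> j < m \<Longrightarrow> (\<Sum>k<m. \<Sum>l<m. R i k * G k l * R l j) = R i j"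
    and tr: "(\<Sum>i<m. \<Sum>j<m. R i j * G i j) = 0"
    and ij: "i < m" "j < m"
  shows "R i j = 0"
proof -
  obtain b where b: "\<And>i j. i < m \<Longrightarrow> j < m \<Longrightarrow> G i j = (\<Sum>s<m. b s i * b s j)"
    using posdef_sum_of_squares[OF G] by blast
  \<comment> \<open>\<open>R G R = R\<close> exhibits the form of \<open>R\<close> as a pullback of
    \<open>G\<close>; so it is nonnegative and vanishes only where \<open>R \<xi>\<close>
    does.\<close>
  have sq: "bilinear_form m R \<xi> \<xi> = bilinear_form m G (apply_matrix m R \<xi>) (apply_matrix m R \<xi>)" for \<xi>
  proof -
    have "bilinear_form m R \<xi> \<xi> = (\<Sum>i<m. \<Sum>j<m. \<Sum>k<m. \<Sum>l<m. R i k * G k l * R l j * \<xi> i * \<xi> j)"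
      unfolding bilinear_form_def by (intro sum.cong refl) (simp add: RGR flip: sum_distrib_right)
    also have "\<dots> = (\<Sum>k<m. \<Sum>l<m. \<Sum>i<m. \<Sum>j<m. R i k * G k l * R l j * \<xi> i * \<xi> j)" by (rule sum_swap_pairs)
    also have "\<dots> = (\<Sum>k<m. \<Sum>l<m. G k l * (\<Sum>i<m. R k i * \<xi> i) * (\<Sum>j<m. R l j * \<xi> j))"
      by (intro sum.cong refl) (simp add: sum_distrib_left sum_distrib_right Rsym algebra_simps)
    finally show ?thesis unfolding bilinear_form_def apply_matrix_def .
  qed
  have nn: "bilinear_form m R \<xi> \<xi> \<ge> 0" for \<xi>
  proof (cases "\<exists>i<m. apply_matrix m R \<xi> i \<noteq> 0")
    case True
    then show ?thesis unfolding sq using posdefD[OF G] less_imp_le by blast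
  next
    case False
    then show ?thesis unfolding sq unfolding bilinear_form_def by simp
  qed
  \<comment> \<open>With \<open>G\<close> written as a sum of squares of covectors
    \<open>b s\<close>, the trace is a sum of nonnegative values of \<open>R\<close>. As the total
    is zero, \<open>R\<close> kills every \<open>b s\<close> and hence
    \<open>R G = 0\<close>.\<close>
  have "(\<Sum>i<m. \<Sum>j<m. R i j * G i j) = (\<Sum>i<m. \<Sum>j<m. \<Sum>s<m. R i j * b s i * b s j)"
    by (intro sum.cong refl) (simp add: b sum_distrib_left algebra_simps)
  also have "\<dots> = (\<Sum>i<m. \<Sum>s<m. \<Sum>j<m. R i j * b s i * b s j)" by (intro sum.cong refl sum.swap)
  also have "\<dots> = (\<Sum>s<m. bilinear_form m R (b s) (b s))" unfolding bilinear_form_def by (rule sum.swap)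
  finally have "(\<Sum>s<m. bilinear_form m R (b s) (b s)) = 0" using tr by simp
  then have "bilinear_form m R (b s) (b s) = 0" if "s < m" for s
    using nn that by (simp add: sum_nonneg_eq_0_iff)
  then have Rb: "apply_matrix m R (b s) i = 0" if "s < m" "i < m" for s i
    using posdefD[OF G that(2), of "apply_matrix m R (b s)"] that(1) unfolding sq by force
  have RG: "(\<Sum>l<m. R i l * G l k) = 0" if "i < m" "k < m" for i k
  proof -
    have "(\<Sum>l<m. R i l * G l k) = (\<Sum>l<m. \<Sum>s<m. R i l * b s l * b s k)"
      using that by (intro sum.cong refl) (simp add: b sum_distrib_left algebra_simps)
    also have "\<dots> = (\<Sum>s<m. apply_matrix m R (b s) i * b s k)"
      unfolding apply_matrix_def by (subst sum.swap) (simp add: sum_distrib_right)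
    also have "\<dots> = 0" using Rb that by simp
    finally show ?thesis .
  qed
  have "R i j = (\<Sum>l<m. \<Sum>k<m. R i k * G k l * R l j)" using RGR[OF ij] by (subst sum.swap) simp
  also have "\<dots> = (\<Sum>l<m. (\<Sum>k<m. R i k * G k l) * R l j)" by (simp add: sum_distrib_right)
  also have "\<dots> = 0" using RG ij by simp
  finally show ?thesis .
qed

section \<open>Differentiating determinants and inverse matrices\<close>

lemma C1_determinant:
  assumes "\<And>i j. i < m \<Longrightarrow> j < m \<Longrightarrow> C1 n V (\<lambda>x. G x i j)"
  shows "C1 n V (\<lambda>x. determinant m (G x))"
proof -
  have "determinant m (G x) = (\<Sum>p | p permutes {0..<m}. signof p * (\<Prod>i = 0..<m. G x i (p i)))" for x
  proof -
    have "(\<Prod>i = 0..<m. mat m m (\<lambda>(i, j). G x i j) $$ (i, p i)) = (\<Prod>i = 0..<m. G x i (p i))"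
      if "p permutes {0..<m}" for p
      by (rule prod.cong) (use permutes_in_image[OF that] in auto)
    then show ?thesis unfolding determinant_def det_def'[OF mat_carrier_fun] by simp
  qed
  moreover have "C1 n V (\<lambda>x. \<Sum>p | p permutes {0..<m}. signof p * (\<Prod>i = 0..<m. G x i (p i)))"
  proof (intro C1_sum(1) C1_mult(1) C1_const C1_prod finite_permutations finite_atLeastLessThan)
    fix p i assume "p \<in> {p. p permutes {0..<m}}" "i \<in> {0..<m}"
    then have "i < m" "p i < m" using permutes_in_image[of p "{0..<m}" i] by auto
    then show "C1 n V (\<lambda>x. G x i (p i))" by (rule assms)
  qed
  ultimately show ?thesis by simp
qed

text \<open>Cramer's rule: every entry is a signed minor divided by the determinant. The index
  shifts spell out the deletion of row \<open>j\<close> and column \<open>i\<close>.\<close>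

lemma C1_inverse_matrix:
  assumes G: "\<And>i j. i < m \<Longrightarrow> j < m \<Longrightarrow> C1 n V (\<lambda>x. G x i j)"
    and nz: "\<And>x. x \<in> V \<Longrightarrow> determinant m (G x) \<noteq> 0" and ij: "i < m" "j < m"
  shows "C1 n V (\<lambda>x. inverse_matrix m (G x) i j)"
proof -
  have "inverse_matrix m (G x) i j = (- 1) ^ (j + i) * determinant (m - 1)
      (\<lambda>a b. G x (if a < j then a else Suc a) (if b < i then b else Suc b)) / determinant m (G x)" for x
  proof -
    have "mat_delete (mat m m (\<lambda>(i, j). G x i j)) j i =
        mat (m - 1) (m - 1) (\<lambda>(a, b). G x (if a < j then a else Suc a) (if b < i then b else Suc b))"
      unfolding mat_delete_def by (rule eq_matI) auto
    then show ?thesis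
      unfolding inverse_matrix_def adj_mat_def cofactor_def determinant_def[of "m - 1"] using ij by simp
  qed
  moreover have "C1 n V (\<lambda>x. (- 1) ^ (j + i) * determinant (m - 1)
      (\<lambda>a b. G x (if a < j then a else Suc a) (if b < i then b else Suc b)) / determinant m (G x))"
    by (intro C1_divide C1_mult(1) C1_const C1_determinant G nz) (use ij in auto)
  ultimately show ?thesis by simp
qed

text \<open>Jacobi's formula. Differentiating the Leibniz formula row by row gives determinants in which
  one row is replaced by its derivative; these are expanded along that row.\<close>

lemma has_real_derivative_determinant:
  assumes d: "\<And>i j. i < m \<Longrightarrow> j < m \<Longrightarrow> ((\<lambda>s. G s i j) has_real_derivative G' i j) (at t)"
    and nz: "determinant m (G t) \<noteq> 0"
  shows "((\<lambda>s. determinant m (G s)) has_real_derivative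
    determinant m (G t) * (\<Sum>i<m. \<Sum>j<m. inverse_matrix m (G t) j i * G' i j)) (at t)"
proof -
  let ?P = "{p. p permutes {0..<m}}"
  let ?M = "\<lambda>s. mat m m (\<lambda>(i, j). G s i j)"
  define row where "row a = mat m m (\<lambda>(i, j). if i = a then G' i j else G t i j)" for a
  have det: "determinant m (G s) = (\<Sum>p\<in>?P. signof p * (\<Prod>i = 0..<m. G s i (p i)))" for s
  proof -
    have "(\<Prod>i = 0..<m. ?M s $$ (i, p i)) = (\<Prod>i = 0..<m. G s i (p i))" if "p permutes {0..<m}" for p
      by (rule prod.cong) (use permutes_in_image[OF that] in auto)
    then show ?thesis unfolding determinant_def det_def'[OF mat_carrier_fun] by simp
  qed
  have "((\<lambda>s. determinant m (G s)) has_real_derivative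
      (\<Sum>p\<in>?P. signof p * (\<Sum>a\<in>{0..<m}. G' a (p a) * (\<Prod>i\<in>{0..<m} - {a}. G t i (p i))))) (at t)"
    unfolding det
  proof (intro DERIV_sum DERIV_cmult has_field_derivative_prod)
    fix p i assume "p \<in> ?P" "i \<in> {0..<m}"
    then have "i < m" "p i < m" using permutes_in_image[of p "{0..<m}" i] by auto
    then show "((\<lambda>s. G s i (p i)) has_real_derivative G' i (p i)) (at t)" by (rule d)
  qed
  also have "(\<Sum>p\<in>?P. signof p * (\<Sum>a\<in>{0..<m}. G' a (p a) * (\<Prod>i\<in>{0..<m} - {a}. G t i (p i)))) =
      (\<Sum>a\<in>{0..<m}. \<Sum>p\<in>?P. signof p * (G' a (p a) * (\<Prod>i\<in>{0..<m} - {a}. G t i (p i))))"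
    by (subst sum.swap) (simp add: sum_distrib_left)
  also have "\<dots> = (\<Sum>a\<in>{0..<m}. Determinant.det (row a))"
  proof (rule sum.cong[OF refl])
    fix a assume a: "a \<in> {0..<m}"
    have "(\<Prod>i = 0..<m. row a $$ (i, p i)) = G' a (p a) * (\<Prod>i\<in>{0..<m} - {a}. G t i (p i))"
      if "p permutes {0..<m}" for p
    proof -
      have pi: "i < m \<Longrightarrow> p i < m" for i using permutes_in_image[OF that, of i] by simp
      have "(\<Prod>i = 0..<m. row a $$ (i, p i)) = row a $$ (a, p a) * (\<Prod>i\<in>{0..<m} - {a}. row a $$ (i, p i))"
        by (rule prod.remove) (use a in auto)
      also have "(\<Prod>i\<in>{0..<m} - {a}. row a $$ (i, p i)) = (\<Prod>i\<in>{0..<m} - {a}. G t i (p i))"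
        by (rule prod.cong) (auto simp: row_def pi)
      finally show ?thesis using a pi by (simp add: row_def)
    qed
    then show "(\<Sum>p\<in>?P. signof p * (G' a (p a) * (\<Prod>i\<in>{0..<m} - {a}. G t i (p i)))) = Determinant.det (row a)"
      unfolding det_def'[of "row a" m, unfolded row_def, OF mat_carrier_fun, folded row_def] by simp
  qed
  also have "\<dots> = (\<Sum>a\<in>{0..<m}. \<Sum>j<m. determinant m (G t) * (inverse_matrix m (G t) j a * G' a j))"
  proof (rule sum.cong[OF refl])
    fix a assume a: "a \<in> {0..<m}"
    have "Determinant.det (row a) = (\<Sum>j<m. row a $$ (a, j) * cofactor (row a) a j)"
      by (rule laplace_expansion_row) (use a in \<open>auto simp: row_def\<close>)
    also have "\<dots> = (\<Sum>j<m. determinant m (G t) * (inverse_matrix m (G t) j a * G' a j))"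
    proof (rule sum.cong[OF refl])
      fix j assume j: "j \<in> {..<m}"
      have "mat_delete (row a) a j = mat_delete (?M t) a j"
        unfolding mat_delete_def row_def by (rule eq_matI) auto
      then have "cofactor (row a) a j = adj_mat (?M t) $$ (j, a)"
        using a j by (simp add: cofactor_def adj_mat_def)
      then have "cofactor (row a) a j = determinant m (G t) * inverse_matrix m (G t) j a"
        using nz by (simp add: inverse_matrix_def)
      then show "row a $$ (a, j) * cofactor (row a) a j = determinant m (G t) * (inverse_matrix m (G t) j a * G' a j)"
        using a j by (simp add: row_def)
    qed
    finally show "Determinant.det (row a) = (\<Sum>j<m. determinant m (G t) * (inverse_matrix m (G t) j a * G' a j))" .
  qed
  finally show ?thesis by (simp add: sum_distrib_left atLeast0LessThan)
qed

lemma partial_determinant: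
  assumes G: "\<And>i j. i < m \<Longrightarrow> j < m \<Longrightarrow> C1 n V (\<lambda>x. G x i j)"
    and nz: "determinant m (G x) \<noteq> 0" and x: "x \<in> V" "k < n"
  shows "partial k (\<lambda>x. determinant m (G x)) x =
    determinant m (G x) * (\<Sum>i<m. \<Sum>j<m. inverse_matrix m (G x) j i * partial k (\<lambda>x. G x i j) x)"
proof (rule partial_eqI)
  have "((\<lambda>t. determinant m (G (x(k := t)))) has_real_derivative determinant m (G (x(k := x k))) *
      (\<Sum>i<m. \<Sum>j<m. inverse_matrix m (G (x(k := x k))) j i * partial k (\<lambda>x. G x i j) x)) (at (x k))"
    by (rule has_real_derivative_determinant) (use C1_deriv[OF G x(2,1)] nz in auto)
  then show "((\<lambda>t. determinant m (G (x(k := t)))) has_real_derivative determinant m (G x) *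
      (\<Sum>i<m. \<Sum>j<m. inverse_matrix m (G x) j i * partial k (\<lambda>x. G x i j) x)) (at (x k))"
    by simp
qed

text \<open>The product of \<open>G\<close> with its inverse is constant; differentiating it and
  multiplying by the inverse from the left isolates the derivative sought.\<close>

lemma partial_inverse_matrix:
  assumes V: "eucl_open n V"
    and G: "\<And>i j. i < m \<Longrightarrow> j < m \<Longrightarrow> C1 n V (\<lambda>x. G x i j)"
    and nz: "\<And>x. x \<in> V \<Longrightarrow> determinant m (G x) \<noteq> 0" and x: "x \<in> V" "k < n" and ij: "i < m" "j < m"
  shows "partial k (\<lambda>x. inverse_matrix m (G x) i j) x =
    - (\<Sum>a<m. \<Sum>b<m. inverse_matrix m (G x) i a * partial k (\<lambda>x. G x a b) x * inverse_matrix m (G x) b j)"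
proof -
  note I = C1_inverse_matrix[OF G nz]
  define D where "D b = partial k (\<lambda>x. inverse_matrix m (G x) b j) x" for b
  have *: "(\<Sum>b<m. G x a b * D b) = - (\<Sum>b<m. partial k (\<lambda>x. G x a b) x * inverse_matrix m (G x) b j)"
    if a: "a < m" for a
  proof -
    have "partial k (\<lambda>x. \<Sum>b<m. G x a b * inverse_matrix m (G x) b j) x = partial k (\<lambda>x. if a = j then 1 else 0) x"
      by (rule partial_cong[OF V x(2,1)]) (rule inverse_matrix_right[OF nz a ij(2)])
    then have "partial k (\<lambda>x. \<Sum>b<m. G x a b * inverse_matrix m (G x) b j) x = 0"
      by (simp add: partial_const)
    moreover have "partial k (\<lambda>x. \<Sum>b<m. G x a b * inverse_matrix m (G x) b j) x =
        (\<Sum>b<m. partial k (\<lambda>x. G x a b * inverse_matrix m (G x) b j) x)"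
      by (rule C1_sum(2)[OF _ _ x]) (auto intro!: C1_mult(1) G I a ij)
    moreover have "\<dots> = (\<Sum>b<m. partial k (\<lambda>x. G x a b) x * inverse_matrix m (G x) b j + G x a b * D b)"
      unfolding D_def by (intro sum.cong refl C1_mult(2)[OF _ _ x]) (auto intro!: G I a ij)
    ultimately show ?thesis by (simp add: sum.distrib)
  qed
  have "D i = apply_matrix m (inverse_matrix m (G x)) (apply_matrix m (G x) D) i"
    by (rule apply_matrix_inverse(2)[OF nz[OF x(1)] ij(1), symmetric])
  also have "\<dots> = (\<Sum>a<m. inverse_matrix m (G x) i a * - (\<Sum>b<m. partial k (\<lambda>x. G x a b) x * inverse_matrix m (G x) b j))"
    unfolding apply_matrix_def by (intro sum.cong refl) (simp add: *)
  finally show ?thesis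
    unfolding D_def by (simp add: sum_distrib_left sum_negf mult.assoc)
qed

section \<open>Lebesgue measure on \<open>Euclidean_space m\<close>\<close>

abbreviation (input) "linear_map m A x \<equiv> \<lambda>i. if i < m then apply_matrix m A x i else 0"

lemma sets_lebesgue_space [measurable_cong, simp]: "sets (lebesgue_space m) = sets borel"
  by (simp add: lebesgue_space_def)

lemma space_lebesgue_space [simp]: "space (lebesgue_space m) = UNIV"
  by (simp add: lebesgue_space_def)

lemma product_sigma_finite_lborel: "product_sigma_finite (\<lambda>_ :: nat. lborel :: real measure)"
  by (simp add: product_sigma_finite_def sigma_finite_lborel)

lemma measurable_embed [measurable]:
  fixes m :: nat
  assumes "{..<m} \<subseteq> I"
  shows "(\<lambda>x i. if i < m then x i else 0) \<in> borel_measurable (\<Pi>\<^sub>M i\<in>I. (lborel :: real measure))"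
proof (rule measurable_coordinatewise_then_product)
  fix i
  show "(\<lambda>x. if i < m then x i else 0) \<in> borel_measurable (\<Pi>\<^sub>M i\<in>I. (lborel :: real measure))"
  proof (cases "i < m")
    case True
    then have "(\<lambda>x. x i) \<in> measurable (\<Pi>\<^sub>M i\<in>I. (lborel :: real measure)) lborel"
      using assms by (intro measurable_component_singleton) auto
    then show ?thesis using True by simp
  qed simp
qed

lemma measurable_upd [measurable]:
  "(\<lambda>p. (fst p)(m := snd p)) \<in> borel_measurable ((borel :: (nat \<Rightarrow> real) measure) \<Otimes>\<^sub>M (borel :: real measure))"
  "(\<lambda>p. (snd p)(m := fst p)) \<in> borel_measurable ((borel :: real measure) \<Otimes>\<^sub>M (borel :: (nat \<Rightarrow> real) measure))"
proof -
  have 1: "(\<lambda>p. fst p i) \<in> borel_measurable ((borel :: (nat \<Rightarrow> real) measure) \<Otimes>\<^sub>M (borel :: real measure))"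
    and 2: "(\<lambda>p. snd p i) \<in> borel_measurable ((borel :: real measure) \<Otimes>\<^sub>M (borel :: (nat \<Rightarrow> real) measure))" for i
    by (rule measurable_product_then_coordinatewise[of fst], rule measurable_fst)
      (rule measurable_product_then_coordinatewise[of snd], rule measurable_snd)
  show "(\<lambda>p. (fst p)(m := snd p)) \<in> borel_measurable ((borel :: (nat \<Rightarrow> real) measure) \<Otimes>\<^sub>M (borel :: real measure))"
  proof (rule measurable_coordinatewise_then_product)
    fix i show "(\<lambda>p. ((fst p)(m := snd p)) i) \<in> borel_measurable ((borel :: (nat \<Rightarrow> real) measure) \<Otimes>\<^sub>M (borel :: real measure))"
      by (cases "i = m") (auto simp: 1)
  qed
  show "(\<lambda>p. (snd p)(m := fst p)) \<in> borel_measurable ((borel :: real measure) \<Otimes>\<^sub>M (borel :: (nat \<Rightarrow> real) measure))"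
  proof (rule measurable_coordinatewise_then_product)
    fix i show "(\<lambda>p. ((snd p)(m := fst p)) i) \<in> borel_measurable ((borel :: real measure) \<Otimes>\<^sub>M (borel :: (nat \<Rightarrow> real) measure))"
      by (cases "i = m") (auto simp: 2)
  qed
qed

lemma nn_integral_lebesgue_space:
  "f \<in> borel_measurable borel \<Longrightarrow> (\<integral>\<^sup>+x. f x \<partial>lebesgue_space m) =
    (\<integral>\<^sup>+x. f (\<lambda>i. if i < m then x i else 0) \<partial>(\<Pi>\<^sub>M i\<in>{..<m}. lborel))"
  unfolding lebesgue_space_def by (rule nn_integral_distr) (auto intro: measurable_embed)

text \<open>Tonelli for the last coordinate, in both orders of integration: the induction for linear
  maps changes variables first in the last coordinate and then in the remaining ones. The
  measurability facts allow the lemma to be applied again to the inner integrals.\<close>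

lemma nn_integral_lebesgue_space_Suc:
  fixes f :: "(nat \<Rightarrow> real) \<Rightarrow> ennreal"
  assumes [measurable]: "f \<in> borel_measurable borel"
  shows "(\<integral>\<^sup>+x. f x \<partial>lebesgue_space (Suc m)) = (\<integral>\<^sup>+x. \<integral>\<^sup>+t. f (x(m := t)) \<partial>lborel \<partial>lebesgue_space m)"
    and "(\<integral>\<^sup>+x. f x \<partial>lebesgue_space (Suc m)) = (\<integral>\<^sup>+t. \<integral>\<^sup>+x. f (x(m := t)) \<partial>lebesgue_space m \<partial>lborel)"
    and "(\<lambda>x. \<integral>\<^sup>+t. f (x(m := t)) \<partial>lborel) \<in> borel_measurable borel"
    and "(\<lambda>x. f (x(m := t))) \<in> borel_measurable borel"
proof -
  interpret lb: product_sigma_finite "\<lambda>_ :: nat. lborel :: real measure" by (rule product_sigma_finite_lborel)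
  have fm: "(\<lambda>p. f ((fst p)(m := snd p))) \<in> borel_measurable (borel \<Otimes>\<^sub>M borel)"
    by (rule measurable_compose[OF measurable_upd(1)]) simp
  then have fm': "(\<lambda>(x, t). f (x(m := t))) \<in> borel_measurable (borel \<Otimes>\<^sub>M lborel)"
    by (simp add: case_prod_beta' cong: measurable_cong_sets)
  show m1: "(\<lambda>x. \<integral>\<^sup>+t. f (x(m := t)) \<partial>lborel) \<in> borel_measurable borel"
    by (rule lborel.borel_measurable_nn_integral[OF fm'])
  have m2: "(\<lambda>x. f (x(m := t))) \<in> borel_measurable borel" for t
  proof -
    have "(\<lambda>x :: nat \<Rightarrow> real. (x, t)) \<in> measurable borel (borel \<Otimes>\<^sub>M borel)" by measurable
    from measurable_compose[OF this fm] show ?thesis by simp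
  qed
  then show "(\<lambda>x. f (x(m := t))) \<in> borel_measurable borel" .
  have fe: "(\<lambda>x. f (\<lambda>i. if i < Suc m then x i else 0)) \<in> borel_measurable (\<Pi>\<^sub>M i\<in>insert m {..<m}. lborel)"
    by (rule measurable_compose[OF measurable_embed]) (auto simp: less_Suc_eq)
  have emb: "(\<lambda>i. if i < Suc m then (x(m := t)) i else 0) = (\<lambda>i. if i < m then x i else 0)(m := t)" for x :: "nat \<Rightarrow> real" and t
    by auto
  have "(\<integral>\<^sup>+x. f x \<partial>lebesgue_space (Suc m)) =
      (\<integral>\<^sup>+x. f (\<lambda>i. if i < Suc m then x i else 0) \<partial>(\<Pi>\<^sub>M i\<in>insert m {..<m}. lborel))"
    by (simp only: nn_integral_lebesgue_space[OF assms] lessThan_Suc)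
  also have "\<dots> = (\<integral>\<^sup>+x. \<integral>\<^sup>+t. f ((\<lambda>i. if i < m then x i else 0)(m := t)) \<partial>lborel \<partial>(\<Pi>\<^sub>M i\<in>{..<m}. lborel))"
    by (subst lb.product_nn_integral_insert[OF _ _ fe]) (auto simp only: emb finite_lessThan)
  also have "\<dots> = (\<integral>\<^sup>+x. \<integral>\<^sup>+t. f (x(m := t)) \<partial>lborel \<partial>lebesgue_space m)"
    by (rule nn_integral_lebesgue_space[OF m1, symmetric])
  finally show "(\<integral>\<^sup>+x. f x \<partial>lebesgue_space (Suc m)) = (\<integral>\<^sup>+x. \<integral>\<^sup>+t. f (x(m := t)) \<partial>lborel \<partial>lebesgue_space m)" .
  have "(\<integral>\<^sup>+x. f x \<partial>lebesgue_space (Suc m)) =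
      (\<integral>\<^sup>+x. f (\<lambda>i. if i < Suc m then x i else 0) \<partial>(\<Pi>\<^sub>M i\<in>insert m {..<m}. lborel))"
    by (simp only: nn_integral_lebesgue_space[OF assms] lessThan_Suc)
  also have "\<dots> = (\<integral>\<^sup>+t. \<integral>\<^sup>+x. f ((\<lambda>i. if i < m then x i else 0)(m := t)) \<partial>(\<Pi>\<^sub>M i\<in>{..<m}. lborel) \<partial>lborel)"
    by (subst lb.product_nn_integral_insert_rev[OF _ _ fe]) (auto simp only: emb finite_lessThan)
  also have "\<dots> = (\<integral>\<^sup>+t. \<integral>\<^sup>+x. f (x(m := t)) \<partial>lebesgue_space m \<partial>lborel)"
    by (simp only: nn_integral_lebesgue_space[OF m2])
  finally show "(\<integral>\<^sup>+x. f x \<partial>lebesgue_space (Suc m)) = (\<integral>\<^sup>+t. \<integral>\<^sup>+x. f (x(m := t)) \<partial>lebesgue_space m \<partial>lborel)" .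
qed

text \<open>Fubini with coordinate \<open>i\<close> integrated first. Its use is for a partial
  derivative of compactly supported functions, where the inner integral vanishes by the fundamental
  theorem of calculus.\<close>

lemma integral_lebesgue_space_zero:
  fixes f :: "(nat \<Rightarrow> real) \<Rightarrow> real"
  assumes i: "i < m" and f: "integrable (lebesgue_space m) f"
    and z: "\<And>x. (\<And>j. j \<ge> m \<Longrightarrow> x j = 0) \<Longrightarrow> (\<integral>t. f (x(i := t)) \<partial>lborel) = 0"
  shows "(\<integral>x. f x \<partial>lebesgue_space m) = 0"
proof -
  interpret lb: product_sigma_finite "\<lambda>_ :: nat. lborel :: real measure" by (rule product_sigma_finite_lborel)
  let ?I = "{..<m} - {i}"
  let ?e = "\<lambda>x j. if j < m then x j else (0 :: real)"
  have I: "{..<m} = insert i ?I" using i by auto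
  have f': "integrable (\<Pi>\<^sub>M i\<in>insert i ?I. lborel) (\<lambda>x. f (?e x))"
    using f unfolding lebesgue_space_def I[symmetric] by (rule integrable_distr[rotated]) (rule measurable_embed, simp)
  have "(\<integral>x. f x \<partial>lebesgue_space m) = (\<integral>x. f (?e x) \<partial>(\<Pi>\<^sub>M i\<in>{..<m}. lborel))"
    unfolding lebesgue_space_def
    by (rule integral_distr) (use f in \<open>auto intro: measurable_embed\<close>)
  also have "\<dots> = (\<integral>x. f (?e x) \<partial>(\<Pi>\<^sub>M i\<in>insert i ?I. lborel))" by (simp only: I[symmetric])
  also have "\<dots> = (\<integral>x. \<integral>t. f (?e (x(i := t))) \<partial>lborel \<partial>(\<Pi>\<^sub>M i\<in>?I. lborel))"
    by (rule lb.product_integral_insert[OF _ _ f']) auto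
  also have "\<dots> = (\<integral>x. 0 \<partial>(\<Pi>\<^sub>M i\<in>?I. lborel))"
  proof -
    have "?e (x(i := t)) = (?e x)(i := t)" for x t using i by auto
    then have "(\<integral>t. f (?e (x(i := t))) \<partial>lborel) = 0" for x using z[of "?e x"] by simp
    then show ?thesis by simp
  qed
  finally show ?thesis by simp
qed

text \<open>The sides \<open>B i\<close> are arbitrary Borel sets of prescribed length, so open,
  closed and half-open boxes are all covered.\<close>

lemma emeasure_lebesgue_space_box:
  assumes lohi: "\<And>i. i < m \<Longrightarrow> lo i \<le> hi i"
    and B: "\<And>i. i < m \<Longrightarrow> B i \<in> sets borel" "\<And>i. i < m \<Longrightarrow> emeasure lborel (B i) = ennreal (hi i - lo i)"
  shows "emeasure (lebesgue_space m) {x. flat m x \<and> (\<forall>i<m. x i \<in> B i)} = ennreal (\<Prod>i<m. hi i - lo i)"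
proof -
  interpret lb: product_sigma_finite "\<lambda>_ :: nat. lborel :: real measure" by (rule product_sigma_finite_lborel)
  let ?e = "\<lambda>x j. if j < m then x j else (0 :: real)"
  let ?S = "{x. flat m x \<and> (\<forall>i<m. x i \<in> B i)}"
  have "?S = (\<Inter>i. {x. x i \<in> (if i < m then B i else {0})})" by (auto split: if_splits)
  moreover have "{x. x i \<in> A} \<in> sets borel" if "A \<in> sets borel" for i :: nat and A :: "real set"
    using measurable_sets[OF measurable_product_coordinates that, of i] by (simp add: vimage_def)
  ultimately have S: "?S \<in> sets borel" using B(1) by (auto intro!: sets.countable_INT)
  have "emeasure (lebesgue_space m) ?S = emeasure (\<Pi>\<^sub>M i\<in>{..<m}. lborel) (?e -` ?S \<inter> space (\<Pi>\<^sub>M i\<in>{..<m}. (lborel :: real measure)))"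
    unfolding lebesgue_space_def by (rule emeasure_distr[OF measurable_embed S]) simp
  also have "?e -` ?S \<inter> space (\<Pi>\<^sub>M i\<in>{..<m}. (lborel :: real measure)) = (\<Pi>\<^sub>E i\<in>{..<m}. B i)"
    by (auto simp: space_PiM PiE_iff)
  also have "emeasure (\<Pi>\<^sub>M i\<in>{..<m}. lborel) (\<Pi>\<^sub>E i\<in>{..<m}. B i) = (\<Prod>i<m. emeasure lborel (B i))"
    by (rule lb.emeasure_PiM) (use B in auto)
  also have "\<dots> = (\<Prod>i<m. ennreal (hi i - lo i))" using B by simp
  also have "\<dots> = ennreal (\<Prod>i<m. hi i - lo i)" by (rule prod_ennreal) (use lohi in auto)
  finally show ?thesis .
qed

lemma openin_Euclidean_borel: "eucl_open m V \<Longrightarrow> V \<in> sets borel"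
proof -
  assume "eucl_open m V"
  then obtain T where T: "open T" "V = T \<inter> {x. \<forall>i\<ge>m. x i = 0}" unfolding openin_Euclidean_space_iff by auto
  have "closed {x :: nat \<Rightarrow> real. \<forall>i\<ge>m. x i = 0}"
    using closedin_topspace[of "Euclidean_space m"] unfolding topspace_Euclidean_space
    by (rule closedin_Euclidean_imp_closed)
  then show ?thesis using T by (simp add: borel_open borel_closed sets.Int)
qed

lemma AE_lebesgue_space: "AE x in lebesgue_space m. \<forall>i\<ge>m. x i = 0"
proof -
  let ?e = "\<lambda>x j. if j < m then x j else (0 :: real)"
  have "{x :: nat \<Rightarrow> real. \<forall>i\<ge>m. x i = 0} \<in> sets borel"
    by (rule openin_Euclidean_borel[of m]) (use openin_topspace[of "Euclidean_space m"] in \<open>simp add: topspace_Euclidean_space\<close>)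
  then show ?thesis
    unfolding lebesgue_space_def by (subst AE_distr_iff[OF measurable_embed]) auto
qed

lemma measurable_apply_matrix [measurable]:
  "(\<lambda>x i. if i < m then apply_matrix k A x i else 0) \<in> borel_measurable borel"
proof (rule measurable_coordinatewise_then_product)
  fix i show "(\<lambda>x. if i < m then apply_matrix k A x i else 0) \<in> borel_measurable borel"
    by (cases "i < m") (auto simp: apply_matrix_def intro!: borel_measurable_add borel_measurable_sum borel_measurable_times)
qed

lemma measurable_translate [measurable]: "(\<lambda>x (i :: nat). x i + c i :: real) \<in> borel_measurable borel"
  by (rule measurable_coordinatewise_then_product) auto

lemma nn_integral_lebesgue_space_translate:
  assumes "f \<in> borel_measurable borel" "\<And>i. i \<ge> m \<Longrightarrow> c i = 0"
  shows "(\<integral>\<^sup>+x. f (\<lambda>i. x i + c i) \<partial>lebesgue_space m) = (\<integral>\<^sup>+x. f x \<partial>lebesgue_space m)"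
  using assms
proof (induction m arbitrary: f c)
  case 0
  then show ?case by simp
next
  case (Suc m)
  note [measurable] = Suc.prems(1)
  have fm: "(\<lambda>x. f (\<lambda>i. x i + c i)) \<in> borel_measurable borel"
    by (rule measurable_compose[OF measurable_translate]) simp
  define c' where "c' = c(m := 0)"
  have "(\<integral>\<^sup>+x. f (\<lambda>i. x i + c i) \<partial>lebesgue_space (Suc m)) =
      (\<integral>\<^sup>+x. \<integral>\<^sup>+t. f (\<lambda>i. (x(m := t)) i + c i) \<partial>lborel \<partial>lebesgue_space m)"
    by (rule nn_integral_lebesgue_space_Suc(1)[OF fm])
  also have "\<dots> = (\<integral>\<^sup>+x. \<integral>\<^sup>+t. f ((\<lambda>i. x i + c' i)(m := t)) \<partial>lborel \<partial>lebesgue_space m)"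
  proof (rule nn_integral_cong)
    fix x :: "nat \<Rightarrow> real"
    have g: "(\<lambda>t. f ((\<lambda>i. x i + c' i)(m := t))) \<in> borel_measurable borel"
      by (rule measurable_compose[OF borel_measurable_continuous_onI[OF continuous_on_upd]]) simp
    have "(\<lambda>i. (x(m := t)) i + c i) = (\<lambda>i. x i + c' i)(m := c m + 1 * t)" for t
      by (auto simp: c'_def)
    then show "(\<integral>\<^sup>+t. f (\<lambda>i. (x(m := t)) i + c i) \<partial>lborel) = (\<integral>\<^sup>+t. f ((\<lambda>i. x i + c' i)(m := t)) \<partial>lborel)"
      using nn_integral_real_affine[OF g, of 1 "c m"] by simp
  qed
  also have "\<dots> = (\<integral>\<^sup>+x. \<integral>\<^sup>+t. f (x(m := t)) \<partial>lborel \<partial>lebesgue_space m)"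
    by (rule Suc.IH[OF nn_integral_lebesgue_space_Suc(3)[OF Suc.prems(1)]]) (use Suc.prems in \<open>auto simp: c'_def\<close>)
  also have "\<dots> = (\<integral>\<^sup>+x. f x \<partial>lebesgue_space (Suc m))"
    by (rule nn_integral_lebesgue_space_Suc(1)[OF Suc.prems(1), symmetric])
  finally show ?case .
qed

text \<open>Induction on the dimension. If \<open>A m m \<noteq> 0\<close>, the last output coordinate is used as integration
  variable in place of the last input coordinate; the remaining matrix is the Schur complement.
  Otherwise a row is added to the last one, which is a shear of the target.\<close>

lemma nn_integral_lebesgue_space_linear:
  assumes "f \<in> borel_measurable borel" "determinant m A \<noteq> 0"
  shows "ennreal \<bar>determinant m A\<bar> * (\<integral>\<^sup>+x. f (linear_map m A x) \<partial>lebesgue_space m) =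
    (\<integral>\<^sup>+x. f x \<partial>lebesgue_space m)"
  using assms
proof (induction m arbitrary: f A)
  case 0
  have "AE x in lebesgue_space 0. x = (\<lambda>i. 0)" using AE_lebesgue_space[of 0] by (auto simp: fun_eq_iff)
  then have "(\<integral>\<^sup>+x. f (\<lambda>i. 0) \<partial>lebesgue_space 0) = (\<integral>\<^sup>+x. f x \<partial>lebesgue_space 0)"
    by (intro nn_integral_cong_AE) auto
  then show ?case by (simp add: determinant_def)
next
  case (Suc m)
  have main: "ennreal \<bar>determinant (Suc m) A\<bar> * (\<integral>\<^sup>+x. f (linear_map (Suc m) A x) \<partial>lebesgue_space (Suc m)) =
      (\<integral>\<^sup>+x. f x \<partial>lebesgue_space (Suc m))"
    if fm: "f \<in> borel_measurable borel" and A: "determinant (Suc m) A \<noteq> 0" and d: "A m m \<noteq> 0" for f A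
  proof -
    define B where "B = schur_complement m A"
    define d where "d = A m m"
    have det: "determinant (Suc m) A = d * determinant m B"
      unfolding B_def d_def by (rule determinant_Suc_schur) (rule d)
    have B: "determinant m B \<noteq> 0" and "d \<noteq> 0" using A unfolding det by auto
    \<comment> \<open>\<open>h\<close> is the linear map with its last output
      \<open>s = \<rho> + d * t\<close> as variable in place of the last input \<open>t\<close>. The
      substitution costs the factor \<open>d\<close> in absolute value; for fixed \<open>s\<close>
      what remains is the Schur complement followed by a translation.\<close>
    define h where "h z = (\<lambda>i. if i < m then apply_matrix m B z i + A i m / d * z m else if i = m then z m else 0)" for z
    have hm: "h \<in> borel_measurable borel"
    proof (rule measurable_coordinatewise_then_product)
      fix i show "(\<lambda>z. h z i) \<in> borel_measurable borel"
        by (cases "i < m"; cases "i = m") (auto simp: h_def apply_matrix_def intro!: borel_measurable_add borel_measurable_sum borel_measurable_times)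
    qed
    then have fh: "(\<lambda>z. f (h z)) \<in> borel_measurable borel" by (rule measurable_compose[OF _ fm])
    have fA: "(\<lambda>x. f (linear_map (Suc m) A x)) \<in> borel_measurable borel"
      by (rule measurable_compose[OF measurable_apply_matrix fm])
    have inner: "ennreal \<bar>d\<bar> * (\<integral>\<^sup>+t. f (linear_map (Suc m) A (x(m := t))) \<partial>lborel) =
        (\<integral>\<^sup>+s. f (h (x(m := s))) \<partial>lborel)" for x
    proof -
      define \<rho> where "\<rho> = (\<Sum>j<m. A m j * x j)"
      have "(linear_map (Suc m) A (x(m := t))) = h (x(m := \<rho> + d * t))" for t
      proof
        fix i
        have u: "(\<Sum>j<m. c j * (x(m := t)) j) = (\<Sum>j<m. c j * x j)" for c t by (rule sum.cong) auto
        have "(\<Sum>j<m. A i j * x j) + A i m * t = (\<Sum>j<m. B i j * x j) + A i m / d * (\<rho> + d * t)"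
          using \<open>d \<noteq> 0\<close>
          by (simp add: B_def schur_complement_def d_def[symmetric] \<rho>_def left_diff_distrib sum_subtractf sum_distrib_left
              distrib_left mult.assoc)
        then show "(if i < Suc m then apply_matrix (Suc m) A (x(m := t)) i else 0) = h (x(m := \<rho> + d * t)) i"
          using u by (simp add: h_def apply_matrix_def \<rho>_def d_def less_Suc_eq)
      qed
      moreover have "(\<lambda>s. f (h (x(m := s)))) \<in> borel_measurable borel"
        by (rule measurable_compose[OF borel_measurable_continuous_onI[OF continuous_on_upd] fh])
      ultimately show ?thesis
        using nn_integral_real_affine[of "\<lambda>s. f (h (x(m := s)))" d \<rho>] \<open>d \<noteq> 0\<close> by simp
    qed
    have "ennreal \<bar>determinant (Suc m) A\<bar> * (\<integral>\<^sup>+x. f (linear_map (Suc m) A x) \<partial>lebesgue_space (Suc m)) =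
        ennreal \<bar>determinant m B\<bar> * (ennreal \<bar>d\<bar> * (\<integral>\<^sup>+x. \<integral>\<^sup>+t. f (linear_map (Suc m) A (x(m := t))) \<partial>lborel \<partial>lebesgue_space m))"
      unfolding nn_integral_lebesgue_space_Suc(1)[OF fA] det abs_mult by (simp add: ennreal_mult mult_ac)
    also have "\<dots> = ennreal \<bar>determinant m B\<bar> * (\<integral>\<^sup>+x. \<integral>\<^sup>+s. f (h (x(m := s))) \<partial>lborel \<partial>lebesgue_space m)"
      using nn_integral_lebesgue_space_Suc(3)[OF fA] by (simp add: nn_integral_cmult[symmetric] inner)
    also have "\<dots> = ennreal \<bar>determinant m B\<bar> * (\<integral>\<^sup>+s. \<integral>\<^sup>+x. f (h (x(m := s))) \<partial>lebesgue_space m \<partial>lborel)"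
      using nn_integral_lebesgue_space_Suc(1,2)[OF fh] by simp
    also have "\<dots> = (\<integral>\<^sup>+s. ennreal \<bar>determinant m B\<bar> * (\<integral>\<^sup>+x. f (h (x(m := s))) \<partial>lebesgue_space m) \<partial>lborel)"
    proof (rule nn_integral_cmult[symmetric])
      have "(\<lambda>p. f (h ((snd p)(m := fst p)))) \<in> borel_measurable (borel \<Otimes>\<^sub>M borel)"
        by (rule measurable_compose[OF measurable_upd(2) fh])
      then have *: "(\<lambda>(s, x). f (h (x(m := s)))) \<in> borel_measurable (lborel \<Otimes>\<^sub>M lebesgue_space m)"
        by (simp add: case_prod_beta' cong: measurable_cong_sets)
      interpret lb: product_sigma_finite "\<lambda>_ :: nat. lborel :: real measure" by (rule product_sigma_finite_lborel)
      interpret P: sigma_finite_measure "\<Pi>\<^sub>M i\<in>{..<m}. (lborel :: real measure)" by (rule lb.sigma_finite) simp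
      have "(\<integral>\<^sup>+x. f (h (x(m := s))) \<partial>lebesgue_space m) =
          (\<integral>\<^sup>+x. f (h ((\<lambda>i. if i < m then x i else 0)(m := s))) \<partial>(\<Pi>\<^sub>M i\<in>{..<m}. lborel))" for s
        by (rule nn_integral_lebesgue_space[OF nn_integral_lebesgue_space_Suc(4)[OF fh]])
      moreover have "(\<lambda>s. \<integral>\<^sup>+x. f (h ((\<lambda>i. if i < m then x i else 0)(m := s))) \<partial>(\<Pi>\<^sub>M i\<in>{..<m}. lborel)) \<in> borel_measurable lborel"
      proof (rule P.borel_measurable_nn_integral)
        have "(\<lambda>p :: real \<times> (nat \<Rightarrow> real). (fst p, (\<lambda>i. if i < m then snd p i else 0))) \<in> measurable (lborel \<Otimes>\<^sub>M (\<Pi>\<^sub>M i\<in>{..<m}. lborel)) (borel \<Otimes>\<^sub>M borel)"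
        proof (rule measurable_Pair)
          show "(\<lambda>p :: real \<times> (nat \<Rightarrow> real). (\<lambda>i. if i < m then snd p i else 0)) \<in> borel_measurable (lborel \<Otimes>\<^sub>M (\<Pi>\<^sub>M i\<in>{..<m}. lborel))"
            by (rule measurable_compose[OF measurable_snd measurable_embed]) simp
        qed simp
        from measurable_compose[OF this measurable_compose[OF measurable_upd(2) fh]]
        show "(\<lambda>(s, x). f (h ((\<lambda>i. if i < m then x i else 0)(m := s)))) \<in> borel_measurable (lborel \<Otimes>\<^sub>M (\<Pi>\<^sub>M i\<in>{..<m}. lborel))"
          by (simp add: case_prod_beta')
      qed
      ultimately show "(\<lambda>s. \<integral>\<^sup>+x. f (h (x(m := s))) \<partial>lebesgue_space m) \<in> borel_measurable lborel" by simp
    qed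
    also have "\<dots> = (\<integral>\<^sup>+s. \<integral>\<^sup>+x. f (x(m := s)) \<partial>lebesgue_space m \<partial>lborel)"
    proof (rule nn_integral_cong)
      fix s :: real
      define c where "c i = (if i < m then A i m / d * s else 0)" for i
      define g where "g y = f ((\<lambda>i. y i + c i)(m := s))" for y
      have gm: "g \<in> borel_measurable borel"
        unfolding g_def by (rule measurable_compose[OF measurable_translate nn_integral_lebesgue_space_Suc(4)[OF fm]])
      have "h (x(m := s)) = (\<lambda>i. (if i < m then apply_matrix m B x i else 0) + c i)(m := s)" for x
      proof
        fix i
        have "(\<Sum>j<m. B i j * (x(m := s)) j) = (\<Sum>j<m. B i j * x j)" by (rule sum.cong) auto
        then show "h (x(m := s)) i = ((\<lambda>i. (if i < m then apply_matrix m B x i else 0) + c i)(m := s)) i"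
          by (simp add: h_def c_def apply_matrix_def)
      qed
      then have "ennreal \<bar>determinant m B\<bar> * (\<integral>\<^sup>+x. f (h (x(m := s))) \<partial>lebesgue_space m) = (\<integral>\<^sup>+x. g x \<partial>lebesgue_space m)"
        using Suc.IH[OF gm B] by (simp add: g_def)
      also have "\<dots> = (\<integral>\<^sup>+x. f (x(m := s)) \<partial>lebesgue_space m)"
        unfolding g_def
        by (rule nn_integral_lebesgue_space_translate[OF nn_integral_lebesgue_space_Suc(4)[OF fm]]) (simp add: c_def)
      finally show "ennreal \<bar>determinant m B\<bar> * (\<integral>\<^sup>+x. f (h (x(m := s))) \<partial>lebesgue_space m) = (\<integral>\<^sup>+x. f (x(m := s)) \<partial>lebesgue_space m)" .
    qed
    also have "\<dots> = (\<integral>\<^sup>+x. f x \<partial>lebesgue_space (Suc m))"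
      by (rule nn_integral_lebesgue_space_Suc(2)[OF fm, symmetric])
    finally show ?thesis .
  qed
  show ?case
  proof (cases "A m m = 0")
    case False
    then show ?thesis by (rule main[OF Suc.prems])
  next
    case True
    have "\<exists>l<m. A l m \<noteq> 0"
    proof (rule ccontr)
      assume "\<not> ?thesis"
      then have "determinant (Suc m) A = 0" using True by (intro determinant_zero_column[of m]) (auto simp: less_Suc_eq)
      then show False using Suc.prems(2) by simp
    qed
    then obtain l where l: "l < m" "A l m \<noteq> 0" by blast
    define A' where "A' i j = (if i = m then A m j + A l j else A i j)" for i j
    have det': "determinant (Suc m) A' = determinant (Suc m) A"
      unfolding A'_def by (rule determinant_add_row) (use l in auto)
    define f' where "f' y = f (y(m := y m - y l))" for y
    have "(\<lambda>y :: nat \<Rightarrow> real. y(m := y m - y l)) \<in> borel_measurable borel"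
    proof (rule measurable_coordinatewise_then_product)
      fix i show "(\<lambda>y. (y(m := y m - y l)) i :: real) \<in> borel_measurable borel"
        by (cases "i = m") auto
    qed
    then have f'm: "f' \<in> borel_measurable borel" unfolding f'_def by (rule measurable_compose[OF _ Suc.prems(1)])
    have "f (linear_map (Suc m) A x) =
        f' (linear_map (Suc m) A' x)" for x
    proof -
      have "(linear_map (Suc m) A x) =
        (linear_map (Suc m) A' x)(m := apply_matrix (Suc m) A' x m - apply_matrix (Suc m) A' x l)"
        using l by (auto simp: A'_def apply_matrix_def fun_eq_iff sum.distrib algebra_simps)
      then show ?thesis using l by (simp add: f'_def)
    qed
    then have "ennreal \<bar>determinant (Suc m) A\<bar> * (\<integral>\<^sup>+x. f (linear_map (Suc m) A x) \<partial>lebesgue_space (Suc m)) =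
        (\<integral>\<^sup>+x. f' x \<partial>lebesgue_space (Suc m))"
      using main[OF f'm, of A'] Suc.prems(2) l True unfolding det' by (simp add: A'_def)
    also have "\<dots> = (\<integral>\<^sup>+x. \<integral>\<^sup>+t. f' (x(m := t)) \<partial>lborel \<partial>lebesgue_space m)"
      by (rule nn_integral_lebesgue_space_Suc(1)[OF f'm])
    also have "\<dots> = (\<integral>\<^sup>+x. \<integral>\<^sup>+t. f (x(m := t)) \<partial>lborel \<partial>lebesgue_space m)"
    proof (rule nn_integral_cong)
      fix x :: "nat \<Rightarrow> real"
      have g: "(\<lambda>t. f (x(m := t))) \<in> borel_measurable borel"
        by (rule measurable_compose[OF borel_measurable_continuous_onI[OF continuous_on_upd] Suc.prems(1)])
      have "f' (x(m := t)) = f (x(m := - x l + 1 * t))" for t using l by (simp add: f'_def)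
      then show "(\<integral>\<^sup>+t. f' (x(m := t)) \<partial>lborel) = (\<integral>\<^sup>+t. f (x(m := t)) \<partial>lborel)"
        using nn_integral_real_affine[OF g, of 1 "- x l"] by simp
    qed
    also have "\<dots> = (\<integral>\<^sup>+x. f x \<partial>lebesgue_space (Suc m))"
      by (rule nn_integral_lebesgue_space_Suc(1)[OF Suc.prems(1), symmetric])
    finally show ?thesis .
  qed
qed

text \<open>The preimage of a box under an affine map is a parallelepiped. These are the sets
  between which the image of a small cube under a diffeomorphism is caught.\<close>

lemma emeasure_lebesgue_space_parallelepiped:
  assumes A: "determinant m A \<noteq> 0" and S: "S \<in> sets borel" and c: "\<And>i. i \<ge> m \<Longrightarrow> c i = 0"
  shows "{x. (linear_map m A (\<lambda>i. x i - c i)) \<in> S} \<in> sets borel"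
    and "ennreal \<bar>determinant m A\<bar> * emeasure (lebesgue_space m) {x. (linear_map m A (\<lambda>i. x i - c i)) \<in> S} =
      emeasure (lebesgue_space m) S"
proof -
  let ?T = "\<lambda>x i. if i < m then apply_matrix m A x i else 0"
  have T: "?T \<in> borel_measurable borel" by (rule measurable_apply_matrix)
  have tr: "(\<lambda>x i. x i - c i) \<in> borel_measurable borel" using measurable_translate[of "\<lambda>i. - c i"] by simp
  show S': "{x. ?T (\<lambda>i. x i - c i) \<in> S} \<in> sets borel"
    using measurable_sets[OF measurable_compose[OF tr T] S] by (simp add: vimage_def)
  have "emeasure (lebesgue_space m) {x. ?T (\<lambda>i. x i - c i) \<in> S} =
      (\<integral>\<^sup>+x. indicator {x. ?T (\<lambda>i. x i - c i) \<in> S} x \<partial>lebesgue_space m)"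
    by (rule nn_integral_indicator[symmetric]) (simp add: S')
  also have "\<dots> = (\<integral>\<^sup>+x. indicator S (?T (\<lambda>i. x i + - c i)) \<partial>lebesgue_space m)"
    by (rule nn_integral_cong) (simp add: indicator_def cong: if_cong)
  also have "\<dots> = (\<integral>\<^sup>+x. indicator S (?T x) \<partial>lebesgue_space m)"
    by (rule nn_integral_lebesgue_space_translate[OF measurable_compose[OF T]]) (use S c in auto)
  finally show "ennreal \<bar>determinant m A\<bar> * emeasure (lebesgue_space m) {x. ?T (\<lambda>i. x i - c i) \<in> S} = emeasure (lebesgue_space m) S"
    using nn_integral_lebesgue_space_linear[OF _ A, of "indicator S"] S by (simp add: nn_integral_indicator)
qed

section \<open>Comparing measures on small cubes\<close>

text \<open>Half-open sides make the dyadic cubes of one generation disjoint.\<close>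

definition half_cube :: "nat \<Rightarrow> (nat \<Rightarrow> real) \<Rightarrow> real \<Rightarrow> (nat \<Rightarrow> real) set" where
  "half_cube m a s = {y. flat m y \<and> (\<forall>i<m. y i \<in> {a i..<a i + s})}"

lemma half_cube_borel: "half_cube m a s \<in> sets borel"
proof -
  have "half_cube m a s = (\<Inter>i. {y. y i \<in> (if i < m then {a i..<a i + s} else {0})})"
    by (auto simp: half_cube_def split: if_splits)
  moreover have "{x. x i \<in> A} \<in> sets borel" if "A \<in> sets borel" for i :: nat and A :: "real set"
    using measurable_sets[OF measurable_product_coordinates that, of i] by (simp add: vimage_def)
  ultimately show ?thesis by (auto intro!: sets.countable_INT)
qed

lemma emeasure_half_cube:
  assumes "0 \<le> s"
  shows "emeasure (lebesgue_space m) (half_cube m a s) = ennreal (s ^ m)"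
  using emeasure_lebesgue_space_box[of m a "\<lambda>i. a i + s" "\<lambda>i. {a i..<a i + s}"] assms
  by (simp add: half_cube_def)

text \<open>Let \<open>G k\<close> be the union of all dyadic cubes of side \<open>2\<^sup>-\<^sup>k\<close> that lie in \<open>W\<close> and satisfy
  the inequality. Every point of \<open>W\<close> is in \<open>G k\<close> for all large \<open>k\<close>, so \<open>W\<close> is the increasing union of
  the sets \<open>\<Inter>l\<ge>k. G l\<close>.\<close>

lemma emeasure_le_of_cubes:
  assumes sets: "sets \<nu> = sets borel" "sets \<mu> = sets borel" and W: "W \<in> sets borel"
    and loc: "\<And>x. x \<in> W \<Longrightarrow> flat m x \<and> (\<exists>r>0. \<forall>a s. 0 < s \<longrightarrow> s < r \<longrightarrow> flat m a \<longrightarrow> x \<in> half_cube m a s \<longrightarrow>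
      half_cube m a s \<subseteq> W \<and> emeasure \<nu> (half_cube m a s) \<le> emeasure \<mu> (half_cube m a s))"
  shows "emeasure \<nu> W \<le> emeasure \<mu> (W :: (nat \<Rightarrow> real) set)"
proof -
  \<comment> \<open>The list \<open>l\<close> holds the integer parts of the coordinates scaled by
    \<open>2 ^ k\<close>. Integer lists are countable, and each flat point lies in exactly one cube
    of length \<open>m\<close> per generation.\<close>
  define D where "D k l = half_cube m (\<lambda>i. if i < m then real_of_int (l ! i) / 2 ^ k else 0) (1 / 2 ^ k)" for k :: nat and l :: "int list"
  define L where "L k = {l. length l = m \<and> D k l \<subseteq> W \<and> emeasure \<nu> (D k l) \<le> emeasure \<mu> (D k l)}" for k
  define G where "G k = (\<Union>l\<in>L k. D k l)" for k
  have D_borel: "D k l \<in> sets borel" for k l unfolding D_def by (rule half_cube_borel)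
  have D_iff: "y \<in> D k l \<longleftrightarrow> flat m y \<and> (\<forall>i<m. \<lfloor>2 ^ k * y i\<rfloor> = l ! i)" for k l y
  proof -
    have "real_of_int z / 2 ^ k \<le> t \<and> t < real_of_int z / 2 ^ k + 1 / 2 ^ k \<longleftrightarrow> \<lfloor>2 ^ k * t\<rfloor> = z" for z t
      unfolding floor_eq_iff by (auto simp: field_simps)
    then show ?thesis unfolding D_def half_cube_def by auto
  qed
  have G_borel: "G k \<in> sets borel" for k unfolding G_def by (intro sets.countable_UN') (auto simp: D_borel)
  have "disjoint_family_on (D k) (L k)" for k
    unfolding disjoint_family_on_def
  proof (intro ballI impI)
    fix l l' assume l: "l \<in> L k" "l' \<in> L k" "l \<noteq> l'"
    show "D k l \<inter> D k l' = {}"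
    proof (rule ccontr)
      assume "D k l \<inter> D k l' \<noteq> {}"
      then obtain y where "y \<in> D k l" "y \<in> D k l'" by blast
      then have "\<forall>i<m. l ! i = l' ! i" unfolding D_iff by metis
      then have "l = l'" using l by (intro nth_equalityI) (auto simp: L_def)
      then show False using l by simp
    qed
  qed
  then have em: "emeasure M (G k) = (\<integral>\<^sup>+l. emeasure M (D k l) \<partial>count_space (L k))" if "sets M = sets borel" for M k
    unfolding G_def by (intro emeasure_UN_countable) (auto simp: that D_borel)
  have le: "emeasure \<nu> (G k) \<le> emeasure \<mu> (G k)" for k
    unfolding em[OF sets(1)] em[OF sets(2)] by (rule nn_integral_mono) (auto simp: L_def)
  have GW: "G k \<subseteq> W" for k by (auto simp: G_def L_def)
  define A where "A k = (\<Inter>l\<in>{k..}. G l)" for k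
  have A_borel: "A k \<in> sets borel" for k unfolding A_def by (intro sets.countable_INT'' G_borel) auto
  have AG: "A k \<subseteq> G k" for k by (auto simp: A_def)
  have "(\<Union>k. A k) = W"
  proof (intro equalityI subsetI)
    fix x assume x: "x \<in> W"
    then obtain r where r: "r > 0" "\<And>a s. 0 < s \<Longrightarrow> s < r \<Longrightarrow> flat m a \<Longrightarrow> x \<in> half_cube m a s \<Longrightarrow>
      half_cube m a s \<subseteq> W \<and> emeasure \<nu> (half_cube m a s) \<le> emeasure \<mu> (half_cube m a s)"
      using loc[OF x] by blast
    obtain k where k: "(1 / 2) ^ k < r" using real_arch_pow_inv[OF r(1), of "1 / 2"] by auto
    have "x \<in> G l" if l: "l \<ge> k" for l
    proof -
      have "(1 / 2 :: real) ^ l \<le> (1 / 2) ^ k" by (rule power_decreasing) (use l in auto)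
      then have s: "1 / 2 ^ l < r" using k by (simp add: power_one_over)
      define z where "z = map (\<lambda>i. \<lfloor>2 ^ l * x i\<rfloor>) [0..<m]"
      have xz: "x \<in> D l z" unfolding D_iff using loc[OF x] by (simp add: z_def)
      have "D l z \<subseteq> W \<and> emeasure \<nu> (D l z) \<le> emeasure \<mu> (D l z)"
        unfolding D_def by (rule r(2)) (use s xz in \<open>auto simp: D_def\<close>)
      then have "z \<in> L l" by (simp add: L_def z_def)
      then show ?thesis using xz by (auto simp: G_def)
    qed
    then show "x \<in> (\<Union>k. A k)" by (auto simp: A_def)
  qed (use AG GW in blast)
  moreover have "incseq A" unfolding incseq_def A_def by fastforce
  ultimately have "emeasure \<nu> W = (SUP k. emeasure \<nu> (A k))"
    using SUP_emeasure_incseq[of A \<nu>] A_borel sets by (auto simp: image_subset_iff)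
  also have "\<dots> \<le> emeasure \<mu> W"
  proof (rule SUP_least)
    fix k
    have "emeasure \<nu> (A k) \<le> emeasure \<nu> (G k)" by (rule emeasure_mono[OF AG]) (simp add: sets G_borel)
    also note le
    also have "emeasure \<mu> (G k) \<le> emeasure \<mu> W" by (rule emeasure_mono[OF GW]) (simp add: sets W)
    finally show "emeasure \<nu> (A k) \<le> emeasure \<mu> W" .
  qed
  finally show ?thesis .
qed

text \<open>The comparisons on cubes always lose a factor, but one arbitrarily close to 1. The
  infinite value of \<open>y\<close> is split off first, and finiteness of \<open>x\<close> then
  follows from the factor 2.\<close>

lemma ennreal_le_of_mult_gt_one:
  fixes x y :: ennreal
  assumes "\<And>c::real. c > 1 \<Longrightarrow> x \<le> ennreal c * y"
  shows "x \<le> y"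
proof (cases y)
  case (real y')
  have "x \<le> ennreal 2 * y" by (rule assms) simp
  also have "ennreal 2 * y = ennreal (2 * y')" using real by (subst ennreal_mult) auto
  finally have "x \<noteq> \<infinity>" by (auto simp: top_unique)
  then obtain x' where x': "x = ennreal x'" "x' \<ge> 0" by (cases x) auto
  have *: "x' \<le> c * y'" if "c > 1" for c
    using assms[OF that] that real x' by (simp add: ennreal_mult[symmetric])
  have "x' \<le> y'"
  proof (rule ccontr)
    assume "\<not> x' \<le> y'"
    then have xy: "x' > y'" by simp
    show False
    proof (cases "y' = 0")
      case True
      then show False using *[of 2] xy by simp
    next
      case False
      then have "y' > 0" using real by simp
      \<comment> \<open>The midpoint between 1 and \<open>x' / y'\<close>: larger than 1, yet too
        small for the assumed inequality.\<close>
      then show False using *[of "(x' / y' + 1) / 2"] xy by (simp add: field_simps)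
    qed
  qed
  then show ?thesis using real x' by (simp add: ennreal_leI)
qed simp

section \<open>Change of variables\<close>

text \<open>Both directions of the diffeomorphism are given as \<open>C1\<close> maps, so no inverse
  function theorem is called for. The symmetry in \<open>\<phi>\<close> and \<open>\<psi>\<close>
  lets every estimate for one map be reused for the other through
  \<open>inverse_change\<close>.\<close>

locale coordinate_change =
  fixes m :: nat and U U' :: "(nat \<Rightarrow> real) set" and \<phi> \<psi> :: "(nat \<Rightarrow> real) \<Rightarrow> (nat \<Rightarrow> real)"
  assumes U: "eucl_open m U" and U': "eucl_open m U'"
    and \<phi>U: "x \<in> U \<Longrightarrow> \<phi> x \<in> U'" and \<psi>U: "y \<in> U' \<Longrightarrow> \<psi> y \<in> U"
    and \<psi>\<phi>: "x \<in> U \<Longrightarrow> \<psi> (\<phi> x) = x" and \<phi>\<psi>: "y \<in> U' \<Longrightarrow> \<phi> (\<psi> y) = y"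
    and \<phi>C1: "k < m \<Longrightarrow> C1 m U (\<lambda>x. \<phi> x k)" and \<psi>C1: "k < m \<Longrightarrow> C1 m U' (\<lambda>x. \<psi> x k)"
begin

lemma inverse_change: "coordinate_change m U' U \<psi> \<phi>"
  by unfold_locales (fact U U' \<phi>U \<psi>U \<psi>\<phi> \<phi>\<psi> \<phi>C1 \<psi>C1)+

lemma jacobian_left_inverse:
  assumes x: "x \<in> U" and ij: "i < m" "j < m"
  shows "(\<Sum>k<m. jacobian \<psi> (\<phi> x) i k * jacobian \<phi> x k j) = (if i = j then 1 else 0)"
proof -
  have "partial j (\<lambda>x. \<psi> (\<phi> x) i) x = partial j (\<lambda>x. x i) x"
    by (rule partial_cong[OF U ij(2) x]) (simp add: \<psi>\<phi>)
  moreover have "partial j (\<lambda>x. \<psi> (\<phi> x) i) x = (\<Sum>k<m. partial k (\<lambda>y. \<psi> y i) (\<phi> x) * partial j (\<lambda>z. \<phi> z k) x)"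
    by (rule partial_compose[OF U U' \<psi>C1[OF ij(1)] \<phi>C1 \<phi>U x ij(2)])
  ultimately show ?thesis by (simp add: jacobian_def partial_coord)
qed

lemma jacobian_right_inverse:
  assumes x: "x \<in> U" and ij: "i < m" "j < m"
  shows "(\<Sum>k<m. jacobian \<phi> x i k * jacobian \<psi> (\<phi> x) k j) = (if i = j then 1 else 0)"
  using coordinate_change.jacobian_left_inverse[OF inverse_change \<phi>U[OF x] ij] by (simp add: \<psi>\<phi> x)

lemma determinant_jacobian:
  assumes "x \<in> U"
  shows "determinant m (jacobian \<psi> (\<phi> x)) * determinant m (jacobian \<phi> x) = 1"
proof -
  have "determinant m (\<lambda>i j. \<Sum>k<m. jacobian \<psi> (\<phi> x) i k * jacobian \<phi> x k j) = determinant m (\<lambda>i j. if i = j then 1 else 0)"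
    by (rule determinant_cong) (rule jacobian_left_inverse[OF assms])
  also have "\<dots> = 1" by (rule determinant_unit_lower) auto
  finally show ?thesis by (simp add: determinant_mult)
qed

lemma strict_vector:
  assumes x: "x \<in> U" and "e > 0"
  shows "\<exists>r>0. \<forall>k<m. \<forall>y z. flat m y \<longrightarrow> flat m z \<longrightarrow>
       close m r x y \<longrightarrow> close m r x z \<longrightarrow>
       y \<in> U \<and> \<bar>\<phi> z k - \<phi> y k - (\<Sum>i<m. jacobian \<phi> x k i * (z i - y i))\<bar> \<le> e * (\<Sum>i<m. \<bar>z i - y i\<bar>)"
proof (rule ex_common_radius)
  fix k assume "k < m"
  from C1_strict[OF U \<phi>C1[OF this] x \<open>e > 0\<close>]
  show "\<exists>r>0. \<forall>y z. flat m y \<longrightarrow> flat m z \<longrightarrow>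
       close m r x y \<longrightarrow> close m r x z \<longrightarrow>
       y \<in> U \<and> \<bar>\<phi> z k - \<phi> y k - (\<Sum>i<m. jacobian \<phi> x k i * (z i - y i))\<bar> \<le> e * (\<Sum>i<m. \<bar>z i - y i\<bar>)"
    unfolding jacobian_def .
next
  fix k and r s :: real assume *: "\<forall>y z. flat m y \<longrightarrow> flat m z \<longrightarrow>
       close m r x y \<longrightarrow> close m r x z \<longrightarrow>
       y \<in> U \<and> \<bar>\<phi> z k - \<phi> y k - (\<Sum>i<m. jacobian \<phi> x k i * (z i - y i))\<bar> \<le> e * (\<Sum>i<m. \<bar>z i - y i\<bar>)" and "s \<le> r"
  show "\<forall>y z. flat m y \<longrightarrow> flat m z \<longrightarrow>
       close m s x y \<longrightarrow> close m s x z \<longrightarrow>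
       y \<in> U \<and> \<bar>\<phi> z k - \<phi> y k - (\<Sum>i<m. jacobian \<phi> x k i * (z i - y i))\<bar> \<le> e * (\<Sum>i<m. \<bar>z i - y i\<bar>)"
  proof (intro allI impI)
    fix y z :: "nat \<Rightarrow> real" assume yz: "flat m y" "flat m z" "close m s x y" "close m s x z"
    have "close m r x y" "close m r x z" using yz(3,4) \<open>s \<le> r\<close> by force+
    with * yz show "y \<in> U \<and> \<bar>\<phi> z k - \<phi> y k - (\<Sum>i<m. jacobian \<phi> x k i * (z i - y i))\<bar> \<le> e * (\<Sum>i<m. \<bar>z i - y i\<bar>)"
      by blast
  qed
qed

abbreviation (input) "J x \<equiv> \<bar>determinant m (jacobian \<phi> x)\<bar>"

text \<open>It measures a set by the Lebesgue measure of its image under \<open>\<phi>\<close>. The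
  default value off \<open>U'\<close> only makes the map total; that region has been given no
  mass.\<close>

definition "pushed = distr (density (lebesgue_space m) (indicator U')) borel (\<lambda>y. if y \<in> U' then \<psi> y else (\<lambda>_. 0))"

definition "weighted = density (lebesgue_space m) (\<lambda>x. if x \<in> U then ennreal (J x) else 0)"

lemma U_borel: "U \<in> sets borel" and U'_borel: "U' \<in> sets borel"
  using openin_Euclidean_borel U U' by auto

lemma measurable_inverse: "(\<lambda>y. if y \<in> U' then \<psi> y else (\<lambda>_. 0)) \<in> borel_measurable borel"
  by (rule borel_measurable_continuous_on_if[OF U'_borel])
    (auto intro!: continuous_on_components[OF U C1_continuous[OF \<psi>C1] \<psi>U])

lemma continuous_on_jacobian: "continuous_on U (\<lambda>x. J x)"
proof -
  have "continuous_on U (\<lambda>x. jacobian \<phi> x k i)" if "k < m" "i < m" for k i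
    unfolding jacobian_def by (rule C1_continuous_partial[OF \<phi>C1[OF that(1)] that(2)])
  then have "continuous_on U (\<lambda>x. \<Sum>p | p permutes {0..<m}. signof p * (\<Prod>i = 0..<m. jacobian \<phi> x i (p i)))"
    by (intro continuous_intros) (auto simp: permutes_in_image[of _ "{0..<m}", simplified])
  moreover have "determinant m (jacobian \<phi> x) = (\<Sum>p | p permutes {0..<m}. signof p * (\<Prod>i = 0..<m. jacobian \<phi> x i (p i)))" for x
  proof -
    have "(\<Prod>i = 0..<m. mat m m (\<lambda>(i, j). jacobian \<phi> x i j) $$ (i, p i)) = (\<Prod>i = 0..<m. jacobian \<phi> x i (p i))"
      if "p permutes {0..<m}" for p
      by (rule prod.cong) (use permutes_in_image[OF that] in auto)
    then show ?thesis unfolding determinant_def det_def'[OF mat_carrier_fun] by simp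
  qed
  ultimately show ?thesis by (simp add: continuous_on_rabs)
qed

lemma measurable_jacobian:
  "(\<lambda>x. if x \<in> U then ennreal (J x) else 0) \<in> borel_measurable borel"
  by (rule borel_measurable_continuous_on_if[OF U_borel]) (auto intro!: continuous_on_ennreal continuous_on_jacobian)

lemma emeasure_pushed:
  assumes "S \<in> sets borel"
  shows "{y\<in>U'. \<psi> y \<in> S} \<in> sets borel"
    and "emeasure pushed S = emeasure (lebesgue_space m) {y\<in>U'. \<psi> y \<in> S}"
proof -
  let ?\<psi> = "\<lambda>y. if y \<in> U' then \<psi> y else (\<lambda>_. 0)"
  have eq: "{y\<in>U'. \<psi> y \<in> S} = ?\<psi> -` S \<inter> U'" by auto
  have m: "?\<psi> -` S \<in> sets borel" using measurable_sets[OF measurable_inverse assms] by simp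
  then show "{y\<in>U'. \<psi> y \<in> S} \<in> sets borel" unfolding eq using U'_borel by (rule sets.Int)
  have "emeasure pushed S = emeasure (density (lebesgue_space m) (indicator U')) (?\<psi> -` S)"
    unfolding pushed_def
    by (subst emeasure_distr) (use measurable_inverse assms in \<open>auto cong: measurable_cong_sets\<close>)
  also have "\<dots> = emeasure (lebesgue_space m) (U' \<inter> ?\<psi> -` S)"
    by (rule emeasure_restricted) (use U'_borel m in auto)
  finally show "emeasure pushed S = emeasure (lebesgue_space m) {y\<in>U'. \<psi> y \<in> S}" by (simp add: eq Int_commute)
qed

lemma emeasure_weighted:
  assumes "S \<in> sets borel"
  shows "emeasure weighted S =
    (\<integral>\<^sup>+x. (if x \<in> U then ennreal (J x) else 0) * indicator S x \<partial>lebesgue_space m)"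
  unfolding weighted_def by (rule emeasure_density) (use assms measurable_jacobian in auto)

text \<open>After normalization by the linear map \<open>B\<close>, the image of a small cube of
  side \<open>s\<close> lies between boxes of sides \<open>(1 - 2 * \<delta>) * s\<close> and
  \<open>(1 + 2 * \<delta>) * s\<close>. The outer box comes from strict differentiability of
  \<open>\<phi>\<close>, the inner one from that of \<open>\<psi>\<close>, so no topological
  covering argument is involved.\<close>

lemma image_cube:
  assumes x: "x \<in> U" and W: "eucl_open m W" "W \<subseteq> U" "x \<in> W" and \<delta>: "0 < \<delta>" "\<delta> < 1 / 4"
  defines "B \<equiv> jacobian \<psi> (\<phi> x)"
  shows "\<exists>r>0. \<forall>a s. 0 < s \<longrightarrow> s < r \<longrightarrow> flat m a \<longrightarrow> x \<in> half_cube m a s \<longrightarrow>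
     half_cube m a s \<subseteq> W \<and>
     ennreal \<bar>determinant m B\<bar> * emeasure pushed (half_cube m a s) \<le> ennreal (((1 + 2 * \<delta>) * s) ^ m) \<and>
     ennreal \<bar>determinant m B\<bar> * emeasure pushed (half_cube m a s) \<ge> ennreal (((1 - 2 * \<delta>) * s) ^ m)"
proof -
  define A where "A = jacobian \<phi> x"
  have BA: "(\<Sum>k<m. B i k * A k j) = (if i = j then 1 else 0)" if "i < m" "j < m" for i j
    unfolding A_def B_def by (rule jacobian_left_inverse[OF x that])
  have AB: "(\<Sum>k<m. A i k * B k j) = (if i = j then 1 else 0)" if "i < m" "j < m" for i j
    unfolding A_def B_def by (rule jacobian_right_inverse[OF x that])
  have detB: "determinant m B \<noteq> 0" using determinant_jacobian[OF x] by (auto simp: B_def)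
  \<comment> \<open>Crude operator norms of \<open>B\<close> and \<open>A\<close> for the maximum
    norm; the added 1 keeps them positive.\<close>
  define \<beta> where "\<beta> = (\<Sum>i<m. \<Sum>k<m. \<bar>B i k\<bar>) + 1"
  define \<alpha> where "\<alpha> = (\<Sum>i<m. \<Sum>k<m. \<bar>A i k\<bar>) + 1"
  have \<beta>1: "\<beta> > 0" and \<alpha>1: "\<alpha> > 0" unfolding \<beta>_def \<alpha>_def by (auto intro!: add_nonneg_pos sum_nonneg)
  have row: "(\<Sum>k<m. \<bar>M i k\<bar>) \<le> (\<Sum>i<m. \<Sum>k<m. \<bar>M i k\<bar>) + 1" if "i < m" for M :: "nat \<Rightarrow> nat \<Rightarrow> real" and i
  proof -
    have "(\<Sum>k<m. \<bar>M i k\<bar>) \<le> (\<Sum>i<m. \<Sum>k<m. \<bar>M i k\<bar>)"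
      by (rule member_le_sum) (use that in \<open>auto intro: sum_nonneg\<close>)
    then show ?thesis by simp
  qed
  have bound: "\<bar>apply_matrix m M v i\<bar> \<le> ((\<Sum>i<m. \<Sum>k<m. \<bar>M i k\<bar>) + 1) * b" if "i < m" "\<And>k. k < m \<Longrightarrow> \<bar>v k\<bar> \<le> b" "b \<ge> 0" for M v b i
  proof -
    have "\<bar>apply_matrix m M v i\<bar> \<le> (\<Sum>k<m. \<bar>M i k * v k\<bar>)" unfolding apply_matrix_def by (rule sum_abs)
    also have "\<dots> \<le> (\<Sum>k<m. \<bar>M i k\<bar> * b)" by (rule sum_mono) (auto simp: abs_mult intro!: mult_left_mono that)
    also have "\<dots> = (\<Sum>k<m. \<bar>M i k\<bar>) * b" by (simp add: sum_distrib_right)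
    also have "\<dots> \<le> ((\<Sum>i<m. \<Sum>k<m. \<bar>M i k\<bar>) + 1) * b" by (rule mult_right_mono[OF row[OF that(1)] that(3)])
    finally show ?thesis .
  qed
  \<comment> \<open>Chosen so that the linearization error of \<open>\<phi>\<close> over a cube of
    side \<open>s\<close>, after multiplication by \<open>B\<close>, is at most
    \<open>\<delta> * s\<close> in each coordinate.\<close>
  define e where "e = \<delta> / (\<beta> * (real m + 1))"
  have e: "e > 0" "\<beta> * (e * real m) \<le> \<delta>"
  proof -
    show "e > 0" unfolding e_def using \<beta>1 \<delta> by (intro divide_pos_pos mult_pos_pos) auto
    have "\<beta> * (e * real m) = \<delta> * (real m / (real m + 1))" using \<beta>1 by (simp add: e_def)
    also have "\<dots> \<le> \<delta>" using \<delta> by (intro mult_left_le) auto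
    finally show "\<beta> * (e * real m) \<le> \<delta>" .
  qed
  \<comment> \<open>The points of the inner box lie within \<open>\<alpha> * s\<close> of
    \<open>\<phi> a\<close>. The extra factor 2 makes the resulting error strictly smaller than
    \<open>\<delta> * s\<close>, as the half-open cube demands.\<close>
  define e' where "e' = \<delta> / (2 * \<alpha> * (real m + 1))"
  have e': "e' > 0" "e' * (real m * \<alpha>) < \<delta>"
  proof -
    show "e' > 0" unfolding e'_def using \<alpha>1 \<delta> by (intro divide_pos_pos mult_pos_pos) auto
    have "e' * (real m * \<alpha>) = \<delta> / 2 * (real m / (real m + 1))" using \<alpha>1 by (simp add: e'_def)
    also have "\<dots> \<le> \<delta> / 2" using \<delta> by (intro mult_left_le) auto
    finally show "e' * (real m * \<alpha>) < \<delta>" using \<delta> by simp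
  qed
  obtain r1 where r1: "r1 > 0" "\<And>k y z. k < m \<Longrightarrow> flat m y \<Longrightarrow> flat m z \<Longrightarrow>
       close m r1 x y \<Longrightarrow> close m r1 x z \<Longrightarrow>
       y \<in> U \<and> \<bar>\<phi> z k - \<phi> y k - apply_matrix m A (\<lambda>i. z i - y i) k\<bar> \<le> e * (\<Sum>i<m. \<bar>z i - y i\<bar>)"
    using strict_vector[OF x e(1)] unfolding A_def apply_matrix_def by blast
  obtain r2 where r2: "r2 > 0" "\<And>k y z. k < m \<Longrightarrow> flat m y \<Longrightarrow> flat m z \<Longrightarrow>
       (close m r2 (\<phi> x) y) \<Longrightarrow> (close m r2 (\<phi> x) z) \<Longrightarrow>
       y \<in> U' \<and> \<bar>\<psi> z k - \<psi> y k - apply_matrix m B (\<lambda>i. z i - y i) k\<bar> \<le> e' * (\<Sum>i<m. \<bar>z i - y i\<bar>)"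
    using coordinate_change.strict_vector[OF inverse_change \<phi>U[OF x] e'(1)] unfolding B_def apply_matrix_def by blast
  obtain r3 where r3: "r3 > 0" "\<And>y. flat m y \<Longrightarrow> close m r3 x y \<Longrightarrow> y \<in> W"
    using openin_Euclidean_cube[OF W(1,3)] by blast
  obtain r4 where r4: "r4 > 0" "\<And>y k. k < m \<Longrightarrow> flat m y \<Longrightarrow> close m r4 x y \<Longrightarrow> \<bar>\<phi> y k - \<phi> x k\<bar> < r2 / 2"
  proof -
    have "\<exists>r>0. \<forall>k<m. \<forall>y. flat m y \<longrightarrow> close m r x y \<longrightarrow> \<bar>\<phi> y k - \<phi> x k\<bar> < r2 / 2"
    proof (rule ex_common_radius)
      fix k assume "k < m"
      show "\<exists>r>0. \<forall>y. flat m y \<longrightarrow> close m r x y \<longrightarrow> \<bar>\<phi> y k - \<phi> x k\<bar> < r2 / 2"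
        using continuous_on_cube[OF U C1_continuous[OF \<phi>C1[OF \<open>k < m\<close>]] x, of "r2 / 2"] r2(1) by auto
    next
      fix k and r s :: real
      assume *: "\<forall>y. flat m y \<longrightarrow> close m r x y \<longrightarrow> \<bar>\<phi> y k - \<phi> x k\<bar> < r2 / 2" and "s \<le> r"
      show "\<forall>y. flat m y \<longrightarrow> close m s x y \<longrightarrow> \<bar>\<phi> y k - \<phi> x k\<bar> < r2 / 2"
      proof (intro allI impI)
        fix y :: "nat \<Rightarrow> real" assume y: "flat m y" "close m s x y"
        have "close m r x y" using y(2) \<open>s \<le> r\<close> by force
        then show "\<bar>\<phi> y k - \<phi> x k\<bar> < r2 / 2" using * y(1) by blast
      qed
    qed
    then show ?thesis using that by blast
  qed
  define r where "r = min (min r1 r3) (min r4 (r2 / (2 * \<alpha>)))"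
  have r: "r > 0" "r \<le> r1" "r \<le> r3" "r \<le> r4" "r \<le> r2 / (2 * \<alpha>)"
    using r1(1) r2(1) r3(1) r4(1) \<alpha>1 by (auto simp: r_def)
  show ?thesis
  proof (rule exI[of _ r], rule conjI[OF r(1)], intro allI impI conjI)
    fix a and s :: real assume s: "0 < s" "s < r" and a0: "\<forall>i\<ge>m. a i = (0 :: real)" and xQ: "x \<in> half_cube m a s"
    define Q where "Q = half_cube m a s"
    have aQ: "a \<in> Q" using s a0 by (simp add: Q_def half_cube_def)
    have Q0: "flat m z" and Qx: "i < m \<Longrightarrow> \<bar>z i - x i\<bar> < r" and Qa: "i < m \<Longrightarrow> 0 \<le> z i - a i \<and> z i - a i < s" if "z \<in> Q" for z i
      using that xQ s by (auto simp: Q_def half_cube_def abs_if) (smt (verit))+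
    have Qx': "\<forall>i<m. \<bar>z i - x i\<bar> < \<rho>" if "z \<in> Q" "r \<le> \<rho>" for z \<rho>
      using Qx[OF that(1)] that(2) by (auto intro: less_le_trans)
    have QW: "Q \<subseteq> W"
      by (intro subsetI r3(2)) (use Q0 Qx r in fastforce)+
    have detB': "\<bar>determinant m B\<bar> > 0" using detB by simp
    \<comment> \<open>The affine normalization is centred at the corner \<open>a\<close> of the
      cube, while the derivative stays frozen at \<open>x\<close>; strict differentiability permits
      this mismatch.\<close>
    define T where "T w = (linear_map m B (\<lambda>i. w i - \<phi> a i))" for w
    have aU: "a \<in> U" using aQ QW W by blast
    have \<phi>a0: "\<phi> a i = 0" if "i \<ge> m" for i using openin_Euclidean_space_subset[OF U' \<phi>U[OF aU] that] .
    have box: "emeasure (lebesgue_space m) {z. flat m z \<and> (\<forall>i<m. z i \<in> {lo..hi})} = ennreal ((hi - lo) ^ m)"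
      if "lo \<le> hi" for lo hi
      using emeasure_lebesgue_space_box[of m "\<lambda>_. lo" "\<lambda>_. hi" "\<lambda>_. {lo..hi}"] that by simp
    have box_borel: "{z :: nat \<Rightarrow> real. flat m z \<and> (\<forall>i<m. z i \<in> {lo..hi})} \<in> sets borel" for lo hi
    proof -
      have "{z :: nat \<Rightarrow> real. flat m z \<and> (\<forall>i<m. z i \<in> {lo..hi})} = (\<Inter>i. {y. y i \<in> (if i < m then {lo..hi} else {0})})"
        by (auto split: if_splits)
      moreover have "{x. x i \<in> A} \<in> sets borel" if "A \<in> sets borel" for i :: nat and A :: "real set"
        using measurable_sets[OF measurable_product_coordinates that, of i] by (simp add: vimage_def)
      ultimately show ?thesis by (auto intro!: sets.countable_INT)
    qed
    have par: "{w. T w \<in> S} \<in> sets borel" "ennreal \<bar>determinant m B\<bar> * emeasure (lebesgue_space m) {w. T w \<in> S} = emeasure (lebesgue_space m) S"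
      if "S \<in> sets borel" for S
      unfolding T_def using emeasure_lebesgue_space_parallelepiped[OF detB that \<phi>a0] by auto
    have nu: "emeasure pushed Q = emeasure (lebesgue_space m) {y\<in>U'. \<psi> y \<in> Q}" "{y\<in>U'. \<psi> y \<in> Q} \<in> sets borel"
      using emeasure_pushed half_cube_borel by (auto simp: Q_def)
    have "ennreal \<bar>determinant m B\<bar> * emeasure pushed Q \<le> ennreal (((1 + 2 * \<delta>) * s) ^ m)"
    proof -
      define S where "S = {z :: nat \<Rightarrow> real. flat m z \<and> (\<forall>i<m. z i \<in> {- \<delta> * s..(1 + \<delta>) * s})}"
      have S_borel: "S \<in> sets borel" unfolding S_def by (rule box_borel)
      have "{y\<in>U'. \<psi> y \<in> Q} \<subseteq> {w. T w \<in> S}"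
      proof safe
        fix w assume w: "w \<in> U'" "\<psi> w \<in> Q"
        define z where "z = \<psi> w"
        have zQ: "z \<in> Q" and wz: "w = \<phi> z" using w by (auto simp: z_def \<phi>\<psi>)
        define er where "er k = \<phi> z k - \<phi> a k - apply_matrix m A (\<lambda>i. z i - a i) k" for k
        have "(\<Sum>i<m. \<bar>z i - a i\<bar>) \<le> (\<Sum>i<m. s)" by (rule sum_mono) (use Qa[OF zQ] in fastforce)
        then have sums: "e * (\<Sum>i<m. \<bar>z i - a i\<bar>) \<le> e * real m * s" using e(1) by simp
        have er: "\<bar>er k\<bar> \<le> e * real m * s" if "k < m" for k
        proof -
          have "\<bar>er k\<bar> \<le> e * (\<Sum>i<m. \<bar>z i - a i\<bar>)"
            unfolding er_def
            by (rule r1(2)[THEN conjunct2, OF that]) (use Q0[OF zQ] a0 Qx'[OF zQ r(2)] Qx'[OF aQ r(2)] in auto)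
          then show ?thesis using sums by simp
        qed
        have in_box: "T w i \<in> {- \<delta> * s..(1 + \<delta>) * s}" if "i < m" for i
        proof -
          have "apply_matrix m B (\<lambda>i. w i - \<phi> a i) i = apply_matrix m B er i + apply_matrix m B (apply_matrix m A (\<lambda>i. z i - a i)) i"
            unfolding er_def wz by (simp add: apply_matrix_def[of m B] right_diff_distrib sum_subtractf)
          also have "apply_matrix m B (apply_matrix m A (\<lambda>i. z i - a i)) i = z i - a i"
            by (rule apply_matrix_cancel[where P = B and Q = A, OF that BA[OF that]])
          finally have T: "T w i = apply_matrix m B er i + (z i - a i)" using that by (simp add: T_def)
          have "\<bar>apply_matrix m B er i\<bar> \<le> \<beta> * (e * real m * s)"
            unfolding \<beta>_def by (rule bound[OF that er]) (use e(1) s in auto)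
          also have "\<dots> = (\<beta> * (e * real m)) * s" by simp
          also have "\<dots> \<le> \<delta> * s" using e(2) s by (intro mult_right_mono) auto
          finally show ?thesis using Qa[OF zQ that] unfolding T by (auto simp: algebra_simps abs_le_iff)
        qed
        have "T w i = 0" if "i \<ge> m" for i using that by (simp add: T_def)
        then show "T w \<in> S" unfolding S_def using in_box by blast
      qed
      then have "emeasure pushed Q \<le> emeasure (lebesgue_space m) {w. T w \<in> S}"
        unfolding nu(1) by (rule emeasure_mono) (simp add: par(1)[OF S_borel])
      then have "ennreal \<bar>determinant m B\<bar> * emeasure pushed Q \<le>
          ennreal \<bar>determinant m B\<bar> * emeasure (lebesgue_space m) {w. T w \<in> S}"
        by (rule mult_left_mono) simp
      also have "\<dots> = emeasure (lebesgue_space m) S" by (rule par(2)[OF S_borel])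
      also have "\<dots> = ennreal (((1 + \<delta>) * s - - \<delta> * s) ^ m)"
        unfolding S_def by (rule box) (use \<delta> s in \<open>auto simp: algebra_simps intro: order_trans[of _ 0]\<close>)
      finally show ?thesis by (simp add: algebra_simps)
    qed
    moreover have "ennreal (((1 - 2 * \<delta>) * s) ^ m) \<le> ennreal \<bar>determinant m B\<bar> * emeasure pushed Q"
    proof -
      define S where "S = {z :: nat \<Rightarrow> real. flat m z \<and> (\<forall>i<m. z i \<in> {\<delta> * s..(1 - \<delta>) * s})}"
      have S_borel: "S \<in> sets borel" unfolding S_def by (rule box_borel)
      \<comment> \<open>\<open>T\<close> ignores the coordinates from \<open>m\<close> on, so the
        preimage of \<open>S\<close> contains points outside the subspace. Cutting down to
        \<open>P\<close> costs no measure.\<close>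
      define P where "P = {w. \<forall>i\<ge>m. w i = (0 :: real)}"
      have P_borel: "P \<in> sets borel" unfolding P_def
        by (rule openin_Euclidean_borel[of m]) (use openin_topspace[of "Euclidean_space m"] in \<open>simp add: topspace_Euclidean_space\<close>)
      have "{w. T w \<in> S} \<inter> P \<subseteq> {y\<in>U'. \<psi> y \<in> Q}"
      proof (intro subsetI)
        fix w assume "w \<in> {w. T w \<in> S} \<inter> P"
        then have w: "T w \<in> S" "flat m w" by (auto simp: P_def)
        have Tw: "\<delta> * s \<le> T w i \<and> T w i \<le> (1 - \<delta>) * s" if "i < m" for i using w(1) that by (simp add: S_def)
        have wA: "w k - \<phi> a k = apply_matrix m A (T w) k" if "k < m" for k
        proof -
          have "apply_matrix m A (T w) k = apply_matrix m A (apply_matrix m B (\<lambda>i. w i - \<phi> a i)) k"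
            unfolding apply_matrix_def[of m A] T_def by (rule sum.cong) auto
          also have "\<dots> = w k - \<phi> a k" by (rule apply_matrix_cancel[where P = A and Q = B, OF that AB[OF that]])
          finally show ?thesis by simp
        qed
        have wb: "\<bar>w k - \<phi> a k\<bar> \<le> \<alpha> * s" if "k < m" for k
          unfolding wA[OF that] \<alpha>_def
        proof (rule bound[OF that])
          fix k assume "k < m"
          have "(1 - \<delta>) * s \<le> 1 * s" "0 \<le> \<delta> * s" using \<delta> s by (auto intro: mult_right_mono)
          then show "\<bar>T w k\<bar> \<le> s" using Tw[OF \<open>k < m\<close>] by auto
        qed (use s in simp)
        have "\<alpha> * s < \<alpha> * r" "\<alpha> * r \<le> r2 / 2" using s r(5) \<alpha>1 by (auto simp: field_simps)
        then have "\<alpha> * s < r2 / 2" by simp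
        moreover have pa: "\<bar>\<phi> a k - \<phi> x k\<bar> < r2 / 2" if "k < m" for k
          by (rule r4(2)[OF that a0]) (use Qx'[OF aQ r(4)] in auto)
        ultimately have near: "\<bar>w k - \<phi> x k\<bar> < r2" "\<bar>\<phi> a k - \<phi> x k\<bar> < r2" if "k < m" for k
          using wb[OF that] pa[OF that] that r2(1) by (smt (verit) field_sum_of_halves)+
        have sums: "(\<Sum>i<m. \<bar>w i - \<phi> a i\<bar>) \<le> real m * (\<alpha> * s)"
          using sum_bounded_above[of "{..<m}" "\<lambda>i. \<bar>w i - \<phi> a i\<bar>" "\<alpha> * s"] wb by simp
        have est: "\<bar>\<psi> w k - a k - T w k\<bar> < \<delta> * s" if k: "k < m" for k
        proof -
          have "\<bar>\<psi> w k - \<psi> (\<phi> a) k - apply_matrix m B (\<lambda>i. w i - \<phi> a i) k\<bar> \<le> e' * (\<Sum>i<m. \<bar>w i - \<phi> a i\<bar>)"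
            by (rule r2(2)[THEN conjunct2, OF k]) (use w(2) \<phi>a0 near in auto)
          also have "\<dots> \<le> e' * (real m * (\<alpha> * s))" using sums e'(1) by simp
          also have "\<dots> = e' * (real m * \<alpha>) * s" by simp
          also have "\<dots> < \<delta> * s" using e'(2) s by simp
          finally show ?thesis using k by (simp add: T_def \<psi>\<phi>[OF aU])
        qed
        \<comment> \<open>Without coordinates the bounds in \<open>r2\<close> say nothing; then the
          space is a single point and \<open>w\<close> is \<open>\<phi> a\<close>.\<close>
        have wU: "w \<in> U'"
        proof (cases "m = 0")
          case True
          then have "w = \<phi> a" using w(2) \<phi>a0 by auto
          then show ?thesis using \<phi>U[OF aU] by simp
        next
          case False
          then show ?thesis using r2(2)[THEN conjunct1, of 0 w w] w(2) near by auto
        qed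
        have "\<psi> w \<in> Q"
          unfolding Q_def half_cube_def
        proof (intro CollectI conjI allI impI)
          show "\<psi> w i = 0" if "i \<ge> m" for i by (rule openin_Euclidean_space_subset[OF U \<psi>U[OF wU] that])
          show "\<psi> w i \<in> {a i..<a i + s}" if "i < m" for i
            using est[OF that] Tw[OF that] by (auto simp: algebra_simps abs_less_iff)
        qed
        then show "w \<in> {y\<in>U'. \<psi> y \<in> Q}" using wU by simp
      qed
      then have "emeasure (lebesgue_space m) ({w. T w \<in> S} \<inter> P) \<le> emeasure pushed Q"
        unfolding nu(1) using nu(2) by (intro emeasure_mono) auto
      moreover have "emeasure (lebesgue_space m) ({w. T w \<in> S} \<inter> P) = emeasure (lebesgue_space m) {w. T w \<in> S}"
      proof (rule emeasure_eq_AE)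
        show "AE w in lebesgue_space m. (w \<in> {w. T w \<in> S} \<inter> P) = (w \<in> {w. T w \<in> S})"
          using AE_lebesgue_space[of m] by eventually_elim (simp add: P_def)
      qed (use par(1)[OF S_borel] P_borel in auto)
      ultimately have "emeasure (lebesgue_space m) {w. T w \<in> S} \<le> emeasure pushed Q" by simp
      then have "ennreal \<bar>determinant m B\<bar> * emeasure (lebesgue_space m) {w. T w \<in> S} \<le>
          ennreal \<bar>determinant m B\<bar> * emeasure pushed Q"
        by (rule mult_left_mono) simp
      then have "ennreal \<bar>determinant m B\<bar> * emeasure pushed Q \<ge> emeasure (lebesgue_space m) S"
        by (simp only: par(2)[OF S_borel])
      moreover have "emeasure (lebesgue_space m) S = ennreal (((1 - \<delta>) * s - \<delta> * s) ^ m)"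
        unfolding S_def by (rule box) (use \<delta> s in \<open>auto intro!: mult_right_mono\<close>)
      ultimately show ?thesis by (simp add: algebra_simps)
    qed
    ultimately show "half_cube m a s \<subseteq> W"
      "ennreal \<bar>determinant m B\<bar> * emeasure pushed (half_cube m a s) \<le> ennreal (((1 + 2 * \<delta>) * s) ^ m)"
      "ennreal \<bar>determinant m B\<bar> * emeasure pushed (half_cube m a s) \<ge> ennreal (((1 - 2 * \<delta>) * s) ^ m)"
      using QW by (simp_all add: Q_def)
  qed
qed

lemma jacobian_cube:
  assumes x: "x \<in> U" and \<delta>: "0 < \<delta>"
  defines "D \<equiv> J x"
  shows "\<exists>r>0. \<forall>a s. 0 < s \<longrightarrow> s < r \<longrightarrow> x \<in> half_cube m a s \<longrightarrow>
     emeasure weighted (half_cube m a s) \<le> ennreal ((1 + \<delta>) * D * s ^ m) \<and>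
     emeasure weighted (half_cube m a s) \<ge> ennreal ((1 - \<delta>) * D * s ^ m)"
proof -
  have D: "D > 0" using determinant_jacobian[OF x] by (auto simp: D_def)
  then have "\<delta> * D > 0" using \<delta> by simp
  from continuous_on_cube[OF U continuous_on_jacobian x this]
  obtain r where r: "r > 0" "\<And>y. flat m y \<Longrightarrow> close m r x y \<Longrightarrow>
      y \<in> U \<and> \<bar>J y - D\<bar> < \<delta> * D"
    unfolding D_def by blast
  show ?thesis
  proof (rule exI[of _ r], rule conjI[OF r(1)], intro allI impI conjI)
    fix a and s :: real assume s: "0 < s" "s < r" and xQ: "x \<in> half_cube m a s"
    define Q where "Q = half_cube m a s"
    let ?J = "\<lambda>y. if y \<in> U then ennreal (J y) else 0"
    have near: "y \<in> U \<and> \<bar>J y - D\<bar> < \<delta> * D" if "y \<in> Q" for y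
      by (rule r(2)) (use that xQ s in \<open>auto simp: Q_def half_cube_def abs_less_iff\<close>, (smt (verit))+)
    have vol: "(\<integral>\<^sup>+y. ennreal c * indicator Q y \<partial>lebesgue_space m) = ennreal (c * s ^ m)" if "c \<ge> 0" for c
      using emeasure_half_cube[of s m a] s half_cube_borel that
      by (simp add: nn_integral_cmult_indicator Q_def ennreal_mult)
    have "emeasure weighted Q = (\<integral>\<^sup>+y. ?J y * indicator Q y \<partial>lebesgue_space m)"
      unfolding Q_def by (rule emeasure_weighted[OF half_cube_borel])
    moreover have "\<dots> \<le> (\<integral>\<^sup>+y. ennreal ((1 + \<delta>) * D) * indicator Q y \<partial>lebesgue_space m)"
      by (rule nn_integral_mono) (use near in \<open>force simp: indicator_def algebra_simps intro!: ennreal_leI\<close>)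
    moreover have "\<dots> = ennreal ((1 + \<delta>) * D * s ^ m)" by (rule vol) (use D \<delta> in simp)
    ultimately show "emeasure weighted (half_cube m a s) \<le> ennreal ((1 + \<delta>) * D * s ^ m)" by (simp add: Q_def)
    show "emeasure weighted (half_cube m a s) \<ge> ennreal ((1 - \<delta>) * D * s ^ m)"
    proof (cases "\<delta> \<le> 1")
      case True
      have "emeasure weighted Q = (\<integral>\<^sup>+y. ?J y * indicator Q y \<partial>lebesgue_space m)"
        unfolding Q_def by (rule emeasure_weighted[OF half_cube_borel])
      moreover have "(\<integral>\<^sup>+y. ennreal ((1 - \<delta>) * D) * indicator Q y \<partial>lebesgue_space m) \<le> (\<integral>\<^sup>+y. ?J y * indicator Q y \<partial>lebesgue_space m)"
        by (rule nn_integral_mono) (use near in \<open>force simp: indicator_def algebra_simps intro!: ennreal_leI\<close>)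
      moreover have "(\<integral>\<^sup>+y. ennreal ((1 - \<delta>) * D) * indicator Q y \<partial>lebesgue_space m) = ennreal ((1 - \<delta>) * D * s ^ m)"
        by (rule vol) (use D True in simp)
      ultimately show ?thesis by (simp add: Q_def)
    next
      case False
      then have "(1 - \<delta>) * D * s ^ m \<le> 0" using D s by (simp add: mult_nonpos_nonneg)
      then show ?thesis by (simp add: ennreal_neg)
    qed
  qed
qed

text \<open>Both inequalities are strict at \<open>\<delta> = 0\<close> since \<open>c > 1\<close>,
  hence persist for small positive \<open>\<delta>\<close>. They combine the errors of
  \<open>image_cube\<close> and \<open>jacobian_cube\<close> into the one factor
  \<open>c\<close>.\<close>

lemma exists_delta:
  assumes "c > (1 :: real)"
  shows "\<exists>\<delta>. 0 < \<delta> \<and> \<delta> < 1 / 4 \<and> (1 + 2 * \<delta>) ^ m \<le> c * (1 - \<delta>) \<and> 1 + \<delta> \<le> c * (1 - 2 * \<delta>) ^ m"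
proof -
  have "((\<lambda>\<delta>. c * (1 - \<delta>) - (1 + 2 * \<delta>) ^ m) \<longlongrightarrow> c * (1 - 0) - (1 + 2 * 0) ^ m) (at_right 0)"
    by (intro tendsto_intros)
  then have 1: "\<forall>\<^sub>F \<delta> in at_right 0. 0 < c * (1 - \<delta>) - (1 + 2 * \<delta>) ^ m"
    by (rule order_tendstoD) (use assms in simp)
  have "((\<lambda>\<delta>. c * (1 - 2 * \<delta>) ^ m - (1 + \<delta>)) \<longlongrightarrow> c * (1 - 2 * 0) ^ m - (1 + 0)) (at_right 0)"
    by (intro tendsto_intros)
  then have 2: "\<forall>\<^sub>F \<delta> in at_right 0. 0 < c * (1 - 2 * \<delta>) ^ m - (1 + \<delta>)"
    by (rule order_tendstoD) (use assms in simp)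
  have "\<forall>\<^sub>F \<delta> in at_right 0. \<delta> \<in> {0<..<1 / 4 :: real}" by (rule eventually_at_right_real) simp
  with 1 2 have "\<forall>\<^sub>F \<delta> in at_right 0. 0 < \<delta> \<and> \<delta> < 1 / 4 \<and> (1 + 2 * \<delta>) ^ m \<le> c * (1 - \<delta>) \<and> 1 + \<delta> \<le> c * (1 - 2 * \<delta>) ^ m"
    by eventually_elim auto
  then show ?thesis by (rule eventually_happens'[rotated]) simp
qed

text \<open>On small cubes the two measures agree up to a factor \<open>c > 1\<close>. The passage
  from cubes to open sets is made with the scaled measures, once in each direction, and then
  \<open>c\<close> tends to 1.\<close>

lemma measures_eq_open:
  assumes W: "eucl_open m W" "W \<subseteq> U"
  shows "emeasure pushed W = emeasure weighted W"
proof -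
  have sets: "sets pushed = sets borel" "sets weighted = sets borel"
    by (simp_all add: pushed_def weighted_def)
  have W0: "flat m x" if "x \<in> W" for x using openin_Euclidean_space_subset[OF W(1) that] by blast
  have both: "emeasure pushed W \<le> ennreal c * emeasure weighted W \<and>
      emeasure weighted W \<le> ennreal c * emeasure pushed W" if "c > 1" for c
  proof -
    obtain \<delta> where \<delta>: "0 < \<delta>" "\<delta> < 1 / 4" "(1 + 2 * \<delta>) ^ m \<le> c * (1 - \<delta>)" "1 + \<delta> \<le> c * (1 - 2 * \<delta>) ^ m"
      using exists_delta[OF \<open>c > 1\<close>] by blast
    have loc: "\<exists>r>0. \<forall>a s. 0 < s \<longrightarrow> s < r \<longrightarrow> flat m a \<longrightarrow> x \<in> half_cube m a s \<longrightarrow>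
      half_cube m a s \<subseteq> W \<and>
      emeasure pushed (half_cube m a s) \<le> ennreal c * emeasure weighted (half_cube m a s) \<and>
      emeasure weighted (half_cube m a s) \<le> ennreal c * emeasure pushed (half_cube m a s)" if x: "x \<in> W" for x
    proof -
      have xU: "x \<in> U" using x W by blast
      define D where "D = J x"
      define d where "d = \<bar>determinant m (jacobian \<psi> (\<phi> x))\<bar>"
      have dD: "D * d = 1" "D > 0" using determinant_jacobian[OF xU] by (auto simp: D_def d_def mult.commute simp flip: abs_mult)
      obtain r1 where r1: "r1 > 0" "\<And>a s. 0 < s \<Longrightarrow> s < r1 \<Longrightarrow> flat m a \<Longrightarrow> x \<in> half_cube m a s \<Longrightarrow>
         half_cube m a s \<subseteq> W \<and>
         ennreal d * emeasure pushed (half_cube m a s) \<le> ennreal (((1 + 2 * \<delta>) * s) ^ m) \<and>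
         ennreal d * emeasure pushed (half_cube m a s) \<ge> ennreal (((1 - 2 * \<delta>) * s) ^ m)"
        using image_cube[OF xU W x \<delta>(1,2)] unfolding d_def by blast
      obtain r2 where r2: "r2 > 0" "\<And>a s. 0 < s \<Longrightarrow> s < r2 \<Longrightarrow> x \<in> half_cube m a s \<Longrightarrow>
         emeasure weighted (half_cube m a s) \<le> ennreal ((1 + \<delta>) * D * s ^ m) \<and>
         emeasure weighted (half_cube m a s) \<ge> ennreal ((1 - \<delta>) * D * s ^ m)"
        using jacobian_cube[OF xU \<delta>(1)] unfolding D_def by blast
      show ?thesis
      proof (rule exI[of _ "min r1 r2"], rule conjI, use r1(1) r2(1) in simp, intro allI impI)
        fix a and s :: real
        assume s: "0 < s" "s < min r1 r2" and a: "\<forall>i\<ge>m. a i = (0 :: real)" "x \<in> half_cube m a s"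
        let ?Q = "half_cube m a s"
        have 1: "?Q \<subseteq> W" "ennreal d * emeasure pushed ?Q \<le> ennreal (((1 + 2 * \<delta>) * s) ^ m)"
          "ennreal (((1 - 2 * \<delta>) * s) ^ m) \<le> ennreal d * emeasure pushed ?Q"
          using r1(2)[of s a] s a by auto
        have 2: "emeasure weighted ?Q \<le> ennreal ((1 + \<delta>) * D * s ^ m)"
          "ennreal ((1 - \<delta>) * D * s ^ m) \<le> emeasure weighted ?Q"
          using r2(2)[of s a] s a by auto
        \<comment> \<open>The Jacobians of inverse maps are reciprocal, so multiplying by
          \<open>D\<close> removes the factor \<open>d\<close> of the cube estimate.\<close>
        have nu: "emeasure pushed ?Q = ennreal D * (ennreal d * emeasure pushed ?Q)"
          using dD by (simp add: d_def flip: mult.assoc ennreal_mult)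
        have "emeasure pushed ?Q \<le> ennreal D * ennreal (((1 + 2 * \<delta>) * s) ^ m)"
          by (subst nu) (rule mult_left_mono[OF 1(2)], simp)
        also have "\<dots> = ennreal ((1 + 2 * \<delta>) ^ m * (D * s ^ m))"
          using dD s \<delta> by (simp add: ennreal_mult power_mult_distrib mult_ac)
        also have "\<dots> \<le> ennreal (c * (1 - \<delta>) * (D * s ^ m))"
          using \<delta>(3) dD s by (intro ennreal_leI mult_right_mono) auto
        also have "\<dots> = ennreal c * ennreal ((1 - \<delta>) * D * s ^ m)"
          using \<delta> dD s \<open>c > 1\<close> by (subst ennreal_mult[symmetric]) (auto simp: mult_ac)
        also have "\<dots> \<le> ennreal c * emeasure weighted ?Q" by (rule mult_left_mono[OF 2(2)]) simp
        finally have A: "emeasure pushed ?Q \<le> ennreal c * emeasure weighted ?Q" .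
        have "emeasure weighted ?Q \<le> ennreal ((1 + \<delta>) * (D * s ^ m))" using 2(1) by (simp add: mult.assoc)
        also have "\<dots> \<le> ennreal (c * (1 - 2 * \<delta>) ^ m * (D * s ^ m))"
          using \<delta>(4) dD s by (intro ennreal_leI mult_right_mono) auto
        also have "\<dots> = ennreal c * (ennreal D * ennreal (((1 - 2 * \<delta>) * s) ^ m))"
          using \<delta> dD s \<open>c > 1\<close> by (simp add: ennreal_mult[symmetric] power_mult_distrib mult_ac)
        also have "\<dots> \<le> ennreal c * (ennreal D * (ennreal d * emeasure pushed ?Q))"
          by (intro mult_left_mono 1(3)) auto
        also have "\<dots> = ennreal c * emeasure pushed ?Q" by (simp only: nu[symmetric])
        finally show "?Q \<subseteq> W \<and> emeasure pushed ?Q \<le> ennreal c * emeasure weighted ?Q \<and>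
            emeasure weighted ?Q \<le> ennreal c * emeasure pushed ?Q"
          using 1(1) A by blast
      qed
    qed
    have "emeasure pushed W \<le> emeasure (scale_measure (ennreal c) weighted) W"
    proof (rule emeasure_le_of_cubes[where m = m])
      fix x assume x: "x \<in> W"
      from loc[OF x] show "flat m x \<and> (\<exists>r>0. \<forall>a s. 0 < s \<longrightarrow> s < r \<longrightarrow> flat m a \<longrightarrow> x \<in> half_cube m a s \<longrightarrow>
        half_cube m a s \<subseteq> W \<and> emeasure pushed (half_cube m a s) \<le> emeasure (scale_measure (ennreal c) weighted) (half_cube m a s))"
        unfolding emeasure_scale_measure using W0[OF x] by blast
    qed (use sets openin_Euclidean_borel[OF W(1)] in simp_all)
    moreover have "emeasure weighted W \<le> emeasure (scale_measure (ennreal c) pushed) W"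
    proof (rule emeasure_le_of_cubes[where m = m])
      fix x assume x: "x \<in> W"
      from loc[OF x] show "flat m x \<and> (\<exists>r>0. \<forall>a s. 0 < s \<longrightarrow> s < r \<longrightarrow> flat m a \<longrightarrow> x \<in> half_cube m a s \<longrightarrow>
        half_cube m a s \<subseteq> W \<and> emeasure weighted (half_cube m a s) \<le> emeasure (scale_measure (ennreal c) pushed) (half_cube m a s))"
        unfolding emeasure_scale_measure using W0[OF x] by blast
    qed (use sets openin_Euclidean_borel[OF W(1)] in simp_all)
    ultimately show ?thesis by (simp add: emeasure_scale_measure)
  qed
  show ?thesis
    by (rule antisym; rule ennreal_le_of_mult_gt_one) (simp_all add: both)
qed

text \<open>Uniqueness from a generator of the Borel sets needs finite measures, but
  \<open>weighted\<close> may be infinite. Both measures are therefore cut down to the open sets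
  \<open>V j\<close>, where the Jacobian and all coordinates are below \<open>j\<close>; these
  exhaust \<open>U\<close>.\<close>

lemma measures_eq: "pushed = weighted"
proof (rule measure_eqI)
  have sets: "sets pushed = sets borel" "sets weighted = sets borel"
    by (simp_all add: pushed_def weighted_def)
  then show "sets pushed = sets weighted" by simp
  define V where "V j = {x\<in>U. J x \<in> {..<real j}} \<inter>
      {y. flat m y \<and> (\<forall>i\<in>{..<m}. \<bar>y i - 0\<bar> < real j)}" for j
  have V: "eucl_open m (V j)" "V j \<subseteq> U" for j
    unfolding V_def by (intro openin_Int openin_Euclidean_vimage[OF U continuous_on_jacobian] openin_Euclidean_cubeI) auto
  have fin: "emeasure weighted (V j) \<noteq> \<infinity>" for j
  proof -
    define B where "B = {y :: nat \<Rightarrow> real. flat m y \<and> (\<forall>i<m. y i \<in> {- real j<..<real j})}"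
    have "\<bar>t - 0\<bar> < real j \<longleftrightarrow> t \<in> {- real j<..<real j}" for t by (auto simp: abs_less_iff)
    then have B_eq: "B = {y. flat m y \<and> (\<forall>i\<in>{..<m}. \<bar>y i - 0\<bar> < real j)}" unfolding B_def by (simp add: Ball_def)
    have VB: "V j \<subseteq> B" unfolding B_eq V_def by blast
    have B: "B \<in> sets borel" unfolding B_eq using openin_Euclidean_borel[OF openin_Euclidean_cubeI[of "{..<m}" m "\<lambda>_. 0" "real j"]] by simp
    have "emeasure weighted (V j) \<le> (\<integral>\<^sup>+x. ennreal (real j) * indicator B x \<partial>lebesgue_space m)"
      unfolding emeasure_weighted[OF openin_Euclidean_borel[OF V(1)]]
      by (rule nn_integral_mono) (use VB in \<open>auto simp: indicator_def V_def intro!: ennreal_leI\<close>)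
    also have "\<dots> = ennreal (real j) * emeasure (lebesgue_space m) B"
      using B by (simp add: nn_integral_cmult_indicator)
    also have "emeasure (lebesgue_space m) B = ennreal (\<Prod>i<m. real j - - real j)"
      unfolding B_def by (rule emeasure_lebesgue_space_box) auto
    finally show ?thesis by (auto simp: ennreal_mult[symmetric] top_unique)
  qed
  fix S assume "S \<in> sets pushed"
  then have S: "S \<in> sets borel" by (simp add: sets)
  have Veq: "emeasure pushed (S \<inter> V j) = emeasure weighted (S \<inter> V j)" for j
  proof -
    have Vb: "V j \<in> sets borel" by (rule openin_Euclidean_borel[OF V(1)])
    have r: "emeasure (density M (indicator (V j))) X = emeasure M (V j \<inter> X)" if "sets M = sets borel" "X \<in> sets borel" for M X
      by (rule emeasure_restricted) (use that Vb in auto)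
    have "density pushed (indicator (V j)) = density weighted (indicator (V j))"
    proof (rule measure_eqI_generator_eq[where E = "{X. open X}" and \<Omega> = UNIV and A = "\<lambda>_. UNIV"])
      show "Int_stable {X :: (nat \<Rightarrow> real) set. open X}" by (auto simp: Int_stable_def)
      show "emeasure (density pushed (indicator (V j))) X = emeasure (density weighted (indicator (V j))) X"
        if "X \<in> {X. open X}" for X
      proof -
        have "V j \<inter> X = {x\<in>V j. x \<in> X}" by blast
        then have "eucl_open m (V j \<inter> X)"
          using openin_Euclidean_vimage[OF V(1) continuous_on_id, of X j] that by simp
        moreover have "V j \<inter> X \<subseteq> U" using V(2) by blast
        ultimately have "emeasure pushed (V j \<inter> X) = emeasure weighted (V j \<inter> X)"
          by (rule measures_eq_open)
        moreover have "X \<in> sets borel" using that by simp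
        ultimately show ?thesis by (simp only: r sets)
      qed
      show "emeasure (density pushed (indicator (V j))) UNIV \<noteq> \<infinity>"
        using fin[of j] measures_eq_open[OF V] by (subst r) (auto simp: sets)
    qed (auto simp: sets borel_def)
    then have "emeasure (density pushed (indicator (V j))) S = emeasure (density weighted (indicator (V j))) S" by simp
    then show ?thesis using r sets S by (simp add: Int_commute)
  qed
  have lim: "emeasure M (S \<inter> U) = (SUP j. emeasure M (S \<inter> V j))" if "sets M = sets borel" for M
  proof -
    have "(\<Union>j. S \<inter> V j) = S \<inter> U"
    proof (intro equalityI subsetI)
      fix x assume x: "x \<in> S \<inter> U"
      obtain j :: nat where j: "J x + (\<Sum>i<m. \<bar>x i\<bar>) < real j" using reals_Archimedean2 by blast
      have "\<bar>x i\<bar> \<le> (\<Sum>i<m. \<bar>x i\<bar>)" if "i < m" for i by (rule member_le_sum) (use that in auto)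
      moreover have "0 \<le> (\<Sum>i<m. \<bar>x i\<bar>)" by (simp add: sum_nonneg)
      ultimately have "x \<in> V j" using x j openin_Euclidean_space_subset[OF U] by (fastforce simp: V_def)
      then show "x \<in> (\<Union>j. S \<inter> V j)" using x by blast
    qed (use V(2) in blast)
    moreover have "incseq (\<lambda>j. S \<inter> V j)"
      unfolding incseq_def
    proof (intro allI impI Int_mono subset_refl subsetI)
      fix i j :: nat and x assume "i \<le> j" and x: "x \<in> V i"
      then have ij: "real i \<le> real j" by simp
      show "x \<in> V j"
        unfolding V_def
      proof (intro IntI CollectI conjI ballI)
        show "J x \<in> {..<real j}" "\<And>k. k \<in> {..<m} \<Longrightarrow> \<bar>x k - 0\<bar> < real j"
          using x ij unfolding V_def by force+
      qed (use x in \<open>simp_all add: V_def\<close>)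
    qed
    ultimately show ?thesis
      using SUP_emeasure_incseq[of "\<lambda>j. S \<inter> V j" M] openin_Euclidean_borel[OF V(1)] S that
      by (auto simp: image_subset_iff)
  qed
  have UI: "emeasure M S = emeasure M (S \<inter> U)" if "sets M = sets borel" "emeasure M (S - U) = 0" for M
  proof -
    have "emeasure M ((S \<inter> U) \<union> (S - U)) = emeasure M (S \<inter> U) + emeasure M (S - U)"
      by (rule plus_emeasure[symmetric]) (use S U_borel that in auto)
    then show ?thesis using that by (simp add: Int_Diff_Un)
  qed
  have "emeasure pushed (S - U) = 0"
  proof -
    have "{y\<in>U'. \<psi> y \<in> S - U} = {}" using \<psi>U by auto
    then show ?thesis using emeasure_pushed(2)[OF sets.Diff[OF S U_borel]] by (simp only: emeasure_empty)
  qed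
  moreover have "emeasure weighted (S - U) = 0"
  proof -
    have "(if x \<in> U then ennreal (J x) else 0) * indicator (S - U) x = 0" for x
      by (simp add: indicator_def)
    then show ?thesis
      unfolding emeasure_weighted[OF sets.Diff[OF S U_borel]] by (simp only: nn_integral_const mult_zero_left)
  qed
  ultimately show "emeasure pushed S = emeasure weighted S"
    using UI sets lim Veq by simp
qed

theorem nn_integral_change_of_variables:
  assumes "g \<in> borel_measurable borel"
  shows "(\<integral>\<^sup>+y. g (\<psi> y) * indicator U' y \<partial>lebesgue_space m) =
    (\<integral>\<^sup>+x. g x * ennreal (J x) * indicator U x \<partial>lebesgue_space m)"
proof -
  let ?\<psi> = "\<lambda>y. if y \<in> U' then \<psi> y else (\<lambda>_. 0)"
  have g\<psi>: "(\<lambda>y. g (?\<psi> y)) \<in> borel_measurable borel" by (rule measurable_compose[OF measurable_inverse assms])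
  have "(\<integral>\<^sup>+x. g x \<partial>pushed) = (\<integral>\<^sup>+y. g (?\<psi> y) \<partial>density (lebesgue_space m) (indicator U'))"
    unfolding pushed_def by (rule nn_integral_distr) (use measurable_inverse assms in \<open>auto cong: measurable_cong_sets\<close>)
  also have "\<dots> = (\<integral>\<^sup>+y. indicator U' y * g (?\<psi> y) \<partial>lebesgue_space m)"
    by (rule nn_integral_density) (use g\<psi> U'_borel in auto)
  also have "\<dots> = (\<integral>\<^sup>+y. g (\<psi> y) * indicator U' y \<partial>lebesgue_space m)"
    by (rule nn_integral_cong) (auto simp: indicator_def)
  finally have 1: "(\<integral>\<^sup>+x. g x \<partial>pushed) = (\<integral>\<^sup>+y. g (\<psi> y) * indicator U' y \<partial>lebesgue_space m)" .
  have "(\<integral>\<^sup>+x. g x \<partial>weighted) =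
      (\<integral>\<^sup>+x. (if x \<in> U then ennreal (J x) else 0) * g x \<partial>lebesgue_space m)"
    unfolding weighted_def by (rule nn_integral_density) (use assms measurable_jacobian in auto)
  also have "\<dots> = (\<integral>\<^sup>+x. g x * ennreal (J x) * indicator U x \<partial>lebesgue_space m)"
    by (rule nn_integral_cong) (auto simp: indicator_def mult.commute)
  finally show ?thesis using 1 measures_eq by simp
qed

end

section \<open>Existence and uniqueness of the Riemannian volume of a compact manifold\<close>

abbreviation (input) "loc c f \<equiv> \<lambda>x. f (chart_inv c x)"

text \<open>Deliberately weaker than a closed smooth manifold: only first derivatives of the
  transition maps and of the metric appear. The round sphere can thus be treated alongside the total
  space after a first-order check of its two charts.\<close>

locale compact_riemannian =
  fixes m :: nat and M :: "'a riemannian"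
  assumes compact: "compact_space (topology_of M)" and hausdorff: "Hausdorff_space (topology_of M)"
    and nonempty: "points M \<noteq> {}"
    and chart: "c \<in> atlas M \<Longrightarrow> is_chart m (topology_of M) c"
    and cover: "points M = (\<Union>c\<in>atlas M. chart_dom c)"
    and transition: "\<lbrakk>c \<in> atlas M; d \<in> atlas M; k < m\<rbrakk> \<Longrightarrow>
      C1 m (chart_map c ` (chart_dom c \<inter> chart_dom d)) (\<lambda>x. chart_map d (chart_inv c x) k)"
    and metric_C1: "\<lbrakk>c \<in> atlas M; i < m; j < m\<rbrakk> \<Longrightarrow> C1 m (chart_map c ` chart_dom c) (\<lambda>x. components M c x i j)"
    and metric_posdef: "\<lbrakk>c \<in> atlas M; x \<in> chart_map c ` chart_dom c\<rbrakk> \<Longrightarrow> posdef m (components M c x)"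
    and metric_change: "\<lbrakk>c \<in> atlas M; d \<in> atlas M; p \<in> chart_dom c; p \<in> chart_dom d; i < m; j < m\<rbrakk> \<Longrightarrow>
      components M c (chart_map c p) i j =
        (\<Sum>k<m. \<Sum>l<m. jacobian (loc c (chart_map d)) (chart_map c p) k i *
          jacobian (loc c (chart_map d)) (chart_map c p) l j * components M d (chart_map d p) k l)"
begin

abbreviation T where "T \<equiv> topology_of M"
abbreviation (input) "root_det c x \<equiv> sqrt (determinant m (components M c x))"
abbreviation (input) "image_in c A \<equiv> chart_map c ` (A \<inter> chart_dom c)"
abbreviation (input) "overlap c d \<equiv> chart_map c ` (chart_dom c \<inter> chart_dom d)"

definition im :: "'a chart \<Rightarrow> (nat \<Rightarrow> real) set" where "im c = chart_map c ` chart_dom c"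

lemma dom_open: "c \<in> atlas M \<Longrightarrow> openin T (chart_dom c)"
  using chart unfolding is_chart_def by blast

lemma dom_subset: "c \<in> atlas M \<Longrightarrow> chart_dom c \<subseteq> points M"
  unfolding points_def using dom_open openin_subset by blast

lemma im_open: "c \<in> atlas M \<Longrightarrow> eucl_open m (im c)"
  using chart unfolding is_chart_def im_def by blast

lemma chart_homeomorphic:
  "c \<in> atlas M \<Longrightarrow> homeomorphic_map (subtopology T (chart_dom c)) (subtopology (Euclidean_space m) (im c)) (chart_map c)"
  using chart unfolding is_chart_def im_def by blast

lemma chart_inj: "c \<in> atlas M \<Longrightarrow> inj_on (chart_map c) (chart_dom c)"
  using homeomorphic_imp_injective_map[OF chart_homeomorphic, of c] dom_subset[of c]
  unfolding points_def by (simp add: inf.absorb2)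

lemma chart_inv_map: "c \<in> atlas M \<Longrightarrow> p \<in> chart_dom c \<Longrightarrow> chart_inv c (chart_map c p) = p"
  unfolding chart_inv_def by (rule inv_into_f_f[OF chart_inj])

lemma chart_map_inv: "x \<in> im c \<Longrightarrow> chart_map c (chart_inv c x) = x"
  unfolding chart_inv_def im_def by (rule f_inv_into_f)

lemma chart_inv_dom: "x \<in> im c \<Longrightarrow> chart_inv c x \<in> chart_dom c"
  unfolding chart_inv_def im_def by (rule inv_into_into)

lemma chart_map_im: "p \<in> chart_dom c \<Longrightarrow> chart_map c p \<in> im c"
  unfolding im_def by blast

lemma chart_inv_in_iff:
  assumes c: "c \<in> atlas M" and x: "x \<in> im c"
  shows "chart_inv c x \<in> A \<longleftrightarrow> x \<in> image_in c A"
proof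
  assume "chart_inv c x \<in> A"
  then have "chart_inv c x \<in> A \<inter> chart_dom c" using chart_inv_dom[OF x] by blast
  then have "chart_map c (chart_inv c x) \<in> image_in c A" by (rule imageI)
  then show "x \<in> image_in c A" by (simp add: chart_map_inv[OF x])
next
  assume "x \<in> image_in c A"
  then show "chart_inv c x \<in> A" using chart_inv_map[OF c] by auto
qed

lemma image_open:
  assumes c: "c \<in> atlas M" and U: "openin T U" "U \<subseteq> chart_dom c"
  shows "eucl_open m (chart_map c ` U)"
proof -
  have "openin (subtopology T (chart_dom c)) U" using U unfolding openin_subtopology by blast
  then have "openin (subtopology (Euclidean_space m) (im c)) (chart_map c ` U)"
    using homeomorphic_map_openness[OF chart_homeomorphic[OF c], of U] openin_subset by blast
  then show ?thesis using openin_trans_full im_open[OF c] by blast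
qed

lemma inverse_image_open:
  assumes c: "c \<in> atlas M" and W: "eucl_open m W"
  shows "openin T {p\<in>chart_dom c. chart_map c p \<in> W}"
proof -
  have "continuous_map (subtopology T (chart_dom c)) (subtopology (Euclidean_space m) (im c)) (chart_map c)"
    using homeomorphic_imp_continuous_map[OF chart_homeomorphic[OF c]] .
  then have "continuous_map (subtopology T (chart_dom c)) (Euclidean_space m) (chart_map c)"
    by (simp add: continuous_map_in_subtopology)
  from openin_continuous_map_preimage[OF this W]
  have "openin (subtopology T (chart_dom c)) {p \<in> topspace (subtopology T (chart_dom c)). chart_map c p \<in> W}" .
  moreover have "topspace (subtopology T (chart_dom c)) = chart_dom c"
    using dom_subset[OF c] unfolding points_def by auto
  ultimately show ?thesis using openin_trans_full dom_open[OF c] by metis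
qed

definition borel_M :: "'a measure" where "borel_M = sigma (points M) {U. openin T U}"

lemma opens_Pow: "{U. openin T U} \<subseteq> Pow (points M)"
  unfolding points_def using openin_subset by blast

lemma space_borel_M: "space borel_M = points M"
  unfolding borel_M_def using opens_Pow by simp

lemma sets_borel_M: "sets borel_M = sigma_sets (points M) {U. openin T U}"
  unfolding borel_M_def using opens_Pow by simp

lemma open_sets_M: "openin T U \<Longrightarrow> U \<in> sets borel_M"
  unfolding sets_borel_M by auto

lemma dom_sets: "c \<in> atlas M \<Longrightarrow> chart_dom c \<in> sets borel_M"
  by (rule open_sets_M[OF dom_open])

text \<open>A measure is pushed forward along a total function only. The default point outside
  \<open>im c\<close> carries no mass, as \<open>chart_density\<close> vanishes there.\<close>

definition total_inv :: "'a chart \<Rightarrow> (nat \<Rightarrow> real) \<Rightarrow> 'a" where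
  "total_inv c x = (if x \<in> im c then chart_inv c x else (SOME p. p \<in> points M))"

lemma measurable_total_inv:
  assumes c: "c \<in> atlas M"
  shows "total_inv c \<in> measurable borel borel_M"
  unfolding borel_M_def
proof (rule measurable_measure_of[OF opens_Pow])
  have p0: "(SOME p. p \<in> points M) \<in> points M" using nonempty by (simp add: some_in_eq)
  then show "total_inv c \<in> space borel \<rightarrow> points M"
    using subsetD[OF dom_subset[OF c] chart_inv_dom] by (auto simp: total_inv_def)
  fix U assume "U \<in> {U. openin T U}"
  then have U: "openin T (U \<inter> chart_dom c)" using dom_open[OF c] by auto
  have "total_inv c -` U \<inter> space borel =
      image_in c U \<union> (if (SOME p. p \<in> points M) \<in> U then - im c else {})"
  proof -
    have "x \<in> im c \<Longrightarrow> chart_inv c x \<in> U \<longleftrightarrow> x \<in> image_in c U" for x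
      by (rule chart_inv_in_iff[OF c])
    moreover have "image_in c U \<subseteq> im c" unfolding im_def by blast
    ultimately show ?thesis by (auto simp: total_inv_def split: if_splits)
  qed
  moreover have "image_in c U \<in> sets borel" "im c \<in> sets borel"
    using openin_Euclidean_borel image_open[OF c U] im_open[OF c] by auto
  ultimately show "total_inv c -` U \<inter> space borel \<in> sets borel" by auto
qed

section \<open>The measures given by single charts, and how they are glued\<close>

definition chart_density :: "'a chart \<Rightarrow> (nat \<Rightarrow> real) \<Rightarrow> real" where
  "chart_density c x = (if x \<in> im c then root_det c x else 0)"

lemma C1_density: "c \<in> atlas M \<Longrightarrow> C1 m (im c) (\<lambda>x. root_det c x)"
  by (intro C1_sqrt(1) C1_determinant) (auto simp: im_def metric_C1 posdef_determinant_pos metric_posdef)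

lemma chart_density_nonneg: "c \<in> atlas M \<Longrightarrow> chart_density c x \<ge> 0"
  using posdef_determinant_pos[OF metric_posdef, of c x] by (auto simp: chart_density_def im_def)

lemma measurable_density: "c \<in> atlas M \<Longrightarrow> chart_density c \<in> borel_measurable borel"
  unfolding chart_density_def
  by (rule borel_measurable_continuous_on_if[OF openin_Euclidean_borel[OF im_open] C1_continuous[OF C1_density]]) auto

definition chart_measure :: "'a chart \<Rightarrow> 'a measure" where
  "chart_measure c = distr (density (lebesgue_space m) (\<lambda>x. ennreal (chart_density c x))) borel_M (total_inv c)"

lemma sets_chart_measure: "sets (chart_measure c) = sets borel_M"
  by (simp add: chart_measure_def)

lemma image_borel:
  assumes c: "c \<in> atlas M" and A: "A \<in> sets borel_M"
  shows "image_in c A \<in> sets borel"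
proof -
  have "image_in c A = total_inv c -` A \<inter> im c"
  proof -
    have "x \<in> im c \<Longrightarrow> chart_inv c x \<in> A \<longleftrightarrow> x \<in> image_in c A" for x
      by (rule chart_inv_in_iff[OF c])
    moreover have "image_in c A \<subseteq> im c" unfolding im_def by blast
    ultimately show ?thesis by (auto simp: total_inv_def split: if_splits)
  qed
  moreover have "total_inv c -` A \<in> sets borel" using measurable_sets[OF measurable_total_inv[OF c] A] by simp
  ultimately show ?thesis using openin_Euclidean_borel[OF im_open[OF c]] by simp
qed

lemma emeasure_chart_measure:
  assumes c: "c \<in> atlas M" and A: "A \<in> sets borel_M"
  shows "emeasure (chart_measure c) A =
    (\<integral>\<^sup>+x. ennreal (root_det c x) * indicator (image_in c A) x \<partial>lebesgue_space m)"
proof -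
  have "emeasure (chart_measure c) A = emeasure (density (lebesgue_space m) (\<lambda>x. ennreal (chart_density c x))) (total_inv c -` A)"
    unfolding chart_measure_def
    by (subst emeasure_distr) (use measurable_total_inv[OF c] A in \<open>auto cong: measurable_cong_sets\<close>)
  also have "\<dots> = (\<integral>\<^sup>+x. ennreal (chart_density c x) * indicator (total_inv c -` A) x \<partial>lebesgue_space m)"
    by (rule emeasure_density) (use measurable_density[OF c] measurable_sets[OF measurable_total_inv[OF c] A] in auto)
  also have "\<dots> = (\<integral>\<^sup>+x. ennreal (root_det c x) * indicator (image_in c A) x \<partial>lebesgue_space m)"
  proof (rule nn_integral_cong)
    fix x
    have "x \<in> im c \<Longrightarrow> chart_inv c x \<in> A \<longleftrightarrow> x \<in> image_in c A"
      by (rule chart_inv_in_iff[OF c])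
    moreover have "x \<notin> im c \<Longrightarrow> x \<notin> image_in c A" unfolding im_def by blast
    ultimately show "ennreal (chart_density c x) * indicator (total_inv c -` A) x =
        ennreal (root_det c x) * indicator (image_in c A) x"
      by (auto simp: chart_density_def total_inv_def indicator_def)
  qed
  finally show ?thesis .
qed

lemma overlap_change:
  assumes c: "c \<in> atlas M" and d: "d \<in> atlas M"
  shows "coordinate_change m (overlap c d) (chart_map d ` (chart_dom c \<inter> chart_dom d))
    (loc c (chart_map d)) (loc d (chart_map c))"
proof
  have "openin T (chart_dom c \<inter> chart_dom d)" using dom_open[OF c] dom_open[OF d] by (rule openin_Int)
  then show "eucl_open m (overlap c d)"
    "eucl_open m (chart_map d ` (chart_dom c \<inter> chart_dom d))"
    using image_open[OF c] image_open[OF d] by blast+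
  show "C1 m (chart_map d ` (chart_dom c \<inter> chart_dom d)) (\<lambda>x. chart_map c (chart_inv d x) k)" if "k < m" for k
    using transition[OF d c that] by (simp add: Int_commute)
qed (use chart_inv_map[OF c] chart_inv_map[OF d] transition[OF c d] in auto)

text \<open>The metric transforms by the matrix \<open>J\<close> on both sides, so its determinant
  picks up the square of that of \<open>J\<close>; the root leaves the absolute value.\<close>

lemma determinant_change:
  assumes c: "c \<in> atlas M" and d: "d \<in> atlas M" and p: "p \<in> chart_dom c" "p \<in> chart_dom d"
  shows "root_det c (chart_map c p) =
    \<bar>determinant m (jacobian (loc c (chart_map d)) (chart_map c p))\<bar> * root_det d (chart_map d p)"
proof -
  let ?J = "jacobian (loc c (chart_map d)) (chart_map c p)"
  let ?G = "components M d (chart_map d p)"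
  have "determinant m (components M c (chart_map c p)) = determinant m (\<lambda>i j. \<Sum>k<m. ?J k i * (\<Sum>l<m. ?G k l * ?J l j))"
    by (rule determinant_cong) (simp add: metric_change[OF c d p] sum_distrib_left mult_ac)
  also have "\<dots> = determinant m (\<lambda>i k. ?J k i) * (determinant m ?G * determinant m ?J)"
    by (simp add: determinant_mult[of m "\<lambda>i k. ?J k i" "\<lambda>k j. \<Sum>l<m. ?G k l * ?J l j"] determinant_mult)
  also have "determinant m (\<lambda>i k. ?J k i) = determinant m ?J"
  proof -
    have "mat m m (\<lambda>(i, k). ?J k i) = transpose_mat (mat m m (\<lambda>(i, k). ?J i k))" by (rule eq_matI) auto
    then show ?thesis unfolding determinant_def using Determinant.det_transpose[OF mat_carrier_fun] by metis
  qed
  finally show ?thesis by (simp add: real_sqrt_mult)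
qed

text \<open>Change of variables along the transition map; the Jacobian that it produces is the one
  by which the densities differ.\<close>

lemma chart_measure_compatible:
  assumes c: "c \<in> atlas M" and d: "d \<in> atlas M" and A: "A \<in> sets borel_M" "A \<subseteq> chart_dom c" "A \<subseteq> chart_dom d"
  shows "emeasure (chart_measure c) A = emeasure (chart_measure d) A"
proof -
  define U where "U = overlap c d"
  define U' where "U' = chart_map d ` (chart_dom c \<inter> chart_dom d)"
  define \<phi> where "\<phi> = (loc c (chart_map d))"
  define \<psi> where "\<psi> = (loc d (chart_map c))"
  interpret coordinate_change m U U' \<phi> \<psi>
    unfolding U_def U'_def \<phi>_def \<psi>_def by (rule overlap_change[OF c d])
  have Ac: "A \<inter> chart_dom c = A" "A \<inter> chart_dom d = A" using A by auto
  have bc: "chart_map c ` A \<in> sets borel" using image_borel[OF c A(1)] by (simp add: Ac)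
  define h where "h x = (if x \<in> U then sqrt (determinant m (components M d (\<phi> x))) else 0)" for x
  have hm: "h \<in> borel_measurable borel"
    unfolding h_def
  proof (rule borel_measurable_continuous_on_if[OF U_borel])
    have "C1 m U (\<lambda>x. sqrt (determinant m (components M d (\<phi> x))))"
      by (rule C1_compose[OF U im_open[OF d] C1_density[OF d] \<phi>C1]) (auto simp: im_def U_def \<phi>_def chart_inv_map[OF c])
    then show "continuous_on U (\<lambda>x. sqrt (determinant m (components M d (\<phi> x))))" by (rule C1_continuous)
  qed simp
  define g where "g x = ennreal (h x) * indicator (chart_map c ` A) x" for x
  have gm: "g \<in> borel_measurable borel" unfolding g_def using hm bc by simp
  have inU: "chart_map c p \<in> U" "chart_map d p \<in> U'" if "p \<in> A" for p using that A by (auto simp: U_def U'_def)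
  have "emeasure (chart_measure d) A = (\<integral>\<^sup>+y. g (\<psi> y) * indicator U' y \<partial>lebesgue_space m)"
    unfolding emeasure_chart_measure[OF d A(1)] Ac
  proof (rule nn_integral_cong)
    fix y
    show "ennreal (sqrt (determinant m (components M d y))) * indicator (chart_map d ` A) y = g (\<psi> y) * indicator U' y"
    proof (cases "y \<in> U'")
      case True
      then obtain p where p: "p \<in> chart_dom c" "p \<in> chart_dom d" "y = chart_map d p" by (auto simp: U'_def)
      have \<psi>y: "\<psi> y = chart_map c p" using p chart_inv_map[OF d] by (simp add: \<psi>_def)
      have "y \<in> chart_map d ` A \<longleftrightarrow> p \<in> A" "chart_map c p \<in> chart_map c ` A \<longleftrightarrow> p \<in> A"
        using p A inj_on_image_mem_iff[OF chart_inj] c d by auto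
      moreover have "h (\<psi> y) = sqrt (determinant m (components M d y))" using \<psi>U[OF True] \<phi>\<psi>[OF True] by (simp add: h_def)
      ultimately show ?thesis using True by (auto simp: g_def \<psi>y indicator_def)
    next
      case False
      then have "y \<notin> chart_map d ` A" using inU by auto
      then show ?thesis using False by simp
    qed
  qed
  also have "\<dots> = (\<integral>\<^sup>+x. g x * ennreal \<bar>determinant m (jacobian \<phi> x)\<bar> * indicator U x \<partial>lebesgue_space m)"
    by (rule nn_integral_change_of_variables[OF gm])
  also have "\<dots> = emeasure (chart_measure c) A"
    unfolding emeasure_chart_measure[OF c A(1)] Ac
  proof (rule nn_integral_cong)
    fix x
    show "g x * ennreal \<bar>determinant m (jacobian \<phi> x)\<bar> * indicator U x =
        ennreal (root_det c x) * indicator (chart_map c ` A) x"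
    proof (cases "x \<in> chart_map c ` A")
      case True
      then obtain p where p: "p \<in> A" "x = chart_map c p" by blast
      then have pc: "p \<in> chart_dom c" "p \<in> chart_dom d" using A by auto
      have "determinant m (components M d (chart_map d p)) > 0"
        by (rule posdef_determinant_pos[OF metric_posdef[OF d]]) (use pc in blast)
      then have "ennreal (root_det c x) = ennreal (h x) * ennreal \<bar>determinant m (jacobian \<phi> x)\<bar>"
        using determinant_change[OF c d pc] inU[OF p(1)] chart_inv_map[OF c pc(1)]
        by (simp add: h_def p(2) \<phi>_def ennreal_mult[symmetric] mult.commute)
      then show ?thesis using True inU[OF p(1)] p(2) by (simp add: g_def)
    qed (simp add: g_def)
  qed
  finally show ?thesis by simp
qed

lemma finite_atlas: "\<exists>cs. set cs \<subseteq> atlas M \<and> points M = (\<Union>i<length cs. chart_dom (cs ! i))"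
proof -
  have "\<exists>\<F>. finite \<F> \<and> \<F> \<subseteq> chart_dom ` atlas M \<and> points M \<subseteq> \<Union>\<F>"
    using compact cover dom_open unfolding compact_space_alt points_def by (metis (no_types, lifting) imageE order_refl)
  then obtain \<F> where F: "finite \<F>" "\<F> \<subseteq> chart_dom ` atlas M" "points M \<subseteq> \<Union>\<F>" by blast
  then obtain C where C: "finite C" "C \<subseteq> atlas M" "\<F> = chart_dom ` C" by (metis finite_subset_image)
  obtain cs where cs: "set cs = C" using finite_list[OF C(1)] by blast
  have "\<Union>\<F> = (\<Union>i<length cs. chart_dom (cs ! i))" unfolding C(3) cs[symmetric] by (auto simp: set_conv_nth)
  moreover have "\<Union>\<F> \<subseteq> points M" using F(2) dom_subset by blast
  ultimately show ?thesis using F(3) cs C(2) by auto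
qed

definition "charts = (SOME cs. set cs \<subseteq> atlas M \<and> points M = (\<Union>i<length cs. chart_dom (cs ! i)))"

lemma charts: "set charts \<subseteq> atlas M" "points M = (\<Union>i<length charts. chart_dom (charts ! i))"
  using someI_ex[OF finite_atlas] unfolding charts_def by auto

lemma charts_nth: "i < length charts \<Longrightarrow> charts ! i \<in> atlas M"
  using charts(1) nth_mem by blast

text \<open>A finite cover by charts made disjoint. The volume is assembled piece by piece, and
  compatibility of the chart measures makes it correct in every chart, chosen or not.\<close>

definition piece :: "nat \<Rightarrow> 'a set" where
  "piece i = chart_dom (charts ! i) - (\<Union>j<i. chart_dom (charts ! j))"

lemma piece_sets: "i < length charts \<Longrightarrow> piece i \<in> sets borel_M"
  unfolding piece_def by (intro sets.Diff sets.finite_UN dom_sets charts_nth) auto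

lemma piece_dom: "piece i \<subseteq> chart_dom (charts ! i)"
  unfolding piece_def by blast

lemma piece_disjoint: "disjoint_family_on piece {..<length charts}"
  unfolding disjoint_family_on_def piece_def by (metis (no_types, lifting) DiffE UN_I disjoint_iff lessThan_iff nat_neq_iff)

lemma piece_cover: "(\<Union>i<length charts. piece i) = points M"
proof (intro equalityI subsetI)
  fix p assume "p \<in> points M"
  then obtain i where "i < length charts" "p \<in> chart_dom (charts ! i)" using charts(2) by auto
  then have ex: "\<exists>i. p \<in> chart_dom (charts ! i)" and "(LEAST i. p \<in> chart_dom (charts ! i)) \<le> i"
    by (auto intro: Least_le)
  moreover have "p \<in> piece (LEAST i. p \<in> chart_dom (charts ! i))"
    using LeastI_ex[OF ex] not_less_Least unfolding piece_def by blast
  ultimately show "p \<in> (\<Union>i<length charts. piece i)" using \<open>i < length charts\<close> by fastforce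
qed (use piece_dom charts(2) in blast)

definition volume :: "'a measure" where
  "volume = measure_of (points M) {U. openin T U} (\<lambda>A. \<Sum>i<length charts. emeasure (chart_measure (charts ! i)) (A \<inter> piece i))"

lemma sets_volume: "sets volume = sets borel_M"
  unfolding volume_def sets_borel_M using opens_Pow by simp

lemma space_volume: "space volume = points M"
  unfolding volume_def using opens_Pow by (simp add: space_measure_of_conv)

lemma emeasure_volume:
  assumes "A \<in> sets borel_M"
  shows "emeasure volume A = (\<Sum>i<length charts. emeasure (chart_measure (charts ! i)) (A \<inter> piece i))"
proof (rule emeasure_measure_of[OF volume_def opens_Pow])
  show "A \<in> sets volume" using assms by (simp add: sets_volume)
  show "positive (sets volume) (\<lambda>A. \<Sum>i<length charts. emeasure (chart_measure (charts ! i)) (A \<inter> piece i))"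
    by (simp add: positive_def)
  show "countably_additive (sets volume) (\<lambda>A. \<Sum>i<length charts. emeasure (chart_measure (charts ! i)) (A \<inter> piece i))"
    unfolding countably_additive_def
  proof (intro allI impI)
    fix F :: "nat \<Rightarrow> 'a set"
    assume F: "range F \<subseteq> sets volume" "disjoint_family F"
    have "(\<Sum>n. \<Sum>i<length charts. emeasure (chart_measure (charts ! i)) (F n \<inter> piece i)) =
        (\<Sum>i<length charts. \<Sum>n. emeasure (chart_measure (charts ! i)) (F n \<inter> piece i))"
      by (rule suminf_sum) simp
    also have "\<dots> = (\<Sum>i<length charts. emeasure (chart_measure (charts ! i)) ((\<Union>n. F n) \<inter> piece i))"
    proof (rule sum.cong[OF refl])
      fix i assume "i \<in> {..<length charts}"
      then have "(\<Sum>n. emeasure (chart_measure (charts ! i)) (F n \<inter> piece i)) = emeasure (chart_measure (charts ! i)) (\<Union>n. F n \<inter> piece i)"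
        by (intro suminf_emeasure) (use F piece_sets in \<open>auto simp: sets_chart_measure sets_volume disjoint_family_on_def\<close>)
      then show "(\<Sum>n. emeasure (chart_measure (charts ! i)) (F n \<inter> piece i)) = emeasure (chart_measure (charts ! i)) ((\<Union>n. F n) \<inter> piece i)"
        by simp
    qed
    finally show "(\<Sum>n. \<Sum>i<length charts. emeasure (chart_measure (charts ! i)) (F n \<inter> piece i)) =
        (\<Sum>i<length charts. emeasure (chart_measure (charts ! i)) ((\<Union>n. F n) \<inter> piece i))" .
  qed
qed

lemma sum_pieces:
  assumes "sets N = sets borel_M" "A \<in> sets borel_M"
  shows "emeasure N A = (\<Sum>i<length charts. emeasure N (A \<inter> piece i))"
proof -
  have "A \<subseteq> points M" using sets.sets_into_space[OF assms(2)] by (simp add: space_borel_M)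
  then have "A = (\<Union>i<length charts. A \<inter> piece i)" using piece_cover by blast
  moreover have "(\<Sum>i<length charts. emeasure N (A \<inter> piece i)) = emeasure N (\<Union>i<length charts. A \<inter> piece i)"
  proof (rule sum_emeasure)
    show "disjoint_family_on (\<lambda>i. A \<inter> piece i) {..<length charts}"
      using piece_disjoint unfolding disjoint_family_on_def by blast
  qed (use assms piece_sets in auto)
  ultimately show ?thesis by simp
qed

lemma volume_chart:
  assumes c: "c \<in> atlas M" and A: "A \<in> sets borel_M" "A \<subseteq> chart_dom c"
  shows "emeasure volume A = emeasure (chart_measure c) A"
  unfolding emeasure_volume[OF A(1)] sum_pieces[OF sets_chart_measure A(1)]
proof (rule sum.cong[OF refl])
  fix i assume "i \<in> {..<length charts}"
  then show "emeasure (chart_measure (charts ! i)) (A \<inter> piece i) = emeasure (chart_measure c) (A \<inter> piece i)"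
    by (intro chart_measure_compatible charts_nth c) (use A piece_sets piece_dom in auto)
qed

text \<open>A measure with the prescribed densities is forced on each piece, hence on all Borel
  sets. This gives the definite description a unique solution.\<close>

lemma riemannian_volume_eq: "riemannian_volume m M = volume"
  unfolding riemannian_volume_def
proof (rule the_equality)
  have cs: "emeasure (chart_measure c) A = (\<integral>\<^sup>+x\<in>chart_map c ` A. ennreal (root_det c x) \<partial>lebesgue_space m)"
    if "c \<in> atlas M" "A \<in> sets borel_M" "A \<subseteq> chart_dom c" for c A
    using emeasure_chart_measure[OF that(1,2)] that(3) by (simp add: inf.absorb1)
  show "space volume = points M \<and> sets volume = sigma_sets (points M) {U. openin T U} \<and>
      (\<forall>c\<in>atlas M. \<forall>A\<in>sets volume. A \<subseteq> chart_dom c \<longrightarrow> emeasure volume A =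
        (\<integral>\<^sup>+x\<in>chart_map c ` A. ennreal (root_det c x) \<partial>lebesgue_space m))"
    using space_volume sets_volume sets_borel_M volume_chart cs by simp
  fix \<mu> assume \<mu>: "space \<mu> = points M \<and> sets \<mu> = sigma_sets (points M) {U. openin T U} \<and>
      (\<forall>c\<in>atlas M. \<forall>A\<in>sets \<mu>. A \<subseteq> chart_dom c \<longrightarrow> emeasure \<mu> A =
        (\<integral>\<^sup>+x\<in>chart_map c ` A. ennreal (root_det c x) \<partial>lebesgue_space m))"
  then have sets: "sets \<mu> = sets borel_M" by (simp add: sets_borel_M)
  show "\<mu> = volume"
  proof (rule measure_eqI)
    show "sets \<mu> = sets volume" by (simp add: sets sets_volume)
    fix A assume "A \<in> sets \<mu>"
    then have A: "A \<in> sets borel_M" by (simp add: sets)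
    have "emeasure \<mu> (A \<inter> piece i) = emeasure (chart_measure (charts ! i)) (A \<inter> piece i)" if "i < length charts" for i
    proof -
      have "A \<inter> piece i \<in> sets borel_M" "A \<inter> piece i \<subseteq> chart_dom (charts ! i)" using A piece_sets[OF that] piece_dom by auto
      then show ?thesis using \<mu> charts_nth[OF that] cs sets by auto
    qed
    then show "emeasure \<mu> A = emeasure volume A"
      unfolding emeasure_volume[OF A] sum_pieces[OF sets A] by simp
  qed
qed

text \<open>A chart image contains a cube, on which the density is positive. Positive and finite
  total volume is what makes the quotients of the theorem genuine ratios, since division by zero
  gives zero.\<close>

lemma volume_pos: "emeasure volume (points M) > 0"
proof -
  obtain p where p: "p \<in> points M" using nonempty by blast
  then obtain c where c: "c \<in> atlas M" "p \<in> chart_dom c" using cover by blast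
  have eq: "emeasure volume (chart_dom c) =
      (\<integral>\<^sup>+x. ennreal (root_det c x) * indicator (im c) x \<partial>lebesgue_space m)"
    using volume_chart[OF c(1) dom_sets[OF c(1)]] emeasure_chart_measure[OF c(1) dom_sets[OF c(1)]] by (simp add: im_def)
  obtain r where r: "r > 0" "\<And>y. flat m y \<Longrightarrow> (\<forall>i<m. \<bar>y i - chart_map c p i\<bar> < r) \<Longrightarrow> y \<in> im c"
    using openin_Euclidean_cube[OF im_open[OF c(1)] chart_map_im[OF c(2)]] by blast
  define Q where "Q = half_cube m (chart_map c p) r"
  have Q: "Q \<subseteq> im c"
  proof
    fix y assume "y \<in> Q"
    then show "y \<in> im c" by (intro r(2)) (auto simp: Q_def half_cube_def abs_if)
  qed
  have "emeasure (lebesgue_space m) Q > 0" using emeasure_half_cube[of r m] r(1) by (simp add: Q_def)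
  have meas: "(\<lambda>x. ennreal (chart_density c x)) \<in> borel_measurable (lebesgue_space m)"
    using measurable_density[OF c(1)] by simp
  have "emeasure volume (chart_dom c) = (\<integral>\<^sup>+x. ennreal (chart_density c x) \<partial>lebesgue_space m)"
    unfolding eq by (rule nn_integral_cong) (simp add: chart_density_def indicator_def)
  moreover have "(\<integral>\<^sup>+x. ennreal (chart_density c x) \<partial>lebesgue_space m) \<noteq> 0"
  proof
    assume "(\<integral>\<^sup>+x. ennreal (chart_density c x) \<partial>lebesgue_space m) = 0"
    then have "AE x in lebesgue_space m. ennreal (chart_density c x) = 0"
      using nn_integral_0_iff_AE[OF meas] by simp
    then have "AE x in lebesgue_space m. x \<notin> Q"
    proof eventually_elim
      case (elim x)
      show ?case
      proof
        assume "x \<in> Q"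
        then have "x \<in> im c" using Q by blast
        then show False using elim posdef_determinant_pos[OF metric_posdef[OF c(1)], of x]
          by (simp add: chart_density_def im_def ennreal_eq_0_iff)
      qed
    qed
    then have "emeasure (lebesgue_space m) Q = 0"
      by (subst (asm) AE_iff_measurable[of Q]) (auto simp: Q_def half_cube_borel)
    then show False using \<open>emeasure (lebesgue_space m) Q > 0\<close> by simp
  qed
  moreover have "emeasure volume (chart_dom c) \<le> emeasure volume (points M)"
    by (rule emeasure_mono[OF dom_subset[OF c(1)]]) (metis sets.top space_volume)
  ultimately show ?thesis by (metis not_gr_zero le_zero_eq)
qed

text \<open>The density may be unbounded on a whole chart. Near a point it stays below its value
  plus 1 by continuity, and compactness extends finiteness to the manifold.\<close>

lemma small_neighbourhood:
  assumes "p \<in> points M"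
  shows "\<exists>U. openin T U \<and> p \<in> U \<and> emeasure volume U \<noteq> \<infinity>"
proof -
  obtain c where c: "c \<in> atlas M" "p \<in> chart_dom c" using assms cover by blast
  define x where "x = chart_map c p"
  define D where "D x = root_det c x" for x
  have "(0 :: real) < 1" by simp
  then obtain r where r: "r > 0" "\<And>y. flat m y \<Longrightarrow> close m r x y \<Longrightarrow> y \<in> im c \<and> \<bar>D y - D x\<bar> < 1"
    using continuous_on_cube[OF im_open[OF c(1)] C1_continuous[OF C1_density[OF c(1)]] chart_map_im[OF c(2)], of 1]
    unfolding D_def x_def by blast
  define W where "W = {y. flat m y \<and> (\<forall>i\<in>{..<m}. \<bar>y i - x i\<bar> < r)}"
  define U where "U = {p\<in>chart_dom c. chart_map c p \<in> W}"
  have Wo: "eucl_open m W" unfolding W_def by (rule openin_Euclidean_cubeI) simp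
  have U: "openin T U" unfolding U_def by (rule inverse_image_open[OF c(1) Wo])
  have Ub: "U \<in> sets borel_M" "U \<subseteq> chart_dom c" using open_sets_M[OF U] by (auto simp: U_def)
  have "p \<in> U"
    using c(2) r(1) openin_Euclidean_space_subset[OF im_open[OF c(1)] chart_map_im[OF c(2)]] by (auto simp: U_def W_def x_def)
  have W_box: "W = {y. flat m y \<and> (\<forall>i<m. y i \<in> {x i - r<..<x i + r})}"
  proof -
    have "\<bar>t - x i\<bar> < r \<longleftrightarrow> t \<in> {x i - r<..<x i + r}" for t i by (auto simp: abs_less_iff)
    then show ?thesis unfolding W_def by (simp add: Ball_def)
  qed
  have "emeasure volume U = (\<integral>\<^sup>+x. ennreal (D x) * indicator (chart_map c ` U) x \<partial>lebesgue_space m)"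
    using volume_chart[OF c(1) Ub] emeasure_chart_measure[OF c(1) Ub(1)] Ub(2) by (simp add: inf.absorb1 D_def)
  also have "\<dots> \<le> (\<integral>\<^sup>+y. ennreal (D x + 1) * indicator W y \<partial>lebesgue_space m)"
  proof (rule nn_integral_mono)
    fix y
    show "ennreal (D y) * indicator (chart_map c ` U) y \<le> ennreal (D x + 1) * indicator W y"
    proof (cases "y \<in> chart_map c ` U")
      case True
      then have y: "y \<in> W" by (auto simp: U_def)
      then have "\<bar>D y - D x\<bar> < 1" using r(2) by (simp add: W_def)
      then show ?thesis using y True by (auto intro!: ennreal_leI)
    qed simp
  qed
  also have "\<dots> = ennreal (D x + 1) * emeasure (lebesgue_space m) W"
    using openin_Euclidean_borel[OF Wo] by (simp add: nn_integral_cmult_indicator)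
  also have "emeasure (lebesgue_space m) W = ennreal (\<Prod>i<m. (x i + r) - (x i - r))"
    unfolding W_box by (rule emeasure_lebesgue_space_box) (use r(1) in auto)
  finally have "emeasure volume U \<noteq> \<infinity>" by (auto simp: top_unique ennreal_mult_eq_top_iff)
  then show ?thesis using U \<open>p \<in> U\<close> by blast
qed

lemma volume_finite: "emeasure volume (points M) \<noteq> \<infinity>"
proof -
  define \<U> where "\<U> = {U. openin T U \<and> emeasure volume U \<noteq> \<infinity>}"
  have "points M \<subseteq> \<Union>\<U>" using small_neighbourhood unfolding \<U>_def by blast
  moreover have "\<forall>U\<in>\<U>. openin T U" by (simp add: \<U>_def)
  ultimately obtain \<F> where F: "finite \<F>" "\<F> \<subseteq> \<U>" "points M \<subseteq> \<Union>\<F>"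
    using compact unfolding compact_space_alt points_def by meson
  have meas: "U \<in> sets volume" if "U \<in> \<F>" for U using that F(2) open_sets_M by (auto simp: \<U>_def sets_volume)
  have "emeasure volume (points M) \<le> emeasure volume (\<Union>U\<in>\<F>. U)"
    using F(1,3) meas by (intro emeasure_mono sets.finite_UN) auto
  also have "\<dots> \<le> (\<Sum>U\<in>\<F>. emeasure volume U)" by (rule emeasure_subadditive_finite[OF F(1)]) (use meas in auto)
  also have "\<dots> < \<infinity>" using F(1,2) by (auto simp: \<U>_def less_top subset_iff)
  finally show ?thesis by simp
qed

lemma volume_finite_measure: "finite_measure volume"
  by (rule finite_measureI) (use volume_finite in \<open>simp add: space_volume\<close>)

lemma measure_volume_pos: "measure volume (points M) > 0"
  using volume_pos volume_finite by (simp add: measure_def enn2real_positive_iff less_top)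

lemma continuous_measurable:
  assumes "continuous_map T euclideanreal f"
  shows "f \<in> borel_measurable volume"
proof (rule borel_measurableI)
  fix S :: "real set" assume "open S"
  then have "openin T {p \<in> topspace T. f p \<in> S}"
    using openin_continuous_map_preimage[OF assms] by simp
  moreover have "f -` S \<inter> space volume = {p \<in> topspace T. f p \<in> S}" by (auto simp: space_volume points_def)
  ultimately show "f -` S \<inter> space volume \<in> sets volume" using open_sets_M by (simp add: sets_volume)
qed

text \<open>Restricted to the domain of \<open>c\<close>, the volume is
  \<open>chart_measure c\<close>, and a function supported there does not notice the
  restriction.\<close>

lemma integral_volume_chart:
  assumes c: "c \<in> atlas M" and f: "f \<in> borel_measurable volume" and z: "\<And>p. p \<in> points M \<Longrightarrow> p \<notin> chart_dom c \<Longrightarrow> f p = 0"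
  shows "(\<integral>p. f p \<partial>volume) = (\<integral>x. chart_density c x * f (chart_inv c x) \<partial>lebesgue_space m)"
proof -
  have fm: "f \<in> borel_measurable borel_M" using f sets_volume by (simp cong: measurable_cong_sets)
  have "density volume (\<lambda>p. ennreal (indicator (chart_dom c) p)) = chart_measure c"
  proof (rule measure_eqI)
    show "sets (density volume (\<lambda>p. ennreal (indicator (chart_dom c) p))) = sets (chart_measure c)"
      by (simp add: sets_volume sets_chart_measure)
    fix A assume "A \<in> sets (density volume (\<lambda>p. ennreal (indicator (chart_dom c) p)))"
    then have A: "A \<in> sets borel_M" by (simp add: sets_volume)
    have "emeasure (density volume (\<lambda>p. ennreal (indicator (chart_dom c) p))) A = emeasure volume (chart_dom c \<inter> A)"
      unfolding ennreal_indicator by (rule emeasure_restricted) (use A dom_sets[OF c] in \<open>auto simp: sets_volume\<close>)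
    also have "\<dots> = emeasure (chart_measure c) (chart_dom c \<inter> A)"
      by (rule volume_chart[OF c]) (use A dom_sets[OF c] in auto)
    also have "\<dots> = emeasure (chart_measure c) A"
    proof -
      have "chart_dom c \<inter> A \<inter> chart_dom c = A \<inter> chart_dom c" by blast
      moreover have "chart_dom c \<inter> A \<in> sets borel_M" using A dom_sets[OF c] by auto
      ultimately show ?thesis using emeasure_chart_measure[OF c] A by simp
    qed
    finally show "emeasure (density volume (\<lambda>p. ennreal (indicator (chart_dom c) p))) A = emeasure (chart_measure c) A" .
  qed
  moreover have "(\<integral>p. f p \<partial>density volume (\<lambda>p. ennreal (indicator (chart_dom c) p))) = (\<integral>p. indicator (chart_dom c) p *\<^sub>R f p \<partial>volume)"
    by (rule integral_density) (use f dom_sets[OF c] in \<open>auto simp: sets_volume intro!: borel_measurable_indicator\<close>)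
  moreover have "(\<integral>p. indicator (chart_dom c) p *\<^sub>R f p \<partial>volume) = (\<integral>p. f p \<partial>volume)"
    by (rule Bochner_Integration.integral_cong) (auto simp: indicator_def space_volume z)
  ultimately have "(\<integral>p. f p \<partial>volume) = (\<integral>p. f p \<partial>chart_measure c)" by simp
  also have "\<dots> = (\<integral>x. f (total_inv c x) \<partial>density (lebesgue_space m) (\<lambda>x. ennreal (chart_density c x)))"
    unfolding chart_measure_def
    by (rule integral_distr) (use measurable_total_inv[OF c] fm in \<open>auto cong: measurable_cong_sets\<close>)
  also have "\<dots> = (\<integral>x. chart_density c x *\<^sub>R f (total_inv c x) \<partial>lebesgue_space m)"
    by (rule integral_density)
      (use measurable_density[OF c] chart_density_nonneg[OF c] measurable_compose[OF measurable_total_inv[OF c] fm] in \<open>auto cong: measurable_cong_sets\<close>)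
  also have "\<dots> = (\<integral>x. chart_density c x * f (chart_inv c x) \<partial>lebesgue_space m)"
    by (rule Bochner_Integration.integral_cong) (auto simp: chart_density_def total_inv_def)
  finally show ?thesis .
qed

end

section \<open>Integration by parts\<close>

definition closed_cube :: "nat \<Rightarrow> (nat \<Rightarrow> real) \<Rightarrow> real \<Rightarrow> (nat \<Rightarrow> real) set" where
  "closed_cube m a r = {y. flat m y \<and> (\<forall>i<m. \<bar>y i - a i\<bar> \<le> r)}"

lemma openin_Euclidean_UNIV: "eucl_open m {x. \<forall>i\<ge>m. x i = 0}"
  using openin_topspace[of "Euclidean_space m"] by (simp add: topspace_Euclidean_space)

lemma compact_closed_cube: "compact (closed_cube m a r)"
proof -
  have "closed_cube m a r = (\<Pi>\<^sub>E i\<in>UNIV. if i < m then {a i - r..a i + r} else {0})"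
  proof -
    have "\<bar>t - a i\<bar> \<le> r \<longleftrightarrow> t \<in> {a i - r..a i + r}" for t i by (auto simp: abs_le_iff)
    then show ?thesis by (auto simp: closed_cube_def PiE_iff split: if_splits)
  qed
  moreover have "compactin (product_topology (\<lambda>i. euclideanreal) UNIV) (\<Pi>\<^sub>E i\<in>UNIV. if i < m then {a i - r..a i + r} else {0})"
    by (subst compactin_PiE) auto
  ultimately show ?thesis by (simp add: euclidean_product_topology)
qed

lemma openin_Euclidean_Diff_compact:
  assumes "eucl_open m V" "compact K"
  shows "eucl_open m (V - K)"
proof -
  obtain S where S: "open S" "V = S \<inter> {x. \<forall>i\<ge>m. x i = 0}"
    using assms(1) unfolding openin_Euclidean_space_iff by auto
  have "closed K" by (rule compact_imp_closed[OF assms(2)])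
  then have "open (S - K)" using S(1) by (rule open_Diff[rotated])
  moreover have "V - K = (S - K) \<inter> {x. \<forall>i\<ge>m. x i = 0}" using S(2) by blast
  ultimately show ?thesis unfolding openin_Euclidean_space_iff by blast
qed

text \<open>The open set \<open>V\<close> and the complement of the compact set \<open>K\<close>
  cover the space, and the extended function is \<open>C1\<close> on each.\<close>

lemma C1_extend_zero:
  assumes V: "eucl_open m V" and f: "C1 m V f"
    and K: "K \<subseteq> V" "compact K" and z: "\<And>x. x \<in> V \<Longrightarrow> x \<notin> K \<Longrightarrow> f x = 0"
  shows "C1 m {x. \<forall>i\<ge>m. x i = 0} (\<lambda>x. if x \<in> V then f x else 0)"
proof (rule C1_local)
  fix x :: "nat \<Rightarrow> real" assume x: "x \<in> {x. \<forall>i\<ge>m. x i = 0}"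
  let ?f = "\<lambda>x. if x \<in> V then f x else 0"
  show "\<exists>W. eucl_open m W \<and> x \<in> W \<and> W \<subseteq> {x. \<forall>i\<ge>m. x i = 0} \<and> C1 m W ?f"
  proof (cases "x \<in> V")
    case True
    have "C1 m V ?f" using f by (subst C1_cong[OF V, of ?f f]) auto
    then show ?thesis using V True openin_Euclidean_space_subset[OF V] by (intro exI[of _ V]) auto
  next
    case False
    let ?W = "{x. \<forall>i\<ge>m. x i = 0} - K"
    have W: "eucl_open m ?W" by (rule openin_Euclidean_Diff_compact[OF openin_Euclidean_UNIV K(2)])
    have "C1 m ?W ?f"
      by (subst C1_cong[OF W, of ?f "\<lambda>_. 0"]) (auto simp: z C1_const)
    then show ?thesis using W x False K(1) by (intro exI[of _ ?W]) auto
  qed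
qed

text \<open>Along every line in direction \<open>i\<close> the fundamental theorem applies between
  two points beyond the cube, where \<open>G\<close> is zero; Fubini does the rest.\<close>

lemma integral_partial_zero:
  assumes G: "C1 m {x. \<forall>i\<ge>m. x i = 0} G" and z: "\<And>x. flat m x \<Longrightarrow> x \<notin> closed_cube m a r \<Longrightarrow> G x = 0"
    and i: "i < m"
  shows "integrable (lebesgue_space m) (\<lambda>x. if \<forall>i\<ge>m. x i = 0 then partial i G x else 0)"
    and "(\<integral>x. (if \<forall>i\<ge>m. x i = 0 then partial i G x else 0) \<partial>lebesgue_space m) = 0"
proof -
  let ?E = "{x :: nat \<Rightarrow> real. \<forall>i\<ge>m. x i = 0}"
  let ?K = "closed_cube m a r"
  let ?g = "\<lambda>x. if \<forall>i\<ge>m. x i = 0 then partial i G x else 0"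
  have E: "eucl_open m ?E" by (rule openin_Euclidean_UNIV)
  have Dz: "partial i G x = 0" if "x \<in> ?E" "x \<notin> ?K" for x
  proof -
    have "partial i G x = partial i (\<lambda>_. 0) x"
      by (rule partial_cong[OF openin_Euclidean_Diff_compact[OF E compact_closed_cube] i]) (use that z in auto)
    then show ?thesis by (simp add: partial_const)
  qed
  have cont: "continuous_on ?E (partial i G)" by (rule C1_continuous_partial[OF G i])
  have KE: "?K \<subseteq> ?E" by (auto simp: closed_cube_def)
  have "compact (partial i G ` ?K)"
    by (rule compact_continuous_image[OF continuous_on_subset[OF cont KE] compact_closed_cube])
  then have "bounded (partial i G ` ?K)" by (rule compact_imp_bounded)
  then obtain B where B: "\<And>x. x \<in> ?K \<Longrightarrow> \<bar>partial i G x\<bar> \<le> B"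
    unfolding bounded_iff by auto
  have gm: "?g \<in> borel_measurable (lebesgue_space m)"
    using borel_measurable_continuous_on_if[OF openin_Euclidean_borel[OF E] cont continuous_on_const[of _ 0]]
    by (simp cong: measurable_cong_sets)
  have K_borel: "?K \<in> sets borel" using compact_closed_cube compact_imp_closed borel_closed by blast
  have fin: "emeasure (lebesgue_space m) ?K < \<infinity>"
  proof (cases "r \<ge> 0")
    case True
    have "?K = {x. flat m x \<and> (\<forall>i<m. x i \<in> {a i - r..a i + r})}"
      unfolding closed_cube_def by (rule Collect_cong) (auto simp: abs_le_iff; force)
    then show ?thesis
      using emeasure_lebesgue_space_box[of m "\<lambda>i. a i - r" "\<lambda>i. a i + r" "\<lambda>i. {a i - r..a i + r}"] True by simp
  next
    case False
    then have "?K = {}" using i by (force simp: closed_cube_def)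
    then show ?thesis by simp
  qed
  show int: "integrable (lebesgue_space m) ?g"
  proof (rule Bochner_Integration.integrable_bound)
    show "integrable (lebesgue_space m) (\<lambda>x. B * indicator ?K x)"
      using K_borel fin by (intro integrable_mult_right integrable_real_indicator) auto
    have "norm (?g x) \<le> norm (B * indicator ?K x)" for x
      using B[of x] Dz[of x] by (auto simp: indicator_def)
    then show "AE x in lebesgue_space m. norm (?g x) \<le> norm (B * indicator ?K x)" by simp
  qed (rule gm)
  show "(\<integral>x. ?g x \<partial>lebesgue_space m) = 0"
  proof (rule integral_lebesgue_space_zero[OF i int])
    fix x :: "nat \<Rightarrow> real" assume x: "\<And>j. j \<ge> m \<Longrightarrow> x j = 0"
    have xE: "x(i := t) \<in> ?E" for t using x i by auto
    define F where "F t = G (x(i := t))" for t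
    define f where "f t = partial i G (x(i := t))" for t
    have out: "x(i := t) \<notin> ?K" if "\<bar>t - a i\<bar> > r" for t
      using that i by (auto simp: closed_cube_def)
    have der: "(F has_real_derivative f t) (at t)" for t
      unfolding F_def f_def by (rule C1_deriv_upd[OF G i xE])
    have cf: "isCont f t" for t
    proof -
      have "continuous_on UNIV f"
        unfolding f_def by (rule continuous_on_compose2[OF cont continuous_on_upd]) (use xE in auto)
      then show ?thesis by (simp add: continuous_on_eq_continuous_at)
    qed
    \<comment> \<open>One unit beyond the cube on either side. The absolute value keeps the interval
      ordered even if \<open>r\<close> is negative.\<close>
    let ?a = "a i - \<bar>r\<bar> - 1" and ?b = "a i + \<bar>r\<bar> + 1"
    have "(\<integral>t. f t * indicator {?a..?b} t \<partial>lborel) = F ?b - F ?a"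
      by (rule integral_FTC_Icc_real) (use der cf in auto)
    also have "F ?b = 0" unfolding F_def by (rule z) (use xE out[of ?b] in auto)
    also have "F ?a = 0" unfolding F_def by (rule z) (use xE out[of ?a] in auto)
    finally have "(\<integral>t. f t * indicator {?a..?b} t \<partial>lborel) = 0" by simp
    moreover have "f t * indicator {?a..?b} t = ?g (x(i := t))" for t
    proof (cases "\<bar>t - a i\<bar> > r")
      case True
      then have "f t = 0" unfolding f_def using Dz xE out by blast
      moreover have "?g (x(i := t)) = f t" using xE[of t] by (simp add: f_def)
      ultimately show ?thesis by simp
    next
      case False
      then have "t \<in> {?a..?b}" by (auto simp: abs_if split: if_splits)
      moreover have "?g (x(i := t)) = f t" using xE[of t] by (simp add: f_def)
      ultimately show ?thesis by simp
    qed
    ultimately show "(\<integral>t. ?g (x(i := t)) \<partial>lborel) = 0" by simp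
  qed
qed

text \<open>In the divergence form of the Laplacian the derivatives of \<open>sqrt (det g)\<close> and of the inverse
  metric combine to the Christoffel symbols.\<close>

lemma divergence_algebra:
  fixes I :: "nat \<Rightarrow> nat \<Rightarrow> real" and D :: "nat \<Rightarrow> nat \<Rightarrow> nat \<Rightarrow> real" and P :: "nat \<Rightarrow> real"
  assumes I: "\<And>i j. i < m \<Longrightarrow> j < m \<Longrightarrow> I i j = I j i"
    and D: "\<And>i j k. i < m \<Longrightarrow> j < m \<Longrightarrow> k < m \<Longrightarrow> D k i j = D k j i"
  shows "(\<Sum>i<m. (\<Sum>a<m. \<Sum>b<m. I b a * D i a b) / 2 * (\<Sum>j<m. I i j * P j)) -
      (\<Sum>i<m. \<Sum>j<m. (\<Sum>a<m. \<Sum>b<m. I i a * D i a b * I b j) * P j) =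
    - (\<Sum>i<m. \<Sum>j<m. I i j * (\<Sum>k<m. (\<Sum>l<m. I k l * (D i j l + D j i l - D l i j)) / 2 * P k))"
proof -
  \<comment> \<open>\<open>W\<close> is the gradient of the function whose derivative is
    \<open>P\<close>. With this index raised, both sides turn into combinations of the two scalars
    \<open>X\<close> and \<open>Y\<close> below, namely into \<open>Y / 2 - X\<close>.\<close>
  define W where "W i = (\<Sum>j<m. I i j * P j)" for i
  have raise: "(\<Sum>k<m. (\<Sum>l<m. I k l * E l) / 2 * P k) = (\<Sum>l<m. E l * W l) / 2" for E
  proof -
    have "(\<Sum>k<m. (\<Sum>l<m. I k l * E l) / 2 * P k) = (\<Sum>k<m. \<Sum>l<m. I k l * E l * P k) / 2"
      by (simp add: sum_distrib_right sum_divide_distrib)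
    also have "(\<Sum>k<m. \<Sum>l<m. I k l * E l * P k) = (\<Sum>l<m. \<Sum>k<m. I k l * E l * P k)" by (rule sum.swap)
    also have "\<dots> = (\<Sum>l<m. E l * W l)"
      unfolding W_def sum_distrib_left by (intro sum.cong refl) (simp add: I)
    finally show ?thesis .
  qed
  define X where "X = (\<Sum>i<m. \<Sum>j<m. I i j * (\<Sum>l<m. D i j l * W l))"
  define Y where "Y = (\<Sum>i<m. \<Sum>j<m. I i j * (\<Sum>l<m. D l i j * W l))"
  have X': "(\<Sum>i<m. \<Sum>j<m. I i j * (\<Sum>l<m. D j i l * W l)) = X"
    unfolding X_def by (subst sum.swap) (intro sum.cong refl, simp add: I)
  have "- (\<Sum>i<m. \<Sum>j<m. I i j * (\<Sum>k<m. (\<Sum>l<m. I k l * (D i j l + D j i l - D l i j)) / 2 * P k)) =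
      - (\<Sum>i<m. \<Sum>j<m. I i j * ((\<Sum>l<m. D i j l * W l) + (\<Sum>l<m. D j i l * W l) - (\<Sum>l<m. D l i j * W l)) / 2)"
    unfolding raise by (simp add: distrib_right left_diff_distrib sum.distrib sum_subtractf)
  also have "\<dots> = - ((X + (\<Sum>i<m. \<Sum>j<m. I i j * (\<Sum>l<m. D j i l * W l)) - Y) / 2)"
    unfolding X_def Y_def sum_divide_distrib[symmetric]
    by (simp add: distrib_left right_diff_distrib sum.distrib sum_subtractf)
  finally have R: "- (\<Sum>i<m. \<Sum>j<m. I i j * (\<Sum>k<m. (\<Sum>l<m. I k l * (D i j l + D j i l - D l i j)) / 2 * P k)) = Y / 2 - X"
    unfolding X' by (simp add: field_simps)
  have "(\<Sum>i<m. (\<Sum>a<m. \<Sum>b<m. I b a * D i a b) / 2 * (\<Sum>j<m. I i j * P j)) =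
      (\<Sum>i<m. \<Sum>a<m. \<Sum>b<m. I a b * (D i a b * W i)) / 2"
    unfolding W_def[symmetric] sum_divide_distrib sum_distrib_right
    by (intro sum.cong refl) (simp add: I)
  also have "(\<Sum>i<m. \<Sum>a<m. \<Sum>b<m. I a b * (D i a b * W i)) = (\<Sum>a<m. \<Sum>b<m. \<Sum>i<m. I a b * (D i a b * W i))"
    by (rule sum_swap3[symmetric])
  also have "\<dots> = Y" by (simp add: Y_def sum_distrib_left)
  finally have L1: "(\<Sum>i<m. (\<Sum>a<m. \<Sum>b<m. I b a * D i a b) / 2 * (\<Sum>j<m. I i j * P j)) = Y / 2" .
  have "(\<Sum>j<m. (\<Sum>a<m. \<Sum>b<m. I i a * D i a b * I b j) * P j) = (\<Sum>a<m. I i a * (\<Sum>b<m. D i a b * W b))" for i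
  proof -
    have "(\<Sum>j<m. (\<Sum>a<m. \<Sum>b<m. I i a * D i a b * I b j) * P j) = (\<Sum>j<m. \<Sum>a<m. \<Sum>b<m. I i a * (D i a b * (I b j * P j)))"
      by (simp add: sum_distrib_right mult.assoc)
    also have "\<dots> = (\<Sum>a<m. \<Sum>b<m. \<Sum>j<m. I i a * (D i a b * (I b j * P j)))" by (rule sum_swap3[symmetric])
    finally show ?thesis by (simp add: W_def sum_distrib_left)
  qed
  then have L2: "(\<Sum>i<m. \<Sum>j<m. (\<Sum>a<m. \<Sum>b<m. I i a * D i a b * I b j) * P j) = X"
    by (simp add: X_def)
  show ?thesis unfolding L1 L2 R ..
qed

text \<open>\<open>metric_product\<close> is the scalar product of the gradients of two functions.\<close>

definition metric_christoffel where
  "metric_christoffel m G x k i j =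
     (\<Sum>l<m. inverse_matrix m (G x) k l *
        (partial i (\<lambda>z. G z j l) x + partial j (\<lambda>z. G z i l) x - partial l (\<lambda>z. G z i j) x)) / 2"

definition metric_hessian where
  "metric_hessian m G h x i j = partial i (partial j h) x - (\<Sum>k<m. metric_christoffel m G x k i j * partial k h x)"

definition metric_laplacian where
  "metric_laplacian m G h x = (\<Sum>i<m. \<Sum>j<m. inverse_matrix m (G x) i j * metric_hessian m G h x i j)"

definition metric_product where
  "metric_product m G f h x = (\<Sum>i<m. \<Sum>j<m. inverse_matrix m (G x) i j * partial i f x * partial j h x)"

lemma partial_sym_metric:
  assumes V: "eucl_open m V" and pd: "\<And>x. x \<in> V \<Longrightarrow> posdef m (G x)" and x: "x \<in> V" and "k < m" "i < m" "j < m"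
  shows "partial k (\<lambda>x. G x i j) x = partial k (\<lambda>x. G x j i) x"
  by (rule partial_cong[OF V \<open>k < m\<close> x]) (rule posdef_sym[OF pd], use assms in auto)

text \<open>The coordinate form of \<open>div (f grad h) = <grad f, grad h> + f \<Delta>h\<close>,
  multiplied by the volume density so that the left side is a plain sum of partial
  derivatives.\<close>

lemma divergence_formula:
  assumes V: "eucl_open m V"
    and G: "\<And>i j. i < m \<Longrightarrow> j < m \<Longrightarrow> C1 m V (\<lambda>x. G x i j)" and pd: "\<And>x. x \<in> V \<Longrightarrow> posdef m (G x)"
    and h: "C2 m V h" and f: "C1 m V f" and x: "x \<in> V"
  shows "(\<Sum>i<m. partial i (\<lambda>x. sqrt (determinant m (G x)) * f x * (\<Sum>j<m. inverse_matrix m (G x) i j * partial j h x)) x) =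
    sqrt (determinant m (G x)) * (metric_product m G f h x + f x * metric_laplacian m G h x)"
proof -
  let ?W = "\<lambda>i x. \<Sum>j<m. inverse_matrix m (G x) i j * partial j h x"
  let ?X = "\<lambda>i x. sqrt (determinant m (G x)) * f x * ?W i x"
  define I where "I = inverse_matrix m (G x)"
  define s where "s = sqrt (determinant m (G x))"
  define D where "D k a b = partial k (\<lambda>x. G x a b) x" for k a b
  define P where "P k = partial k h x" for k
  have pos: "determinant m (G x) > 0" if "x \<in> V" for x by (rule posdef_determinant_pos[OF pd[OF that]])
  have nz: "determinant m (G x) \<noteq> 0" if "x \<in> V" for x using pos[OF that] by simp
  have s: "s > 0" "s * s = determinant m (G x)" using pos[OF x] by (auto simp: s_def)
  note Cd = C1_determinant[OF G] and Ci = C1_inverse_matrix[OF G nz] and Ph = C2_partial[OF h]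
  note Cs = C1_sqrt(1)[OF Cd pos]
  have ds: "partial i (\<lambda>x. sqrt (determinant m (G x))) x = s * ((\<Sum>a<m. \<Sum>b<m. I b a * D i a b) / 2)" if i: "i < m" for i
  proof -
    have "partial i (\<lambda>x. sqrt (determinant m (G x))) x = inverse s / 2 * partial i (\<lambda>x. determinant m (G x)) x"
      unfolding s_def by (rule C1_sqrt(2)[OF Cd pos x i])
    also have "partial i (\<lambda>x. determinant m (G x)) x = s * s * (\<Sum>a<m. \<Sum>b<m. I b a * D i a b)"
      unfolding s(2) I_def D_def by (rule partial_determinant[OF G nz[OF x] x i])
    finally show ?thesis using s(1) by (simp add: field_simps)
  qed
  have di: "partial i (\<lambda>x. inverse_matrix m (G x) a j) x = - (\<Sum>c<m. \<Sum>b<m. I a c * D i c b * I b j)"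
    if "i < m" "j < m" "a < m" for i j a
    unfolding I_def D_def by (rule partial_inverse_matrix[OF V G nz x \<open>i < m\<close> \<open>a < m\<close> \<open>j < m\<close>])
  have C: "C1 m V (?W i)" if "i < m" for i
    by (intro C1_sum(1) C1_mult(1) Ci Ph that) auto
  have dW: "partial i (?W i) x =
      (\<Sum>j<m. - (\<Sum>c<m. \<Sum>b<m. I i c * D i c b * I b j) * P j + I i j * partial i (partial j h) x)" if i: "i < m" for i
  proof -
    have "partial i (?W i) x =
        (\<Sum>j<m. partial i (\<lambda>x. inverse_matrix m (G x) i j * partial j h x) x)"
      by (rule C1_sum(2)[OF _ _ x i]) (auto intro!: C1_mult(1) Ci Ph i)
    also have "\<dots> = (\<Sum>j<m. partial i (\<lambda>x. inverse_matrix m (G x) i j) x * partial j h x + inverse_matrix m (G x) i j * partial i (partial j h) x)"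
      by (intro sum.cong refl C1_mult(2)[OF _ _ x i]) (auto intro!: Ci Ph i)
    finally show ?thesis using i by (simp add: di P_def I_def)
  qed
  have "partial i (?X i) x =
      s * ((\<Sum>a<m. \<Sum>b<m. I b a * D i a b) / 2) * f x * (\<Sum>j<m. I i j * P j) +
      s * partial i f x * (\<Sum>j<m. I i j * P j) +
      s * f x * (\<Sum>j<m. - (\<Sum>c<m. \<Sum>b<m. I i c * D i c b * I b j) * P j + I i j * partial i (partial j h) x)" if i: "i < m" for i
  proof -
    have 1: "partial i (?X i) x =
        partial i (\<lambda>x. sqrt (determinant m (G x)) * f x) x * (\<Sum>j<m. I i j * P j) +
        s * f x * partial i (?W i) x"
      unfolding s_def I_def P_def by (rule C1_mult(2)[OF C1_mult(1)[OF Cs f] C[OF i] x i])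
    have 2: "partial i (\<lambda>x. sqrt (determinant m (G x)) * f x) x = partial i (\<lambda>x. sqrt (determinant m (G x))) x * f x + s * partial i f x"
      unfolding s_def by (rule C1_mult(2)[OF Cs f x i])
    show ?thesis unfolding 1 2 ds[OF i] dW[OF i] by (simp only: distrib_right)
  qed
  note dX = this
  \<comment> \<open>\<open>A i\<close> is the logarithmic derivative of the volume density.
    \<open>B i j\<close> below is minus the derivative in direction \<open>i\<close> of the entry
    \<open>I i j\<close> of the inverse metric.\<close>
  define A where "A i = (\<Sum>a<m. \<Sum>b<m. I b a * D i a b) / 2" for i
  define W where "W i = (\<Sum>j<m. I i j * P j)" for i
  define B where "B i j = (\<Sum>c<m. \<Sum>b<m. I i c * D i c b * I b j)" for i j
  have "(\<Sum>i<m. partial i (?X i) x) =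
      (\<Sum>i<m. s * (\<Sum>j<m. I i j * partial i f x * P j) +
        s * f x * ((\<Sum>j<m. I i j * partial i (partial j h) x) + (A i * W i - (\<Sum>j<m. B i j * P j))))"
  proof (rule sum.cong[OF refl])
    fix i assume "i \<in> {..<m}"
    then have i: "i < m" by simp
    have "(\<Sum>j<m. - B i j * P j + I i j * partial i (partial j h) x) =
        (\<Sum>j<m. I i j * partial i (partial j h) x) - (\<Sum>j<m. B i j * P j)"
      by (simp add: sum.distrib sum_negf sum_subtractf)
    moreover have "(\<Sum>j<m. I i j * partial i f x * P j) = partial i f x * W i"
      unfolding W_def sum_distrib_left by (intro sum.cong refl) simp
    ultimately show "partial i (?X i) x =
        s * (\<Sum>j<m. I i j * partial i f x * P j) +
        s * f x * ((\<Sum>j<m. I i j * partial i (partial j h) x) + (A i * W i - (\<Sum>j<m. B i j * P j)))"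
      unfolding dX[OF i] A_def[symmetric] W_def[symmetric] B_def[symmetric] by (simp only:) (simp add: algebra_simps)
  qed
  also have "\<dots> = s * metric_product m G f h x + s * f x * ((\<Sum>i<m. \<Sum>j<m. I i j * partial i (partial j h) x) +
      ((\<Sum>i<m. A i * W i) - (\<Sum>i<m. \<Sum>j<m. B i j * P j)))"
    unfolding metric_product_def I_def[symmetric] P_def[symmetric]
    by (simp only: sum.distrib sum_distrib_left[symmetric] sum_subtractf)
  also have "(\<Sum>i<m. A i * W i) - (\<Sum>i<m. \<Sum>j<m. B i j * P j) =
       - (\<Sum>i<m. \<Sum>j<m. I i j * (\<Sum>k<m. (\<Sum>l<m. I k l * (D i j l + D j i l - D l i j)) / 2 * P k))"
    unfolding A_def W_def B_def
    by (rule divergence_algebra)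
      (auto simp: I_def D_def intro: posdef_inverse_sym[OF pd[OF x]] partial_sym_metric[OF V pd x])
  also have "(\<Sum>i<m. \<Sum>j<m. I i j * partial i (partial j h) x) + - (\<Sum>i<m. \<Sum>j<m. I i j * (\<Sum>k<m. (\<Sum>l<m. I k l * (D i j l + D j i l - D l i j)) / 2 * P k)) =
      metric_laplacian m G h x"
    unfolding metric_laplacian_def metric_hessian_def metric_christoffel_def I_def D_def P_def
    by (simp add: right_diff_distrib sum_subtractf)
  finally show ?thesis by (simp add: s_def algebra_simps)
qed

lemma integral_divergence_zero:
  assumes V: "eucl_open m V"
    and X: "\<And>i. i < m \<Longrightarrow> C1 m V (X i)" and K: "closed_cube m a r \<subseteq> V"
    and z: "\<And>i x. i < m \<Longrightarrow> x \<in> V \<Longrightarrow> x \<notin> closed_cube m a r \<Longrightarrow> X i x = 0"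
  shows "(\<integral>x. (if x \<in> V then \<Sum>i<m. partial i (X i) x else 0) \<partial>lebesgue_space m) = 0"
proof -
  let ?E = "{x :: nat \<Rightarrow> real. \<forall>i\<ge>m. x i = 0}"
  define Y where "Y i x = (if x \<in> V then X i x else 0)" for i x
  have Y: "C1 m ?E (Y i)" if "i < m" for i
    unfolding Y_def by (rule C1_extend_zero[OF V X[OF that] K compact_closed_cube z[OF that]])
  have Yz: "Y i x = 0" if "i < m" "x \<notin> closed_cube m a r" for i x using z that by (simp add: Y_def)
  have "(if x \<in> V then \<Sum>i<m. partial i (X i) x else 0) = (\<Sum>i<m. if \<forall>i\<ge>m. x i = 0 then partial i (Y i) x else 0)" for x
  proof (cases "x \<in> V")
    case True
    then have "flat m x" using openin_Euclidean_space_subset[OF V] by blast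
    moreover have "partial i (X i) x = partial i (Y i) x" if "i < m" for i
      by (rule partial_cong[OF V that True]) (simp add: Y_def)
    ultimately show ?thesis using True by simp
  next
    case False
    have "(if \<forall>i\<ge>m. x i = 0 then partial i (Y i) x else 0) = 0" if "i < m" for i
    proof (cases "flat m x")
      case True
      have W: "eucl_open m (?E - closed_cube m a r)"
        by (rule openin_Euclidean_Diff_compact[OF openin_Euclidean_UNIV compact_closed_cube])
      have "partial i (Y i) x = partial i (\<lambda>_. 0) x"
        by (rule partial_cong[OF W that]) (use True False K Yz[OF that] in auto)
      then show ?thesis by (simp add: partial_const)
    qed auto
    then show ?thesis using False by simp
  qed
  then have "(\<integral>x. (if x \<in> V then \<Sum>i<m. partial i (X i) x else 0) \<partial>lebesgue_space m) =
      (\<integral>x. (\<Sum>i<m. if \<forall>i\<ge>m. x i = 0 then partial i (Y i) x else 0) \<partial>lebesgue_space m)"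
    by simp
  also have "\<dots> = (\<Sum>i<m. \<integral>x. (if \<forall>i\<ge>m. x i = 0 then partial i (Y i) x else 0) \<partial>lebesgue_space m)"
    by (rule Bochner_Integration.integral_sum) (auto intro!: integral_partial_zero(1)[OF Y Yz])
  also have "\<dots> = 0" by (intro sum.neutral ballI integral_partial_zero(2)[OF Y Yz]) auto
  finally show ?thesis .
qed

section \<open>Green's identity on a compact manifold\<close>

context compact_riemannian
begin

abbreviation (input) "product_in c f h \<equiv> metric_product m (components M c) (loc c f) (loc c h)"
abbreviation (input) "laplacian_in c h \<equiv> metric_laplacian m (components M c) (loc c h)"

section \<open>Functions on the manifold and the scalar product of their gradients\<close>

definition C1_M :: "('a \<Rightarrow> real) \<Rightarrow> bool" where
  "C1_M f \<longleftrightarrow> (\<forall>c\<in>atlas M. C1 m (im c) (loc c f))"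

lemma C1_MD: "C1_M f \<Longrightarrow> c \<in> atlas M \<Longrightarrow> C1 m (im c) (loc c f)"
  by (simp add: C1_M_def)

lemma C1_M_mult: "C1_M f \<Longrightarrow> C1_M g \<Longrightarrow> C1_M (\<lambda>p. f p * g p)"
  unfolding C1_M_def by (auto intro: C1_mult(1))

lemma C1_M_power: "C1_M f \<Longrightarrow> C1_M (\<lambda>p. f p ^ k)"
  unfolding C1_M_def by (auto intro: C1_power(1))

lemma C1_M_sum: "finite I \<Longrightarrow> (\<And>k. k \<in> I \<Longrightarrow> C1_M (f k)) \<Longrightarrow> C1_M (\<lambda>p. \<Sum>k\<in>I. f k p)"
  unfolding C1_M_def by (auto intro: C1_sum(1))

lemma chart_inv_points: "c \<in> atlas M \<Longrightarrow> x \<in> im c \<Longrightarrow> chart_inv c x \<in> points M"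
  using dom_subset chart_inv_dom by blast

lemma C1_M_divide: "C1_M f \<Longrightarrow> C1_M g \<Longrightarrow> (\<And>p. p \<in> points M \<Longrightarrow> g p \<noteq> 0) \<Longrightarrow> C1_M (\<lambda>p. f p / g p)"
  unfolding C1_M_def by (auto intro!: C1_divide simp: chart_inv_points)

lemma continuous_M:
  assumes "\<And>c. c \<in> atlas M \<Longrightarrow> continuous_on (im c) (loc c f)"
  shows "continuous_map T euclideanreal f"
  unfolding continuous_map_def
proof (intro conjI allI impI)
  fix S :: "real set" assume "openin euclideanreal S"
  then have S: "open S" by simp
  have "{p \<in> topspace T. f p \<in> S} = (\<Union>c\<in>atlas M. {p\<in>chart_dom c. chart_map c p \<in> {x\<in>im c. f (chart_inv c x) \<in> S}})"
    using cover dom_subset chart_map_im chart_inv_map unfolding points_def by auto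
  also have "openin T \<dots>"
  proof (intro openin_Union ballI)
    fix U assume "U \<in> (\<lambda>c. {p\<in>chart_dom c. chart_map c p \<in> {x\<in>im c. f (chart_inv c x) \<in> S}}) ` atlas M"
    then obtain c where c: "c \<in> atlas M" "U = {p\<in>chart_dom c. chart_map c p \<in> {x\<in>im c. f (chart_inv c x) \<in> S}}" by blast
    show "openin T U"
      unfolding c(2) by (rule inverse_image_open[OF c(1) openin_Euclidean_vimage[OF im_open[OF c(1)] assms[OF c(1)] S]])
  qed
  finally show "openin T {p \<in> topspace T. f p \<in> S}" .
qed simp

lemma continuous_bounded:
  assumes "continuous_map T euclideanreal f"
  obtains B where "\<And>p. p \<in> points M \<Longrightarrow> \<bar>f p\<bar> \<le> B"
proof -
  have "compactin euclideanreal (f ` topspace T)"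
    using image_compactin[OF _ assms] compact unfolding compact_space_def by blast
  then have "bounded (f ` topspace T)" using compact_imp_bounded by simp
  then show ?thesis using that unfolding bounded_iff points_def by auto
qed

lemma continuous_integrable:
  assumes "continuous_map T euclideanreal f"
  shows "integrable volume f"
proof -
  interpret finite_measure volume by (rule volume_finite_measure)
  obtain B where B: "\<And>p. p \<in> points M \<Longrightarrow> \<bar>f p\<bar> \<le> B" using continuous_bounded[OF assms] by blast
  show ?thesis
    by (rule integrable_const_bound[of _ B]) (auto simp: B space_volume intro!: AE_I2 continuous_measurable[OF assms])
qed

text \<open>A change of charts is an isometry between the coordinate metrics, that is, a submersion
  with invertible differential. So \<open>submersion_inverse_metric\<close> yields the
  transformation law of the inverse metric.\<close>

lemma grad_product_change:
  assumes f: "C1_M f" and h: "C1_M h" and c: "c \<in> atlas M" and d: "d \<in> atlas M" and p: "p \<in> chart_dom c" "p \<in> chart_dom d"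
  shows "product_in c f h (chart_map c p) =
    product_in d f h (chart_map d p)"
proof -
  define U where "U = overlap c d"
  define U' where "U' = chart_map d ` (chart_dom c \<inter> chart_dom d)"
  define \<phi> where "\<phi> = (loc c (chart_map d))"
  define \<psi> where "\<psi> = (loc d (chart_map c))"
  interpret coordinate_change m U U' \<phi> \<psi>
    unfolding U_def U'_def \<phi>_def \<psi>_def by (rule overlap_change[OF c d])
  define x where "x = chart_map c p"
  have x: "x \<in> U" using p by (auto simp: x_def U_def)
  have \<phi>x: "\<phi> x = chart_map d p" using p chart_inv_map[OF c] by (simp add: \<phi>_def x_def)
  define J where "J = jacobian \<phi> x"
  define G where "G = components M c x"
  define H where "H = components M d (\<phi> x)"
  have xim: "x \<in> im c" "\<phi> x \<in> im d" unfolding \<phi>x unfolding x_def using p by (auto intro: chart_map_im)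
  have G: "posdef m G" unfolding G_def using metric_posdef[OF c] xim by (simp add: im_def)
  have H: "posdef m H" unfolding H_def using metric_posdef[OF d] xim by (simp add: im_def)
  have chain: "partial i (loc c F) x = (\<Sum>k<m. J k i * partial k (loc d F) (\<phi> x))" if F: "C1_M F" and i: "i < m" for F i
  proof -
    have "partial i (loc c F) x = partial i (\<lambda>x. F (chart_inv d (\<phi> x))) x"
      by (rule partial_cong[OF U i x]) (auto simp: U_def \<phi>_def chart_inv_map[OF c] chart_inv_map[OF d])
    also have "\<dots> = (\<Sum>k<m. partial k (loc d F) (\<phi> x) * partial i (\<lambda>z. \<phi> z k) x)"
      by (rule partial_compose[OF U im_open[OF d] C1_MD[OF F d] \<phi>C1 _ x i])
        (auto simp: U_def \<phi>_def chart_inv_map[OF c] im_def)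
    finally show ?thesis by (simp add: J_def jacobian_def mult.commute)
  qed
  have push: "(\<Sum>i<m. \<Sum>j<m. J k i * inverse_matrix m G i j * J l j) = inverse_matrix m H k l" if kl: "k < m" "l < m" for k l
  proof (rule submersion_inverse_metric[OF G posdef_det_nz[OF H] posdef_sym[OF H] _ _ kl])
    show "\<exists>v. \<forall>k<m. apply_matrix m J v k = w k" for w
      by (rule exI[of _ "apply_matrix m (jacobian \<psi> (\<phi> x)) w"])
        (auto simp: J_def intro: apply_matrix_cancel jacobian_right_inverse[OF x])
    show "bilinear_form m H (apply_matrix m J v) (apply_matrix m J w) = bilinear_form m G v w" for v w
    proof -
      have "bilinear_form m G v w = (\<Sum>i<m. \<Sum>j<m. (\<Sum>k<m. \<Sum>l<m. J k i * J l j * H k l) * v i * w j)"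
        unfolding bilinear_form_def G_def H_def J_def x_def \<phi>_def
        by (intro sum.cong refl) (simp add: metric_change[OF c d p] chart_inv_map[OF c p(1)])
      also have "\<dots> = (\<Sum>i<m. \<Sum>j<m. \<Sum>k<m. \<Sum>l<m. H k l * (J k i * v i) * (J l j * w j))"
        by (intro sum.cong refl) (simp add: sum_distrib_right sum_distrib_left mult_ac)
      also have "\<dots> = (\<Sum>k<m. \<Sum>l<m. \<Sum>i<m. \<Sum>j<m. H k l * (J k i * v i) * (J l j * w j))" by (rule sum_swap_pairs)
      also have "\<dots> = bilinear_form m H (apply_matrix m J v) (apply_matrix m J w)"
        unfolding bilinear_form_def apply_matrix_def
        by (intro sum.cong refl) (simp add: sum_distrib_left sum_distrib_right mult_ac)
      finally show ?thesis by simp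
    qed
  qed
  define \<xi> where "\<xi> k = partial k (loc d f) (\<phi> x)" for k
  define \<eta> where "\<eta> k = partial k (loc d h) (\<phi> x)" for k
  have "product_in c f h x =
      (\<Sum>i<m. \<Sum>j<m. inverse_matrix m G i j * (\<Sum>k<m. J k i * \<xi> k) * (\<Sum>l<m. J l j * \<eta> l))"
    unfolding metric_product_def G_def[symmetric] by (intro sum.cong refl) (simp add: chain f h \<xi>_def \<eta>_def)
  also have "\<dots> = (\<Sum>i<m. \<Sum>j<m. \<Sum>k<m. \<Sum>l<m. J k i * inverse_matrix m G i j * J l j * \<xi> k * \<eta> l)"
    by (intro sum.cong refl) (simp add: sum_distrib_left sum_distrib_right mult_ac)
  also have "\<dots> = (\<Sum>k<m. \<Sum>l<m. \<Sum>i<m. \<Sum>j<m. J k i * inverse_matrix m G i j * J l j * \<xi> k * \<eta> l)" by (rule sum_swap_pairs)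
  also have "\<dots> = (\<Sum>k<m. \<Sum>l<m. inverse_matrix m H k l * \<xi> k * \<eta> l)"
    by (intro sum.cong refl) (simp add: push[symmetric] sum_distrib_right)
  also have "\<dots> = product_in d f h (\<phi> x)"
    by (simp add: metric_product_def H_def \<xi>_def \<eta>_def)
  finally show ?thesis unfolding \<phi>x unfolding x_def .
qed

text \<open>The chart is an arbitrary choice; by \<open>grad_product_change\<close> the value for
  \<open>C1\<close> functions does not depend on it.\<close>

definition grad_product :: "('a \<Rightarrow> real) \<Rightarrow> ('a \<Rightarrow> real) \<Rightarrow> 'a \<Rightarrow> real" where
  "grad_product f h p = (let c = SOME c. c \<in> atlas M \<and> p \<in> chart_dom c in
     product_in c f h (chart_map c p))"

lemma grad_product_chart:
  assumes f: "C1_M f" and h: "C1_M h" and c: "c \<in> atlas M" and p: "p \<in> chart_dom c"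
  shows "grad_product f h p =
    product_in c f h (chart_map c p)"
proof -
  define d where "d = (SOME c. c \<in> atlas M \<and> p \<in> chart_dom c)"
  have d: "d \<in> atlas M \<and> p \<in> chart_dom d" unfolding d_def by (rule someI[of _ c]) (use c p in simp)
  have "grad_product f h p = product_in d f h (chart_map d p)"
    by (simp add: grad_product_def d_def Let_def)
  also have "\<dots> = product_in c f h (chart_map c p)"
    by (rule grad_product_change[OF f h]) (use c p d in auto)
  finally show ?thesis .
qed

lemma grad_product_inv:
  assumes "C1_M f" "C1_M h" "c \<in> atlas M" "x \<in> im c"
  shows "grad_product f h (chart_inv c x) =
    product_in c f h x"
  using grad_product_chart[OF assms(1,2,3) chart_inv_dom[OF assms(4)]] chart_map_inv[OF assms(4)] by simp

lemma continuous_grad_product: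
  assumes f: "C1_M f" and h: "C1_M h"
  shows "continuous_map T euclideanreal (grad_product f h)"
proof (rule continuous_M)
  fix c assume c: "c \<in> atlas M"
  have "continuous_on (im c) (product_in c f h)"
    unfolding metric_product_def
  proof (intro continuous_on_sum continuous_on_mult)
    fix i j assume "i \<in> {..<m}" "j \<in> {..<m}"
    then show "continuous_on (im c) (\<lambda>x. inverse_matrix m (components M c x) i j)"
      by (intro C1_continuous[of m] C1_inverse_matrix) (auto simp: im_def metric_C1[OF c] posdef_det_nz metric_posdef[OF c])
  qed (auto intro!: C1_continuous_partial C1_MD f h c)
  then show "continuous_on (im c) (\<lambda>x. grad_product f h (chart_inv c x))"
    using grad_product_inv[OF f h c] continuous_on_cong by metis
qed

lemma grad_product_local_zero:
  assumes f: "C1_M f" and h: "C1_M h" and U: "openin T U" "p \<in> U" and z: "\<And>q. q \<in> U \<Longrightarrow> f q = 0"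
  shows "grad_product f h p = 0"
proof -
  have "p \<in> points M" using U openin_subset unfolding points_def by blast
  then obtain c where c: "c \<in> atlas M" "p \<in> chart_dom c" using cover by blast
  have W: "eucl_open m (image_in c U)"
    by (rule image_open[OF c(1)]) (use U dom_open[OF c(1)] in auto)
  have "partial i (loc c f) (chart_map c p) = partial i (\<lambda>x. 0) (chart_map c p)" if "i < m" for i
    by (rule partial_cong[OF W that]) (use U c z chart_inv_map[OF c(1)] in auto)
  then show ?thesis
    unfolding grad_product_chart[OF f h c] metric_product_def by (simp add: partial_const)
qed

text \<open>A compact set in a Hausdorff space is closed. So off such a cube a cutoff function
  vanishes on an open set of the whole manifold, not merely of the chart.\<close>

lemma closedin_cube_preimage:
  assumes c: "c \<in> atlas M" and K: "closed_cube m a r \<subseteq> im c"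
  shows "closedin T (chart_inv c ` closed_cube m a r)"
proof -
  let ?K = "closed_cube m a r"
  have KE: "?K \<subseteq> {x. \<forall>i\<ge>m. x i = 0}" by (auto simp: closed_cube_def)
  have "compactin (Euclidean_space m) ?K"
    unfolding Euclidean_space_def compactin_subtopology euclidean_product_topology
    using compact_closed_cube KE by simp
  then have "compactin (subtopology (Euclidean_space m) (im c)) ?K"
    using K by (simp add: compactin_subtopology)
  moreover have "chart_map c ` (chart_inv c ` ?K) = ?K"
    using K chart_map_inv by (force simp: image_image)
  moreover have "chart_inv c ` ?K \<subseteq> topspace (subtopology T (chart_dom c))"
    using K chart_inv_dom dom_subset[OF c] unfolding points_def by auto
  ultimately have "compactin (subtopology T (chart_dom c)) (chart_inv c ` ?K)"
    using homeomorphic_map_compactness[OF chart_homeomorphic[OF c], of "chart_inv c ` ?K"] by simp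
  then have "compactin T (chart_inv c ` ?K)" by (simp add: compactin_subtopology)
  then show ?thesis by (rule compactin_imp_closedin[OF hausdorff])
qed

text \<open>The support of \<open>f\<close> lies in one chart, where the integrand times the density
  is the coordinate divergence of a compactly supported field. The Laplacian enters as a function
  \<open>L\<close> that represents it in every chart, so its invariance under coordinate changes is
  an assumption on \<open>h\<close>.\<close>

lemma greens_identity_chart:
  assumes c: "c \<in> atlas M" and K: "closed_cube m a r \<subseteq> im c"
    and f: "C1_M f" and z: "\<And>p. p \<in> points M \<Longrightarrow> p \<notin> chart_inv c ` closed_cube m a r \<Longrightarrow> f p = 0"
    and h: "\<And>c. c \<in> atlas M \<Longrightarrow> C2 m (im c) (loc c h)"
    and L: "continuous_map T euclideanreal L"
      "\<And>c x. c \<in> atlas M \<Longrightarrow> x \<in> im c \<Longrightarrow> L (chart_inv c x) = laplacian_in c h x"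
  shows "(\<integral>p. grad_product f h p + f p * L p \<partial>volume) = 0"
proof -
  let ?X = "\<lambda>i x. root_det c x * f (chart_inv c x) *
    (\<Sum>j<m. inverse_matrix m (components M c x) i j * partial j (loc c h) x)"
  have hC: "C1_M h" unfolding C1_M_def using C2_C1[OF h] by blast
  have fc: "continuous_map T euclideanreal f" by (rule continuous_M[OF C1_continuous[OF C1_MD[OF f]]])
  let ?K = "closed_cube m a r"
  have cl: "openin T (topspace T - chart_inv c ` ?K)" using closedin_cube_preimage[OF c K] by (simp add: closedin_def)
  have "(\<integral>p. grad_product f h p + f p * L p \<partial>volume) =
      (\<integral>x. chart_density c x * (grad_product f h (chart_inv c x) + f (chart_inv c x) * L (chart_inv c x)) \<partial>lebesgue_space m)"
  proof (rule integral_volume_chart[OF c])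
    show "(\<lambda>p. grad_product f h p + f p * L p) \<in> borel_measurable volume"
      by (intro borel_measurable_add borel_measurable_times continuous_measurable continuous_grad_product f hC fc L)
    fix p assume p: "p \<in> points M" "p \<notin> chart_dom c"
    then have pK: "p \<notin> chart_inv c ` ?K" using K chart_inv_dom by blast
    have "grad_product f h p = 0"
      by (rule grad_product_local_zero[OF f hC cl]) (use p pK z in \<open>auto simp: points_def\<close>)
    then show "grad_product f h p + f p * L p = 0" using z[OF p(1) pK] by simp
  qed
  also have "\<dots> = (\<integral>x. (if x \<in> im c then \<Sum>i<m. partial i (?X i) x else 0) \<partial>lebesgue_space m)"
  proof (rule Bochner_Integration.integral_cong[OF refl])
    fix x
    show "chart_density c x * (grad_product f h (chart_inv c x) + f (chart_inv c x) * L (chart_inv c x)) =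
      (if x \<in> im c then \<Sum>i<m. partial i (?X i) x else 0)"
    proof (cases "x \<in> im c")
      case True
      have "(\<Sum>i<m. partial i (?X i) x) =
        root_det c x * (product_in c f h x +
          f (chart_inv c x) * laplacian_in c h x)"
        by (rule divergence_formula[OF im_open[OF c] _ _ h[OF c] C1_MD[OF f c] True])
          (auto simp: im_def metric_C1[OF c] metric_posdef[OF c])
      then show ?thesis using True by (simp add: chart_density_def grad_product_inv[OF f hC c] L(2)[OF c])
    qed (simp add: chart_density_def)
  qed
  also have "\<dots> = 0"
  proof (rule integral_divergence_zero[OF im_open[OF c] _ K])
    show "C1 m (im c) (?X i)" if "i < m" for i
      by (intro C1_mult(1) C1_density[OF c] C1_MD[OF f c] C1_sum(1) C1_inverse_matrix C2_partial[OF h[OF c]] that)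
        (auto simp: im_def metric_C1[OF c] posdef_det_nz metric_posdef[OF c])
    fix i x assume x: "x \<in> im c" "x \<notin> ?K"
    have "chart_inv c x \<notin> chart_inv c ` ?K"
    proof
      assume "chart_inv c x \<in> chart_inv c ` ?K"
      then obtain y where y: "y \<in> ?K" "chart_inv c x = chart_inv c y" by blast
      then have "x = y" using chart_map_inv[OF x(1)] chart_map_inv[of y c] K by auto
      then show False using x y by simp
    qed
    then have "f (chart_inv c x) = 0" by (intro z chart_inv_points[OF c x(1)])
    then show "?X i x = 0" by simp
  qed
  finally show ?thesis .
qed

text \<open>Positive parts of parabolas, squared to remove the kink at the boundary of the cube.
  This gives \<open>C1\<close>, the regularity that Green's identity asks of its first function,
  without exponential cutoffs.\<close>

lemma C1_bump:
  "C1 m V (\<lambda>y. \<Prod>i<m. (max 0 (1 - ((y i - a i) / r)\<^sup>2))\<^sup>2)"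
proof (rule C1_prod)
  fix i
  have d: "((\<lambda>u :: real. (max 0 u)\<^sup>2) has_real_derivative 2 * max 0 u) (at u)" for u
  proof (cases "u = 0")
    case True
    have "((\<lambda>t :: real. max 0 t) \<longlongrightarrow> max 0 0) (at 0)" by (intro tendsto_max tendsto_const tendsto_ident_at)
    moreover have "\<forall>\<^sub>F t in at 0. max 0 t = ((max 0 t)\<^sup>2 - (max 0 0)\<^sup>2) / (t - (0 :: real))"
      by (auto simp: eventually_at_filter max_def power2_eq_square)
    ultimately show ?thesis
      unfolding True has_field_derivative_iff by (simp add: Lim_transform_eventually)
  next
    case False
    then consider "u > 0" | "u < 0" by linarith
    then show ?thesis
    proof cases
      case 1
      have "((\<lambda>u :: real. u\<^sup>2) has_real_derivative 2 * max 0 u) (at u)"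
        using 1 by (auto intro!: derivative_eq_intros)
      then show ?thesis
        by (rule has_field_derivative_transform_within_open[of _ _ _ "{0<..}"]) (use 1 in auto)
    next
      case 2
      have "((\<lambda>u :: real. 0) has_real_derivative 2 * max 0 u) (at u)" using 2 by simp
      then show ?thesis
        by (rule has_field_derivative_transform_within_open[of _ _ _ "{..<0}"]) (use 2 in auto)
    qed
  qed
  have "C1 m V (\<lambda>y. 1 - ((y i - a i) * inverse r)\<^sup>2)"
    by (intro C1_diff(1) C1_power(1) C1_mult(1) C1_const C1_coord)
  moreover have "continuous_on S (\<lambda>u :: real. 2 * max 0 u)" for S
    by (intro continuous_on_mult continuous_on_max continuous_on_const continuous_on_id)
  ultimately show "C1 m V (\<lambda>y. (max 0 (1 - ((y i - a i) / r)\<^sup>2))\<^sup>2)"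
    using C1_real_compose(1)[of m V "\<lambda>y. 1 - ((y i - a i) * inverse r)\<^sup>2" "\<lambda>u. (max 0 u)\<^sup>2" "\<lambda>u. 2 * max 0 u", OF _ d]
    by (simp add: divide_inverse)
qed simp

text \<open>The closed cube has half the radius of one known to lie in the chart image. At points
  outside the chart the zero extension is still \<open>C1\<close>, because it vanishes on the open
  complement of the compact cube.\<close>

lemma bump_M:
  assumes p: "p \<in> points M"
  shows "\<exists>\<psi> c a r. c \<in> atlas M \<and> closed_cube m a r \<subseteq> im c \<and> C1_M \<psi> \<and> (\<forall>q. 0 \<le> \<psi> q) \<and> 0 < \<psi> p \<and>
    (\<forall>q\<in>points M. q \<notin> chart_inv c ` closed_cube m a r \<longrightarrow> \<psi> q = 0)"
proof -
  obtain c where c: "c \<in> atlas M" "p \<in> chart_dom c" using p cover by blast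
  define a where "a = chart_map c p"
  have a: "a \<in> im c" unfolding a_def by (rule chart_map_im[OF c(2)])
  obtain r0 where r0: "r0 > 0" "\<And>y. flat m y \<Longrightarrow> close m r0 a y \<Longrightarrow> y \<in> im c"
    using openin_Euclidean_cube[OF im_open[OF c(1)] a] by blast
  define r where "r = r0 / 2"
  have r: "0 < r" "r < r0" using r0(1) by (auto simp: r_def)
  let ?K = "closed_cube m a r"
  have K: "?K \<subseteq> im c"
  proof
    fix y assume y: "y \<in> ?K"
    show "y \<in> im c" by (rule r0(2)) (use y r in \<open>force simp: closed_cube_def\<close>)+
  qed
  define b where "b y = (\<Prod>i<m. (max 0 (1 - ((y i - a i) / r)\<^sup>2))\<^sup>2)" for y :: "nat \<Rightarrow> real"
  have b0: "b y = 0" if "y \<in> im c" "y \<notin> ?K" for y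
  proof -
    have "flat m y" using openin_Euclidean_space_subset[OF im_open[OF c(1)] that(1)] by blast
    then have "\<exists>i<m. \<not> \<bar>y i - a i\<bar> \<le> r" using that(2) unfolding closed_cube_def by blast
    then obtain i where i: "i < m" "\<bar>y i - a i\<bar> > r" by (auto simp: not_le)
    then have "1 < \<bar>(y i - a i) / r\<bar>" using r by (simp add: abs_divide)
    then have "1 < \<bar>(y i - a i) / r\<bar>\<^sup>2" by (rule one_less_power) simp
    then have "1 < ((y i - a i) / r)\<^sup>2" by (simp only: power2_abs)
    then have "(max 0 (1 - ((y i - a i) / r)\<^sup>2))\<^sup>2 = 0" by simp
    then show ?thesis unfolding b_def using i(1) by (intro prod_zero) auto
  qed
  define \<psi> where "\<psi> q = (if q \<in> chart_dom c then b (chart_map c q) else 0)" for q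
  have z: "\<psi> q = 0" if "q \<in> points M" "q \<notin> chart_inv c ` ?K" for q
  proof (cases "q \<in> chart_dom c")
    case True
    have "chart_map c q \<notin> ?K" using that(2) chart_inv_map[OF c(1) True] by force
    then show ?thesis using b0 chart_map_im[OF True] by (simp add: \<psi>_def)
  qed (simp add: \<psi>_def)
  have "C1_M \<psi>"
    unfolding C1_M_def
  proof (intro ballI C1_local)
    fix d x assume d: "d \<in> atlas M" and x: "x \<in> im d"
    define q where "q = chart_inv d x"
    have q: "q \<in> chart_dom d" "chart_map d q = x" using chart_inv_dom[OF x] chart_map_inv[OF x] by (auto simp: q_def)
    show "\<exists>W. eucl_open m W \<and> x \<in> W \<and> W \<subseteq> im d \<and> C1 m W (loc d \<psi>)"
    proof (cases "q \<in> chart_dom c")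
      case True
      interpret coordinate_change m "overlap d c" "chart_map c ` (chart_dom d \<inter> chart_dom c)"
        "\<lambda>x. chart_map c (chart_inv d x)" "\<lambda>x. chart_map d (chart_inv c x)"
        by (rule overlap_change[OF d c(1)])
      let ?W = "overlap d c"
      have "C1 m ?W (\<lambda>x. b (chart_map c (chart_inv d x)))"
        unfolding b_def by (rule C1_compose[OF U U' C1_bump \<phi>C1 \<phi>U])
      then have "C1 m ?W (loc d \<psi>)"
        by (subst C1_cong[OF U, of _ "\<lambda>x. b (chart_map c (chart_inv d x))"]) (auto simp: \<psi>_def chart_inv_map[OF d])
      then show ?thesis using U True q by (intro exI[of _ ?W]) (auto simp: im_def)
    next
      case False
      define N where "N = (topspace T - chart_inv c ` ?K) \<inter> chart_dom d"
      have N: "openin T N"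
        unfolding N_def using closedin_cube_preimage[OF c(1) K] dom_open[OF d] by (auto simp: closedin_def)
      let ?W = "chart_map d ` N"
      have W: "eucl_open m ?W" by (rule image_open[OF d N]) (auto simp: N_def)
      have "C1 m ?W (loc d \<psi>)"
        by (subst C1_cong[OF W, of _ "\<lambda>x. 0"]) (auto simp: N_def chart_inv_map[OF d] points_def intro: z C1_const)
      moreover have "q \<notin> chart_inv c ` ?K" using False K chart_inv_dom by blast
      then have "q \<in> N" using q dom_subset[OF d] by (auto simp: N_def points_def)
      then have "x \<in> ?W" using q by blast
      ultimately show ?thesis using W by (intro exI[of _ ?W]) (auto simp: im_def N_def)
    qed
  qed
  moreover have "0 \<le> \<psi> q" for q unfolding \<psi>_def b_def by (auto intro: prod_nonneg)
  moreover have "0 < \<psi> p" unfolding \<psi>_def b_def using c(2) by (auto simp: a_def[symmetric] intro!: prod_pos)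
  ultimately show ?thesis using c(1) K z by blast
qed

text \<open>Finitely many of the sets where a bump is positive cover the compact manifold. The bumps
  are indexed by the points at which they were built, and their sum is positive everywhere, ready
  for normalization.\<close>

lemma finite_bumps:
  "\<exists>(I :: 'a set) \<psi> c a r. finite I \<and> (\<forall>k\<in>I. c k \<in> atlas M \<and> closed_cube m (a k) (r k) \<subseteq> im (c k) \<and> C1_M (\<psi> k) \<and>
    (\<forall>q\<in>points M. q \<notin> chart_inv (c k) ` closed_cube m (a k) (r k) \<longrightarrow> \<psi> k q = 0)) \<and>
    (\<forall>q\<in>points M. (\<Sum>k\<in>I. \<psi> k q) > 0)"
proof -
  define P where "P p t = (case t of (\<psi>, c, a, r) \<Rightarrow> c \<in> atlas M \<and> closed_cube m a r \<subseteq> im c \<and> C1_M \<psi> \<and> (\<forall>q. 0 \<le> \<psi> q) \<and> 0 < \<psi> p \<and>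
    (\<forall>q\<in>points M. q \<notin> chart_inv c ` closed_cube m a r \<longrightarrow> \<psi> q = 0))" for p t
  have "\<forall>p\<in>points M. \<exists>t. P p t"
  proof
    fix p assume "p \<in> points M"
    from bump_M[OF this] obtain \<psi> c a r where "P p (\<psi>, c, a, r)" unfolding P_def by auto
    then show "\<exists>t. P p t" by blast
  qed
  from bchoice[OF this] obtain t where t: "\<forall>p\<in>points M. P p (t p)" by blast
  define \<psi> c a r where "\<psi> p = fst (t p)" and "c p = fst (snd (t p))" and "a p = fst (snd (snd (t p)))" and "r p = snd (snd (snd (t p)))" for p
  have *: "c p \<in> atlas M \<and> closed_cube m (a p) (r p) \<subseteq> im (c p) \<and> C1_M (\<psi> p) \<and>
    (\<forall>q. 0 \<le> \<psi> p q) \<and> 0 < \<psi> p p \<and> (\<forall>q\<in>points M. q \<notin> chart_inv (c p) ` closed_cube m (a p) (r p) \<longrightarrow> \<psi> p q = 0)"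
    if "p \<in> points M" for p
    using t that unfolding P_def \<psi>_def c_def a_def r_def by (auto simp: case_prod_beta)
  define W where "W p = {q \<in> topspace T. \<psi> p q \<in> {0<..}}" for p
  have W: "openin T (W p)" if "p \<in> points M" for p
  proof -
    have "continuous_map T euclideanreal (\<psi> p)"
      using * that by (intro continuous_M[OF C1_continuous[OF C1_MD]]) auto
    then show ?thesis unfolding W_def by (rule openin_continuous_map_preimage) simp
  qed
  have "p \<in> W p" if "p \<in> points M" for p using *[OF that] that unfolding W_def points_def by simp
  then have "topspace T \<subseteq> \<Union>(W ` points M)" unfolding points_def by blast
  moreover have "\<forall>U\<in>W ` points M. openin T U" using W by blast
  ultimately obtain \<F> where F: "finite \<F>" "\<F> \<subseteq> W ` points M" "topspace T \<subseteq> \<Union>\<F>"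
    using compact unfolding compact_space_alt by meson
  then obtain I where I: "finite I" "I \<subseteq> points M" "\<F> = W ` I" by (metis finite_subset_image)
  have "(\<Sum>k\<in>I. \<psi> k q) > 0" if q: "q \<in> points M" for q
  proof -
    obtain k where k: "k \<in> I" "q \<in> W k" using F(3) I(3) q unfolding points_def by blast
    show ?thesis by (rule sum_pos2[OF I(1) k(1)]) (use k * I(2) in \<open>auto simp: W_def\<close>)
  qed
  moreover have "\<forall>k\<in>I. c k \<in> atlas M \<and> closed_cube m (a k) (r k) \<subseteq> im (c k) \<and> C1_M (\<psi> k) \<and>
    (\<forall>q\<in>points M. q \<notin> chart_inv (c k) ` closed_cube m (a k) (r k) \<longrightarrow> \<psi> k q = 0)"
    using * I(2) by blast
  ultimately show ?thesis using I(1) by blast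
qed

text \<open>A partition of unity made from the bumps reduces the identity to functions supported in
  single charts; both terms of the integrand are additive in \<open>F\<close>.\<close>

theorem greens_identity:
  assumes F: "C1_M F" and h: "\<And>c. c \<in> atlas M \<Longrightarrow> C2 m (im c) (loc c h)"
    and L: "continuous_map T euclideanreal L"
      "\<And>c x. c \<in> atlas M \<Longrightarrow> x \<in> im c \<Longrightarrow> L (chart_inv c x) = laplacian_in c h x"
  shows "(\<integral>p. grad_product F h p + F p * L p \<partial>volume) = 0"
proof -
  have hC: "C1_M h" unfolding C1_M_def using C2_C1[OF h] by blast
  from finite_bumps obtain I :: "'a set" and \<psi> c a r where *: "finite I \<and> (\<forall>k\<in>I. c k \<in> atlas M \<and> closed_cube m (a k) (r k) \<subseteq> im (c k) \<and> C1_M (\<psi> k) \<and>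
    (\<forall>q\<in>points M. q \<notin> chart_inv (c k) ` closed_cube m (a k) (r k) \<longrightarrow> \<psi> k q = 0)) \<and>
    (\<forall>q\<in>points M. (\<Sum>k\<in>I. \<psi> k q) > 0)"
    by (elim exE) (rule that)
  then have I: "finite I"
    and k: "\<And>k. k \<in> I \<Longrightarrow> c k \<in> atlas M \<and> closed_cube m (a k) (r k) \<subseteq> im (c k) \<and> C1_M (\<psi> k) \<and>
      (\<forall>q\<in>points M. q \<notin> chart_inv (c k) ` closed_cube m (a k) (r k) \<longrightarrow> \<psi> k q = 0)"
    and pos: "\<And>q. q \<in> points M \<Longrightarrow> (\<Sum>k\<in>I. \<psi> k q) > 0"
    by simp_all
  define S where "S q = (\<Sum>k\<in>I. \<psi> k q)" for q
  have S: "C1_M S" unfolding S_def by (rule C1_M_sum[OF I]) (use k in blast)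
  \<comment> \<open>The quotients \<open>\<psi> k / S\<close> form the partition of unity;
    multiplied by \<open>F\<close> they decompose it into chart-supported summands.\<close>
  define f where "f k q = \<psi> k q / S q * F q" for k q
  have f: "C1_M (f k)" if "k \<in> I" for k
    unfolding f_def using k[OF that] pos by (intro C1_M_mult C1_M_divide S F) (auto simp: S_def less_imp_neq[symmetric])
  have sum_f: "(\<Sum>k\<in>I. f k q) = F q" if "q \<in> points M" for q
  proof -
    have "(\<Sum>k\<in>I. f k q) = (\<Sum>k\<in>I. \<psi> k q) / S q * F q" by (simp add: f_def sum_divide_distrib sum_distrib_right)
    then show ?thesis using pos[OF that] by (simp add: S_def)
  qed
  have sum_g: "(\<Sum>k\<in>I. grad_product (f k) h q) = grad_product F h q" if q: "q \<in> points M" for q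
  proof -
    obtain d where d: "d \<in> atlas M" "q \<in> chart_dom d" using q cover by blast
    define x where "x = chart_map d q"
    have x: "x \<in> im d" unfolding x_def by (rule chart_map_im[OF d(2)])
    have "partial i (loc d F) x = (\<Sum>k\<in>I. partial i (loc d (f k)) x)" if i: "i < m" for i
    proof -
      have "partial i (loc d F) x = partial i (\<lambda>x. \<Sum>k\<in>I. f k (chart_inv d x)) x"
        by (rule partial_cong[OF im_open[OF d(1)] i x]) (simp add: sum_f chart_inv_points[OF d(1)])
      also have "\<dots> = (\<Sum>k\<in>I. partial i (loc d (f k)) x)"
        by (rule C1_sum(2)[OF I C1_MD[OF f d(1)] x i])
      finally show ?thesis .
    qed
    then have "product_in d F h x =
        (\<Sum>i<m. \<Sum>j<m. \<Sum>k\<in>I. inverse_matrix m (components M d x) i j * partial i (loc d (f k)) x * partial j (loc d h) x)"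
      unfolding metric_product_def by (intro sum.cong refl) (simp add: sum_distrib_left sum_distrib_right)
    also have "\<dots> = (\<Sum>i<m. \<Sum>k\<in>I. \<Sum>j<m. inverse_matrix m (components M d x) i j * partial i (loc d (f k)) x * partial j (loc d h) x)" by (intro sum.cong refl sum.swap)
    also have "\<dots> = (\<Sum>k\<in>I. product_in d (f k) h x)"
      unfolding metric_product_def by (rule sum.swap)
    also have "\<dots> = (\<Sum>k\<in>I. grad_product (f k) h q)"
      by (intro sum.cong refl) (simp add: grad_product_chart[OF f hC d] x_def)
    finally show ?thesis by (simp add: grad_product_chart[OF F hC d] x_def)
  qed
  have cont: "continuous_map T euclideanreal g" if "C1_M g" for g by (rule continuous_M[OF C1_continuous[OF C1_MD[OF that]]])
  have int: "integrable volume (\<lambda>p. grad_product (f k) h p + f k p * L p)" if "k \<in> I" for k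
    by (intro continuous_integrable continuous_map_add continuous_map_real_mult continuous_grad_product f that hC L cont)
  have "(\<integral>p. grad_product F h p + F p * L p \<partial>volume) = (\<integral>p. (\<Sum>k\<in>I. grad_product (f k) h p + f k p * L p) \<partial>volume)"
    by (rule Bochner_Integration.integral_cong[OF refl])
      (simp add: space_volume sum.distrib sum_g sum_f flip: sum_distrib_right)
  also have "\<dots> = (\<Sum>k\<in>I. \<integral>p. grad_product (f k) h p + f k p * L p \<partial>volume)"
    by (rule Bochner_Integration.integral_sum) (rule int)
  also have "\<dots> = 0"
  proof (intro sum.neutral ballI)
    fix j assume j: "j \<in> I"
    show "(\<integral>p. grad_product (f j) h p + f j p * L p \<partial>volume) = 0"
      by (rule greens_identity_chart[of "c j" "a j" "r j"]) (use k[OF j] f[OF j] h L in \<open>auto simp: f_def\<close>)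
  qed
  finally show ?thesis .
qed

end

section \<open>Functions whose gradients have prescribed scalar products\<close>

lemma metric_hessian_sym:
  assumes V: "eucl_open m V" and pd: "\<And>x. x \<in> V \<Longrightarrow> posdef m (G x)"
    and h: "C2 m V h" and x: "x \<in> V" and ij: "i < m" "j < m"
  shows "metric_hessian m G h x i j = metric_hessian m G h x j i"
proof -
  have "metric_christoffel m G x k i j = metric_christoffel m G x k j i" if "k < m" for k
    unfolding metric_christoffel_def
    by (intro arg_cong[where f = "\<lambda>t. t / 2"] sum.cong refl) (simp add: partial_sym_metric[OF V pd x _ ij])
  then show ?thesis
    unfolding metric_hessian_def using partial_commute[OF V h x ij] by simp
qed

text \<open>Compatibility of the Levi-Civita connection with the metric: the derivative of
  \<open><grad p, grad q>\<close> in direction \<open>X\<close> is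
  \<open>Hess p (X, grad q) + Hess q (X, grad p)\<close>.\<close>

lemma partial_metric_product:
  assumes V: "eucl_open m V"
    and G: "\<And>i j. i < m \<Longrightarrow> j < m \<Longrightarrow> C1 m V (\<lambda>x. G x i j)" and pd: "\<And>x. x \<in> V \<Longrightarrow> posdef m (G x)"
    and p: "C2 m V p" and q: "C2 m V q" and x: "x \<in> V" and k: "k < m"
  shows "partial k (metric_product m G p q) x =
    (\<Sum>i<m. metric_hessian m G p x k i * (\<Sum>j<m. inverse_matrix m (G x) i j * partial j q x)) +
    (\<Sum>i<m. metric_hessian m G q x k i * (\<Sum>j<m. inverse_matrix m (G x) i j * partial j p x))"
proof -
  define I where "I = inverse_matrix m (G x)"
  define D where "D k a b = partial k (\<lambda>x. G x a b) x" for k a b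
  define P where "P i = (\<Sum>j<m. I i j * partial j p x)" for i
  define Q where "Q i = (\<Sum>j<m. I i j * partial j q x)" for i
  have nz: "determinant m (G x) \<noteq> 0" if "x \<in> V" for x by (rule posdef_det_nz[OF pd[OF that]])
  have Isym: "I i j = I j i" if "i < m" "j < m" for i j unfolding I_def by (rule posdef_inverse_sym[OF pd[OF x] that])
  have Dsym: "D k i j = D k j i" if "k < m" "i < m" "j < m" for k i j unfolding D_def by (rule partial_sym_metric[OF V pd x that])
  have Ci: "C1 m V (\<lambda>x. inverse_matrix m (G x) i j)" if "i < m" "j < m" for i j
    by (rule C1_inverse_matrix[OF _ _ that]) (use G nz in auto)
  have di: "partial k (\<lambda>x. inverse_matrix m (G x) i j) x = - (\<Sum>a<m. \<Sum>b<m. I i a * D k a b * I b j)"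
    if "i < m" "j < m" for i j
    unfolding I_def D_def by (rule partial_inverse_matrix[OF V G nz x k that])
  have "partial k (metric_product m G p q) x = (\<Sum>i<m. \<Sum>j<m. partial k (\<lambda>x. inverse_matrix m (G x) i j * partial i p x * partial j q x) x)"
  proof -
    have 1: "C1 m V (\<lambda>x. inverse_matrix m (G x) i j * partial i p x * partial j q x)" if "i < m" "j < m" for i j
      by (intro C1_mult(1) Ci C2_partial[OF p] C2_partial[OF q] that)
    have "partial k (metric_product m G p q) x = (\<Sum>i<m. partial k (\<lambda>x. \<Sum>j<m. inverse_matrix m (G x) i j * partial i p x * partial j q x) x)"
      unfolding metric_product_def by (rule C1_sum(2)[OF _ _ x k]) (auto intro!: C1_sum(1) 1)
    also have "\<dots> = (\<Sum>i<m. \<Sum>j<m. partial k (\<lambda>x. inverse_matrix m (G x) i j * partial i p x * partial j q x) x)"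
      by (intro sum.cong refl C1_sum(2)[OF _ _ x k]) (auto intro!: 1)
    finally show ?thesis .
  qed
  also have "\<dots> = (\<Sum>i<m. \<Sum>j<m. - (\<Sum>a<m. \<Sum>b<m. I i a * D k a b * I b j) * partial i p x * partial j q x +
      (I i j * partial k (partial i p) x * partial j q x + I i j * partial i p x * partial k (partial j q) x))"
  proof (intro sum.cong refl)
    fix i j assume "i \<in> {..<m}" "j \<in> {..<m}"
    then have ij: "i < m" "j < m" by auto
    show "partial k (\<lambda>x. inverse_matrix m (G x) i j * partial i p x * partial j q x) x =
        - (\<Sum>a<m. \<Sum>b<m. I i a * D k a b * I b j) * partial i p x * partial j q x +
        (I i j * partial k (partial i p) x * partial j q x + I i j * partial i p x * partial k (partial j q) x)"
    proof -
      have 1: "partial k (\<lambda>x. inverse_matrix m (G x) i j * partial i p x * partial j q x) x =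
          partial k (\<lambda>x. inverse_matrix m (G x) i j * partial i p x) x * partial j q x + I i j * partial i p x * partial k (partial j q) x"
        unfolding I_def by (rule C1_mult(2)[OF C1_mult(1)[OF Ci[OF ij] C2_partial[OF p ij(1)]] C2_partial[OF q ij(2)] x k])
      have 2: "partial k (\<lambda>x. inverse_matrix m (G x) i j * partial i p x) x =
          partial k (\<lambda>x. inverse_matrix m (G x) i j) x * partial i p x + I i j * partial k (partial i p) x"
        unfolding I_def by (rule C1_mult(2)[OF Ci[OF ij] C2_partial[OF p ij(1)] x k])
      show ?thesis unfolding 1 2 di[OF ij] by (simp add: distrib_right left_diff_distrib)
    qed
  qed
  also have "\<dots> = - (\<Sum>i<m. \<Sum>j<m. (\<Sum>a<m. \<Sum>b<m. I i a * D k a b * I b j) * partial i p x * partial j q x) +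
      ((\<Sum>i<m. partial k (partial i p) x * Q i) + (\<Sum>i<m. partial k (partial i q) x * P i))"
  proof -
    have "(\<Sum>i<m. \<Sum>j<m. I i j * partial k (partial i p) x * partial j q x) = (\<Sum>i<m. partial k (partial i p) x * Q i)"
      unfolding Q_def sum_distrib_left by (intro sum.cong refl) simp
    moreover have "(\<Sum>i<m. \<Sum>j<m. I i j * partial i p x * partial k (partial j q) x) = (\<Sum>i<m. partial k (partial i q) x * P i)"
      unfolding P_def sum_distrib_left by (subst sum.swap) (intro sum.cong refl, simp add: Isym)
    ultimately show ?thesis by (simp add: sum.distrib sum_negf sum_subtractf)
  qed
  also have "(\<Sum>i<m. \<Sum>j<m. (\<Sum>a<m. \<Sum>b<m. I i a * D k a b * I b j) * partial i p x * partial j q x) =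
      (\<Sum>a<m. \<Sum>b<m. D k a b * P a * Q b)"
  proof -
    define F where "F i j a b = D k a b * (I a i * partial i p x) * (I b j * partial j q x)" for i j a b
    have "(\<Sum>i<m. \<Sum>j<m. (\<Sum>a<m. \<Sum>b<m. I i a * D k a b * I b j) * partial i p x * partial j q x) =
        (\<Sum>i<m. \<Sum>j<m. \<Sum>a<m. \<Sum>b<m. F i j a b)"
      unfolding F_def sum_distrib_right by (intro sum.cong refl) (simp add: Isym)
    also have "\<dots> = (\<Sum>a<m. \<Sum>b<m. \<Sum>i<m. \<Sum>j<m. F i j a b)" by (rule sum_swap_pairs)
    also have "\<dots> = (\<Sum>a<m. \<Sum>b<m. D k a b * P a * Q b)"
      by (simp only: F_def P_def Q_def sum_product mult.assoc flip: sum_distrib_left)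
    finally show ?thesis .
  qed
  finally have L: "partial k (metric_product m G p q) x = - (\<Sum>a<m. \<Sum>b<m. D k a b * P a * Q b) +
      ((\<Sum>i<m. partial k (partial i p) x * Q i) + (\<Sum>i<m. partial k (partial i q) x * P i))" .
  have chr: "(\<Sum>l<m. metric_christoffel m G x l k i * partial l f x) =
      (\<Sum>a<m. (D k i a + D i k a - D a k i) * (\<Sum>l<m. I a l * partial l f x)) / 2" for i f
  proof -
    have "(\<Sum>l<m. metric_christoffel m G x l k i * partial l f x) =
        (\<Sum>l<m. \<Sum>a<m. I l a * (D k i a + D i k a - D a k i) * partial l f x) / 2"
      unfolding metric_christoffel_def I_def[symmetric] D_def[symmetric] by (simp add: sum_distrib_right sum_divide_distrib)
    also have "(\<Sum>l<m. \<Sum>a<m. I l a * (D k i a + D i k a - D a k i) * partial l f x) =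
        (\<Sum>a<m. \<Sum>l<m. I l a * (D k i a + D i k a - D a k i) * partial l f x)" by (rule sum.swap)
    also have "\<dots> = (\<Sum>a<m. (D k i a + D i k a - D a k i) * (\<Sum>l<m. I a l * partial l f x))"
      unfolding sum_distrib_left by (intro sum.cong refl) (simp add: Isym)
    finally show ?thesis .
  qed
  have "(\<Sum>i<m. metric_hessian m G p x k i * Q i) + (\<Sum>i<m. metric_hessian m G q x k i * P i) =
      ((\<Sum>i<m. partial k (partial i p) x * Q i) + (\<Sum>i<m. partial k (partial i q) x * P i)) -
      ((\<Sum>i<m. \<Sum>a<m. (D k i a + D i k a - D a k i) * P a * Q i) + (\<Sum>i<m. \<Sum>a<m. (D k i a + D i k a - D a k i) * Q a * P i)) / 2"
    unfolding metric_hessian_def chr P_def[symmetric] Q_def[symmetric]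
    by (simp add: left_diff_distrib sum_subtractf sum_distrib_right sum_divide_distrib[symmetric] add_divide_distrib)
  \<comment> \<open>After renaming, the two Christoffel sums carry the same vector factors. The
    terms \<open>D i k a - D a k i\<close> change sign when \<open>i\<close> and \<open>a\<close>
    are exchanged and cancel, leaving twice the sum with \<open>D k\<close>.\<close>
  also have "(\<Sum>i<m. \<Sum>a<m. (D k i a + D i k a - D a k i) * P a * Q i) = (\<Sum>a<m. \<Sum>i<m. (D k i a + D i k a - D a k i) * P a * Q i)" by (rule sum.swap)
  also have "(\<Sum>a<m. \<Sum>i<m. (D k i a + D i k a - D a k i) * P a * Q i) + (\<Sum>i<m. \<Sum>a<m. (D k i a + D i k a - D a k i) * Q a * P i) =
      2 * (\<Sum>a<m. \<Sum>b<m. D k a b * P a * Q b)"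
    unfolding sum.distrib[symmetric] sum_distrib_left
    by (intro sum.cong refl) (simp add: Dsym[OF k] algebra_simps)
  finally have "(\<Sum>i<m. metric_hessian m G p x k i * Q i) + (\<Sum>i<m. metric_hessian m G q x k i * P i) =
      ((\<Sum>i<m. partial k (partial i p) x * Q i) + (\<Sum>i<m. partial k (partial i q) x * P i)) - (\<Sum>a<m. \<Sum>b<m. D k a b * P a * Q b)"
    by simp
  then show ?thesis unfolding L P_def Q_def I_def by simp
qed

text \<open>The trick of the Koszul formula: \<open>Hess h\<^sub>p (grad h\<^sub>q, grad h\<^sub>r) + h\<^sub>p \<langle>grad h\<^sub>q, grad h\<^sub>r\<rangle>\<close> is symmetric
  in the last two indices and antisymmetric in the first two, hence zero.\<close>

lemma hessian_on_gradients:
  fixes H :: "nat \<Rightarrow> (nat \<Rightarrow> real) \<Rightarrow> real"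
  assumes V: "eucl_open m V"
    and G: "\<And>i j. i < m \<Longrightarrow> j < m \<Longrightarrow> C1 m V (\<lambda>x. G x i j)" and pd: "\<And>x. x \<in> V \<Longrightarrow> posdef m (G x)"
    and H: "\<And>a. a \<in> A \<Longrightarrow> C2 m V (H a)"
    and prod: "\<And>a b x. a \<in> A \<Longrightarrow> b \<in> A \<Longrightarrow> x \<in> V \<Longrightarrow> metric_product m G (H a) (H b) x = (if a = b then 1 else 0) - H a x * H b x"
    and x: "x \<in> V" and abc: "a \<in> A" "b \<in> A" "c \<in> A"
  defines "g \<equiv> \<lambda>a i. \<Sum>j<m. inverse_matrix m (G x) i j * partial j (H a) x"
  shows "(\<Sum>i<m. \<Sum>j<m. metric_hessian m G (H a) x i j * g b i * g c j) = - H a x * metric_product m G (H b) (H c) x"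
proof -
  define T where "T a b c = (\<Sum>i<m. \<Sum>j<m. metric_hessian m G (H a) x i j * g b i * g c j)" for a b c
  define Pr where "Pr a b = metric_product m G (H a) (H b) x" for a b
  have Isym: "inverse_matrix m (G x) i j = inverse_matrix m (G x) j i" if "i < m" "j < m" for i j
    by (rule posdef_inverse_sym[OF pd[OF x] that])
  have Tsym: "T a b c = T a c b" if "a \<in> A" for a b c
    unfolding T_def by (subst sum.swap) (intro sum.cong refl, simp add: metric_hessian_sym[OF V pd H[OF that] x])
  have Pg: "(\<Sum>k<m. g c k * partial k (H a) x) = Pr c a" for a c
  proof -
    have "(\<Sum>k<m. g c k * partial k (H a) x) = (\<Sum>k<m. \<Sum>j<m. inverse_matrix m (G x) j k * partial j (H c) x * partial k (H a) x)"
      unfolding g_def sum_distrib_right by (intro sum.cong refl) (simp add: Isym)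
    then show ?thesis unfolding Pr_def metric_product_def by (subst sum.swap) simp
  qed
  have Psym: "Pr a b = Pr b a" for a b
    unfolding Pr_def metric_product_def by (subst sum.swap) (intro sum.cong refl, simp add: Isym)
  \<comment> \<open>The product of two gradients is differentiated along the third gradient in two
    ways: by metric compatibility, and from its explicit form as a constant minus a product of the
    functions.\<close>
  have key: "T a c b + T b c a = - (Pr c a * H b x + H a x * Pr c b)" if "a \<in> A" "b \<in> A" for a b c
  proof -
    have "partial k (metric_product m G (H a) (H b)) x = - (partial k (H a) x * H b x + H a x * partial k (H b) x)" if k: "k < m" for k
    proof -
      have "partial k (metric_product m G (H a) (H b)) x = partial k (\<lambda>x. (if a = b then 1 else 0) - H a x * H b x) x"
        by (rule partial_cong[OF V k x]) (rule prod[OF \<open>a \<in> A\<close> \<open>b \<in> A\<close>])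
      also have "\<dots> = - (partial k (H a) x * H b x + H a x * partial k (H b) x)"
        using C1_diff(2)[OF C1_const C1_mult(1)[OF C2_C1[OF H[OF \<open>a \<in> A\<close>]] C2_C1[OF H[OF \<open>b \<in> A\<close>]]] x k]
          C1_mult(2)[OF C2_C1[OF H[OF \<open>a \<in> A\<close>]] C2_C1[OF H[OF \<open>b \<in> A\<close>]] x k]
        by (simp add: partial_const)
      finally show ?thesis .
    qed
    then have "(\<Sum>k<m. g c k * partial k (metric_product m G (H a) (H b)) x) =
        (\<Sum>k<m. g c k * - (partial k (H a) x * H b x + H a x * partial k (H b) x))"
      by (intro sum.cong refl) simp
    also have "\<dots> = - ((\<Sum>k<m. g c k * partial k (H a) x) * H b x + H a x * (\<Sum>k<m. g c k * partial k (H b) x))"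
      unfolding sum_distrib_right sum_distrib_left sum.distrib[symmetric] sum_negf[symmetric]
      by (intro sum.cong refl) (simp add: algebra_simps)
    finally have "(\<Sum>k<m. g c k * partial k (metric_product m G (H a) (H b)) x) =
        - ((\<Sum>k<m. g c k * partial k (H a) x) * H b x + H a x * (\<Sum>k<m. g c k * partial k (H b) x))" .
    moreover have "(\<Sum>k<m. g c k * partial k (metric_product m G (H a) (H b)) x) = T a c b + T b c a"
    proof -
      have "(\<Sum>k<m. g c k * partial k (metric_product m G (H a) (H b)) x) =
          (\<Sum>k<m. g c k * ((\<Sum>i<m. metric_hessian m G (H a) x k i * g b i) + (\<Sum>i<m. metric_hessian m G (H b) x k i * g a i)))"
        unfolding g_def by (intro sum.cong refl) (simp add: partial_metric_product[OF V G pd H H x] \<open>a \<in> A\<close> \<open>b \<in> A\<close>)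
      also have "\<dots> = T a c b + T b c a"
        unfolding T_def by (simp add: distrib_left sum.distrib sum_distrib_left mult_ac)
      finally show ?thesis .
    qed
    ultimately show ?thesis by (simp add: Pg)
  qed
  define S where "S a b c = T a b c + H a x * Pr b c" for a b c
  have S1: "S a b c = S a c b" if "a \<in> A" for a b c using Tsym[OF that, of b c] Psym[of b c] by (simp add: S_def)
  have S2: "S a c b = - S b c a" if "a \<in> A" "b \<in> A" for a b c using key[OF that, of c] by (simp add: S_def algebra_simps)
  have "S a b c = S a c b" by (rule S1[OF abc(1)])
  also have "\<dots> = - S b c a" by (rule S2[OF abc(1,2)])
  also have "S b c a = S b a c" by (rule S1[OF abc(2)])
  also have "\<dots> = - S c a b" by (rule S2[OF abc(2,3)])
  also have "S c a b = S c b a" by (rule S1[OF abc(3)])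
  also have "\<dots> = - S a b c" by (rule S2[OF abc(3,1)])
  finally have "S a b c = 0" by simp
  then show ?thesis by (simp add: S_def T_def Pr_def)
qed

text \<open>The inverse metric splits into the projection onto the span of the gradients \<open>g\<^sub>\<alpha>\<close>, for which
  they form a tight frame, and the projection onto the span of the vectors \<open>t\<^sub>a\<close>: the difference is a
  projection of trace \<open>m - n - (m - n) = 0\<close>.\<close>

lemma inverse_metric_split:
  fixes G :: "nat \<Rightarrow> nat \<Rightarrow> real" and d t :: "nat \<Rightarrow> nat \<Rightarrow> real" and h :: "nat \<Rightarrow> real"
  assumes G: "posdef m G" and nm: "n \<le> m"
    and h1: "(\<Sum>a\<le>n. h a * h a) = 1" and hd: "\<And>i. i < m \<Longrightarrow> (\<Sum>a\<le>n. h a * d a i) = 0"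
    and dd: "\<And>a b. a \<le> n \<Longrightarrow> b \<le> n \<Longrightarrow> (\<Sum>i<m. \<Sum>j<m. inverse_matrix m G i j * d a i * d b j) = (if a = b then 1 else 0) - h a * h b"
    and dt: "\<And>a b. a \<le> n \<Longrightarrow> b < m - n \<Longrightarrow> (\<Sum>i<m. d a i * t b i) = 0"
    and q: "determinant (m - n) (\<lambda>a b. bilinear_form m G (t a) (t b)) \<noteq> 0"
    and ij: "i < m" "j < m"
  defines "g \<equiv> \<lambda>a i. \<Sum>j<m. inverse_matrix m G i j * d a j"
    and "Q \<equiv> inverse_matrix (m - n) (\<lambda>a b. bilinear_form m G (t a) (t b))"
  shows "inverse_matrix m G i j = (\<Sum>a\<le>n. g a i * g a j) + (\<Sum>a<m - n. \<Sum>b<m - n. Q a b * t a i * t b j)"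
proof -
  define I where "I = inverse_matrix m G"
  define K where "K i j = (\<Sum>a\<le>n. g a i * g a j)" for i j
  define W where "W i j = (\<Sum>a<m - n. \<Sum>b<m - n. Q a b * t a i * t b j)" for i j
  define R where "R i j = I i j - K i j - W i j" for i j
  \<comment> \<open>\<open>st A B\<close> is the product \<open>A G B\<close> of contravariant
    tensors, for which the inverse metric \<open>I\<close> is the unit. The computations below show
    that \<open>K\<close> and \<open>W\<close> are idempotent for it and annihilate each
    other.\<close>
  define st where "st A B i j = (\<Sum>k<m. \<Sum>l<m. A i k * G k l * B l j)" for A B :: "nat \<Rightarrow> nat \<Rightarrow> real" and i j
  have Gnz: "determinant m G \<noteq> 0" by (rule posdef_det_nz[OF G])
  have Isym: "I i j = I j i" if "i < m" "j < m" for i j unfolding I_def by (rule posdef_inverse_sym[OF G that])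
  have qsym: "bilinear_form m G (t a) (t b) = bilinear_form m G (t b) (t a)" for a b
    by (rule bilinear_form_commute) (rule posdef_sym[OF G])
  have Qsym: "Q a b = Q b a" if "a < m - n" "b < m - n" for a b
    unfolding Q_def by (rule inverse_matrix_sym[OF q qsym that])
  have Wsym: "W i j = W j i" for i j
    unfolding W_def by (subst sum.swap) (intro sum.cong refl, simp add: Qsym)
  have Ksym: "K i j = K j i" for i j by (simp add: K_def mult.commute)
  have g_apply: "g a = apply_matrix m I (d a)" for a by (simp add: g_def apply_matrix_def I_def fun_eq_iff)
  have Gg: "bilinear_form m G (g a) w = (\<Sum>i<m. d a i * w i)" for a w
    unfolding g_apply I_def by (rule bilinear_form_inverse[OF G])
  have gg: "bilinear_form m G (g a) (g b) = (if a = b then 1 else 0) - h a * h b" if "a \<le> n" "b \<le> n" for a b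
  proof -
    have "bilinear_form m G (g a) (g b) = (\<Sum>i<m. \<Sum>j<m. inverse_matrix m G i j * d a i * d b j)"
      unfolding Gg unfolding g_def sum_distrib_left by (intro sum.cong refl) simp
    then show ?thesis using dd[OF that] by simp
  qed
  have gt: "bilinear_form m G (g a) (t b) = 0" if "a \<le> n" "b < m - n" for a b unfolding Gg by (rule dt[OF that])
  have hg: "(\<Sum>a\<le>n. h a * g a i) = 0" for i
  proof -
    have "(\<Sum>a\<le>n. h a * g a i) = (\<Sum>j<m. I i j * (\<Sum>a\<le>n. h a * d a j))"
      unfolding g_def I_def sum_distrib_left by (subst sum.swap) (simp add: mult_ac)
    then show ?thesis by (simp add: hd)
  qed
  have st_IA: "st I A i j = A i j" if "i < m" for A i j
  proof -
    have "st I A i j = (\<Sum>l<m. (\<Sum>k<m. I i k * G k l) * A l j)"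
      unfolding st_def sum_distrib_right by (rule sum.swap)
    also have "\<dots> = (\<Sum>l<m. if i = l then A l j else 0)"
      unfolding I_def by (intro sum.cong refl) (simp add: inverse_matrix_left[OF Gnz that])
    finally show ?thesis using that by simp
  qed
  have st_AI: "st A I i j = A i j" if "j < m" for A i j
  proof -
    have "st A I i j = (\<Sum>k<m. A i k * (\<Sum>l<m. G k l * I l j))" by (simp add: st_def sum_distrib_left mult.assoc)
    also have "\<dots> = (\<Sum>k<m. if k = j then A i k else 0)"
      unfolding I_def by (intro sum.cong refl) (simp add: inverse_matrix_right[OF Gnz _ that])
    finally show ?thesis using that by simp
  qed
  have st_diff: "st (\<lambda>i j. A i j - B i j) C i j = st A C i j - st B C i j"
    "st C (\<lambda>i j. A i j - B i j) i j = st C A i j - st C B i j" for A B C i j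
    by (simp_all add: st_def left_diff_distrib right_diff_distrib sum_subtractf)
  have rank1: "(\<Sum>k<m. \<Sum>l<m. (x * u k) * G k l * (v l * y)) = x * bilinear_form m G u v * y" for x y :: real and u v
    by (simp add: bilinear_form_def sum_distrib_left sum_distrib_right mult_ac)
  have KX: "st K B i j = (\<Sum>a\<le>n. g a i * (\<Sum>k<m. \<Sum>l<m. g a k * G k l * B l j))" for B i j
  proof -
    have "st K B i j = (\<Sum>k<m. \<Sum>l<m. \<Sum>a\<le>n. g a i * (g a k * G k l * B l j))"
      unfolding st_def K_def sum_distrib_right by (simp add: mult_ac)
    also have "\<dots> = (\<Sum>a\<le>n. \<Sum>k<m. \<Sum>l<m. g a i * (g a k * G k l * B l j))" by (rule sum_swap3)
    finally show ?thesis by (simp add: sum_distrib_left)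
  qed
  have uK: "(\<Sum>k<m. \<Sum>l<m. u k * G k l * K l j) = (\<Sum>a\<le>n. bilinear_form m G u (g a) * g a j)" for u j
  proof -
    have "(\<Sum>k<m. \<Sum>l<m. u k * G k l * K l j) = (\<Sum>k<m. \<Sum>l<m. \<Sum>a\<le>n. G k l * u k * g a l * g a j)"
      unfolding K_def sum_distrib_left by (simp add: mult_ac)
    also have "\<dots> = (\<Sum>a\<le>n. \<Sum>k<m. \<Sum>l<m. G k l * u k * g a l * g a j)" by (rule sum_swap3)
    finally show ?thesis by (simp add: bilinear_form_def sum_distrib_right)
  qed
  have uW: "(\<Sum>k<m. \<Sum>l<m. u k * G k l * W l j) = (\<Sum>a<m - n. \<Sum>b<m - n. Q a b * bilinear_form m G u (t a) * t b j)" for u j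
  proof -
    define F where "F k l a b = Q a b * (G k l * u k * t a l) * t b j" for k l a b
    have "(\<Sum>k<m. \<Sum>l<m. u k * G k l * W l j) = (\<Sum>k<m. \<Sum>l<m. \<Sum>a<m - n. \<Sum>b<m - n. F k l a b)"
      unfolding W_def F_def sum_distrib_left by (simp add: mult_ac)
    also have "\<dots> = (\<Sum>a<m - n. \<Sum>b<m - n. \<Sum>k<m. \<Sum>l<m. F k l a b)" by (rule sum_swap_pairs)
    finally show ?thesis by (simp add: F_def bilinear_form_def sum_distrib_left sum_distrib_right)
  qed
  \<comment> \<open>The Gram matrix of the gradients is the identity minus the projection onto
    \<open>h\<close>, and that correction disappears because the gradients combined with the
    coefficients \<open>h\<close> give zero (\<open>hg\<close>).\<close>
  have KK: "st K K i j = K i j" for i j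
  proof -
    have "st K K i j = (\<Sum>a\<le>n. g a i * (\<Sum>b\<le>n. ((if a = b then 1 else 0) - h a * h b) * g b j))"
      unfolding KX uK by (intro sum.cong refl arg_cong2[where f = "(*)"]) (simp add: gg)
    also have "\<dots> = (\<Sum>a\<le>n. g a i * g a j)"
    proof (intro sum.cong refl arg_cong2[where f = "(*)"])
      fix a assume a: "a \<in> {..n}"
      have "(\<Sum>b\<le>n. ((if a = b then 1 else 0) - h a * h b) * g b j) =
          (\<Sum>b\<le>n. if a = b then g b j else 0) - h a * (\<Sum>b\<le>n. h b * g b j)"
        unfolding sum_distrib_left sum_subtractf[symmetric] by (intro sum.cong refl) (simp add: algebra_simps)
      then show "(\<Sum>b\<le>n. ((if a = b then 1 else 0) - h a * h b) * g b j) = g a j" using a by (simp add: hg)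
    qed
    finally show ?thesis by (simp add: K_def)
  qed
  have KW: "st K W i j = 0" for i j unfolding KX uW by (simp add: gt)
  have st_sym: "st A B i j = st B A j i" if "\<And>k. k < m \<Longrightarrow> A i k = A k i" "\<And>l. l < m \<Longrightarrow> B l j = B j l" for A B i j
    unfolding st_def using that by (subst sum.swap) (intro sum.cong refl, simp add: posdef_sym[OF G] mult_ac)
  have WK: "st W K i j = 0" for i j using KW[of j i] st_sym[of W i K j] Wsym Ksym by simp
  have WW: "st W W i j = W i j" for i j
  proof -
    have tW: "(\<Sum>k<m. \<Sum>l<m. t c k * G k l * W l j) = t c j" if c: "c < m - n" for c
    proof -
      have "(\<Sum>k<m. \<Sum>l<m. t c k * G k l * W l j) = (\<Sum>b<m - n. (\<Sum>a<m - n. bilinear_form m G (t c) (t a) * Q a b) * t b j)"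
        unfolding uW sum_distrib_right by (subst sum.swap) (simp add: mult_ac)
      also have "\<dots> = (\<Sum>b<m - n. if c = b then t b j else 0)"
        unfolding Q_def by (intro sum.cong refl) (simp add: inverse_matrix_right[OF q c])
      finally show ?thesis using c by simp
    qed
    have "st W W i j = (\<Sum>k<m. \<Sum>l<m. \<Sum>a<m - n. \<Sum>b<m - n. Q a b * t a i * (t b k * G k l * W l j))"
      unfolding st_def W_def[of i] sum_distrib_right by (simp add: mult_ac)
    also have "\<dots> = (\<Sum>a<m - n. \<Sum>b<m - n. \<Sum>k<m. \<Sum>l<m. Q a b * t a i * (t b k * G k l * W l j))" by (rule sum_swap_pairs)
    also have "\<dots> = (\<Sum>a<m - n. \<Sum>b<m - n. Q a b * t a i * t b j)"
      unfolding sum_distrib_left[symmetric] by (intro sum.cong refl) (simp add: tW)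
    finally show ?thesis by (simp add: W_def)
  qed
  have RR: "st R R i j = R i j" if "i < m" "j < m" for i j
  proof -
    have "st R R i j = st I I i j - st I K i j - st I W i j - (st K I i j - st K K i j - st K W i j) - (st W I i j - st W K i j - st W W i j)"
      unfolding R_def by (simp add: st_diff)
    then show ?thesis using that by (simp add: st_IA st_AI KK KW WK WW R_def)
  qed
  \<comment> \<open>The three traces are \<open>m\<close>, then \<open>n\<close> as the sum of
    \<open>n + 1\<close> terms \<open>1 - h a * h a\<close>, and \<open>m - n\<close> from the Gram
    matrix of the \<open>t a\<close> against its inverse.\<close>
  have tr: "(\<Sum>i<m. \<Sum>j<m. R i j * G i j) = 0"
  proof -
    have "(\<Sum>i<m. \<Sum>j<m. I i j * G i j) = (\<Sum>i<m. \<Sum>j<m. I i j * G j i)"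
      by (intro sum.cong refl) (simp add: posdef_sym[OF G])
    then have 1: "(\<Sum>i<m. \<Sum>j<m. I i j * G i j) = real m"
      unfolding I_def by (simp add: inverse_matrix_left[OF Gnz])
    have "(\<Sum>i<m. \<Sum>j<m. K i j * G i j) = (\<Sum>i<m. \<Sum>j<m. \<Sum>a\<le>n. G i j * g a i * g a j)"
      unfolding K_def sum_distrib_right by (simp add: mult_ac)
    also have "\<dots> = (\<Sum>i<m. \<Sum>a\<le>n. \<Sum>j<m. G i j * g a i * g a j)" by (intro sum.cong refl sum.swap)
    also have "\<dots> = (\<Sum>a\<le>n. bilinear_form m G (g a) (g a))" unfolding bilinear_form_def by (rule sum.swap)
    also have "\<dots> = (\<Sum>a\<le>n. 1 - h a * h a)" by (intro sum.cong refl) (simp add: gg)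
    also have "\<dots> = real n" by (simp add: sum_subtractf h1)
    finally have 2: "(\<Sum>i<m. \<Sum>j<m. K i j * G i j) = real n" .
    have "(\<Sum>i<m. \<Sum>j<m. W i j * G i j) = (\<Sum>i<m. \<Sum>j<m. \<Sum>a<m - n. \<Sum>b<m - n. Q a b * (G i j * t a i * t b j))"
      unfolding W_def sum_distrib_right by (simp add: mult_ac)
    also have "\<dots> = (\<Sum>a<m - n. \<Sum>b<m - n. \<Sum>i<m. \<Sum>j<m. Q a b * (G i j * t a i * t b j))" by (rule sum_swap_pairs)
    also have "\<dots> = (\<Sum>a<m - n. \<Sum>b<m - n. Q a b * bilinear_form m G (t b) (t a))"
      by (intro sum.cong refl) (simp add: bilinear_form_def sum_distrib_left qsym[unfolded bilinear_form_def])
    also have "\<dots> = real (m - n)" unfolding Q_def by (simp add: inverse_matrix_left[OF q])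
    finally have 3: "(\<Sum>i<m. \<Sum>j<m. W i j * G i j) = real (m - n)" .
    have "(\<Sum>i<m. \<Sum>j<m. R i j * G i j) = (\<Sum>i<m. \<Sum>j<m. I i j * G i j) - (\<Sum>i<m. \<Sum>j<m. K i j * G i j) - (\<Sum>i<m. \<Sum>j<m. W i j * G i j)"
      by (simp add: R_def left_diff_distrib sum_subtractf)
    then show ?thesis unfolding 1 2 3 using nm by (simp add: of_nat_diff)
  qed
  have "R i j = 0"
  proof (rule projection_trace_zero[OF G _ _ tr ij])
    show "R i j = R j i" if "i < m" "j < m" for i j using Isym[OF that] Ksym[of i j] Wsym[of i j] by (simp add: R_def)
    show "(\<Sum>k<m. \<Sum>l<m. R i k * G k l * R l j) = R i j" if "i < m" "j < m" for i j using RR[OF that] by (simp add: st_def)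
  qed
  then show ?thesis by (simp add: R_def I_def K_def W_def)
qed

text \<open>The Laplacian is the trace of the Hessian, taken with the split inverse metric. On the
  gradients the Hessian is known, giving \<open>- H c x\<close> times the sum of
  \<open>1 - H a x * H a x\<close>; the assumption \<open>vert\<close> disposes of the remaining
  directions.\<close>

lemma laplacian_split:
  fixes H :: "nat \<Rightarrow> (nat \<Rightarrow> real) \<Rightarrow> real" and t :: "nat \<Rightarrow> nat \<Rightarrow> real"
  assumes V: "eucl_open m V"
    and G: "\<And>i j. i < m \<Longrightarrow> j < m \<Longrightarrow> C1 m V (\<lambda>x. G x i j)" and pd: "\<And>x. x \<in> V \<Longrightarrow> posdef m (G x)"
    and H: "\<And>a. a \<le> n \<Longrightarrow> C2 m V (H a)" and nm: "n \<le> m"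
    and prod: "\<And>a b x. a \<le> n \<Longrightarrow> b \<le> n \<Longrightarrow> x \<in> V \<Longrightarrow> metric_product m G (H a) (H b) x = (if a = b then 1 else 0) - H a x * H b x"
    and H1: "\<And>x. x \<in> V \<Longrightarrow> (\<Sum>a\<le>n. H a x * H a x) = 1"
    and x: "x \<in> V"
    and Ht: "\<And>a b. a \<le> n \<Longrightarrow> b < m - n \<Longrightarrow> (\<Sum>i<m. partial i (H a) x * t b i) = 0"
    and q: "determinant (m - n) (\<lambda>a b. bilinear_form m (G x) (t a) (t b)) \<noteq> 0"
    and vert: "\<And>c. c \<le> n \<Longrightarrow> (\<Sum>a<m - n. \<Sum>b<m - n. inverse_matrix (m - n) (\<lambda>a b. bilinear_form m (G x) (t a) (t b)) a b *
        (\<Sum>i<m. \<Sum>j<m. metric_hessian m G (H c) x i j * t a i * t b j)) = 0"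
    and c: "c \<le> n"
  shows "metric_laplacian m G (H c) x = - real n * H c x"
proof -
  define g where "g a i = (\<Sum>j<m. inverse_matrix m (G x) i j * partial j (H a) x)" for a i
  define Q where "Q = inverse_matrix (m - n) (\<lambda>a b. bilinear_form m (G x) (t a) (t b))"
  \<comment> \<open>The one linear relation among the \<open>n + 1\<close> differentials, obtained
    by differentiating \<open>H1\<close>.\<close>
  have hd: "(\<Sum>a\<le>n. H a x * partial i (H a) x) = 0" if i: "i < m" for i
  proof -
    have "partial i (\<lambda>x. \<Sum>a\<le>n. H a x * H a x) x = partial i (\<lambda>x. 1) x"
      by (rule partial_cong[OF V i x]) (rule H1)
    moreover have "partial i (\<lambda>x. \<Sum>a\<le>n. H a x * H a x) x = (\<Sum>a\<le>n. partial i (\<lambda>x. H a x * H a x) x)"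
      by (rule C1_sum(2)[OF _ _ x i]) (auto intro!: C1_mult(1) C2_C1[OF H])
    moreover have "\<dots> = (\<Sum>a\<le>n. 2 * (H a x * partial i (H a) x))"
      by (intro sum.cong refl) (simp add: C1_mult(2)[OF C2_C1[OF H] C2_C1[OF H] x i])
    ultimately show ?thesis by (simp add: partial_const flip: sum_distrib_left)
  qed
  have split: "inverse_matrix m (G x) i j = (\<Sum>a\<le>n. g a i * g a j) + (\<Sum>a<m - n. \<Sum>b<m - n. Q a b * t a i * t b j)"
    if "i < m" "j < m" for i j
    unfolding g_def Q_def
    by (rule inverse_metric_split[OF pd[OF x] nm H1[OF x] hd _ Ht q that])
      (use prod[OF _ _ x] in \<open>auto simp: metric_product_def\<close>)
  define B where "B = metric_hessian m G (H c) x"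
  have "metric_laplacian m G (H c) x = (\<Sum>i<m. \<Sum>j<m. (\<Sum>a\<le>n. B i j * g a i * g a j) + (\<Sum>a<m - n. \<Sum>b<m - n. Q a b * (B i j * t a i * t b j)))"
    unfolding metric_laplacian_def B_def[symmetric]
    by (intro sum.cong refl) (simp add: split distrib_left sum_distrib_left mult_ac)
  also have "\<dots> = (\<Sum>i<m. \<Sum>j<m. \<Sum>a\<le>n. B i j * g a i * g a j) + (\<Sum>i<m. \<Sum>j<m. \<Sum>a<m - n. \<Sum>b<m - n. Q a b * (B i j * t a i * t b j))"
    by (simp add: sum.distrib)
  also have "(\<Sum>i<m. \<Sum>j<m. \<Sum>a\<le>n. B i j * g a i * g a j) = (\<Sum>a\<le>n. \<Sum>i<m. \<Sum>j<m. B i j * g a i * g a j)"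
    by (rule sum_swap3)
  also have "\<dots> = (\<Sum>a\<le>n. - H c x * (1 - H a x * H a x))"
  proof (intro sum.cong refl)
    fix a assume "a \<in> {..n}"
    then have a: "a \<in> {..n}" "a \<le> n" by auto
    have "(\<Sum>i<m. \<Sum>j<m. B i j * g a i * g a j) = - H c x * metric_product m G (H a) (H a) x"
      unfolding B_def g_def
      by (rule hessian_on_gradients[where A = "{..n}", OF V G pd]) (use H prod x a c in auto)
    then show "(\<Sum>i<m. \<Sum>j<m. B i j * g a i * g a j) = - H c x * (1 - H a x * H a x)" using prod[OF a(2) a(2) x] by simp
  qed
  also have "\<dots> = - H c x * (\<Sum>a\<le>n. 1 - H a x * H a x)" by (rule sum_distrib_left[symmetric])
  also have "\<dots> = - real n * H c x" by (simp add: sum_subtractf H1[OF x])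
  also have "(\<Sum>i<m. \<Sum>j<m. \<Sum>a<m - n. \<Sum>b<m - n. Q a b * (B i j * t a i * t b j)) =
      (\<Sum>a<m - n. \<Sum>b<m - n. \<Sum>i<m. \<Sum>j<m. Q a b * (B i j * t a i * t b j))" by (rule sum_swap_pairs)
  also have "\<dots> = 0" using vert[OF c] by (simp add: Q_def B_def sum_distrib_left)
  finally show ?thesis by simp
qed

section \<open>Traces over minimal submanifolds\<close>

lemma metric_christoffel_eq: "christoffel m M c x k i j = metric_christoffel m (components M c) x k i j"
  by (simp add: christoffel_def metric_christoffel_def)

text \<open>If \<open>h\<close> is constant along the submanifold, the Hessian of \<open>h\<close> on tangent vectors is minus the
  derivative of \<open>h\<close> along the second fundamental form.\<close>

lemma minimal_trace_zero:
  fixes \<psi> :: "(nat \<Rightarrow> real) \<Rightarrow> 'a" and c :: "'a chart"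
  defines "u \<equiv> \<lambda>y. chart_map c (\<psi> y)"
  assumes V: "eucl_open m V" and h: "C2 m V h"
    and W: "eucl_open k W" and u: "\<And>i. i < m \<Longrightarrow> C2 k W (\<lambda>y. u y i)" and uV: "\<And>y. y \<in> W \<Longrightarrow> u y \<in> V"
    and const: "\<And>y. y \<in> W \<Longrightarrow> h (u y) = e" and y: "y \<in> W"
    and mean: "\<And>i. i < m \<Longrightarrow> mean_curvature_vector m M k c \<psi> y i = 0"
  shows "b < k \<Longrightarrow> (\<Sum>i<m. partial i h (u y) * tangent_vector c \<psi> y b i) = 0"
    and "(\<Sum>a<k. \<Sum>b<k. inverse_matrix k (first_fundamental_form m M c \<psi> y) a b *
      (\<Sum>i<m. \<Sum>j<m. metric_hessian m (components M c) h (u y) i j * tangent_vector c \<psi> y a i * tangent_vector c \<psi> y b j)) = 0"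
proof -
  define t where "t = tangent_vector c \<psi> y"
  have t: "t a i = partial a (\<lambda>z. u z i) y" for a i by (simp add: t_def tangent_vector_def u_def)
  have first: "(\<Sum>i<m. partial i h (u z) * partial b (\<lambda>z. u z i) z) = 0" if z: "z \<in> W" and b: "b < k" for z b
  proof -
    have "partial b (\<lambda>z. h (u z)) z = (\<Sum>i<m. partial i h (u z) * partial b (\<lambda>z. u z i) z)"
      by (rule partial_compose[OF W V C2_C1[OF h] C2_C1[OF u] uV z b])
    moreover have "partial b (\<lambda>z. h (u z)) z = partial b (\<lambda>z. e) z" by (rule partial_cong[OF W b z const])
    ultimately show ?thesis by (simp add: partial_const)
  qed
  have dt: "(\<Sum>i<m. partial i h (u y) * t b i) = 0" if "b < k" for b unfolding t by (rule first[OF y that])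
  then show "b < k \<Longrightarrow> (\<Sum>i<m. partial i h (u y) * tangent_vector c \<psi> y b i) = 0" by (simp add: t_def)
  define p where "p i = partial i h (u y)" for i
  define X where "X a b = covariant_derivative m M c \<psi> y a b" for a b
  \<comment> \<open>This comes from differentiating \<open>first\<close>, which holds all along
    \<open>W\<close>, in direction \<open>a\<close>.\<close>
  have second: "(\<Sum>i<m. \<Sum>j<m. partial i (partial j h) (u y) * t a i * t b j) = - (\<Sum>j<m. p j * partial a (\<lambda>z. partial b (\<lambda>w. u w j) z) y)"
    if a: "a < k" and b: "b < k" for a b
  proof -
    have Cp: "C1 k W (\<lambda>z. partial j h (u z))" if "j < m" for j
      by (rule C1_compose[OF W V C2_partial[OF h that] C2_C1[OF u] uV])
    have Cu: "C1 k W (\<lambda>z. partial b (\<lambda>w. u w j) z)" if "j < m" for j by (rule C2_partial[OF u[OF that] b])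
    have "partial a (\<lambda>z. \<Sum>j<m. partial j h (u z) * partial b (\<lambda>w. u w j) z) y = partial a (\<lambda>z. 0) y"
      by (rule partial_cong[OF W a y first[OF _ b]])
    moreover have "partial a (\<lambda>z. \<Sum>j<m. partial j h (u z) * partial b (\<lambda>w. u w j) z) y =
        (\<Sum>j<m. partial a (\<lambda>z. partial j h (u z) * partial b (\<lambda>w. u w j) z) y)"
      by (rule C1_sum(2)[OF _ _ y a]) (auto intro!: C1_mult(1) Cp Cu)
    moreover have "\<dots> = (\<Sum>j<m. (\<Sum>i<m. partial i (partial j h) (u y) * t a i) * t b j + p j * partial a (\<lambda>z. partial b (\<lambda>w. u w j) z) y)"
    proof (intro sum.cong refl)
      fix j assume "j \<in> {..<m}"
      then have j: "j < m" by simp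
      have "partial a (\<lambda>z. partial j h (u z)) y = (\<Sum>i<m. partial i (partial j h) (u y) * t a i)"
        unfolding t by (rule partial_compose[OF W V C2_partial[OF h j] C2_C1[OF u] uV y a])
      then show "partial a (\<lambda>z. partial j h (u z) * partial b (\<lambda>w. u w j) z) y =
          (\<Sum>i<m. partial i (partial j h) (u y) * t a i) * t b j + p j * partial a (\<lambda>z. partial b (\<lambda>w. u w j) z) y"
        using C1_mult(2)[OF Cp[OF j] Cu[OF j] y a] by (simp add: t p_def)
    qed
    ultimately have "(\<Sum>j<m. (\<Sum>i<m. partial i (partial j h) (u y) * t a i) * t b j) + (\<Sum>j<m. p j * partial a (\<lambda>z. partial b (\<lambda>w. u w j) z) y) = 0"
      by (simp add: partial_const sum.distrib)
    moreover have "(\<Sum>j<m. (\<Sum>i<m. partial i (partial j h) (u y) * t a i) * t b j) = (\<Sum>i<m. \<Sum>j<m. partial i (partial j h) (u y) * t a i * t b j)"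
      unfolding sum_distrib_right by (rule sum.swap)
    ultimately show ?thesis by simp
  qed
  have hess: "(\<Sum>i<m. \<Sum>j<m. metric_hessian m (components M c) h (u y) i j * t a i * t b j) = - (\<Sum>l<m. p l * X a b l)"
    if ab: "a < k" "b < k" for a b
  proof -
    let ?C = "metric_christoffel m (components M c) (u y)"
    have "(\<Sum>i<m. \<Sum>j<m. (\<Sum>l<m. ?C l i j * p l) * t a i * t b j) = (\<Sum>i<m. \<Sum>j<m. \<Sum>l<m. p l * (?C l i j * t a i * t b j))"
      unfolding sum_distrib_right by (simp add: mult_ac)
    also have "\<dots> = (\<Sum>l<m. \<Sum>i<m. \<Sum>j<m. p l * (?C l i j * t a i * t b j))" by (rule sum_swap3)
    also have "\<dots> = (\<Sum>l<m. p l * (\<Sum>i<m. \<Sum>j<m. ?C l i j * t a i * t b j))" by (simp add: sum_distrib_left)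
    finally have 1: "(\<Sum>i<m. \<Sum>j<m. (\<Sum>l<m. ?C l i j * p l) * t a i * t b j) = (\<Sum>l<m. p l * (\<Sum>i<m. \<Sum>j<m. ?C l i j * t a i * t b j))" .
    have "X a b l = partial a (\<lambda>z. partial b (\<lambda>w. u w l) z) y + (\<Sum>i<m. \<Sum>j<m. ?C l i j * t a i * t b j)" for l
      by (simp add: X_def covariant_derivative_def metric_christoffel_eq u_def t_def tangent_vector_def)
    then have 2: "(\<Sum>l<m. p l * X a b l) = (\<Sum>l<m. p l * partial a (\<lambda>z. partial b (\<lambda>w. u w l) z) y) + (\<Sum>l<m. p l * (\<Sum>i<m. \<Sum>j<m. ?C l i j * t a i * t b j))"
      by (simp add: distrib_left sum.distrib)
    have "(\<Sum>i<m. \<Sum>j<m. metric_hessian m (components M c) h (u y) i j * t a i * t b j) =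
        (\<Sum>i<m. \<Sum>j<m. partial i (partial j h) (u y) * t a i * t b j) - (\<Sum>i<m. \<Sum>j<m. (\<Sum>l<m. ?C l i j * p l) * t a i * t b j)"
      by (simp add: metric_hessian_def p_def left_diff_distrib sum_subtractf)
    then show ?thesis unfolding second[OF ab] 1 2 by simp
  qed
  define Q where "Q = inverse_matrix k (first_fundamental_form m M c \<psi> y)"
  define \<gamma> where "\<gamma> a b c' d = Q c' d * bilinear_form m (components M c (chart_map c (\<psi> y))) (X a b) (t d)" for a b c' d
  have mc: "mean_curvature_vector m M k c \<psi> y l = (\<Sum>a<k. \<Sum>b<k. Q a b * (X a b l - (\<Sum>c'<k. \<Sum>d<k. \<gamma> a b c' d * t c' l)))" for l
    by (simp add: mean_curvature_vector_def second_fundamental_form_def normal_part_def Q_def X_def t_def \<gamma>_def)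
  \<comment> \<open>The tangential part subtracted by \<open>normal_part\<close> is a combination of
    the \<open>t c'\<close>, which the differential of \<open>h\<close> annihilates. So under
    \<open>h\<close> the second fundamental form and the full covariant derivative look the
    same.\<close>
  have tang: "(\<Sum>l<m. p l * (\<Sum>c'<k. \<Sum>d<k. \<gamma> a b c' d * t c' l)) = 0" for a b
  proof -
    have "(\<Sum>l<m. p l * (\<Sum>c'<k. \<Sum>d<k. \<gamma> a b c' d * t c' l)) = (\<Sum>l<m. \<Sum>c'<k. \<Sum>d<k. \<gamma> a b c' d * (p l * t c' l))"
      by (simp add: sum_distrib_left mult_ac)
    also have "\<dots> = (\<Sum>c'<k. \<Sum>d<k. \<Sum>l<m. \<gamma> a b c' d * (p l * t c' l))" by (rule sum_swap3[symmetric])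
    also have "\<dots> = 0" using dt by (simp add: p_def flip: sum_distrib_left)
    finally show ?thesis .
  qed
  have "0 = (\<Sum>l<m. p l * mean_curvature_vector m M k c \<psi> y l)" using mean by simp
  also have "\<dots> = (\<Sum>l<m. \<Sum>a<k. \<Sum>b<k. Q a b * (p l * X a b l - p l * (\<Sum>c'<k. \<Sum>d<k. \<gamma> a b c' d * t c' l)))"
    unfolding mc sum_distrib_left by (intro sum.cong refl) (simp add: algebra_simps sum_distrib_left)
  also have "\<dots> = (\<Sum>a<k. \<Sum>b<k. \<Sum>l<m. Q a b * (p l * X a b l - p l * (\<Sum>c'<k. \<Sum>d<k. \<gamma> a b c' d * t c' l)))" by (rule sum_swap3[symmetric])
  also have "\<dots> = (\<Sum>a<k. \<Sum>b<k. Q a b * (\<Sum>l<m. p l * X a b l))"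
    unfolding sum_distrib_left[symmetric] sum_subtractf tang by simp
  also have "\<dots> = - (\<Sum>a<k. \<Sum>b<k. Q a b * (\<Sum>i<m. \<Sum>j<m. metric_hessian m (components M c) h (u y) i j * t a i * t b j))"
    by (simp add: hess sum_negf)
  finally show "(\<Sum>a<k. \<Sum>b<k. inverse_matrix k (first_fundamental_form m M c \<psi> y) a b *
      (\<Sum>i<m. \<Sum>j<m. metric_hessian m (components M c) h (u y) i j * tangent_vector c \<psi> y a i * tangent_vector c \<psi> y b j)) = 0"
    by (simp add: Q_def t_def)
qed

section \<open>The law of the height function\<close>

text \<open>Moments determine a law on a bounded interval: polynomials approximate continuous
  functions uniformly, and these approximate the indicator of the band. The factors \<open>a\<close>
  and \<open>b\<close> allow for different total masses without normalizing.\<close>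

lemma equal_moments_band:
  fixes X :: "'b \<Rightarrow> real" and Y :: "'c \<Rightarrow> real"
  assumes A: "finite_measure A" and B: "finite_measure B"
    and X: "X \<in> borel_measurable A" and Y: "Y \<in> borel_measurable B"
    and X1: "\<And>x. x \<in> space A \<Longrightarrow> \<bar>X x\<bar> \<le> 1" and Y1: "\<And>y. y \<in> space B \<Longrightarrow> \<bar>Y y\<bar> \<le> 1"
    and mom: "\<And>k. a * (\<integral>x. X x ^ k \<partial>A) = b * (\<integral>y. Y y ^ k \<partial>B)"
  shows "a * measure A {x\<in>space A. \<bar>X x\<bar> < s} = b * measure B {y\<in>space B. \<bar>Y y\<bar> < s}"
proof -
  have int: "integrable C (\<lambda>z. f (Z z))"
    if C: "finite_measure C" and Z: "Z \<in> borel_measurable C" and Z1: "\<And>z. z \<in> space C \<Longrightarrow> \<bar>Z z\<bar> \<le> 1" and f: "continuous_on UNIV f"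
    for C :: "'d measure" and Z and f :: "real \<Rightarrow> real"
  proof -
    interpret finite_measure C by (rule C)
    have "compact (f ` {-1..1})" by (rule compact_continuous_image[OF continuous_on_subset[OF f]]) auto
    then have "bounded (f ` {-1..1})" by (rule compact_imp_bounded)
    then obtain K where K: "\<forall>t\<in>{-1..1}. \<bar>f t\<bar> \<le> K" unfolding bounded_iff by auto
    have "(\<lambda>z. f (Z z)) \<in> borel_measurable C"
      by (rule measurable_compose[OF Z borel_measurable_continuous_onI[OF f]])
    then show ?thesis
      by (rule integrable_const_bound[of _ K, rotated]) (use K Z1 in \<open>auto simp: abs_le_iff\<close>)
  qed
  have poly: "a * (\<integral>x. g (X x) \<partial>A) = b * (\<integral>y. g (Y y) \<partial>B)" if g: "real_polynomial_function g" for g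
  proof -
    obtain c n where g: "g = (\<lambda>x. \<Sum>i\<le>n. c i * x ^ i)" using g unfolding real_polynomial_function_iff_sum by blast
    have "a * (\<integral>x. g (X x) \<partial>A) = (\<Sum>i\<le>n. c i * (a * (\<integral>x. X x ^ i \<partial>A)))"
      unfolding g
      by (subst Bochner_Integration.integral_sum)
        (auto intro!: integrable_mult_right int[OF A X X1] continuous_intros simp: sum_distrib_left mult_ac)
    moreover have "b * (\<integral>y. g (Y y) \<partial>B) = (\<Sum>i\<le>n. c i * (b * (\<integral>y. Y y ^ i \<partial>B)))"
      unfolding g
      by (subst Bochner_Integration.integral_sum)
        (auto intro!: integrable_mult_right int[OF B Y Y1] continuous_intros simp: sum_distrib_left mult_ac)
    ultimately show ?thesis using mom by simp
  qed
  have close: "\<bar>(\<integral>z. f (Z z) \<partial>C) - (\<integral>z. g (Z z) \<partial>C)\<bar> \<le> e * measure C (space C)"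
    if C: "finite_measure C" and Z: "Z \<in> borel_measurable C" and Z1: "\<And>z. z \<in> space C \<Longrightarrow> \<bar>Z z\<bar> \<le> 1"
      and f: "continuous_on UNIV f" and g: "continuous_on UNIV g" and e: "\<And>t. t \<in> {-1..1} \<Longrightarrow> \<bar>f t - g t\<bar> \<le> e"
    for C :: "'d measure" and Z and f g :: "real \<Rightarrow> real" and e
  proof -
    interpret finite_measure C by (rule C)
    have 1: "integrable C (\<lambda>z. f (Z z))" by (rule int[OF C Z Z1 f])
    have 2: "integrable C (\<lambda>z. g (Z z))" by (rule int[OF C Z Z1 g])
    have "(\<integral>z. f (Z z) \<partial>C) - (\<integral>z. g (Z z) \<partial>C) = (\<integral>z. f (Z z) - g (Z z) \<partial>C)"
      by (rule Bochner_Integration.integral_diff[OF 1 2, symmetric])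
    also have "\<bar>\<dots>\<bar> \<le> (\<integral>z. \<bar>f (Z z) - g (Z z)\<bar> \<partial>C)" by (rule integral_abs_bound)
    also have "\<dots> \<le> (\<integral>z. e \<partial>C)"
    proof (rule integral_mono)
      show "integrable C (\<lambda>z. \<bar>f (Z z) - g (Z z)\<bar>)"
        by (intro integrable_abs Bochner_Integration.integrable_diff 1 2)
      show "\<bar>f (Z z) - g (Z z)\<bar> \<le> e" if "z \<in> space C" for z using e[of "Z z"] Z1[OF that] by (auto simp: abs_le_iff)
    qed simp
    finally show ?thesis by (simp add: mult.commute)
  qed
  have cont: "a * (\<integral>x. f (X x) \<partial>A) = b * (\<integral>y. f (Y y) \<partial>B)" if f: "continuous_on UNIV f" for f
  proof -
    \<comment> \<open>The weighted total mass plus 1, so that approximation up to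
      \<open>\<eta> / D\<close> costs less than \<open>\<eta>\<close> in all, also when the masses
      are zero.\<close>
    define D where "D = \<bar>a\<bar> * measure A (space A) + \<bar>b\<bar> * measure B (space B) + 1"
    have D: "D > 0" unfolding D_def by (simp add: add_nonneg_pos)
    have "\<bar>a * (\<integral>x. f (X x) \<partial>A) - b * (\<integral>y. f (Y y) \<partial>B)\<bar> \<le> \<eta>" if "\<eta> > 0" for \<eta>
    proof -
      have "\<eta> / D > 0" using that D by simp
      then obtain g where g: "real_polynomial_function g" "\<And>t. t \<in> {-1..1} \<Longrightarrow> \<bar>f t - g t\<bar> < \<eta> / D"
        using Stone_Weierstrass_real_polynomial_function[of "{-1..1 :: real}" f "\<eta> / D"] continuous_on_subset[OF f] by auto
      have gc: "continuous_on UNIV g" using continuous_real_polymonial_function[OF g(1)] continuous_at_imp_continuous_on by blast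
      have e: "\<bar>f t - g t\<bar> \<le> \<eta> / D" if "t \<in> {-1..1}" for t using g(2)[OF that] by simp
      define u where "u = (\<integral>x. f (X x) \<partial>A) - (\<integral>x. g (X x) \<partial>A)"
      define v where "v = (\<integral>y. f (Y y) \<partial>B) - (\<integral>y. g (Y y) \<partial>B)"
      have u: "\<bar>u\<bar> \<le> \<eta> / D * measure A (space A)" unfolding u_def by (rule close[OF A X X1 f gc e])
      have v: "\<bar>v\<bar> \<le> \<eta> / D * measure B (space B)" unfolding v_def by (rule close[OF B Y Y1 f gc e])
      have "a * (\<integral>x. f (X x) \<partial>A) - b * (\<integral>y. f (Y y) \<partial>B) = a * u - b * v"
        using poly[OF g(1)] by (simp add: u_def v_def right_diff_distrib)
      then have "\<bar>a * (\<integral>x. f (X x) \<partial>A) - b * (\<integral>y. f (Y y) \<partial>B)\<bar> \<le> \<bar>a\<bar> * \<bar>u\<bar> + \<bar>b\<bar> * \<bar>v\<bar>"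
        using abs_triangle_ineq4[of "a * u" "b * v"] by (simp add: abs_mult)
      also have "\<dots> \<le> \<bar>a\<bar> * (\<eta> / D * measure A (space A)) + \<bar>b\<bar> * (\<eta> / D * measure B (space B))"
        by (intro add_mono mult_left_mono u v) auto
      also have "\<dots> = \<eta> * ((D - 1) / D)" 
      proof -
        have "D - 1 = \<bar>a\<bar> * measure A (space A) + \<bar>b\<bar> * measure B (space B)" by (simp add: D_def)
        then show ?thesis by (simp add: distrib_left add_divide_distrib mult_ac)
      qed
      also have "\<dots> \<le> \<eta> * 1" using D that by (intro mult_left_mono) (auto simp: field_simps)
      finally show ?thesis by simp
    qed
    then have "\<bar>a * (\<integral>x. f (X x) \<partial>A) - b * (\<integral>y. f (Y y) \<partial>B)\<bar> \<le> 0" by (rule field_le_epsilon) simp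
    then show ?thesis by simp
  qed
  \<comment> \<open>Continuous ramps that tend pointwise to the indicator of the open band from
    below.\<close>
  define f where "f k t = min 1 (real k * max 0 (s - \<bar>t\<bar>))" for k :: nat and t
  have fc: "continuous_on UNIV (f k)" for k unfolding f_def by (intro continuous_intros)
  have flim: "(\<lambda>k. f k t) \<longlonglongrightarrow> indicator {t. \<bar>t\<bar> < s} t" for t
  proof (cases "\<bar>t\<bar> < s")
    case True
    obtain K :: nat where K: "1 / (s - \<bar>t\<bar>) < real K" using reals_Archimedean2 by blast
    have "f k t = 1" if "k \<ge> K" for k
    proof -
      have "1 < real K * (s - \<bar>t\<bar>)" using K True by (simp add: pos_divide_less_eq)
      also have "\<dots> \<le> real k * (s - \<bar>t\<bar>)" using that True by (intro mult_right_mono) auto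
      finally show ?thesis using True by (simp add: f_def)
    qed
    then have "\<forall>\<^sub>F k in sequentially. f k t = 1" unfolding eventually_sequentially by blast
    then show ?thesis using True by (simp add: tendsto_eventually)
  next
    case False
    then show ?thesis by (simp add: f_def)
  qed
  have f01: "\<bar>f k t\<bar> \<le> 1" for k t by (simp add: f_def)
  have lim: "(\<lambda>k. \<integral>z. f k (Z z) \<partial>C) \<longlonglongrightarrow> measure C {z\<in>space C. \<bar>Z z\<bar> < s}"
    if C: "finite_measure C" and Z: "Z \<in> borel_measurable C" for C :: "'d measure" and Z
  proof -
    interpret finite_measure C by (rule C)
    have m: "{z\<in>space C. \<bar>Z z\<bar> < s} \<in> sets C" using Z by measurable
    have "(\<lambda>k. \<integral>z. f k (Z z) \<partial>C) \<longlonglongrightarrow> (\<integral>z. indicator {z\<in>space C. \<bar>Z z\<bar> < s} z \<partial>C)"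
    proof (rule integral_dominated_convergence[where w = "\<lambda>_. 1"])
      show "AE z in C. (\<lambda>k. f k (Z z)) \<longlonglongrightarrow> indicator {z\<in>space C. \<bar>Z z\<bar> < s} z"
        using flim by (intro AE_I2) (simp add: indicator_def)
      show "(\<lambda>z. f k (Z z)) \<in> borel_measurable C" for k
        by (rule measurable_compose[OF Z borel_measurable_continuous_onI[OF fc]])
    qed (use m f01 in auto)
    then show ?thesis using m by simp
  qed
  have "(\<lambda>k. a * (\<integral>x. f k (X x) \<partial>A)) \<longlonglongrightarrow> a * measure A {x\<in>space A. \<bar>X x\<bar> < s}"
    by (intro tendsto_mult tendsto_const lim[OF A X])
  moreover have "(\<lambda>k. a * (\<integral>x. f k (X x) \<partial>A)) \<longlonglongrightarrow> b * measure B {y\<in>space B. \<bar>Y y\<bar> < s}"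
    unfolding cont[OF fc] by (intro tendsto_mult tendsto_const lim[OF B Y])
  ultimately show ?thesis by (rule LIMSEQ_unique)
qed

text \<open>For \<open>N = n - 1\<close> the weight is, up to a constant, the distribution of the
  latitude \<open>t\<close> on the sphere of dimension \<open>n\<close>; the height is then
  \<open>sin t\<close>. For \<open>n = 1\<close> it is uniform.\<close>

definition cos_integral :: "nat \<Rightarrow> real set \<Rightarrow> real" where
  "cos_integral N S = (\<integral>t. indicator (S \<inter> {- pi / 2..pi / 2}) t * cos t ^ N \<partial>lborel)"

abbreviation (input) "cos_ratio n \<epsilon> \<equiv> cos_integral (n - 1) {- \<epsilon><..<\<epsilon>} / cos_integral (n - 1) UNIV"

lemma cos_nonneg: "t \<in> {- pi / 2..pi / 2} \<Longrightarrow> 0 \<le> cos t"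
  by (rule cos_ge_zero) auto

lemma cos_integrable:
  assumes "S \<in> sets borel"
  shows "integrable lborel (\<lambda>t. indicator (S \<inter> {- pi / 2..pi / 2}) t * cos (t :: real) ^ N)"
proof (rule Bochner_Integration.integrable_bound)
  show "integrable lborel (indicator {- pi / 2..pi / 2} :: real \<Rightarrow> real)"
    by (rule integrable_real_indicator) (auto simp: emeasure_lborel_Icc_eq)
  show "AE t in lborel. norm (indicator (S \<inter> {- pi / 2..pi / 2}) t * cos (t :: real) ^ N) \<le> norm (indicator {- pi / 2..pi / 2} t :: real)"
    by (intro AE_I2) (auto simp: indicator_def power_abs intro!: power_le_one)
qed (use assms in measurable)

text \<open>The integrand is the derivative of \<open>sin t ^ j * cos t ^ n\<close>, which vanishes
  at both ends because \<open>n \<ge> 1\<close>. It is the one-dimensional shadow of Green's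
  identity for the \<open>j\<close>-th power of the height and the height itself.\<close>

lemma cos_integral_moment:
  fixes n j :: nat
  assumes "n \<ge> 1"
  shows "(\<integral>t. (real j * sin t ^ (j - 1) * (1 - (sin t)\<^sup>2) - real n * sin t ^ (j + 1)) * cos t ^ (n - 1) * indicator {- pi / 2..pi / 2} t \<partial>lborel) = 0"
proof -
  define F where "F t = sin t ^ j * cos t ^ n" for t :: real
  define f where "f t = (real j * sin t ^ (j - 1) * (1 - (sin t)\<^sup>2) - real n * sin t ^ (j + 1)) * cos t ^ (n - 1)" for t :: real
  have "(\<integral>t. f t * indicator {- pi / 2..pi / 2} t \<partial>lborel) = F (pi / 2) - F (- pi / 2)"
  proof (rule integral_FTC_Icc_real)
    show "DERIV F t :> f t" for t
    proof -
      obtain n' where n: "n = Suc n'" using assms by (cases n) auto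
      have "DERIV F t :> real j * sin t ^ (j - 1) * cos t * cos t ^ n + sin t ^ j * (real n * cos t ^ (n - 1) * (- sin t))"
        unfolding F_def by (auto intro!: derivative_eq_intros simp: mult_ac)
      moreover have e: "1 - (sin t)\<^sup>2 = cos t * cos t" using sin_cos_squared_add[of t] by (simp add: power2_eq_square)
      have "f t = real j * sin t ^ (j - 1) * cos t * cos t ^ n + sin t ^ j * (real n * cos t ^ (n - 1) * (- sin t))"
        unfolding f_def e by (simp add: n algebra_simps)
      ultimately show ?thesis by simp
    qed
    show "isCont f t" for t unfolding f_def by (intro continuous_intros)
  qed (use pi_gt_zero in simp)
  also have "\<dots> = 0" using assms by (simp add: F_def)
  finally show ?thesis by (simp add: f_def)
qed

text \<open>The quotient of the two sides is nonincreasing: its derivative has the sign of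
  \<open>z * cos z - sin z\<close>. That this is not positive follows in turn from the derivative
  \<open>z * sin z\<close> of \<open>sin z - z * cos z\<close>.\<close>

lemma cos_le_exp:
  assumes "0 \<le> x" "x \<le> pi / 2"
  shows "cos x \<le> exp (- (x\<^sup>2 / 2))"
proof -
  have sc: "y * cos y \<le> sin y" if "0 \<le> y" "y \<le> pi / 2" for y
  proof -
    have "(\<lambda>y. sin y - y * cos y) 0 \<le> (\<lambda>y. sin y - y * cos y) y"
    proof (rule DERIV_nonneg_imp_nondecreasing[OF that(1)])
      fix z assume z: "0 \<le> z" "z \<le> y"
      have "DERIV (\<lambda>y. sin y - y * cos y) z :> z * sin z" by (auto intro!: derivative_eq_intros)
      moreover have "0 \<le> z * sin z" using z that by (intro mult_nonneg_nonneg sin_ge_zero) auto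
      ultimately show "\<exists>d. DERIV (\<lambda>y. sin y - y * cos y) z :> d \<and> 0 \<le> d" by blast
    qed
    then show ?thesis by simp
  qed
  have "(\<lambda>y. cos y * exp (y\<^sup>2 / 2)) 0 \<ge> (\<lambda>y. cos y * exp (y\<^sup>2 / 2)) x"
  proof (rule DERIV_nonpos_imp_nonincreasing[OF assms(1)])
    fix z assume z: "0 \<le> z" "z \<le> x"
    have "DERIV (\<lambda>y. cos y * exp (y\<^sup>2 / 2)) z :> exp (z\<^sup>2 / 2) * (z * cos z - sin z)"
      by (auto intro!: derivative_eq_intros simp: algebra_simps)
    moreover have "exp (z\<^sup>2 / 2) * (z * cos z - sin z) \<le> 0" using sc[of z] z assms by (intro mult_nonneg_nonpos) auto
    ultimately show "\<exists>d. DERIV (\<lambda>y. cos y * exp (y\<^sup>2 / 2)) z :> d \<and> d \<le> 0" by blast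
  qed
  then have "cos x * exp (x\<^sup>2 / 2) \<le> 1" by simp
  then show ?thesis by (simp add: exp_minus field_simps)
qed

lemma cos_integral_total: "cos_integral N UNIV = 2 * cos_integral N {0..}"
proof -
  have "cos_integral N {..<0} = (\<integral>t. indicator ({..<0} \<inter> {- pi / 2..pi / 2}) (0 + - 1 * t) * cos (0 + - 1 * t) ^ N \<partial>lborel)"
    unfolding cos_integral_def by (subst lborel_integral_real_affine[of "- 1" _ 0]) auto
  also have "\<dots> = (\<integral>t. indicator ({0..} \<inter> {- pi / 2..pi / 2}) t * cos t ^ N \<partial>lborel)"
  proof (rule integral_cong_AE)
    show "AE t in lborel. indicator ({..<0} \<inter> {- pi / 2..pi / 2}) (0 + - 1 * t) * cos (0 + - 1 * t) ^ N =
        indicator ({0..} \<inter> {- pi / 2..pi / 2}) t * cos t ^ N"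
      using AE_lborel_singleton[of 0] by eventually_elim (auto simp: indicator_def)
  qed measurable
  finally have half: "cos_integral N {..<0} = cos_integral N {0..}" by (simp add: cos_integral_def)
  have "cos_integral N UNIV = (\<integral>t. indicator ({..<0} \<inter> {- pi / 2..pi / 2}) t * cos t ^ N + indicator ({0..} \<inter> {- pi / 2..pi / 2}) t * cos t ^ N \<partial>lborel)"
    unfolding cos_integral_def by (rule Bochner_Integration.integral_cong) (auto simp: indicator_def)
  also have "\<dots> = cos_integral N {..<0} + cos_integral N {0..}"
    unfolding cos_integral_def by (rule Bochner_Integration.integral_add) (rule cos_integrable, simp)+
  finally show ?thesis using half by simp
qed

text \<open>The bound for the tails comes from \<open>cos (\<epsilon> + s) \<le> cos \<epsilon> * cos s\<close>.\<close>

lemma cos_integral_tail: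
  assumes \<epsilon>: "0 < \<epsilon>" "\<epsilon> < pi / 2"
  shows "cos_integral N UNIV - cos_integral N {- \<epsilon><..<\<epsilon>} \<le> cos \<epsilon> ^ N * cos_integral N UNIV"
proof -
  let ?H = "indicator ({0..} \<inter> {- pi / 2..pi / 2}) :: real \<Rightarrow> real"
  have shift: "(\<integral>s. indicator {0..pi / 2 - \<epsilon>} s * cos (\<epsilon> + s) ^ N \<partial>lborel) \<le> cos \<epsilon> ^ N * cos_integral N {0..}"
  proof -
    have le: "indicator {0..pi / 2 - \<epsilon>} s * cos (\<epsilon> + s) ^ N \<le> cos \<epsilon> ^ N * (?H s * cos s ^ N)" for s
    proof (cases "s \<in> {0..pi / 2 - \<epsilon>}")
      case True
      have "0 \<le> sin \<epsilon> * sin s" using True \<epsilon> by (intro mult_nonneg_nonneg sin_ge_zero) auto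
      then have "cos (\<epsilon> + s) \<le> cos \<epsilon> * cos s" by (simp add: cos_add)
      moreover have "0 \<le> cos (\<epsilon> + s)" using True \<epsilon> by (intro cos_ge_zero) auto
      ultimately have "cos (\<epsilon> + s) ^ N \<le> (cos \<epsilon> * cos s) ^ N" by (intro power_mono)
      moreover have "?H s = 1" using True \<epsilon> by (auto simp: indicator_def)
      ultimately show ?thesis using True by (simp add: power_mult_distrib)
    next
      case False
      have "0 \<le> ?H s * cos s ^ N" using cos_nonneg[of s] by (auto simp: indicator_def)
      moreover have "0 \<le> cos \<epsilon> ^ N" using \<epsilon> by (intro zero_le_power cos_ge_zero) auto
      ultimately show ?thesis using False by simp
    qed
    have "(\<integral>s. indicator {0..pi / 2 - \<epsilon>} s * cos (\<epsilon> + s) ^ N \<partial>lborel) \<le> (\<integral>s. cos \<epsilon> ^ N * (?H s * cos s ^ N) \<partial>lborel)"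
    proof (rule integral_mono)
      show "integrable lborel (\<lambda>s. indicator {0..pi / 2 - \<epsilon>} s * cos (\<epsilon> + s) ^ N)"
      proof (rule Bochner_Integration.integrable_bound)
        show "integrable lborel (indicator {0..pi / 2 - \<epsilon>} :: real \<Rightarrow> real)"
          by (rule integrable_real_indicator) (auto simp: emeasure_lborel_Icc_eq)
        show "AE s in lborel. norm (indicator {0..pi / 2 - \<epsilon>} s * cos (\<epsilon> + s) ^ N) \<le> norm (indicator {0..pi / 2 - \<epsilon>} s :: real)"
          by (intro AE_I2) (auto simp: indicator_def power_abs intro!: power_le_one)
      qed measurable
      show "integrable lborel (\<lambda>s. cos \<epsilon> ^ N * (?H s * cos s ^ N))" by (intro integrable_mult_right cos_integrable) simp
    qed (rule le)
    then show ?thesis by (simp add: cos_integral_def)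
  qed
  have right: "cos_integral N {\<epsilon>..} = (\<integral>s. indicator {0..pi / 2 - \<epsilon>} s * cos (\<epsilon> + s) ^ N \<partial>lborel)"
  proof -
    have "cos_integral N {\<epsilon>..} = (\<integral>s. indicator ({\<epsilon>..} \<inter> {- pi / 2..pi / 2}) (\<epsilon> + 1 * s) * cos (\<epsilon> + 1 * s) ^ N \<partial>lborel)"
      unfolding cos_integral_def by (subst lborel_integral_real_affine[of 1 _ \<epsilon>]) auto
    also have "\<dots> = (\<integral>s. indicator {0..pi / 2 - \<epsilon>} s * cos (\<epsilon> + s) ^ N \<partial>lborel)"
      by (rule Bochner_Integration.integral_cong) (use \<epsilon> in \<open>auto simp: indicator_def\<close>)
    finally show ?thesis .
  qed
  have left: "cos_integral N {..-\<epsilon>} = (\<integral>s. indicator {0..pi / 2 - \<epsilon>} s * cos (\<epsilon> + s) ^ N \<partial>lborel)"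
  proof -
    have "cos_integral N {..-\<epsilon>} = (\<integral>s. indicator ({..-\<epsilon>} \<inter> {- pi / 2..pi / 2}) (- \<epsilon> + - 1 * s) * cos (- \<epsilon> + - 1 * s) ^ N \<partial>lborel)"
      unfolding cos_integral_def by (subst lborel_integral_real_affine[of "- 1" _ "- \<epsilon>"]) auto
    also have "\<dots> = (\<integral>s. indicator {0..pi / 2 - \<epsilon>} s * cos (\<epsilon> + s) ^ N \<partial>lborel)"
    proof (rule Bochner_Integration.integral_cong[OF refl])
      fix s
      have "cos (- \<epsilon> + - 1 * s) = cos (\<epsilon> + s)" using cos_minus[of "\<epsilon> + s"] by simp
      then show "indicator ({..-\<epsilon>} \<inter> {- pi / 2..pi / 2}) (- \<epsilon> + - 1 * s) * cos (- \<epsilon> + - 1 * s) ^ N =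
          indicator {0..pi / 2 - \<epsilon>} s * cos (\<epsilon> + s) ^ N"
        using \<epsilon> by (auto simp: indicator_def)
    qed
    finally show ?thesis .
  qed
  have "cos_integral N UNIV = (\<integral>t. indicator ({- \<epsilon><..<\<epsilon>} \<inter> {- pi / 2..pi / 2}) t * cos t ^ N +
      (indicator ({\<epsilon>..} \<inter> {- pi / 2..pi / 2}) t * cos t ^ N + indicator ({..-\<epsilon>} \<inter> {- pi / 2..pi / 2}) t * cos t ^ N) \<partial>lborel)"
    unfolding cos_integral_def by (rule Bochner_Integration.integral_cong) (use \<epsilon> in \<open>auto simp: indicator_def\<close>)
  also have "\<dots> = cos_integral N {- \<epsilon><..<\<epsilon>} + (cos_integral N {\<epsilon>..} + cos_integral N {..-\<epsilon>})"
    unfolding cos_integral_def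
    by (simp only: Bochner_Integration.integral_add Bochner_Integration.integrable_add cos_integrable borel_closed closed_atLeast closed_atMost borel_open open_greaterThanLessThan)
  \<comment> \<open>Each tail is at most \<open>cos \<epsilon> ^ N\<close> times half of the total,
    so together they give the full total.\<close>
  finally show ?thesis using shift unfolding left right cos_integral_total by linarith
qed

lemma cos_integral_pos: "cos_integral N UNIV > 0"
proof -
  have "cos_integral N UNIV \<noteq> 0"
  proof
    assume "cos_integral N UNIV = 0"
    then have "AE t in lborel. indicator (UNIV \<inter> {- pi / 2..pi / 2}) t * cos t ^ N = 0"
      unfolding cos_integral_def
      by (subst (asm) integral_nonneg_eq_0_iff_AE[OF cos_integrable]) (auto simp: indicator_def cos_nonneg)
    then have "AE t in lborel. t \<notin> {0<..<1 :: real}"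
    proof eventually_elim
      case (elim t)
      show ?case
      proof
        assume t: "t \<in> {0<..<1}"
        then have "t < pi / 2" using pi_gt3 by simp
        then have "cos t > 0" using t by (intro cos_gt_zero) auto
        then show False using elim t \<open>t < pi / 2\<close> by (auto simp: indicator_def)
      qed
    qed
    then have "emeasure lborel {0<..<1 :: real} = 0"
      by (subst (asm) AE_iff_measurable[of "{0<..<1}"]) auto
    then show False by simp
  qed
  moreover have "cos_integral N UNIV \<ge> 0"
    unfolding cos_integral_def by (rule integral_nonneg_AE) (auto simp: indicator_def cos_nonneg)
  ultimately show ?thesis by simp
qed

text \<open>The complement of the band has ratio at most \<open>cos \<epsilon> ^ (n - 1)\<close>, a
  Gaussian bound with constant 1; the factor \<open>sqrt (pi / 2)\<close> only weakens it.\<close>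

lemma cos_ratio_bound:
  assumes n: "n \<ge> 1" and \<epsilon>: "0 < \<epsilon>" "\<epsilon> < pi / 2"
  shows "cos_ratio n \<epsilon> \<ge>
    1 - sqrt (pi / 2) * exp (- (\<epsilon>\<^sup>2 * ((real n - 1) / 2)))"
proof -
  let ?N = "n - 1"
  have "cos \<epsilon> ^ ?N \<le> exp (- (\<epsilon>\<^sup>2 / 2)) ^ ?N"
    by (rule power_mono[OF cos_le_exp cos_ge_zero]) (use \<epsilon> in auto)
  also have "\<dots> = exp (- (\<epsilon>\<^sup>2 * ((real n - 1) / 2)))"
    using n by (simp add: exp_of_nat_mult[symmetric] of_nat_diff algebra_simps)
  also have "\<dots> \<le> sqrt (pi / 2) * exp (- (\<epsilon>\<^sup>2 * ((real n - 1) / 2)))"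
  proof -
    have "1 \<le> sqrt (pi / 2)" using pi_gt3 by simp
    then show ?thesis by (simp add: mult_le_cancel_right1)
  qed
  finally have c: "cos \<epsilon> ^ ?N \<le> sqrt (pi / 2) * exp (- (\<epsilon>\<^sup>2 * ((real n - 1) / 2)))" .
  have pos: "cos_integral ?N UNIV > 0" by (rule cos_integral_pos)
  have "1 - cos_integral ?N {- \<epsilon><..<\<epsilon>} / cos_integral ?N UNIV = (cos_integral ?N UNIV - cos_integral ?N {- \<epsilon><..<\<epsilon>}) / cos_integral ?N UNIV"
    using pos by (simp add: diff_divide_distrib)
  also have "\<dots> \<le> cos \<epsilon> ^ ?N"
    using cos_integral_tail[OF \<epsilon>, of ?N] pos by (simp add: pos_divide_le_eq)
  finally show ?thesis using c by simp
qed

section \<open>The law of a function with the gradient and Laplacian of a height\<close>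

context compact_riemannian
begin

theorem band_ratio:
  assumes n: "n \<ge> 1" and \<epsilon>: "0 < \<epsilon>" "\<epsilon> < pi / 2"
    and h: "\<And>c. c \<in> atlas M \<Longrightarrow> C2 m (im c) (loc c h)"
    and grad: "\<And>c x. c \<in> atlas M \<Longrightarrow> x \<in> im c \<Longrightarrow>
      product_in c h h x = 1 - (h (chart_inv c x))\<^sup>2"
    and lap: "\<And>c x. c \<in> atlas M \<Longrightarrow> x \<in> im c \<Longrightarrow>
      laplacian_in c h x = - real n * h (chart_inv c x)"
    and h1: "\<And>p. p \<in> points M \<Longrightarrow> \<bar>h p\<bar> \<le> 1"
  shows "measure volume {p\<in>points M. \<bar>h p\<bar> < sin \<epsilon>} / measure volume (points M) =
    cos_ratio n \<epsilon>"
proof -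
  interpret finite_measure volume by (rule volume_finite_measure)
  have hC: "C1_M h" unfolding C1_M_def using C2_C1[OF h] by blast
  have hcont: "continuous_map T euclideanreal h" by (rule continuous_M[OF C1_continuous[OF C1_MD[OF hC]]])
  have hm: "h \<in> borel_measurable volume" by (rule continuous_measurable[OF hcont])
  have pw: "integrable volume (\<lambda>p. h p ^ k)" for k
    by (rule integrable_const_bound[of _ 1])
      (use hm h1 in \<open>auto simp: space_volume power_abs intro!: AE_I2 power_le_one\<close>)
  define \<mu> where "\<mu> k = (\<integral>p. h p ^ k \<partial>volume)" for k
  \<comment> \<open>For \<open>j = 0\<close> the truncated exponent \<open>j - 1\<close> is
    multiplied by zero, and the identity says that the first moment vanishes.\<close>
  have rec: "real (j + n) * \<mu> (j + 1) = real j * \<mu> (j - 1)" for j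
  proof -
    have Lc: "continuous_map T euclideanreal (\<lambda>p. - real n * h p)" by (intro continuous_map_real_mult hcont) simp
    have "(\<integral>p. grad_product (\<lambda>p. h p ^ j) h p + h p ^ j * (- real n * h p) \<partial>volume) = 0"
      by (rule greens_identity[OF C1_M_power[OF hC] h Lc]) (simp_all add: lap)
    moreover have "grad_product (\<lambda>p. h p ^ j) h p + h p ^ j * (- real n * h p) = real j * h p ^ (j - 1) - real (j + n) * h p ^ (j + 1)"
      if p: "p \<in> points M" for p
    proof -
      obtain c where c: "c \<in> atlas M" "p \<in> chart_dom c" using p cover by blast
      define x where "x = chart_map c p"
      have x: "x \<in> im c" "chart_inv c x = p" using chart_map_im[OF c(2)] chart_inv_map[OF c] by (auto simp: x_def)
      have "grad_product (\<lambda>p. h p ^ j) h p =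
          metric_product m (components M c) (\<lambda>x. h (chart_inv c x) ^ j) (loc c h) x"
        unfolding x_def by (rule grad_product_chart[OF C1_M_power[OF hC] hC c])
      also have "\<dots> = real j * h p ^ (j - 1) * product_in c h h x"
        unfolding metric_product_def sum_distrib_left
        by (intro sum.cong refl) (simp add: C1_power(2)[OF C1_MD[OF hC c(1)] x(1)] x(2))
      also have "\<dots> = real j * h p ^ (j - 1) * (1 - (h p)\<^sup>2)" by (simp add: grad[OF c(1) x(1)] x(2))
      finally show ?thesis by (cases j) (simp_all add: algebra_simps power2_eq_square)
    qed
    then have "(\<integral>p. grad_product (\<lambda>p. h p ^ j) h p + h p ^ j * (- real n * h p) \<partial>volume) =
        (\<integral>p. real j * h p ^ (j - 1) - real (j + n) * h p ^ (j + 1) \<partial>volume)"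
      by (intro Bochner_Integration.integral_cong refl) (simp only: space_volume)
    ultimately have "(\<integral>p. real j * h p ^ (j - 1) - real (j + n) * h p ^ (j + 1) \<partial>volume) = 0" by simp
    moreover have "(\<integral>p. real j * h p ^ (j - 1) - real (j + n) * h p ^ (j + 1) \<partial>volume) = real j * \<mu> (j - 1) - real (j + n) * \<mu> (j + 1)"
      unfolding \<mu>_def
      by (subst Bochner_Integration.integral_diff) (intro integrable_mult_right pw | simp)+
    ultimately show ?thesis by simp
  qed
  define N where "N = n - 1"
  define w where "w t = indicator (UNIV \<inter> {- pi / 2..pi / 2}) t * cos t ^ N" for t :: real
  have w0: "w t \<ge> 0" for t using cos_nonneg[of t] by (auto simp: w_def indicator_def)
  have wint: "integrable lborel w" unfolding w_def by (rule cos_integrable) simp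
  have wm: "w \<in> borel_measurable lborel" using wint by simp
  \<comment> \<open>The reference measure: the latitude distribution, on which \<open>sin\<close>
    plays the part of \<open>h\<close>. It satisfies the same recursion.\<close>
  define B where "B = density lborel (\<lambda>t. ennreal (w t))"
  have B: "finite_measure B"
    by (rule finite_measureI)
      (use wint w0 wm in \<open>simp add: B_def emeasure_density nn_integral_eq_integral\<close>)
  have Bint: "(\<integral>t. f t \<partial>B) = (\<integral>t. w t * f t \<partial>lborel)" if "f \<in> borel_measurable borel" for f :: "real \<Rightarrow> real"
    unfolding B_def using integral_density[of f lborel w] that wm w0 by simp
  interpret B: finite_measure B by (rule B)
  define \<beta> where "\<beta> k = (\<integral>t. sin t ^ k \<partial>B)" for k
  have spw: "integrable B (\<lambda>t. sin t ^ k)" for k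
    by (rule B.integrable_const_bound[of _ 1]) (auto simp: B_def power_abs intro!: AE_I2 power_le_one)
  have recB: "real (j + n) * \<beta> (j + 1) = real j * \<beta> (j - 1)" for j
  proof -
    have "real j * \<beta> (j - 1) - real (j + n) * \<beta> (j + 1) = (\<integral>t. real j * sin t ^ (j - 1) - real (j + n) * sin t ^ (j + 1) \<partial>B)"
      unfolding \<beta>_def by (subst Bochner_Integration.integral_diff) (intro integrable_mult_right spw | simp)+
    also have "\<dots> = (\<integral>t. w t * (real j * sin t ^ (j - 1) - real (j + n) * sin t ^ (j + 1)) \<partial>lborel)"
      by (rule Bint) measurable
    also have "\<dots> = (\<integral>t. (real j * sin t ^ (j - 1) * (1 - (sin t)\<^sup>2) - real n * sin t ^ (j + 1)) * cos t ^ (n - 1) * indicator {- pi / 2..pi / 2} t \<partial>lborel)"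
      by (rule Bochner_Integration.integral_cong[OF refl], cases j) (simp_all add: w_def N_def algebra_simps power2_eq_square)
    also have "\<dots> = 0" by (rule cos_integral_moment[OF n])
    finally show ?thesis by simp
  qed
  \<comment> \<open>The moments agree after cross-multiplication with the total masses. Solving the
    recursion for the moment of order \<open>j + 1\<close> divides by \<open>j + n\<close>, which is
    positive since \<open>n \<ge> 1\<close>.\<close>
  have mom: "\<beta> 0 * \<mu> k = \<mu> 0 * \<beta> k" for k
  proof (induction k rule: less_induct)
    case (less k)
    show ?case
    proof (cases k)
      case (Suc j)
      have "\<beta> 0 * \<mu> (j - 1) * real j = \<mu> 0 * \<beta> (j - 1) * real j" using less.IH[of "j - 1"] Suc by (cases j) auto
      then have "real (j + n) * (\<beta> 0 * \<mu> (j + 1)) = real (j + n) * (\<mu> 0 * \<beta> (j + 1))"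
        using rec[of j] recB[of j] by (simp add: mult_ac)
      then show ?thesis using n Suc by simp
    qed simp
  qed
  have "\<beta> 0 * measure volume {p\<in>space volume. \<bar>h p\<bar> < sin \<epsilon>} = \<mu> 0 * measure B {t\<in>space B. \<bar>sin t\<bar> < sin \<epsilon>}"
    by (rule equal_moments_band[OF volume_finite_measure B hm])
      (use h1 mom in \<open>auto simp: space_volume B_def \<mu>_def \<beta>_def\<close>)
  moreover have "\<mu> 0 = measure volume (points M)" by (simp add: \<mu>_def space_volume)
  moreover have "\<beta> 0 = cos_integral N UNIV" unfolding \<beta>_def by (subst Bint) (simp_all add: w_def cos_integral_def)
  moreover have "measure B {t\<in>space B. \<bar>sin t\<bar> < sin \<epsilon>} = cos_integral N {- \<epsilon><..<\<epsilon>}"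
  proof -
    have S: "{t :: real. \<bar>sin t\<bar> < sin \<epsilon>} \<in> sets borel" by measurable
    have "measure B {t\<in>space B. \<bar>sin t\<bar> < sin \<epsilon>} = (\<integral>t. indicator {t. \<bar>sin t\<bar> < sin \<epsilon>} t \<partial>B)"
      using S by (simp add: B_def)
    also have "\<dots> = (\<integral>t. w t * indicator {t. \<bar>sin t\<bar> < sin \<epsilon>} t \<partial>lborel)" by (rule Bint) (use S in simp)
    also have "\<dots> = cos_integral N {- \<epsilon><..<\<epsilon>}"
      unfolding cos_integral_def
    proof (rule Bochner_Integration.integral_cong[OF refl])
      fix t :: real
      have "\<bar>sin t\<bar> < sin \<epsilon> \<longleftrightarrow> t \<in> {- \<epsilon><..<\<epsilon>}" if "t \<in> {- pi / 2..pi / 2}"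
      proof -
        have "sin t < sin \<epsilon> \<longleftrightarrow> t < \<epsilon>" using that \<epsilon> by (intro sin_mono_less_eq) auto
        moreover have "sin (- \<epsilon>) < sin t \<longleftrightarrow> - \<epsilon> < t" using that \<epsilon> by (intro sin_mono_less_eq) auto
        ultimately show ?thesis by (auto simp: abs_less_iff)
      qed
      then show "w t * indicator {t. \<bar>sin t\<bar> < sin \<epsilon>} t = indicator ({- \<epsilon><..<\<epsilon>} \<inter> {- pi / 2..pi / 2}) t * cos t ^ N"
        by (auto simp: w_def indicator_def)
    qed
    finally show ?thesis .
  qed
  ultimately show ?thesis
    using measure_volume_pos cos_integral_pos[of N] by (simp add: N_def space_volume field_simps)
qed

end

section \<open>The round sphere\<close>

definition unit_sphere :: "nat \<Rightarrow> (nat \<Rightarrow> real) set" where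
  "unit_sphere n = {y. (\<Sum>i\<le>n. (y i)\<^sup>2) = 1 \<and> (\<forall>i>n. y i = 0)}"

lemma nsphere_eq: "nsphere n = top_of_set (unit_sphere n)"
  by (simp add: nsphere unit_sphere_def euclidean_product_topology)

lemma compact_unit_sphere: "compact (unit_sphere n)"
proof -
  have "unit_sphere n = closed_cube (Suc n) (\<lambda>_. 0) 1 \<inter> {y. (\<Sum>i\<le>n. (y i)\<^sup>2) = 1}"
  proof (intro equalityI subsetI)
    fix y assume y: "y \<in> unit_sphere n"
    have "\<bar>y i\<bar> \<le> 1" if "i < Suc n" for i
    proof -
      have "(y i)\<^sup>2 \<le> (\<Sum>i\<le>n. (y i)\<^sup>2)" by (rule member_le_sum) (use that in auto)
      then show ?thesis using y by (simp add: unit_sphere_def abs_square_le_1)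
    qed
    then show "y \<in> closed_cube (Suc n) (\<lambda>_. 0) 1 \<inter> {y. (\<Sum>i\<le>n. (y i)\<^sup>2) = 1}"
      using y by (simp add: unit_sphere_def closed_cube_def)
  qed (auto simp: unit_sphere_def closed_cube_def)
  moreover have "closed {y :: nat \<Rightarrow> real. (\<Sum>i\<le>n. (y i)\<^sup>2) = 1}"
    by (intro closed_Collect_eq continuous_intros continuous_on_product_coordinates)
  ultimately show ?thesis using compact_Int_closed[OF compact_closed_cube] by simp
qed

definition coords :: "nat \<Rightarrow> (nat \<Rightarrow> real) set" where "coords n = {x. \<forall>i\<ge>n. x i = 0}"

text \<open>The length scale of the inverse stereographic projection: the round metric is its square
  times the Euclidean one (\<open>round_components\<close>).\<close>

definition conformal :: "nat \<Rightarrow> (nat \<Rightarrow> real) \<Rightarrow> real" where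
  "conformal n x = 2 / (1 + (\<Sum>k<n. (x k)\<^sup>2))"

text \<open>The last coordinate is the solution of \<open>1 - s * y n = conformal n x\<close>, and
  the others follow from \<open>y i = x i * (1 - s * y n)\<close>.\<close>

definition inverse_stereographic :: "nat \<Rightarrow> real \<Rightarrow> (nat \<Rightarrow> real) \<Rightarrow> nat \<Rightarrow> real" where
  "inverse_stereographic n s x k =
     (if k < n then conformal n x * x k else if k = n then s * (1 - conformal n x) else 0)"

lemma coords_open: "eucl_open n (coords n)"
  unfolding coords_def by (rule openin_Euclidean_UNIV)

lemma conformal_denominator: "1 + (\<Sum>k<n. (x k)\<^sup>2) > (0::real)"
  by (simp add: add_pos_nonneg sum_nonneg)

lemma conformal_pos: "conformal n x > 0"
  using conformal_denominator[of x n] by (simp add: conformal_def)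

text \<open>The definition rearranged so as to eliminate the squared norm of \<open>x\<close>. Every
  computation with the charts below ends by this substitution.\<close>

lemma conformal_norm: "conformal n x * (\<Sum>k<n. (x k)\<^sup>2) = 2 - conformal n x"
  using conformal_denominator[of x n] by (simp add: conformal_def field_simps)

lemma inverse_stereographic_sphere:
  assumes "s\<^sup>2 = 1"
  shows "inverse_stereographic n s x \<in> unit_sphere n"
proof -
  let ?w = "conformal n x"
  have "(\<Sum>i\<le>n. (inverse_stereographic n s x i)\<^sup>2) = (\<Sum>i<n. (?w * x i)\<^sup>2) + (s * (1 - ?w))\<^sup>2"
    unfolding lessThan_Suc_atMost[symmetric] by (simp add: inverse_stereographic_def)
  also have "\<dots> = ?w * (?w * (\<Sum>i<n. (x i)\<^sup>2)) + (1 - ?w)\<^sup>2"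
    using assms by (simp add: power_mult_distrib sum_distrib_left power2_eq_square mult_ac)
  also have "\<dots> = 1" unfolding conformal_norm by (simp add: power2_eq_square algebra_simps)
  finally show ?thesis by (simp add: unit_sphere_def inverse_stereographic_def)
qed

section \<open>Both stereographic charts at once, with a pole \<open>s\<close> satisfying
  \<open>s\<^sup>2 = 1\<close>\<close>

context
  fixes n :: nat and s :: real
  assumes s: "s\<^sup>2 = 1"
begin

abbreviation (input) "stc \<equiv> stereographic n s"
abbreviation (input) "gs \<equiv> components (round_sphere n) stc"
abbreviation (input) "isc \<equiv> inverse_stereographic n s"

lemma pole_square: "s * s = 1" using s by (simp add: power2_eq_square)

lemma stereographic_dom: "chart_dom stc = {y\<in>unit_sphere n. y n \<noteq> s}"
  by (simp add: stereographic_def nsphere_eq)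

lemma stereographic_inverse:
  assumes x: "x \<in> coords n"
  shows "isc x \<in> chart_dom stc" and "chart_map stc (isc x) = x"
proof -
  have w: "1 - s * isc x n = conformal n x" by (simp add: inverse_stereographic_def pole_square flip: mult.assoc)
  have "isc x n \<noteq> s" using w conformal_pos[of n x] pole_square by auto
  then show "isc x \<in> chart_dom stc" using inverse_stereographic_sphere[OF s] by (simp add: stereographic_dom)
  have "(if i < n then isc x i / (1 - s * isc x n) else 0) = x i" for i
    unfolding w using x conformal_pos[of n x] by (simp add: inverse_stereographic_def coords_def)
  then show "chart_map stc (isc x) = x" by (simp add: stereographic_def)
qed

lemma stereographic_denominator: 
  assumes "y \<in> chart_dom stc"
  shows "1 - s * y n \<noteq> 0"
proof
  assume "1 - s * y n = 0"
  then have "s * (s * y n) = s * 1" by simp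
  then have "y n = s" by (simp add: pole_square flip: mult.assoc)
  then show False using assms by (simp add: stereographic_dom)
qed

lemma stereographic_map:
  assumes y: "y \<in> chart_dom stc"
  shows "chart_map stc y \<in> coords n" and "isc (chart_map stc y) = y"
proof -
  show "chart_map stc y \<in> coords n" by (simp add: stereographic_def coords_def)
  define D where "D = 1 - s * y n"
  have D: "D \<noteq> 0" unfolding D_def by (rule stereographic_denominator[OF y])
  have y1: "(\<Sum>i<n. (y i)\<^sup>2) = 1 - (y n)\<^sup>2" "\<forall>i>n. y i = 0"
    using y unfolding stereographic_dom unit_sphere_def lessThan_Suc_atMost[symmetric] by auto
  have "(\<Sum>k<n. (chart_map stc y k)\<^sup>2) = (1 - (y n)\<^sup>2) / D\<^sup>2"
    by (simp add: stereographic_def D_def power_divide flip: sum_divide_distrib y1(1))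
  moreover have "1 - (y n)\<^sup>2 = D * (2 - D)" using pole_square by (simp add: D_def power2_eq_square algebra_simps)
  ultimately have "(\<Sum>k<n. (chart_map stc y k)\<^sup>2) = D * (2 - D) / (D * D)" by (simp add: power2_eq_square)
  also have "\<dots> = (2 - D) / D" using D by simp
  finally have "1 + (\<Sum>k<n. (chart_map stc y k)\<^sup>2) = 2 / D" using D by (simp add: diff_divide_distrib)
  then have w: "conformal n (chart_map stc y) = D" by (simp add: conformal_def)
  have "s * (1 - D) = y n" by (simp add: D_def pole_square flip: mult.assoc)
  then have "isc (chart_map stc y) k = y k" for k
    using D y1(2) by (simp add: inverse_stereographic_def w) (simp add: stereographic_def D_def)
  then show "isc (chart_map stc y) = y" by blast
qed

lemma stereographic_im: "chart_map stc ` chart_dom stc = coords n"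
  using stereographic_inverse stereographic_map(1) by (metis image_eqI image_subsetI subsetI subset_antisym)

lemma stereographic_chart_inv: "x \<in> coords n \<Longrightarrow> chart_inv stc x = isc x"
  unfolding chart_inv_def
  by (rule inv_into_f_eq) (auto intro!: inj_onI stereographic_inverse dest: arg_cong[of _ _ isc] simp: stereographic_map)

lemma conformal_C2: "C2 n (coords n) (conformal n)"
  and conformal_partial: "\<And>x i. x \<in> coords n \<Longrightarrow> i < n \<Longrightarrow> partial i (conformal n) x = - ((conformal n x)\<^sup>2 * x i)"
proof -
  have eq: "conformal n = (\<lambda>x. 2 * inverse (1 + (\<Sum>k<n. x k * x k)))"
    by (rule ext) (simp add: conformal_def power2_eq_square divide_inverse)
  have nz: "1 + (\<Sum>k<n. x k * x k) \<noteq> 0" for x :: "nat \<Rightarrow> real"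
    using conformal_denominator[of x n] by (simp add: power2_eq_square)
  have C2d: "C2 n (coords n) (\<lambda>x. 1 + (\<Sum>k<n. x k * x k))"
    by (intro C2_add C2_sum C2_mult C2_const C2_coord coords_open finite_lessThan)
  show "C2 n (coords n) (conformal n)"
    unfolding eq by (intro C2_mult C2_inverse C2d C2_const coords_open nz)
  fix x i assume x: "x \<in> coords n" and i: "i < n"
  have "partial i (\<lambda>x. 1 + (\<Sum>k<n. x k * x k)) x = 2 * x i"
  proof -
    have "partial i (\<lambda>x. 1 + (\<Sum>k<n. x k * x k)) x = partial i (\<lambda>x. 1) x + partial i (\<lambda>x. \<Sum>k<n. x k * x k) x"
      by (rule C1_add(2)[OF C1_const _ x i]) (intro C1_sum(1) C1_mult(1) C1_coord finite_lessThan)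
    also have "partial i (\<lambda>x. \<Sum>k<n. x k * x k) x = (\<Sum>k<n. partial i (\<lambda>x. x k * x k) x)"
      by (rule C1_sum(2)[OF _ _ x i]) (intro C1_mult(1) C1_coord finite_lessThan)+
    also have "\<dots> = (\<Sum>k<n. if k = i then 2 * x k else 0)"
      by (intro sum.cong refl) (simp add: C1_mult(2)[OF C1_coord C1_coord x i] partial_coord)
    finally show ?thesis using i by (simp add: partial_const)
  qed
  note d = this
  have "partial i (\<lambda>x. 2 * inverse (1 + (\<Sum>k<n. x k * x k))) x =
      partial i (\<lambda>x. 2) x * inverse (1 + (\<Sum>k<n. x k * x k)) + 2 * partial i (\<lambda>x. inverse (1 + (\<Sum>k<n. x k * x k))) x"
    by (rule C1_mult(2)[OF C1_const _ x i]) (intro C1_inverse(1) C2_C1[OF C2d] nz)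
  also have "partial i (\<lambda>x. inverse (1 + (\<Sum>k<n. x k * x k))) x = - (inverse (1 + (\<Sum>k<n. x k * x k)) ^ 2) * (2 * x i)"
    unfolding d[symmetric] by (rule C1_inverse(2)[OF C2_C1[OF C2d] nz x i])
  finally show "partial i (conformal n) x = - ((conformal n x)\<^sup>2 * x i)"
    unfolding eq by (simp add: partial_const power2_eq_square)
qed

lemma inverse_stereographic_C2: "C2 n (coords n) (\<lambda>x. isc x k)"
proof -
  consider "k < n" | "k = n" | "k > n" by linarith
  then show ?thesis
  proof cases
    case 1
    then show ?thesis by (simp add: inverse_stereographic_def C2_mult coords_open conformal_C2 C2_coord)
  next
    case 2
    have "C2 n (coords n) (\<lambda>x. s + (- s) * conformal n x)"
      by (intro C2_add C2_mult C2_const conformal_C2 coords_open)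
    then show ?thesis using 2 by (simp add: inverse_stereographic_def algebra_simps)
  next
    case 3
    then show ?thesis by (simp add: inverse_stereographic_def C2_const coords_open)
  qed
qed

lemma inverse_stereographic_partial:
  assumes x: "x \<in> coords n" and i: "i < n"
  shows "k < n \<Longrightarrow> partial i (\<lambda>x. isc x k) x = (if i = k then conformal n x else 0) - (conformal n x)\<^sup>2 * x i * x k"
    and "partial i (\<lambda>x. isc x n) x = s * (conformal n x)\<^sup>2 * x i"
proof -
  note w = C2_C1[OF conformal_C2]
  show "partial i (\<lambda>x. isc x k) x = (if i = k then conformal n x else 0) - (conformal n x)\<^sup>2 * x i * x k" if k: "k < n"
  proof -
    have "partial i (\<lambda>x. conformal n x * x k) x = partial i (conformal n) x * x k + conformal n x * partial i (\<lambda>x. x k) x"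
      by (rule C1_mult(2)[OF w C1_coord x i])
    then show ?thesis using k by (simp add: inverse_stereographic_def partial_coord conformal_partial[OF x i])
  qed
  have "partial i (\<lambda>x. s * (1 - conformal n x)) x = partial i (\<lambda>x. s) x * (1 - conformal n x) + s * partial i (\<lambda>x. 1 - conformal n x) x"
    by (rule C1_mult(2)[OF C1_const C1_diff(1)[OF C1_const w] x i])
  also have "partial i (\<lambda>x. 1 - conformal n x) x = partial i (\<lambda>x. 1) x - partial i (conformal n) x"
    by (rule C1_diff(2)[OF C1_const w x i])
  finally show "partial i (\<lambda>x. isc x n) x = s * (conformal n x)\<^sup>2 * x i"
    by (simp add: inverse_stereographic_def partial_const conformal_partial[OF x i])
qed

lemma stereographic_jacobian:
  "x \<in> coords n \<Longrightarrow> i < n \<Longrightarrow> jacobian (chart_inv stc) x k i = partial i (\<lambda>x. isc x k) x"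
  unfolding jacobian_def by (rule partial_cong[OF coords_open]) (auto simp: stereographic_chart_inv)

text \<open>The derivative matrix of the first \<open>n\<close> components is symmetric in its two
  indices. So one sum serves both for the metric, where components are contracted, and for the
  gradient products, where directions are.\<close>

lemma conformal_sum: "(\<Sum>k<n. ((if i = k then w else 0) - w\<^sup>2 * x i * x k) * ((if j = k then w else 0) - w\<^sup>2 * x j * x k)) =
    (if i = j then w\<^sup>2 else 0) - 2 * w ^ 3 * x i * x j + w ^ 4 * (\<Sum>k<n. (x k)\<^sup>2) * x i * x j"
  if "i < n" "j < n" for i j and x :: "nat \<Rightarrow> real" and w :: real
proof -
  have "(\<Sum>k<n. ((if i = k then w else 0) - w\<^sup>2 * x i * x k) * ((if j = k then w else 0) - w\<^sup>2 * x j * x k)) =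
      (\<Sum>k<n. (if k = i then (if i = j then w\<^sup>2 else 0) - w ^ 3 * x i * x j else 0) - (if k = j then w ^ 3 * x i * x j else 0) +
        w ^ 4 * x i * x j * (x k)\<^sup>2)"
    by (intro sum.cong refl) (auto simp: power2_eq_square power3_eq_cube power4_eq_xxxx algebra_simps)
  then show ?thesis using that by (simp add: sum.distrib sum_subtractf algebra_simps flip: sum_distrib_left)
qed

lemma round_components:
  assumes x: "x \<in> coords n" and ij: "i < n" "j < n"
  shows "gs x i j = (if i = j then (conformal n x)\<^sup>2 else 0)"
proof -
  let ?w = "conformal n x"
  have "gs x i j = (\<Sum>k\<le>n. partial i (\<lambda>x. isc x k) x * partial j (\<lambda>x. isc x k) x)"
    by (simp add: round_sphere_def stereographic_jacobian[OF x] ij)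
  also have "\<dots> = (\<Sum>k<n. partial i (\<lambda>x. isc x k) x * partial j (\<lambda>x. isc x k) x) + partial i (\<lambda>x. isc x n) x * partial j (\<lambda>x. isc x n) x"
    unfolding lessThan_Suc_atMost[symmetric] by simp
  also have "(\<Sum>k<n. partial i (\<lambda>x. isc x k) x * partial j (\<lambda>x. isc x k) x) =
      (\<Sum>k<n. ((if i = k then ?w else 0) - ?w\<^sup>2 * x i * x k) * ((if j = k then ?w else 0) - ?w\<^sup>2 * x j * x k))"
    by (intro sum.cong refl) (simp only: inverse_stereographic_partial(1)[OF x] ij lessThan_iff)
  also have "\<dots> = (if i = j then ?w\<^sup>2 else 0) - 2 * ?w ^ 3 * x i * x j + ?w ^ 4 * (\<Sum>k<n. (x k)\<^sup>2) * x i * x j"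
    by (rule conformal_sum[OF ij])
  also have "?w ^ 4 * (\<Sum>k<n. (x k)\<^sup>2) = ?w ^ 3 * (2 - ?w)"
    unfolding conformal_norm[symmetric] by (simp add: power3_eq_cube power4_eq_xxxx)
  also have "partial i (\<lambda>x. isc x n) x * partial j (\<lambda>x. isc x n) x = s * s * ?w ^ 4 * x i * x j"
    unfolding inverse_stereographic_partial(2)[OF x ij(1)] inverse_stereographic_partial(2)[OF x ij(2)]
    by (simp add: power2_eq_square power4_eq_xxxx)
  finally show ?thesis unfolding pole_square by (simp add: power2_eq_square power3_eq_cube power4_eq_xxxx algebra_simps)
qed

lemma round_posdef:
  assumes x: "x \<in> coords n"
  shows "posdef n (gs x)"
proof -
  let ?w = "conformal n x"
  have "bilinear_form n (gs x) v v = (\<Sum>i<n. \<Sum>j<n. if j = i then (?w * v i)\<^sup>2 else 0)" for v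
    unfolding bilinear_form_def
    by (intro sum.cong refl) (auto simp: round_components[OF x] power2_eq_square)
  then have b: "bilinear_form n (gs x) v v = (\<Sum>i<n. (?w * v i)\<^sup>2)" for v by simp
  show ?thesis
    unfolding posdef_def b
  proof (intro conjI allI impI)
    fix v :: "nat \<Rightarrow> real" assume "\<exists>i<n. v i \<noteq> 0"
    then obtain i where i: "i < n" "v i \<noteq> 0" by blast
    have "0 < (?w * v i)\<^sup>2" using i conformal_pos[of n x] by simp
    also have "\<dots> \<le> (\<Sum>i<n. (?w * v i)\<^sup>2)" by (rule member_le_sum) (use i in auto)
    finally show "0 < (\<Sum>i<n. (?w * v i)\<^sup>2)" .
  qed (simp add: round_components[OF x])
qed

lemma round_inverse:
  assumes x: "x \<in> coords n" and ij: "i < n" "j < n"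
  shows "inverse_matrix n (gs x) i j = (if i = j then inverse ((conformal n x)\<^sup>2) else 0)"
proof (rule inverse_matrix_unique[symmetric, OF posdef_det_nz[OF round_posdef[OF x]] _ ij])
  fix i j assume ij: "i < n" "j < n"
  have "(\<Sum>k<n. gs x i k * (if k = j then inverse ((conformal n x)\<^sup>2) else 0)) =
      (\<Sum>k<n. if k = j then gs x i k * inverse ((conformal n x)\<^sup>2) else 0)"
    by (intro sum.cong refl) simp
  also have "\<dots> = gs x i j * inverse ((conformal n x)\<^sup>2)" using ij by simp
  also have "\<dots> = (if i = j then 1 else 0)" using conformal_pos[of n x] by (simp add: round_components[OF x ij])
  finally show "(\<Sum>k<n. gs x i k * (if k = j then inverse ((conformal n x)\<^sup>2) else 0)) = (if i = j then 1 else 0)" .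
qed

text \<open>Geometrically, the gradient of a coordinate is the tangential part of a basis vector,
  and the formula is their scalar product. It is verified in the chart, with separate cases for the
  last coordinate because it has its own formula.\<close>

lemma round_product:
  assumes x: "x \<in> coords n" and ab: "a \<le> n" "b \<le> n"
  shows "metric_product n gs (\<lambda>x. isc x a) (\<lambda>x. isc x b) x = (if a = b then 1 else 0) - isc x a * isc x b"
proof -
  define w where "w = conformal n x"
  have w: "w > 0" unfolding w_def by (rule conformal_pos)
  define r where "r = (\<Sum>k<n. (x k)\<^sup>2)"
  have r: "w * r = 2 - w" unfolding r_def w_def by (rule conformal_norm)
  define P where "P a k = partial k (\<lambda>x. isc x a) x" for a k
  have P1: "P a k = (if a = k then w else 0) - w\<^sup>2 * x a * x k" if "k < n" "a < n" for a k
    using inverse_stereographic_partial(1)[OF x that] by (simp add: P_def w_def mult_ac)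
  have P2: "P n k = s * w\<^sup>2 * x k" if "k < n" for k
    using inverse_stereographic_partial(2)[OF x that] by (simp add: P_def w_def)
  have Y1: "isc x a = w * x a" if "a < n" for a using that by (simp add: inverse_stereographic_def w_def)
  have Y2: "isc x n = s * (1 - w)" by (simp add: inverse_stereographic_def w_def)
  define S where "S a b = (\<Sum>k<n. P a k * P b k)" for a b
  have "metric_product n gs (\<lambda>x. isc x a) (\<lambda>x. isc x b) x =
      (\<Sum>i<n. \<Sum>j<n. if j = i then inverse (w\<^sup>2) * (P a i * P b i) else 0)"
    unfolding metric_product_def by (intro sum.cong refl) (auto simp: round_inverse[OF x] P_def w_def)
  also have "\<dots> = inverse (w\<^sup>2) * S a b" by (simp add: S_def sum_distrib_left)
  also have "S a b = w\<^sup>2 * ((if a = b then 1 else 0) - isc x a * isc x b)"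
  proof -
    have 1: "S a b = w\<^sup>2 * ((if a = b then 1 else 0) - isc x a * isc x b)" if "a < n" "b < n" for a b
    proof -
      have "S a b = (\<Sum>k<n. ((if a = k then w else 0) - w\<^sup>2 * x a * x k) * ((if b = k then w else 0) - w\<^sup>2 * x b * x k))"
        unfolding S_def by (intro sum.cong refl) (simp only: P1 that lessThan_iff)
      also have "\<dots> = (if a = b then w\<^sup>2 else 0) - 2 * w ^ 3 * x a * x b + w ^ 4 * r * x a * x b"
        unfolding r_def by (rule conformal_sum[OF that])
      also have "w ^ 4 * r = w ^ 3 * (2 - w)" unfolding r[symmetric] by (simp add: power3_eq_cube power4_eq_xxxx)
      finally show ?thesis
        unfolding Y1[OF that(1)] Y1[OF that(2)] by (simp add: power2_eq_square power3_eq_cube power4_eq_xxxx algebra_simps)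
    qed
    have 2: "S a n = w\<^sup>2 * (- isc x a * isc x n)" if "a < n" for a
    proof -
      have "S a n = (\<Sum>k<n. (if k = a then s * w ^ 3 * x k else 0) - s * w ^ 4 * x a * (x k)\<^sup>2)"
        unfolding S_def
        by (intro sum.cong refl) (use that in \<open>auto simp: P1 P2 power2_eq_square power3_eq_cube power4_eq_xxxx algebra_simps\<close>)
      also have "\<dots> = s * w ^ 3 * x a - s * w ^ 4 * x a * r"
        using that by (simp add: sum_subtractf r_def flip: sum_distrib_left)
      also have "s * w ^ 4 * x a * r = s * w ^ 3 * x a * (2 - w)" unfolding r[symmetric] by (simp add: power3_eq_cube power4_eq_xxxx)
      finally show ?thesis unfolding Y1[OF that] Y2 by (simp add: power2_eq_square power3_eq_cube algebra_simps)
    qed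
    have 3: "S n n = w\<^sup>2 * (1 - isc x n * isc x n)"
    proof -
      have "S n n = (\<Sum>k<n. s * s * w ^ 4 * (x k)\<^sup>2)"
        unfolding S_def by (intro sum.cong refl) (simp add: P2 power2_eq_square power4_eq_xxxx)
      also have "\<dots> = w ^ 4 * r" by (simp add: pole_square r_def flip: sum_distrib_left)
      also have "\<dots> = w ^ 3 * (2 - w)" unfolding r[symmetric] by (simp add: power3_eq_cube power4_eq_xxxx)
      also have "\<dots> = w\<^sup>2 * (1 - (s * s) * ((1 - w) * (1 - w)))" unfolding pole_square by (simp add: power2_eq_square power3_eq_cube algebra_simps)
      finally show ?thesis unfolding Y2 by (simp add: mult_ac)
    qed
    have sym: "S a b = S b a" for a b by (simp add: S_def mult.commute)
    consider "a < n" "b < n" | "a < n" "b = n" | "a = n" "b < n" | "a = n" "b = n" using ab by linarith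
    then show ?thesis
    proof cases
      case 1 then show ?thesis by (rule \<open>\<And>b a. a < n \<Longrightarrow> b < n \<Longrightarrow> S a b = w\<^sup>2 * ((if a = b then 1 else 0) - isc x a * isc x b)\<close>)
    qed (use 2 3 sym in auto)
  qed
  finally show ?thesis using w by simp
qed

lemma sphere_is_chart: "is_chart n (nsphere n) stc"
proof -
  have D: "chart_dom stc \<subseteq> unit_sphere n" by (auto simp: stereographic_dom)
  have "openin (top_of_set (unit_sphere n)) (unit_sphere n \<inter> (\<lambda>y. y n) -` (- {s}))"
    by (rule continuous_openin_preimage_gen)
      (auto intro: continuous_on_subset[OF continuous_on_product_coordinates])
  moreover have "unit_sphere n \<inter> (\<lambda>y. y n) -` (- {s}) = chart_dom stc" by (auto simp: stereographic_dom)
  ultimately have 1: "openin (nsphere n) (chart_dom stc)" by (simp add: nsphere_eq)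
  have t1: "subtopology (nsphere n) (chart_dom stc) = top_of_set (chart_dom stc)"
    using D by (simp add: nsphere_eq subtopology_subtopology inf.absorb2)
  have t2: "subtopology (Euclidean_space n) (coords n) = top_of_set (coords n)"
    by (simp add: Euclidean_space_def euclidean_product_topology coords_def subtopology_subtopology)
  have "homeomorphic_maps (top_of_set (chart_dom stc)) (top_of_set (coords n)) (chart_map stc) isc"
    unfolding homeomorphic_maps_def
  proof (intro conjI ballI)
    have "continuous_on (chart_dom stc) (\<lambda>y. chart_map stc y i)" for i
    proof (cases "i < n")
      case True
      have "continuous_on (chart_dom stc) (\<lambda>y. y i / (1 - s * y n))"
        by (intro continuous_intros continuous_on_subset[OF continuous_on_product_coordinates] ballI)
          (use stereographic_denominator in auto)
      then show ?thesis using True by (simp add: stereographic_def)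
    qed (simp add: stereographic_def)
    then have "continuous_on (chart_dom stc) (chart_map stc)" by (rule continuous_on_coordinatewise_then_product)
    then show "continuous_map (top_of_set (chart_dom stc)) (top_of_set (coords n)) (chart_map stc)"
      using stereographic_map(1) by auto
    have "continuous_on (coords n) isc"
      by (rule continuous_on_coordinatewise_then_product) (rule C1_continuous[OF C2_C1[OF inverse_stereographic_C2]])
    then show "continuous_map (top_of_set (coords n)) (top_of_set (chart_dom stc)) isc"
      using stereographic_inverse(1) by auto
  qed (auto simp: stereographic_map stereographic_inverse)
  then have "homeomorphic_map (top_of_set (chart_dom stc)) (top_of_set (coords n)) (chart_map stc)"
    by (rule homeomorphic_maps_imp_map)
  then show ?thesis
    using 1 coords_open unfolding is_chart_def stereographic_im t1 t2 by blast
qed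

lemma round_C1: "i < n \<Longrightarrow> j < n \<Longrightarrow> C1 n (coords n) (\<lambda>x. gs x i j)"
proof -
  assume ij: "i < n" "j < n"
  have "C1 n (coords n) (\<lambda>x. if i = j then (conformal n x)\<^sup>2 else 0)"
    by (cases "i = j") (simp_all add: C1_power(1) C2_C1[OF conformal_C2] C1_const)
  then show ?thesis by (subst C1_cong[OF coords_open round_components[OF _ ij]])
qed

end

lemma sphere_transition:
  fixes n :: nat and s s' :: real
  assumes s: "s\<^sup>2 = 1" and s': "s'\<^sup>2 = 1"
  defines "c \<equiv> stereographic n s" and "d \<equiv> stereographic n s'"
  shows "eucl_open n (chart_map c ` (chart_dom c \<inter> chart_dom d))"
    and "k < n \<Longrightarrow> C1 n (chart_map c ` (chart_dom c \<inter> chart_dom d)) (\<lambda>x. chart_map d (chart_inv c x) k)"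
proof -
  let ?Y = "inverse_stereographic n s"
  define W where "W = chart_map c ` (chart_dom c \<inter> chart_dom d)"
  have WY: "x \<in> coords n \<and> ?Y x \<in> chart_dom d \<and> chart_inv c x = ?Y x" if "x \<in> W" for x
  proof -
    obtain y where y: "y \<in> chart_dom c" "y \<in> chart_dom d" "x = chart_map c y" using \<open>x \<in> W\<close> by (auto simp: W_def)
    have "x \<in> coords n" "?Y x = y" unfolding y(3) c_def using stereographic_map[OF s] y(1) c_def by auto
    then show ?thesis using y stereographic_chart_inv[OF s] by (simp add: c_def)
  qed
  have "W = {x\<in>coords n. ?Y x n \<in> - {s'}}"
  proof (intro equalityI subsetI)
    fix x assume "x \<in> W"
    then show "x \<in> {x\<in>coords n. ?Y x n \<in> - {s'}}" using WY[of x] by (auto simp: d_def stereographic_dom[OF s'])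
  next
    fix x assume "x \<in> {x\<in>coords n. ?Y x n \<in> - {s'}}"
    then have "x \<in> coords n" "?Y x \<in> chart_dom d"
      by (auto simp: d_def stereographic_dom[OF s'] inverse_stereographic_sphere[OF s])
    then show "x \<in> W"
      unfolding W_def using stereographic_inverse[OF s, of x n] by (intro image_eqI[of _ _ "?Y x"]) (auto simp: c_def)
  qed
  moreover have "eucl_open n {x\<in>coords n. ?Y x n \<in> - {s'}}"
    by (rule openin_Euclidean_vimage[OF coords_open C1_continuous[OF C2_C1[OF inverse_stereographic_C2[OF s]]]]) auto
  ultimately have W: "eucl_open n W" by simp
  then show "eucl_open n (chart_map c ` (chart_dom c \<inter> chart_dom d))" by (simp add: W_def)
  assume k: "k < n"
  have YC: "C1 n W (\<lambda>x. ?Y x j)" for j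
    by (rule C1_subset[OF C2_C1[OF inverse_stereographic_C2[OF s]]]) (use WY in auto)
  have "C1 n W (\<lambda>x. ?Y x k / (1 - s' * ?Y x n))"
  proof (rule C1_divide[OF YC C1_diff(1)[OF C1_const C1_mult(1)[OF C1_const YC]]])
    show "1 - s' * ?Y x n \<noteq> 0" if "x \<in> W" for x
      using stereographic_denominator[OF s'] WY[OF that] by (simp add: d_def)
  qed
  moreover have "chart_map d (chart_inv c x) k = ?Y x k / (1 - s' * ?Y x n)" if "x \<in> W" for x
    using WY[OF that] k by (simp add: d_def stereographic_def)
  ultimately show "C1 n (chart_map c ` (chart_dom c \<inter> chart_dom d)) (\<lambda>x. chart_map d (chart_inv c x) k)"
    using C1_cong[OF W, of "\<lambda>x. chart_map d (chart_inv c x) k"] by (simp add: W_def)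
qed

lemma sphere_atlas: "c \<in> atlas (round_sphere n) \<Longrightarrow> \<exists>s. s\<^sup>2 = 1 \<and> c = stereographic n s"
  by (auto simp: round_sphere_def intro: exI[of _ 1] exI[of _ "- 1"])

lemma sphere_points: "points (round_sphere n) = unit_sphere n"
  by (simp add: points_def round_sphere_def nsphere_eq)

text \<open>The transformation law of the metric holds because in both charts the metric is pulled
  back from the same ambient scalar product, and the chain rule relates the two embeddings.\<close>

lemma compact_riemannian_sphere: "compact_riemannian n (round_sphere n)"
proof
  show "compact_space (topology_of (round_sphere n))"
    using compact_unit_sphere by (simp add: round_sphere_def nsphere_eq compact_space_subtopology)
  show "Hausdorff_space (topology_of (round_sphere n))"
    by (simp add: round_sphere_def nsphere_eq Hausdorff_space_subtopology)
  have "(\<lambda>i. if i = n then 1 else 0) \<in> unit_sphere n"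
    by (simp add: unit_sphere_def if_distrib[of "\<lambda>x. x\<^sup>2"] cong: if_cong)
  then show "points (round_sphere n) \<noteq> {}" unfolding sphere_points by blast
  show "points (round_sphere n) = (\<Union>c\<in>atlas (round_sphere n). chart_dom c)"
    unfolding sphere_points by (auto simp: round_sphere_def stereographic_dom)
next
  fix c :: "(nat \<Rightarrow> real) chart" assume "c \<in> atlas (round_sphere n)"
  then obtain s where s: "s\<^sup>2 = 1" and c: "c = stereographic n s" using sphere_atlas by blast
  show "is_chart n (topology_of (round_sphere n)) c"
    using sphere_is_chart[OF s] by (simp add: round_sphere_def c)
  show "C1 n (chart_map c ` chart_dom c) (\<lambda>x. components (round_sphere n) c x i j)" if "i < n" "j < n" for i j
    unfolding c stereographic_im[OF s] by (rule round_C1[OF s that])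
  show "posdef n (components (round_sphere n) c x)" if "x \<in> chart_map c ` chart_dom c" for x
    using that unfolding c stereographic_im[OF s] by (rule round_posdef[OF s])
  fix d :: "(nat \<Rightarrow> real) chart" assume "d \<in> atlas (round_sphere n)"
  then obtain s' where s': "s'\<^sup>2 = 1" and d: "d = stereographic n s'" using sphere_atlas by blast
  let ?W = "chart_map c ` (chart_dom c \<inter> chart_dom d)"
  have tr: "C1 n ?W (\<lambda>x. chart_map d (chart_inv c x) k)" if "k < n" for k
    unfolding c d by (rule sphere_transition(2)[OF s s' that])
  then show "k < n \<Longrightarrow> C1 n ?W (\<lambda>x. chart_map d (chart_inv c x) k)" for k .
  fix p i j assume p: "p \<in> chart_dom c" "p \<in> chart_dom d" and ij: "i < n" "j < n"
  have W: "eucl_open n ?W" unfolding c d by (rule sphere_transition(1)[OF s s'])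
  define u where "u x = chart_map d (chart_inv c x)" for x
  define x where "x = chart_map c p"
  have x: "x \<in> ?W" "x \<in> coords n" using p stereographic_map(1)[OF s] by (auto simp: x_def c)
  have inv: "chart_inv c z \<in> chart_dom d" "z \<in> coords n" if z: "z \<in> ?W" for z
  proof -
    obtain y where y: "y \<in> chart_dom c" "y \<in> chart_dom d" "z = chart_map c y" using z by auto
    then show "z \<in> coords n" using stereographic_map(1)[OF s] by (simp add: c)
    then have "chart_inv c z = y"
      using stereographic_chart_inv[OF s] stereographic_map(2)[OF s] y by (simp add: c)
    then show "chart_inv c z \<in> chart_dom d" using y by simp
  qed
  have uV: "u z \<in> coords n" if "z \<in> ?W" for z
    unfolding u_def using stereographic_map(1)[OF s'] inv(1)[OF that] by (simp add: d)
  have ux: "u x = chart_map d p"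
    using stereographic_chart_inv[OF s x(2)] stereographic_map(2)[OF s] p by (simp add: u_def x_def c)
  let ?J = "jacobian u x" and ?D = "jacobian (chart_inv d) (u x)"
  \<comment> \<open>Near \<open>x\<close> the embedding given by \<open>c\<close> is that given by
    \<open>d\<close> after the transition map \<open>u\<close>.\<close>
  have J: "jacobian (chart_inv c) x a i = (\<Sum>k<n. ?D a k * ?J k i)" if i: "i < n" for a i
  proof -
    let ?Y = "\<lambda>x. inverse_stereographic n s x a" and ?Z = "\<lambda>x. inverse_stereographic n s' x a"
    have "jacobian (chart_inv c) x a i = partial i ?Y x" unfolding c by (rule stereographic_jacobian[OF s]) (use x i c in auto)
    also have "\<dots> = partial i (\<lambda>x. ?Z (u x)) x"
    proof (rule partial_cong[OF W i x(1)])
      fix z assume z: "z \<in> ?W"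
      have "inverse_stereographic n s' (u z) = chart_inv c z"
        unfolding u_def d by (rule stereographic_map(2)[OF s']) (use inv(1)[OF z] d in simp)
      also have "\<dots> = inverse_stereographic n s z" unfolding c by (rule stereographic_chart_inv[OF s inv(2)[OF z]])
      finally show "?Y z = ?Z (u z)" by simp
    qed
    also have "\<dots> = (\<Sum>k<n. partial k ?Z (u x) * partial i (\<lambda>z. u z k) x)"
      by (rule partial_compose[OF W coords_open C2_C1[OF inverse_stereographic_C2[OF s']] _ uV x(1) i]) (use tr u_def in auto)
    also have "\<dots> = (\<Sum>k<n. ?D a k * ?J k i)"
    proof (intro sum.cong refl)
      fix k assume "k \<in> {..<n}"
      then have "?D a k = partial k ?Z (u x)" unfolding d using stereographic_jacobian[OF s' uV[OF x(1)]] by simp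
      then show "partial k ?Z (u x) * partial i (\<lambda>z. u z k) x = ?D a k * ?J k i" by (simp add: jacobian_def[of u])
    qed
    finally show ?thesis .
  qed
  have "components (round_sphere n) c x i j = (\<Sum>a\<le>n. (\<Sum>k<n. ?D a k * ?J k i) * (\<Sum>l<n. ?D a l * ?J l j))"
    by (simp add: round_sphere_def J ij)
  also have "\<dots> = (\<Sum>a\<le>n. \<Sum>k<n. \<Sum>l<n. ?J k i * ?J l j * (?D a k * ?D a l))"
    unfolding sum_product by (intro sum.cong refl) simp
  also have "\<dots> = (\<Sum>k<n. \<Sum>l<n. \<Sum>a\<le>n. ?J k i * ?J l j * (?D a k * ?D a l))" by (rule sum_swap3[symmetric])
  also have "\<dots> = (\<Sum>k<n. \<Sum>l<n. ?J k i * ?J l j * components (round_sphere n) d (u x) k l)"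
    by (simp add: round_sphere_def sum_distrib_left)
  finally show "components (round_sphere n) c (chart_map c p) i j =
      (\<Sum>k<n. \<Sum>l<n. jacobian (loc c (chart_map d)) (chart_map c p) k i *
        jacobian (loc c (chart_map d)) (chart_map c p) l j * components (round_sphere n) d (chart_map d p) k l)"
    unfolding ux by (simp add: x_def u_def[abs_def])
qed

section \<open>Submersions onto the sphere\<close>

lemma partial_linear_combination:
  assumes "finite A" "\<And>a. a \<in> A \<Longrightarrow> C1 m V (f a)" "x \<in> V" "i < m"
  shows "partial i (\<lambda>x. \<Sum>a\<in>A. p a * f a x) x = (\<Sum>a\<in>A. p a * partial i (f a) x)"
proof -
  have "partial i (\<lambda>x. \<Sum>a\<in>A. p a * f a x) x = (\<Sum>a\<in>A. partial i (\<lambda>x. p a * f a x) x)"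
    by (rule C1_sum(2)[OF assms(1) _ assms(3,4)]) (intro C1_mult(1) C1_const assms(2))
  also have "\<dots> = (\<Sum>a\<in>A. p a * partial i (f a) x)"
    by (intro sum.cong refl) (simp add: C1_mult(2)[OF C1_const assms(2) assms(3,4)] partial_const)
  finally show ?thesis .
qed

lemma metric_product_linear_combination:
  assumes A: "finite A" and H: "\<And>a. a \<in> A \<Longrightarrow> C1 m V (H a)" and x: "x \<in> V"
  shows "metric_product m G (\<lambda>x. \<Sum>a\<in>A. p a * H a x) (\<lambda>x. \<Sum>a\<in>A. p a * H a x) x =
    (\<Sum>a\<in>A. \<Sum>b\<in>A. p a * p b * metric_product m G (H a) (H b) x)"
proof -
  define I where "I = inverse_matrix m (G x)"
  define P where "P a i = partial i (H a) x" for a i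
  define F where "F i j a b = p a * p b * (I i j * P a i * P b j)" for i j a b
  have d: "partial i (\<lambda>x. \<Sum>a\<in>A. p a * H a x) x = (\<Sum>a\<in>A. p a * P a i)" if "i < m" for i
    unfolding P_def by (rule partial_linear_combination[OF A H x that])
  have "metric_product m G (\<lambda>x. \<Sum>a\<in>A. p a * H a x) (\<lambda>x. \<Sum>a\<in>A. p a * H a x) x =
      (\<Sum>i<m. \<Sum>j<m. I i j * ((\<Sum>a\<in>A. p a * P a i) * (\<Sum>b\<in>A. p b * P b j)))"
    unfolding metric_product_def I_def by (intro sum.cong refl) (simp add: d)
  also have "\<dots> = (\<Sum>i<m. \<Sum>j<m. \<Sum>a\<in>A. \<Sum>b\<in>A. F i j a b)"
    unfolding sum_product F_def by (simp add: sum_distrib_left mult_ac)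
  also have "\<dots> = (\<Sum>a\<in>A. \<Sum>b\<in>A. \<Sum>i<m. \<Sum>j<m. F i j a b)" by (rule sum_swap_pairs)
  finally show ?thesis by (simp add: F_def I_def P_def metric_product_def sum_distrib_left)
qed

lemma metric_laplacian_linear_combination:
  assumes V: "eucl_open m V" and A: "finite A" and H: "\<And>a. a \<in> A \<Longrightarrow> C2 m V (H a)" and x: "x \<in> V"
  shows "metric_laplacian m G (\<lambda>x. \<Sum>a\<in>A. p a * H a x) x = (\<Sum>a\<in>A. p a * metric_laplacian m G (H a) x)"
proof -
  define I where "I = inverse_matrix m (G x)"
  have hess: "metric_hessian m G (\<lambda>x. \<Sum>a\<in>A. p a * H a x) x i j = (\<Sum>a\<in>A. p a * metric_hessian m G (H a) x i j)"
    if ij: "i < m" "j < m" for i j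
  proof -
    let ?C = "\<lambda>k. metric_christoffel m G x k i j"
    have "partial i (partial j (\<lambda>x. \<Sum>a\<in>A. p a * H a x)) x = partial i (\<lambda>x. \<Sum>a\<in>A. p a * partial j (H a) x) x"
      by (rule partial_cong[OF V ij(1) x]) (rule partial_linear_combination[OF A C2_C1[OF H] _ ij(2)])
    also have "\<dots> = (\<Sum>a\<in>A. p a * partial i (partial j (H a)) x)"
      by (rule partial_linear_combination[OF A C2_partial[OF H ij(2)] x ij(1)])
    finally have 1: "partial i (partial j (\<lambda>x. \<Sum>a\<in>A. p a * H a x)) x = (\<Sum>a\<in>A. p a * partial i (partial j (H a)) x)" .
    have "(\<Sum>k<m. ?C k * partial k (\<lambda>x. \<Sum>a\<in>A. p a * H a x) x) = (\<Sum>k<m. ?C k * (\<Sum>a\<in>A. p a * partial k (H a) x))"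
      by (intro sum.cong refl) (simp add: partial_linear_combination[OF A C2_C1[OF H] x])
    also have "\<dots> = (\<Sum>k<m. \<Sum>a\<in>A. p a * (?C k * partial k (H a) x))" by (simp add: sum_distrib_left mult_ac)
    also have "\<dots> = (\<Sum>a\<in>A. \<Sum>k<m. p a * (?C k * partial k (H a) x))" by (rule sum.swap)
    finally show ?thesis
      unfolding metric_hessian_def 1 by (simp add: sum_distrib_left right_diff_distrib sum_subtractf)
  qed
  have "metric_laplacian m G (\<lambda>x. \<Sum>a\<in>A. p a * H a x) x = (\<Sum>i<m. \<Sum>j<m. \<Sum>a\<in>A. p a * (I i j * metric_hessian m G (H a) x i j))"
    unfolding metric_laplacian_def I_def by (intro sum.cong refl) (simp add: hess sum_distrib_left mult_ac)
  also have "\<dots> = (\<Sum>a\<in>A. \<Sum>i<m. \<Sum>j<m. p a * (I i j * metric_hessian m G (H a) x i j))" by (rule sum_swap3)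
  finally show ?thesis by (simp add: I_def metric_laplacian_def sum_distrib_left)
qed

lemma metric_product_cong:
  assumes "eucl_open m V" "x \<in> V" "\<And>y. y \<in> V \<Longrightarrow> f y = f' y" "\<And>y. y \<in> V \<Longrightarrow> h y = h' y"
  shows "metric_product m G f h x = metric_product m G f' h' x"
  unfolding metric_product_def
  by (intro sum.cong refl) (simp add: partial_cong[OF assms(1) _ assms(2,3)] partial_cong[OF assms(1) _ assms(2,4)])

lemma unit_sphere_inner:
  assumes "p \<in> unit_sphere n" "y \<in> unit_sphere n"
  shows "\<bar>\<Sum>i\<le>n. p i * y i\<bar> \<le> 1"
proof -
  have "(\<Sum>i\<le>n. p i * y i)\<^sup>2 \<le> (\<Sum>i\<le>n. (p i)\<^sup>2) * (\<Sum>i\<le>n. (y i)\<^sup>2)" by (rule Cauchy_Schwarz_ineq_sum)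
  also have "\<dots> = 1" using assms by (simp add: unit_sphere_def)
  finally show ?thesis by (simp add: abs_square_le_1)
qed

lemma equatorial_band_eq:
  assumes p: "p \<in> unit_sphere n" and \<epsilon>: "0 < \<epsilon>" "\<epsilon> < pi / 2"
  shows "equatorial_band n p \<epsilon> = {y\<in>unit_sphere n. \<bar>\<Sum>i\<le>n. p i * y i\<bar> < sin \<epsilon>}"
proof -
  have "pi / 2 - \<epsilon> < arccos t \<and> arccos t < pi / 2 + \<epsilon> \<longleftrightarrow> \<bar>t\<bar> < sin \<epsilon>" if t: "\<bar>t\<bar> \<le> 1" for t
  proof -
    have t': "- 1 \<le> t" "t \<le> 1" using t by auto
    have "t < cos (pi / 2 - \<epsilon>) \<longleftrightarrow> pi / 2 - \<epsilon> < arccos t"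
      using cos_mono_less_eq[of "arccos t" "pi / 2 - \<epsilon>"] arccos_lbound[OF t'] arccos_ubound[OF t'] cos_arccos[OF t'] \<epsilon> by simp
    moreover have "cos (pi / 2 + \<epsilon>) < t \<longleftrightarrow> arccos t < pi / 2 + \<epsilon>"
      using cos_mono_less_eq[of "pi / 2 + \<epsilon>" "arccos t"] arccos_lbound[OF t'] arccos_ubound[OF t'] cos_arccos[OF t'] \<epsilon> by simp
    moreover have "cos (pi / 2 - \<epsilon>) = sin \<epsilon>" "cos (pi / 2 + \<epsilon>) = - sin \<epsilon>" by (simp_all add: cos_diff cos_add)
    ultimately show ?thesis by (auto simp: abs_less_iff)
  qed
  then show ?thesis
    unfolding equatorial_band_def sphere_points sphere_dist_def using unit_sphere_inner[OF p] by blast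
qed

lemma closed_riemannian_manifold_compact:
  assumes "closed_riemannian_manifold m M"
  shows "compact_riemannian m M"
proof
  have sm: "smooth_manifold m M" and me: "riemannian_metric m M" and "compact_space (topology_of M)" "points M \<noteq> {}"
    using assms by (auto simp: closed_riemannian_manifold_def riemannian_manifold_def)
  then show "compact_space (topology_of M)" "points M \<noteq> {}" by auto
  show "Hausdorff_space (topology_of M)" "points M = (\<Union>c\<in>atlas M. chart_dom c)"
    using sm by (auto simp: smooth_manifold_def)
  have ch: "is_chart m (topology_of M) c" if "c \<in> atlas M" for c using sm that by (simp add: smooth_manifold_def)
  then show "c \<in> atlas M \<Longrightarrow> is_chart m (topology_of M) c" for c .
  fix c assume c: "c \<in> atlas M"
  have op: "eucl_open m (chart_map c ` chart_dom c)" "openin (topology_of M) (chart_dom c)"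
    using ch[OF c] by (auto simp: is_chart_def)
  show "C1 m (chart_map c ` chart_dom c) (\<lambda>x. components M c x i j)" if "i < m" "j < m" for i j
    by (rule smooth_on_C1[OF op(1)]) (use me c that in \<open>simp add: riemannian_metric_def\<close>)
  show "posdef m (components M c x)" if "x \<in> chart_map c ` chart_dom c" for x
  proof -
    have "\<forall>x\<in>chart_map c ` chart_dom c. (\<forall>i<m. \<forall>j<m. components M c x i j = components M c x j i) \<and>
        (\<forall>v. (\<exists>i<m. v i \<noteq> 0) \<longrightarrow> 0 < bilinear_form m (components M c x) v v)"
      using me c unfolding riemannian_metric_def by blast
    then show ?thesis using that unfolding posdef_def by blast
  qed
  fix d assume d: "d \<in> atlas M"
  show "C1 m (chart_map c ` (chart_dom c \<inter> chart_dom d)) (\<lambda>x. chart_map d (chart_inv c x) k)" if "k < m" for k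
  proof (rule smooth_on_C1)
    have "openin (topology_of M) (chart_dom c \<inter> chart_dom d)" using ch[OF c] ch[OF d] by (auto simp: is_chart_def)
    then have "openin (subtopology (topology_of M) (chart_dom c)) (chart_dom c \<inter> chart_dom d)"
      unfolding openin_subtopology by blast
    then have "openin (subtopology (Euclidean_space m) (chart_map c ` chart_dom c)) (chart_map c ` (chart_dom c \<inter> chart_dom d))"
      using homeomorphic_map_openness[of "subtopology (topology_of M) (chart_dom c)" _ "chart_map c"] ch[OF c] openin_subset
      unfolding is_chart_def by blast
    then show "eucl_open m (chart_map c ` (chart_dom c \<inter> chart_dom d))" using openin_trans_full op(1) by blast
    show "smooth_on m (chart_map c ` (chart_dom c \<inter> chart_dom d)) (\<lambda>x. chart_map d (chart_inv c x) k)"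
      using sm c d that by (simp add: smooth_manifold_def)
  qed
  show "components M c (chart_map c p) i j = (\<Sum>k<m. \<Sum>l<m. jacobian (loc c (chart_map d)) (chart_map c p) k i *
      jacobian (loc c (chart_map d)) (chart_map c p) l j * components M d (chart_map d p) k l)"
    if "p \<in> chart_dom c" "p \<in> chart_dom d" "i < m" "j < m" for p i j
    using me c d that unfolding riemannian_metric_def Let_def by blast
qed

text \<open>A kernel vector of the Gram matrix gives a combination of the \<open>t a\<close> of
  length zero, which independence rules out.\<close>

lemma gram_determinant:
  assumes G: "posdef m G" and t: "\<And>v. (\<forall>i<m. (\<Sum>a<k. t a i * v a) = 0) \<Longrightarrow> \<forall>a<k. v a = 0"
  shows "determinant k (\<lambda>a b. bilinear_form m G (t a) (t b)) \<noteq> 0"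
proof
  let ?F = "\<lambda>a b. bilinear_form m G (t a) (t b)"
  assume "determinant k ?F = 0"
  then obtain v where v: "\<exists>a<k. v a \<noteq> 0" "\<forall>a<k. apply_matrix k ?F v a = 0" using determinant_zero_kernel by blast
  define w where "w i = (\<Sum>a<k. t a i * v a)" for i
  define B where "B i j a b = v a * v b * (G i j * t a i * t b j)" for i j a b
  have "bilinear_form m G w w = (\<Sum>i<m. \<Sum>j<m. \<Sum>a<k. \<Sum>b<k. B i j a b)"
    unfolding bilinear_form_def w_def B_def mult.assoc sum_product by (simp add: sum_distrib_left mult_ac)
  also have "\<dots> = (\<Sum>a<k. \<Sum>b<k. \<Sum>i<m. \<Sum>j<m. B i j a b)" by (rule sum_swap_pairs)
  also have "\<dots> = (\<Sum>a<k. v a * apply_matrix k ?F v a)"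
    by (simp add: B_def apply_matrix_def bilinear_form_def sum_distrib_left mult_ac)
  also have "\<dots> = 0" using v(2) by simp
  finally have "bilinear_form m G w w = 0" .
  then have "\<forall>i<m. w i = 0" using posdefD[OF G, of _ w] by force
  then have "\<forall>a<k. v a = 0" unfolding w_def by (rule t)
  then show False using v(1) by blast
qed

abbreviation (input) "height f a c \<equiv> \<lambda>x. f (chart_inv c x) a"

section \<open>Height functions of a submersion onto the sphere\<close>

context compact_riemannian
begin

text \<open>Everything is linear or bilinear in the coordinates of \<open>f\<close>, so facts about
  them pass to the height over \<open>p\<close>: as \<open>p\<close> is a unit vector, the products
  \<open>p a * p b\<close> against the identity sum to 1 and against \<open>f a f b\<close> to the
  squared height.\<close>

lemma height_band:
  assumes n: "n \<ge> 1" and \<epsilon>: "0 < \<epsilon>" "\<epsilon> < pi / 2" and p: "p \<in> unit_sphere n"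
    and H: "\<And>a c. a \<le> n \<Longrightarrow> c \<in> atlas M \<Longrightarrow> C2 m (im c) (height f a c)"
    and prod: "\<And>a b c x. a \<le> n \<Longrightarrow> b \<le> n \<Longrightarrow> c \<in> atlas M \<Longrightarrow> x \<in> im c \<Longrightarrow>
      metric_product m (components M c) (height f a c) (height f b c) x =
        (if a = b then 1 else 0) - f (chart_inv c x) a * f (chart_inv c x) b"
    and lap: "\<And>a c x. a \<le> n \<Longrightarrow> c \<in> atlas M \<Longrightarrow> x \<in> im c \<Longrightarrow>
      metric_laplacian m (components M c) (height f a c) x = - real n * f (chart_inv c x) a"
    and S: "\<And>q. q \<in> points M \<Longrightarrow> f q \<in> unit_sphere n"
  shows "measure (riemannian_volume m M) {q\<in>points M. f q \<in> equatorial_band n p \<epsilon>} / measure (riemannian_volume m M) (points M) =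
    cos_ratio n \<epsilon>"
proof -
  define h where "h q = (\<Sum>a\<le>n. p a * f q a)" for q
  have p1: "(\<Sum>a\<le>n. p a * p a) = 1" using p by (simp add: unit_sphere_def power2_eq_square)
  have "{q\<in>points M. f q \<in> equatorial_band n p \<epsilon>} = {q\<in>points M. \<bar>h q\<bar> < sin \<epsilon>}"
    using S by (auto simp: equatorial_band_eq[OF p \<epsilon>] h_def)
  moreover have "measure volume {q\<in>points M. \<bar>h q\<bar> < sin \<epsilon>} / measure volume (points M) =
      cos_ratio n \<epsilon>"
  proof (rule band_ratio[OF n \<epsilon>])
    fix c assume c: "c \<in> atlas M"
    show "C2 m (im c) (loc c h)"
      unfolding h_def by (intro C2_sum C2_mult C2_const im_open c H) auto
    fix x assume x: "x \<in> im c"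
    have "product_in c h h x =
        (\<Sum>a\<le>n. \<Sum>b\<le>n. p a * p b * metric_product m (components M c) (height f a c) (height f b c) x)"
      unfolding h_def by (rule metric_product_linear_combination[OF _ C2_C1[OF H[OF _ c]] x]) auto
    also have "\<dots> = (\<Sum>a\<le>n. \<Sum>b\<le>n. (if b = a then p a * p a else 0) - (p a * f (chart_inv c x) a) * (p b * f (chart_inv c x) b))"
      by (intro sum.cong refl) (auto simp: prod[OF _ _ c x] algebra_simps)
    also have "\<dots> = 1 - (h (chart_inv c x))\<^sup>2"
      by (simp add: sum_subtractf p1 h_def power2_eq_square sum_product)
    finally show "product_in c h h x = 1 - (h (chart_inv c x))\<^sup>2" .
    have "laplacian_in c h x =
        (\<Sum>a\<le>n. p a * metric_laplacian m (components M c) (height f a c) x)"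
      unfolding h_def by (rule metric_laplacian_linear_combination[OF im_open[OF c] _ H[OF _ c] x]) auto
    also have "\<dots> = - real n * h (chart_inv c x)"
      unfolding h_def sum_distrib_left by (intro sum.cong refl) (simp add: lap[OF _ c x])
    finally show "laplacian_in c h x = - real n * h (chart_inv c x)" .
  next
    show "\<bar>h q\<bar> \<le> 1" if "q \<in> points M" for q unfolding h_def by (rule unit_sphere_inner[OF p S[OF that]])
  qed
  ultimately show ?thesis by (simp add: riemannian_volume_eq)
qed

text \<open>Smoothness of \<open>f\<close> is a statement in stereographic coordinates, whereas the
  heights are ambient coordinates. Near each point \<open>f\<close> stays in one stereographic
  chart, through which the heights can be factored.\<close>

lemma smooth_map_sphere_chart:
  assumes f: "smooth_map m M n (round_sphere n) f" and c: "c \<in> atlas M" and x: "x \<in> im c"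
  shows "\<exists>s W. s\<^sup>2 = 1 \<and> stereographic n s \<in> atlas (round_sphere n) \<and> eucl_open m W \<and> x \<in> W \<and> W \<subseteq> im c \<and>
    (\<forall>z\<in>W. f (chart_inv c z) \<in> chart_dom (stereographic n s)) \<and>
    (\<forall>k<n. C2 m W (\<lambda>z. chart_map (stereographic n s) (f (chart_inv c z)) k))"
proof -
  interpret S: compact_riemannian n "round_sphere n" by (rule compact_riemannian_sphere)
  have fc: "continuous_map T (topology_of (round_sphere n)) f" using f by (simp add: smooth_map_def)
  have "f (chart_inv c x) \<in> points (round_sphere n)"
    using continuous_map_funspace[OF fc] chart_inv_points[OF c x] by (auto simp: points_def)
  then obtain d where d: "d \<in> atlas (round_sphere n)" "f (chart_inv c x) \<in> chart_dom d" using S.cover by blast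
  obtain s where s: "s\<^sup>2 = 1" "d = stereographic n s" using sphere_atlas[OF d(1)] by blast
  define U where "U = {p\<in>chart_dom c. f p \<in> chart_dom d}"
  have "U = chart_dom c \<inter> {p\<in>topspace T. f p \<in> chart_dom d}" using dom_subset[OF c] by (auto simp: U_def points_def)
  then have U: "openin T U"
    using openin_Int[OF dom_open[OF c] openin_continuous_map_preimage[OF fc S.dom_open[OF d(1)]]] by simp
  define W where "W = chart_map c ` U"
  have W: "eucl_open m W" unfolding W_def by (rule image_open[OF c U]) (auto simp: U_def)
  have "x \<in> W" unfolding W_def using d(2) chart_inv_dom[OF x] chart_map_inv[OF x]
    by (intro image_eqI[of _ _ "chart_inv c x"]) (auto simp: U_def)
  moreover have "W \<subseteq> im c" by (auto simp: W_def U_def im_def)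
  moreover have "\<forall>z\<in>W. f (chart_inv c z) \<in> chart_dom d" using chart_inv_map[OF c] by (auto simp: W_def U_def)
  moreover have "C2 m W (\<lambda>z. chart_map d (f (chart_inv c z)) k)" if "k < n" for k
    by (rule smooth_on_C2[OF W]) (use f c d(1) that in \<open>simp add: smooth_map_def W_def U_def\<close>)
  ultimately show ?thesis using s d(1) W by blast
qed

lemma height_C2:
  assumes f: "smooth_map m M n (round_sphere n) f" and c: "c \<in> atlas M"
  shows "C2 m (im c) (height f a c)"
proof (rule C2_local)
  fix x assume x: "x \<in> im c"
  obtain s W where s: "s\<^sup>2 = 1" and W: "eucl_open m W" "x \<in> W" "W \<subseteq> im c"
    and D: "\<forall>z\<in>W. f (chart_inv c z) \<in> chart_dom (stereographic n s)"
    and u: "\<forall>k<n. C2 m W (\<lambda>z. chart_map (stereographic n s) (f (chart_inv c z)) k)"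
    using smooth_map_sphere_chart[OF f c x] by blast
  let ?u = "\<lambda>z. chart_map (stereographic n s) (f (chart_inv c z))"
  have "C2 m W (\<lambda>z. inverse_stereographic n s (?u z) a)"
    by (rule C2_compose[OF W(1) coords_open inverse_stereographic_C2[OF s]]) (use u D stereographic_map(1)[OF s] in auto)
  moreover have "f (chart_inv c z) a = inverse_stereographic n s (?u z) a" if "z \<in> W" for z
    using D that stereographic_map(2)[OF s] by simp
  ultimately have "C2 m W (height f a c)" by (subst C2_cong[OF W(1)])
  then show "\<exists>W. eucl_open m W \<and> x \<in> W \<and> W \<subseteq> im c \<and> C2 m W (height f a c)" using W by blast
qed

text \<open>By the chain rule the product is taken through the stereographic chart;
  \<open>submersion_inverse_metric\<close> replaces the inverse metric upstairs by the inverse round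
  metric, and \<open>round_product\<close> evaluates it on the sphere.\<close>

lemma height_product:
  assumes sub: "riemannian_submersion m M n (round_sphere n) f" and c: "c \<in> atlas M" and x: "x \<in> im c" and ab: "a \<le> n" "b \<le> n"
  shows "metric_product m (components M c) (height f a c) (height f b c) x =
    (if a = b then 1 else 0) - f (chart_inv c x) a * f (chart_inv c x) b"
proof -
  have f: "smooth_map m M n (round_sphere n) f" using sub by (simp add: riemannian_submersion_def)
  obtain s W where s: "s\<^sup>2 = 1" and d: "stereographic n s \<in> atlas (round_sphere n)"
    and W: "eucl_open m W" "x \<in> W" "W \<subseteq> im c"
    and D: "\<forall>z\<in>W. f (chart_inv c z) \<in> chart_dom (stereographic n s)"
    and u: "\<forall>k<n. C2 m W (\<lambda>z. chart_map (stereographic n s) (f (chart_inv c z)) k)"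
    using smooth_map_sphere_chart[OF f c x] by blast
  define d where "d = stereographic n s"
  define u where "u z = chart_map d (f (chart_inv c z))" for z
  have uC: "C1 m W (\<lambda>z. u z k)" if "k < n" for k using C2_C1 u that by (auto simp: u_def d_def)
  have uV: "u z \<in> coords n" and uY: "inverse_stereographic n s (u z) = f (chart_inv c z)" if "z \<in> W" for z
    using D stereographic_map[OF s] that by (auto simp: u_def d_def)
  define A where "A k i = partial i (\<lambda>z. u z k) x" for k i
  define Y where "Y a k = partial k (\<lambda>y. inverse_stereographic n s y a) (u x)" for a k
  have dY: "partial i (height f a c) x = (\<Sum>k<n. Y a k * A k i)" if i: "i < m" for i a
  proof -
    have "partial i (height f a c) x = partial i (\<lambda>z. inverse_stereographic n s (u z) a) x"
      by (rule partial_cong[OF W(1) i W(2)]) (simp add: uY)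
    also have "\<dots> = (\<Sum>k<n. Y a k * A k i)"
      unfolding Y_def A_def
      by (rule partial_compose[OF W(1) coords_open C2_C1[OF inverse_stereographic_C2[OF s]] uC uV W(2) i])
    finally show ?thesis .
  qed
  define I where "I = inverse_matrix m (components M c x)"
  let ?N = "components (round_sphere n) d (u x)"
  have AI: "(\<Sum>i<m. \<Sum>j<m. A k i * I i j * A l j) = inverse_matrix n ?N k l" if kl: "k < n" "l < n" for k l
  proof -
    define p where "p = chart_inv c x"
    have px: "chart_map c p = x" and p: "p \<in> chart_dom c" "f p \<in> chart_dom d"
      using chart_map_inv[OF x] chart_inv_dom[OF x] D W(2) by (auto simp: p_def d_def)
    have dA: "differential c d f p = A"
      by (intro ext) (simp add: differential_def jacobian_def px A_def u_def)
    have pd: "posdef n ?N" unfolding d_def by (rule round_posdef[OF s uV[OF W(2)]])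
    have sb: "(\<forall>w. \<exists>v. \<forall>k<n. apply_matrix m A v k = w k) \<and>
        (\<forall>v w. horizontal m M n c d f p v \<and> horizontal m M n c d f p w \<longrightarrow>
          bilinear_form n ?N (apply_matrix m A v) (apply_matrix m A w) = bilinear_form m (components M c x) v w)"
    proof -
      have e: "chart_map d (f p) = u x" by (simp add: u_def p_def)
      have "(\<forall>w. \<exists>v. \<forall>k<n. apply_matrix m (differential c d f p) v k = w k) \<and>
        (\<forall>v w. horizontal m M n c d f p v \<and> horizontal m M n c d f p w \<longrightarrow>
          bilinear_form n (components (round_sphere n) d (chart_map d (f p)))
            (apply_matrix m (differential c d f p) v) (apply_matrix m (differential c d f p) w) =
          bilinear_form m (components M c (chart_map c p)) v w)"
        using sub c \<open>stereographic n s \<in> atlas (round_sphere n)\<close> p unfolding riemannian_submersion_def d_def by blast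
      then show ?thesis unfolding dA px e .
    qed
    have hor: "horizontal m M n c d f p v \<longleftrightarrow> (\<forall>u. (\<forall>k<n. apply_matrix m A u k = 0) \<longrightarrow> bilinear_form m (components M c x) v u = 0)" for v
      by (simp add: horizontal_def vertical_def dA px)
    show ?thesis
      unfolding I_def
    proof (rule submersion_inverse_metric[OF metric_posdef posdef_det_nz[OF pd] posdef_sym[OF pd] _ _ kl])
      show "x \<in> chart_map c ` chart_dom c" using x by (simp add: im_def)
    qed (use sb hor c in auto)
  qed
  have "metric_product m (components M c) (height f a c) (height f b c) x =
      (\<Sum>i<m. \<Sum>j<m. I i j * ((\<Sum>k<n. Y a k * A k i) * (\<Sum>l<n. Y b l * A l j)))"
    unfolding metric_product_def I_def by (intro sum.cong refl) (simp add: dY)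
  also have "\<dots> = (\<Sum>i<m. \<Sum>j<m. \<Sum>k<n. \<Sum>l<n. Y a k * Y b l * (A k i * I i j * A l j))"
    unfolding sum_product by (simp add: sum_distrib_left mult_ac)
  also have "\<dots> = (\<Sum>k<n. \<Sum>l<n. \<Sum>i<m. \<Sum>j<m. Y a k * Y b l * (A k i * I i j * A l j))" by (rule sum_swap_pairs)
  also have "\<dots> = (\<Sum>k<n. \<Sum>l<n. Y a k * Y b l * inverse_matrix n ?N k l)"
    by (intro sum.cong refl) (simp add: AI flip: sum_distrib_left)
  also have "\<dots> = metric_product n (components (round_sphere n) d) (\<lambda>y. inverse_stereographic n s y a) (\<lambda>y. inverse_stereographic n s y b) (u x)"
    by (simp add: metric_product_def Y_def mult_ac)
  also have "\<dots> = (if a = b then 1 else 0) - inverse_stereographic n s (u x) a * inverse_stereographic n s (u x) b"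
    unfolding d_def by (rule round_product[OF s uV[OF W(2)] ab])
  finally show ?thesis unfolding uY[OF W(2)] .
qed

lemma height_sphere:
  assumes f: "smooth_map m M n (round_sphere n) f" and q: "q \<in> points M"
  shows "f q \<in> unit_sphere n"
proof -
  have "continuous_map T (topology_of (round_sphere n)) f" using f by (simp add: smooth_map_def)
  from continuous_map_funspace[OF this] q have "f q \<in> points (round_sphere n)" by (auto simp: points_def)
  then show ?thesis by (simp add: sphere_points)
qed

text \<open>The vectors \<open>t\<close> are the tangent vectors of a local parametrization of the
  fiber through the point. All heights are constant along the fiber, so
  \<open>minimal_trace_zero\<close> supplies both the orthogonality of \<open>t\<close> to the
  gradients and the vanishing of the vertical trace.\<close>

lemma height_laplacian:
  assumes sub: "riemannian_submersion m M n (round_sphere n) f" and min: "minimal_fibers m M n (round_sphere n) f"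
    and nm: "n \<le> m" and c: "c \<in> atlas M" and x: "x \<in> im c" and a: "a \<le> n"
  shows "metric_laplacian m (components M c) (height f a c) x = - real n * f (chart_inv c x) a"
proof -
  have f: "smooth_map m M n (round_sphere n) f" using sub by (simp add: riemannian_submersion_def)
  define p where "p = chart_inv c x"
  define F where "F = {z\<in>points M. f z = f p}"
  let ?k = "m - n"
  have p: "p \<in> points M" "chart_map c p = x" "p \<in> chart_dom c"
    using chart_inv_points[OF c x] chart_map_inv[OF x] chart_inv_dom[OF x] by (auto simp: p_def)
  have minF: "minimal_submanifold m M ?k F"
    using min height_sphere[OF f p(1)] unfolding minimal_fibers_def F_def sphere_points by blast
  have "embedded_submanifold m M ?k F" using minF by (simp add: minimal_submanifold_def)
  moreover have "p \<in> F" using p by (simp add: F_def)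
  ultimately obtain V \<psi> where \<psi>: "local_parametrization m M ?k F V \<psi>" and "p \<in> \<psi> ` V"
    unfolding embedded_submanifold_def by blast
  then obtain y where y: "y \<in> V" "\<psi> y = p" by blast
  have V: "eucl_open ?k V" and oF: "openin (subtopology T F) (\<psi> ` V)"
    and hom: "homeomorphic_map (subtopology (Euclidean_space ?k) V) (subtopology T (\<psi> ` V)) \<psi>"
    using \<psi> by (auto simp: local_parametrization_def)
  have VF: "\<psi> ` V \<subseteq> F" using openin_subset[OF oF] by auto
  define W where "W = {z\<in>V. \<psi> z \<in> chart_dom c}"
  have W: "eucl_open ?k W"
  proof -
    have "continuous_map (subtopology (Euclidean_space ?k) V) T \<psi>"
      using homeomorphic_imp_continuous_map[OF hom] continuous_map_in_subtopology by blast
    then have "openin (subtopology (Euclidean_space ?k) V) {z\<in>topspace (subtopology (Euclidean_space ?k) V). \<psi> z \<in> chart_dom c}"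
      by (rule openin_continuous_map_preimage[OF _ dom_open[OF c]])
    moreover have "{z\<in>topspace (subtopology (Euclidean_space ?k) V). \<psi> z \<in> chart_dom c} = W"
      using openin_subset[OF V] by (auto simp: W_def)
    ultimately show ?thesis using openin_trans_full[OF _ V] by simp
  qed
  have yW: "y \<in> W" using y p by (simp add: W_def)
  define u where "u z = chart_map c (\<psi> z)" for z
  have uC: "C2 ?k W (\<lambda>z. u z i)" if "i < m" for i
    unfolding u_def by (rule smooth_on_C2[OF W]) (use \<psi> c that in \<open>simp add: local_parametrization_def W_def\<close>)
  have uV: "u z \<in> im c" and uf: "f (chart_inv c (u z)) b = f p b" if "z \<in> W" for z b
  proof -
    have z: "\<psi> z \<in> chart_dom c" "\<psi> z \<in> F" using that VF by (auto simp: W_def)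
    show "u z \<in> im c" unfolding u_def by (rule chart_map_im[OF z(1)])
    show "f (chart_inv c (u z)) b = f p b" using z(2) by (simp add: u_def chart_inv_map[OF c z(1)] F_def)
  qed
  have mean: "mean_curvature_vector m M ?k c \<psi> y i = 0" if "i < m" for i
    using minF \<psi> c y p that unfolding minimal_submanifold_def by blast
  define t where "t = tangent_vector c \<psi> y"
  have ux: "u y = x" using y p by (simp add: u_def)
  have ff: "first_fundamental_form m M c \<psi> y = (\<lambda>a b. bilinear_form m (components M c x) (t a) (t b))"
    by (intro ext) (simp add: first_fundamental_form_def t_def y p)
  have pd: "posdef m (components M c z)" if "z \<in> im c" for z
    using metric_posdef[OF c] that by (simp add: im_def)
  have imm: "\<forall>v. (\<forall>i<m. apply_matrix ?k (jacobian u y) v i = 0) \<longrightarrow> (\<forall>a<?k. v a = 0)"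
  proof -
    have "\<psi> y \<in> chart_dom c" using y p by simp
    then show ?thesis using \<psi> c y(1) unfolding local_parametrization_def u_def by blast
  qed
  have det: "determinant ?k (\<lambda>a b. bilinear_form m (components M c x) (t a) (t b)) \<noteq> 0"
  proof (rule gram_determinant[OF pd[OF x]])
    fix v assume "\<forall>i<m. (\<Sum>a<?k. t a i * v a) = 0"
    then have "\<forall>i<m. apply_matrix ?k (jacobian u y) v i = 0"
      by (simp add: apply_matrix_def jacobian_def t_def tangent_vector_def u_def)
    then show "\<forall>a<?k. v a = 0" using imm by blast
  qed
  have H: "C2 m (im c) (height f b c)" for b by (rule height_C2[OF f c])
  note tz = minimal_trace_zero[OF im_open[OF c] H W uC[unfolded u_def] uV[unfolded u_def] uf[unfolded u_def] yW mean]
  show ?thesis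
  proof (rule laplacian_split[where V = "im c" and n = n and t = t and H = "\<lambda>b x. f (chart_inv c x) b",
      OF im_open[OF c] _ pd H nm height_product[OF sub c] _ x _ det _ a])
    show "C1 m (im c) (\<lambda>x. components M c x i j)" if "i < m" "j < m" for i j
      using metric_C1[OF c that] by (simp add: im_def)
    show "(\<Sum>a\<le>n. f (chart_inv c z) a * f (chart_inv c z) a) = 1" if "z \<in> im c" for z
      using height_sphere[OF f chart_inv_points[OF c that]] by (simp add: unit_sphere_def power2_eq_square)
    show "(\<Sum>i<m. partial i (height f b c) x * t a i) = 0" if "a < ?k" for b a
      using tz(1)[of a b] that by (simp add: y p t_def)
    show "(\<Sum>a<?k. \<Sum>b<?k. inverse_matrix ?k (\<lambda>a b. bilinear_form m (components M c x) (t a) (t b)) a b *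
        (\<Sum>i<m. \<Sum>j<m. metric_hessian m (components M c) (height f e c) x i j * t a i * t b j)) = 0" for e
      using tz(2)[of e] by (simp add: ff y p flip: t_def)
  qed auto
qed

end

lemma submersion_band_ratio:
  assumes n: "1 \<le> n" "n \<le> m" and \<epsilon>: "0 < \<epsilon>" "\<epsilon> < pi / 2" and M: "closed_riemannian_manifold m M"
    and sub: "riemannian_submersion m M n (round_sphere n) f" and min: "minimal_fibers m M n (round_sphere n) f"
    and p: "p \<in> points (round_sphere n)"
  shows "measure (riemannian_volume m M) (band_preimage M n f p \<epsilon>) / measure (riemannian_volume m M) (points M) =
    cos_ratio n \<epsilon>"
proof -
  interpret compact_riemannian m M by (rule closed_riemannian_manifold_compact[OF M])
  have f: "smooth_map m M n (round_sphere n) f" using sub by (simp add: riemannian_submersion_def)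
  show ?thesis
    unfolding band_preimage_def
    by (rule height_band[OF n(1) \<epsilon> p[unfolded sphere_points] height_C2[OF f] height_product[OF sub]
        height_laplacian[OF sub min n(2)] height_sphere[OF f]])
qed

text \<open>The identity map of the sphere has fibers of dimension \<open>n - n = 0\<close>. The
  vertical sums are empty and their Gram determinant is 1, so a dummy \<open>t\<close> suffices and
  \<open>laplacian_split\<close> applies directly.\<close>

lemma sphere_band_ratio:
  assumes n: "1 \<le> n" and \<epsilon>: "0 < \<epsilon>" "\<epsilon> < pi / 2" and p: "p \<in> points (round_sphere n)"
  shows "measure (riemannian_volume n (round_sphere n)) (equatorial_band n p \<epsilon>) /
      measure (riemannian_volume n (round_sphere n)) (points (round_sphere n)) =
    cos_ratio n \<epsilon>"
proof -
  interpret S: compact_riemannian n "round_sphere n" by (rule compact_riemannian_sphere)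
  have imc: "S.im c = coords n \<and> (\<exists>s. s\<^sup>2 = 1 \<and> c = stereographic n s)" if "c \<in> atlas (round_sphere n)" for c
    using sphere_atlas[OF that] stereographic_im unfolding S.im_def by blast
  have C: "C2 n (S.im c) (\<lambda>x. chart_inv c x a)" if c: "c \<in> atlas (round_sphere n)" for c a
  proof -
    obtain s where s: "s\<^sup>2 = 1" "c = stereographic n s" "S.im c = coords n" using imc[OF c] by blast
    have "C2 n (coords n) (\<lambda>x. chart_inv c x a) \<longleftrightarrow> C2 n (coords n) (\<lambda>x. inverse_stereographic n s x a)"
      by (rule C2_cong[OF coords_open]) (simp add: s(2) stereographic_chart_inv[OF s(1)])
    then show ?thesis using inverse_stereographic_C2[OF s(1)] by (simp only: s(3))
  qed
  have P: "metric_product n (components (round_sphere n) c) (\<lambda>x. chart_inv c x a) (\<lambda>x. chart_inv c x b) x =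
      (if a = b then 1 else 0) - chart_inv c x a * chart_inv c x b"
    if c: "c \<in> atlas (round_sphere n)" and x: "x \<in> S.im c" and ab: "a \<le> n" "b \<le> n" for a b c x
  proof -
    obtain s where s: "s\<^sup>2 = 1" "c = stereographic n s" "S.im c = coords n" using imc[OF c] by blast
    have inv: "chart_inv c z = inverse_stereographic n s z" if "z \<in> coords n" for z
      unfolding s(2) by (rule stereographic_chart_inv[OF s(1) that])
    have x': "x \<in> coords n" using x s(3) by simp
    have "metric_product n (components (round_sphere n) c) (\<lambda>x. chart_inv c x a) (\<lambda>x. chart_inv c x b) x =
        metric_product n (components (round_sphere n) c) (\<lambda>x. inverse_stereographic n s x a) (\<lambda>x. inverse_stereographic n s x b) x"
      by (rule metric_product_cong[OF coords_open x']) (simp_all add: inv)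
    then show ?thesis unfolding inv[OF x'] unfolding s(2) round_product[OF s(1) x' ab] .
  qed
  have pt: "chart_inv c x \<in> unit_sphere n" if "c \<in> atlas (round_sphere n)" "x \<in> S.im c" for c x
    using S.chart_inv_points[OF that] by (simp add: sphere_points)
  have L: "metric_laplacian n (components (round_sphere n) c) (\<lambda>x. chart_inv c x a) x = - real n * chart_inv c x a"
    if c: "c \<in> atlas (round_sphere n)" and x: "x \<in> S.im c" and a: "a \<le> n" for a c x
  proof (rule laplacian_split[where V = "S.im c" and n = n and t = "\<lambda>_ _. 0" and H = "\<lambda>b x. chart_inv c x b",
      OF S.im_open[OF c] _ _ C[OF c] order_refl P[OF c] _ x _ _ _ a])
    show "C1 n (S.im c) (\<lambda>x. components (round_sphere n) c x i j)" if "i < n" "j < n" for i j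
      using S.metric_C1[OF c that] by (simp add: S.im_def)
    show "posdef n (components (round_sphere n) c z)" if "z \<in> S.im c" for z
      using S.metric_posdef[OF c] that by (simp add: S.im_def)
    show "(\<Sum>a\<le>n. chart_inv c z a * chart_inv c z a) = 1" if "z \<in> S.im c" for z
      using pt[OF c that] by (simp add: unit_sphere_def power2_eq_square)
    show "determinant (n - n) (\<lambda>a b. bilinear_form n (components (round_sphere n) c x) (\<lambda>_. 0) (\<lambda>_. 0)) \<noteq> 0"
      by (subst determinant_unit_lower) auto
  qed auto
  have "{q\<in>points (round_sphere n). q \<in> equatorial_band n p \<epsilon>} = equatorial_band n p \<epsilon>"
    by (auto simp: equatorial_band_def)
  then show ?thesis
    using S.height_band[OF n \<epsilon> p[unfolded sphere_points], of "\<lambda>q. q"] C P L by (simp add: sphere_points)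
qed

theorem theorem1p5:
  fixes \<epsilon> :: real
  assumes "0 < \<epsilon>" and "\<epsilon> < pi / 2"
  shows "(\<forall>(m::nat) (n::nat) (M :: 'a riemannian) (\<pi> :: 'a \<Rightarrow> nat \<Rightarrow> real) p.
           1 \<le> n \<and> n \<le> m \<and> closed_riemannian_manifold m M \<and>
           riemannian_submersion m M n (round_sphere n) \<pi> \<and>
           minimal_fibers m M n (round_sphere n) \<pi> \<and>
           p \<in> points (round_sphere n) \<longrightarrow>
           1 \<ge> measure (riemannian_volume m M) (band_preimage M n \<pi> p \<epsilon>) /
                 measure (riemannian_volume m M) (points M) \<and>
           measure (riemannian_volume m M) (band_preimage M n \<pi> p \<epsilon>) /
             measure (riemannian_volume m M) (points M) =
           measure (riemannian_volume n (round_sphere n)) (equatorial_band n p \<epsilon>) /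
             measure (riemannian_volume n (round_sphere n)) (points (round_sphere n)) \<and>
           measure (riemannian_volume n (round_sphere n)) (equatorial_band n p \<epsilon>) /
             measure (riemannian_volume n (round_sphere n)) (points (round_sphere n))
           \<ge> 1 - sqrt (pi / 2) * exp (- (\<epsilon>\<^sup>2 * ((real n - 1) / 2))))
       \<and>
         (\<forall>(m :: nat \<Rightarrow> nat) (M :: nat \<Rightarrow> 'b riemannian) (\<pi> :: nat \<Rightarrow> 'b \<Rightarrow> nat \<Rightarrow> real) p.
           (\<forall>n\<ge>1. n \<le> m n \<and> closed_riemannian_manifold (m n) (M n) \<and>
              riemannian_submersion (m n) (M n) n (round_sphere n) (\<pi> n) \<and>
              minimal_fibers (m n) (M n) n (round_sphere n) (\<pi> n) \<and>
              p n \<in> points (round_sphere n)) \<longrightarrow>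
           (\<lambda>n. measure (riemannian_volume (m n) (M n)) (band_preimage (M n) n (\<pi> n) (p n) \<epsilon>) /
                  measure (riemannian_volume (m n) (M n)) (points (M n))) \<longlonglongrightarrow> 1)"
proof -
  let ?R = "\<lambda>n. cos_ratio n \<epsilon>"
  have le1: "?R n \<le> 1" for n
  proof -
    have "cos_integral (n - 1) {- \<epsilon><..<\<epsilon>} \<le> cos_integral (n - 1) UNIV"
      unfolding cos_integral_def
      by (rule integral_mono[OF cos_integrable cos_integrable]) (auto simp: indicator_def cos_nonneg)
    then show ?thesis using cos_integral_pos[of "n - 1"] by simp
  qed
  note ge = cos_ratio_bound[OF _ assms]
  show ?thesis
  proof (intro conjI allI impI)
    fix m n :: nat and M :: "'a riemannian" and \<pi> :: "'a \<Rightarrow> nat \<Rightarrow> real" and p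
    assume h: "1 \<le> n \<and> n \<le> m \<and> closed_riemannian_manifold m M \<and> riemannian_submersion m M n (round_sphere n) \<pi> \<and>
      minimal_fibers m M n (round_sphere n) \<pi> \<and> p \<in> points (round_sphere n)"
    have 1: "measure (riemannian_volume m M) (band_preimage M n \<pi> p \<epsilon>) / measure (riemannian_volume m M) (points M) = ?R n"
      by (rule submersion_band_ratio[OF _ _ assms]) (use h in blast)+
    have 2: "measure (riemannian_volume n (round_sphere n)) (equatorial_band n p \<epsilon>) /
        measure (riemannian_volume n (round_sphere n)) (points (round_sphere n)) = ?R n"
      by (rule sphere_band_ratio[OF _ assms]) (use h in blast)+
    show "1 \<ge> measure (riemannian_volume m M) (band_preimage M n \<pi> p \<epsilon>) / measure (riemannian_volume m M) (points M)"
      unfolding 1 by (rule le1)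
    show "measure (riemannian_volume m M) (band_preimage M n \<pi> p \<epsilon>) / measure (riemannian_volume m M) (points M) =
        measure (riemannian_volume n (round_sphere n)) (equatorial_band n p \<epsilon>) /
        measure (riemannian_volume n (round_sphere n)) (points (round_sphere n))"
      unfolding 1 2 ..
    show "measure (riemannian_volume n (round_sphere n)) (equatorial_band n p \<epsilon>) /
        measure (riemannian_volume n (round_sphere n)) (points (round_sphere n)) \<ge>
        1 - sqrt (pi / 2) * exp (- (\<epsilon>\<^sup>2 * ((real n - 1) / 2)))"
      unfolding 2 by (rule ge) (use h in blast)
  next
    fix m :: "nat \<Rightarrow> nat" and M :: "nat \<Rightarrow> 'b riemannian" and \<pi> :: "nat \<Rightarrow> 'b \<Rightarrow> nat \<Rightarrow> real" and p
    assume h: "\<forall>n\<ge>1. n \<le> m n \<and> closed_riemannian_manifold (m n) (M n) \<and>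
      riemannian_submersion (m n) (M n) n (round_sphere n) (\<pi> n) \<and>
      minimal_fibers (m n) (M n) n (round_sphere n) (\<pi> n) \<and> p n \<in> points (round_sphere n)"
    have eq: "measure (riemannian_volume (m n) (M n)) (band_preimage (M n) n (\<pi> n) (p n) \<epsilon>) /
        measure (riemannian_volume (m n) (M n)) (points (M n)) = ?R n" if "n \<ge> 1" for n
      by (rule submersion_band_ratio[OF that _ assms]) (use h that in blast)+
    have "?R \<longlonglongrightarrow> 1"
    proof (rule tendsto_sandwich[of _ _ _ "\<lambda>_. 1"])
      show "\<forall>\<^sub>F n in sequentially. 1 - sqrt (pi / 2) * exp (- (\<epsilon>\<^sup>2 * ((real n - 1) / 2))) \<le> ?R n"
        using ge unfolding eventually_sequentially by blast
      have "(\<lambda>n. exp (- (\<epsilon>\<^sup>2 * ((real n - 1) / 2)))) \<longlonglongrightarrow> 0"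
        using assms(1) by real_asymp
      from tendsto_diff[OF tendsto_const tendsto_mult[OF tendsto_const this]]
      show "(\<lambda>n. 1 - sqrt (pi / 2) * exp (- (\<epsilon>\<^sup>2 * ((real n - 1) / 2)))) \<longlonglongrightarrow> 1" by simp
    qed (use le1 in auto)
    \<comment> \<open>The ratio is identified with \<open>?R n\<close> only from
      \<open>n = 1\<close> on, which is enough for the limit.\<close>
    then show "(\<lambda>n. measure (riemannian_volume (m n) (M n)) (band_preimage (M n) n (\<pi> n) (p n) \<epsilon>) /
        measure (riemannian_volume (m n) (M n)) (points (M n))) \<longlonglongrightarrow> 1"
      by (rule Lim_transform_eventually) (use eq in \<open>auto simp: eventually_sequentially intro!: exI[of _ 1]\<close>)
  qed
qed

end
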